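(* For every integer $m\ge1$ there exists a constant $\mathbf{c}(m)\ge1$ with the following property. Let $U\subset\mathbb{R}^m$ be either $\mathbb{R}^m$ or a bounded open subset having the extension property, let $1<p<\infty$, $f\in W^1_p(U;\mathcal{Q}_Q(\ell_2))$, $1\le q\le p$, and let $V\subset U$ be a nonempty bounded open convex subset of $U$. Then for $\mathcal{L}^m$-almost every $x\in V$, $$\int_V\mathcal{G}_2(f(x),f(y))^q\,d\mathcal{L}^m(y)\le(\mathrm{diam}\,V)^{q+m-1}\int_V\frac{|\delta f|^q(z)}{\|z-x\|^{m-1}}\,d\mathcal{L}^m(z).$$ Furthermore there exists $v\in\mathcal{Q}_Q(\ell_2)$ such that $$\int_V\mathcal{G}_2(f(x),v)^q\,d\mathcal{L}^m(x)\le\mathbf{c}(m)(\mathrm{diam}\,V)^q\left(\frac{(\mathrm{diam}\,V)^m}{\mathcal{L}^m(V)}\right)^{1-\frac1m}\int_V|\delta f|^q\,d\mathcal{L}^m.$$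
   Context: $Q\ge1$ is an integer; $\mathbb{R}^m$ has its Euclidean norm; $Y$ denotes $\ell_2$ (infinite dimensional separable real Hilbert space with canonical basis $e_1,e_2,\dots$) or $\ell_2^n$. $\mathcal{Q}_Q(Y)$ is the quotient of $Y^Q$ by the permutation action of $S_Q$; the class of $(y_1,\dots,y_Q)$ is $[\![y_1,\dots,y_Q]\!]$, $Q[\![0]\!]=[\![0,\dots,0]\!]$, and $\mathcal{G}_2([\![y_1,\dots,y_Q]\!],[\![y_1',\dots,y_Q']\!])=\min_{\sigma\in S_Q}\big(\sum_i\|y_i-y'_{\sigma(i)}\|^2\big)^{1/2}$. $U$ has the extension property if for every $1<p<\infty$ there is a continuous linear extension operator from the classical Sobolev space $W^{1,p}(U)$ to $W^{1,p}(\mathbb{R}^m)$. For linear $L:\mathbb{R}^m\to Y$, $|||L|||=\big(\sum_{j=1}^m\|L(\epsilon_j)\|^2\big)^{1/2}$ with $\epsilon_1,\dots,\epsilon_m$ the canonical basis of $\mathbb{R}^m$. A Borel map $f:U\to\mathcal{Q}_Q(Y)$ is approximately differentiable at $a\in U$ if there are affine maps $A_1,\dots,A_Q:\mathbb{R}^m\to Y$ such that for every $\varepsilon>0$ the set $\{x:\mathcal{G}_2(f(x),[\![A_1(x),\dots,A_Q(x)]\!])>\varepsilon\|x-a\|\}$ has $m$-dimensional density $0$ at $a$; the unordered tuple is unique; with $L_i=A_i-A_i(0)$ put $|Df(a)|=\big(\sum_i|||L_i|||^2\big)^{1/2}$. Lipschitz maps are approximately differentiable $\mathcal{L}^m$-a.e.,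 and so is every member of $W^1_p(U;\mathcal{Q}_Q(\ell_2^n))$. $L_p(U;\mathcal{Q}_Q(Y))$: Borel maps $f:U\to\mathcal{Q}_Q(Y)$ with $\int_U\mathcal{G}_2(f,Q[\![0]\!])^pd\mathcal{L}^m<\infty$; $d_p(f,g)=(\int_U\mathcal{G}_2(f,g)^pd\mathcal{L}^m)^{1/p}$. $W^1_p(U;\mathcal{Q}_Q(Y))$: those $f\in L_p(U;\mathcal{Q}_Q(Y))$ for which there are Lipschitz maps $f_j:\mathbb{R}^m\to\mathcal{Q}_Q(Y)$ with $f_j|_U\in L_p(U;\mathcal{Q}_Q(Y))$, $\sup_j\int_U|Df_j|^pd\mathcal{L}^m<\infty$ and $d_p(f,f_j)\to0$. Let $P_n:\ell_2\to\mathrm{span}\{e_1,\dots,e_n\}\cong\ell_2^n$ be the orthogonal projection and $\mathcal{Q}_Q(P_n)([\![y_1,\dots,y_Q]\!])=[\![P_n(y_1),\dots,P_n(y_Q)]\!]$. For $f\in W^1_p(U;\mathcal{Q}_Q(\ell_2))$ one has $\mathcal{Q}_Q(P_n)\circ f\in W^1_p(U;\mathcal{Q}_Q(\ell_2^n))$, the sequence $|D(\mathcal{Q}_Q(P_n)\circ f)|$ is nondecreasing in $n$ almost everywhere, and $|\delta f|\in L_p(U)$ is defined almost everywhere by $|\delta f|(x)=\lim_n|D(\mathcal{Q}_Q(P_n)\circ f)(x)|$. *)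

theory Defs
  imports "HOL-Analysis.Analysis"
begin

section \<open>The Hilbert space of square summable real sequences\<close>

typedef ell2 = "{x :: nat \<Rightarrow> real. summable (\<lambda>k. (x k)\<^sup>2)}"
  morphisms coord Abs_ell2
  by (rule exI[of _ "\<lambda>_. 0"]) simp

setup_lifting type_definition_ell2

lemma summable_coord_sq: "summable (\<lambda>k. (coord x k)\<^sup>2)"
  using coord[of x] by simp

lemma summable_mult_of_sq:
  fixes x y :: "nat \<Rightarrow> real"
  assumes "summable (\<lambda>k. (x k)\<^sup>2)" "summable (\<lambda>k. (y k)\<^sup>2)"
  shows "summable (\<lambda>k. x k * y k)"
proof (rule summable_comparison_test[OF _ summable_add[OF assms]], intro exI allI impI)
  fix k
  have "2 * \<bar>x k * y k\<bar> \<le> (x k)\<^sup>2 + (y k)\<^sup>2"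
    using sum_squares_bound[of "\<bar>x k\<bar>" "\<bar>y k\<bar>"] by (simp add: abs_mult)
  then show "norm (x k * y k) \<le> (x k)\<^sup>2 + (y k)\<^sup>2"
    using abs_ge_zero[of "x k * y k"] unfolding real_norm_def by linarith
qed

instantiation ell2 :: real_vector
begin

lift_definition zero_ell2 :: ell2 is "\<lambda>_. 0" by simp

lift_definition uminus_ell2 :: "ell2 \<Rightarrow> ell2" is "\<lambda>x k. - x k" by simp

lift_definition plus_ell2 :: "ell2 \<Rightarrow> ell2 \<Rightarrow> ell2" is "\<lambda>x y k. x k + y k"
  by (auto simp: power2_sum intro!: summable_add summable_mult summable_mult_of_sq
           simp: mult.assoc)

lift_definition minus_ell2 :: "ell2 \<Rightarrow> ell2 \<Rightarrow> ell2" is "\<lambda>x y k. x k - y k"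
  by (auto simp: power2_diff intro!: summable_add summable_diff summable_mult
           summable_mult_of_sq simp: mult.assoc)

lift_definition scaleR_ell2 :: "real \<Rightarrow> ell2 \<Rightarrow> ell2" is "\<lambda>r x k. r * x k"
  by (auto simp: power_mult_distrib intro!: summable_mult)

instance
  by standard (transfer; auto simp: algebra_simps)+

end

instantiation ell2 :: real_inner
begin

definition inner_ell2 :: "ell2 \<Rightarrow> ell2 \<Rightarrow> real" where
  "inner_ell2 x y = (\<Sum>k. coord x k * coord y k)"

definition norm_ell2 :: "ell2 \<Rightarrow> real" where
  "norm_ell2 x = sqrt (inner x x)"

definition sgn_ell2 :: "ell2 \<Rightarrow> ell2" where
  "sgn_ell2 x = x /\<^sub>R norm x"

definition dist_ell2 :: "ell2 \<Rightarrow> ell2 \<Rightarrow> real" where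
  "dist_ell2 x y = norm (x - y)"

definition uniformity_ell2 :: "(ell2 \<times> ell2) filter" where
  "uniformity_ell2 = (INF e\<in>{0<..}. principal {(x, y). dist x y < e})"

definition open_ell2 :: "ell2 set \<Rightarrow> bool" where
  "open_ell2 S = (\<forall>x\<in>S. \<forall>\<^sub>F (x', y) in uniformity. x' = x \<longrightarrow> y \<in> S)"

instance
proof
  fix x y z :: ell2 and r :: real
  have s: "summable (\<lambda>k. coord x k * coord y k)" for x y
    by (intro summable_mult_of_sq summable_coord_sq)
  show "inner x y = inner y x" by (simp add: inner_ell2_def mult.commute)
  show "inner (x + y) z = inner x z + inner y z"
    by (simp add: inner_ell2_def plus_ell2.rep_eq distrib_right suminf_add s)
  show "inner (r *\<^sub>R x) y = r * inner x y"
    by (simp add: inner_ell2_def scaleR_ell2.rep_eq mult.assoc suminf_mult s)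
  show "0 \<le> inner x x"
    unfolding inner_ell2_def by (intro suminf_nonneg s) simp
  have "inner x x = 0 \<longleftrightarrow> (\<forall>k. coord x k * coord x k = 0)"
    unfolding inner_ell2_def by (intro suminf_eq_zero_iff s) simp
  also have "\<dots> \<longleftrightarrow> x = 0"
    by transfer auto
  finally show "inner x x = 0 \<longleftrightarrow> x = 0" .
qed (simp_all add: norm_ell2_def sgn_ell2_def dist_ell2_def uniformity_ell2_def open_ell2_def)

end

lemma norm_ell2_sq: "(norm (x::ell2))\<^sup>2 = (\<Sum>k. (coord x k)\<^sup>2)"
  unfolding power2_norm_eq_inner inner_ell2_def by (simp add: power2_eq_square)

lemma sum_coord_sq_le: "(\<Sum>k<n. (coord x k)\<^sup>2) \<le> (norm x)\<^sup>2"
  unfolding norm_ell2_sq by (intro sum_le_suminf summable_coord_sq) auto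

lemma abs_coord_le: "\<bar>coord x k\<bar> \<le> norm x"
proof -
  have "(coord x k)\<^sup>2 \<le> (\<Sum>j<Suc k. (coord x j)\<^sup>2)"
    by (simp add: sum_nonneg)
  also have "\<dots> \<le> (norm x)\<^sup>2" by (rule sum_coord_sq_le)
  finally show ?thesis by (simp add: abs_le_square_iff[symmetric])
qed

instance ell2 :: complete_space
proof
  fix X :: "nat \<Rightarrow> ell2"
  assume X: "Cauchy X"
  have "Cauchy (\<lambda>n. coord (X n) k)" for k
  proof (rule metric_CauchyI)
    fix e :: real assume "0 < e"
    then obtain M where M: "\<forall>m\<ge>M. \<forall>n\<ge>M. dist (X m) (X n) < e"
      using X by (meson metric_CauchyD)
    have "dist (coord (X m) k) (coord (X n) k) \<le> dist (X m) (X n)" for m n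
      using abs_coord_le[of "X m - X n" k] by (simp add: dist_norm minus_ell2.rep_eq)
    then show "\<exists>M. \<forall>m\<ge>M. \<forall>n\<ge>M. dist (coord (X m) k) (coord (X n) k) < e"
      using M by (meson le_less_trans)
  qed
  then have "\<forall>k. \<exists>l. (\<lambda>n. coord (X n) k) \<longlonglongrightarrow> l"
    by (simp add: Cauchy_convergent_iff convergent_def)
  then obtain y where y: "\<And>k. (\<lambda>n. coord (X n) k) \<longlonglongrightarrow> y k" by metis
  have key: "(\<Sum>k<N. (coord (X m) k - y k)\<^sup>2) \<le> e\<^sup>2"
    if "\<forall>m\<ge>M. \<forall>n\<ge>M. dist (X m) (X n) < e" "m \<ge> M" for M m N e
  proof (rule LIMSEQ_le_const2)
    show "(\<lambda>n. \<Sum>k<N. (coord (X m) k - coord (X n) k)\<^sup>2) \<longlonglongrightarrow> (\<Sum>k<N. (coord (X m) k - y k)\<^sup>2)"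
      by (intro tendsto_intros y)
    have "(\<Sum>k<N. (coord (X m) k - coord (X n) k)\<^sup>2) \<le> e\<^sup>2" if "n \<ge> M" for n
    proof -
      have "(\<Sum>k<N. (coord (X m) k - coord (X n) k)\<^sup>2) \<le> (norm (X m - X n))\<^sup>2"
        using sum_coord_sq_le[of "X m - X n" N] by (simp add: minus_ell2.rep_eq)
      also have "\<dots> \<le> e\<^sup>2"
        using \<open>\<forall>m\<ge>M. \<forall>n\<ge>M. dist (X m) (X n) < e\<close> \<open>m \<ge> M\<close> that
        by (intro power_mono) (auto simp: dist_norm intro: less_imp_le)
      finally show ?thesis .
    qed
    then show "\<exists>K. \<forall>n\<ge>K. (\<Sum>k<N. (coord (X m) k - coord (X n) k)\<^sup>2) \<le> e\<^sup>2" by blast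
  qed
  obtain M1 where M1: "\<forall>m\<ge>M1. \<forall>n\<ge>M1. dist (X m) (X n) < 1"
    using metric_CauchyD[OF X, of 1] by auto
  have "summable (\<lambda>k. (coord (X M1) k - y k)\<^sup>2)"
    by (rule summableI_nonneg_bounded[where x = "1\<^sup>2"]) (use key[OF M1 order_refl] in auto)
  then have "coord (Abs_ell2 (\<lambda>k. coord (X M1) k - y k)) = (\<lambda>k. coord (X M1) k - y k)"
    by (simp add: Abs_ell2_inverse)
  then have cy: "coord (X M1 - Abs_ell2 (\<lambda>k. coord (X M1) k - y k)) = y"
    by (simp add: minus_ell2.rep_eq)
  define Y where "Y = X M1 - Abs_ell2 (\<lambda>k. coord (X M1) k - y k)"
  have cy: "coord Y = y" using cy by (simp add: Y_def)
  have "X \<longlonglongrightarrow> Y"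
  proof (rule metric_LIMSEQ_I)
    fix e :: real assume "0 < e"
    then obtain M where M: "\<forall>m\<ge>M. \<forall>n\<ge>M. dist (X m) (X n) < e / 2"
      using metric_CauchyD[OF X, of "e / 2"] by auto
    have "dist (X m) (Y) < e" if "m \<ge> M" for m
    proof -
      have "(\<Sum>k<N. (coord (X m - Y) k)\<^sup>2) \<le> (e / 2)\<^sup>2" for N
        unfolding minus_ell2.rep_eq cy by (rule key[OF M that])
      then have "(norm (X m - Y))\<^sup>2 \<le> (e / 2)\<^sup>2"
        unfolding norm_ell2_sq by (intro suminf_le_const[OF summable_coord_sq])
      then have "norm (X m - Y) \<le> e / 2"
        by (rule power2_le_imp_le) (use \<open>0 < e\<close> in linarith)
      then show ?thesis using \<open>0 < e\<close> by (simp add: dist_norm)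
    qed
    then show "\<exists>no. \<forall>n\<ge>no. dist (X n) (Y) < e" by blast
  qed
  then show "convergent X" by (auto simp: convergent_def)
qed

lift_definition ell2_basis :: "nat \<Rightarrow> ell2" is "\<lambda>k j. if j = k then 1 else 0"
  by (rule summable_finite[of "{k}" for k]) auto

text \<open>The orthogonal projection onto the span of the first \<open>n\<close> basis vectors (numbered from 0).\<close>

definition ell2_proj :: "nat \<Rightarrow> ell2 \<Rightarrow> ell2" where
  "ell2_proj n x = (\<Sum>k<n. (x \<bullet> ell2_basis k) *\<^sub>R ell2_basis k)"


section \<open>Unordered tuples\<close>

text \<open>An unordered \<open>Q\<close>-tuple, that is, an orbit of \<open>S\<^sub>Q\<close> on \<open>Y\<^sup>Q\<close>, is a multiset of size \<open>Q\<close>;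
  the class of \<open>(y\<^sub>1, \<dots>, y\<^sub>Q)\<close> is \<open>mset [y\<^sub>1, \<dots>, y\<^sub>Q]\<close>.\<close>

definition QQ :: "nat \<Rightarrow> 'b multiset set" where
  "QQ Q = {M. size M = Q}"

text \<open>The minimum is over all pairs of enumerations; \<open>G2_mset\<close> below is the usual formula with
  permutations. Multisets of different sizes have no meaningful distance.\<close>

definition G2 :: "'b::real_inner multiset \<Rightarrow> 'b multiset \<Rightarrow> real" where
  "G2 M N = Min {sqrt (\<Sum>(x, y)\<leftarrow>zip xs ys. (norm (x - y))\<^sup>2) | xs ys. mset xs = M \<and> mset ys = N}"

lemma finite_G2_set:
  "finite {sqrt (\<Sum>(x, y)\<leftarrow>zip xs ys. (norm (x - y))\<^sup>2) | xs ys. mset xs = M \<and> mset ys = N}"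
proof -
  have fin: "finite {xs. mset xs = M}" for M :: "'b multiset"
  proof (rule finite_subset)
    show "{xs. mset xs = M} \<subseteq> {xs. set xs \<subseteq> set_mset M \<and> length xs = size M}" by auto
    show "finite {xs. set xs \<subseteq> set_mset M \<and> length xs = size M}"
      by (intro finite_lists_length_eq) simp
  qed
  have "finite ((\<lambda>(xs, ys). sqrt (\<Sum>(x, y)\<leftarrow>zip xs ys. (norm (x - y))\<^sup>2)) `
      ({xs. mset xs = M} \<times> {ys. mset ys = N}))"
    by (intro finite_imageI finite_cartesian_product fin)
  then show ?thesis by (rule rev_finite_subset) auto
qed

lemma nonempty_G2_set:
  "{sqrt (\<Sum>(x, y)\<leftarrow>zip xs ys. (norm (x - y))\<^sup>2) | xs ys. mset xs = M \<and> mset ys = N} \<noteq> {}"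
  using ex_mset[of M] ex_mset[of N] by blast

lemma G2_le:
  "mset xs = M \<Longrightarrow> mset ys = N \<Longrightarrow> G2 M N \<le> sqrt (\<Sum>(x, y)\<leftarrow>zip xs ys. (norm (x - y))\<^sup>2)"
  unfolding G2_def by (intro Min_le finite_G2_set) blast

lemma G2_attained:
  obtains xs ys where "mset xs = M" "mset ys = N"
    "G2 M N = sqrt (\<Sum>(x, y)\<leftarrow>zip xs ys. (norm (x - y))\<^sup>2)"
  using Min_in[OF finite_G2_set nonempty_G2_set, of M N] unfolding G2_def by blast

lemma zip_align:
  assumes "mset xs = mset xs'" "length xs' = length ys'"
  obtains \<sigma> where "\<sigma> permutes {..<length ys'}" "xs = permute_list \<sigma> xs'"
    "mset (zip xs (permute_list \<sigma> ys')) = mset (zip xs' ys')"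
proof -
  obtain \<sigma> where \<sigma>: "\<sigma> permutes {..<length xs'}" "permute_list \<sigma> xs' = xs"
    using mset_eq_permutation[OF assms(1)] by auto
  have "zip xs (permute_list \<sigma> ys') = permute_list \<sigma> (zip xs' ys')"
    using permute_list_zip[OF \<sigma>(1) refl assms(2)] \<sigma>(2) by simp
  moreover have "mset (permute_list \<sigma> (zip xs' ys')) = mset (zip xs' ys')"
    using \<sigma>(1) assms(2) by (intro mset_permute_list) simp
  ultimately show ?thesis using that[of \<sigma>] \<sigma> assms(2) by simp
qed

lemma sum_list_mset_cong:
  fixes g :: "'a \<Rightarrow> real"
  assumes "mset xs = mset ys"
  shows "(\<Sum>x\<leftarrow>xs. g x) = (\<Sum>x\<leftarrow>ys. g x)"
  using assms by (metis mset_map sum_mset_sum_list)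

lemma G2_attained_perm:
  assumes "length xs = length ys"
  obtains \<sigma> where "\<sigma> permutes {..<length ys}"
    "G2 (mset xs) (mset ys) = sqrt (\<Sum>(x, y)\<leftarrow>zip xs (permute_list \<sigma> ys). (norm (x - y))\<^sup>2)"
proof -
  obtain xs' ys' where 1: "mset xs' = mset xs" "mset ys' = mset ys"
    "G2 (mset xs) (mset ys) = sqrt (\<Sum>(x, y)\<leftarrow>zip xs' ys'. (norm (x - y))\<^sup>2)"
    by (rule G2_attained)
  have len: "length xs' = length ys'" using 1 assms by (metis size_mset)
  obtain \<tau> where \<tau>: "\<tau> permutes {..<length ys'}"
    "mset (zip xs (permute_list \<tau> ys')) = mset (zip xs' ys')"
    using zip_align[OF 1(1)[symmetric] len] by metis
  have "mset (permute_list \<tau> ys') = mset ys" using \<tau>(1) 1(2) by simp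
  then obtain \<sigma> where "\<sigma> permutes {..<length ys}" "permute_list \<sigma> ys = permute_list \<tau> ys'"
    using mset_eq_permutation by metis
  then show ?thesis using that[of \<sigma>] 1(3) sum_list_mset_cong[OF \<tau>(2)] by simp
qed

lemma sum_list_zip_norm:
  assumes "length xs = length ys"
  shows "(\<Sum>(x, y)\<leftarrow>zip xs ys. (norm (x - y))\<^sup>2) = (\<Sum>i<length xs. (norm (xs ! i - ys ! i))\<^sup>2)"
  using assms by (simp add: sum_list_sum_nth lessThan_atLeast0)

lemma G2_mset:
  assumes "length xs = length ys"
  shows "G2 (mset xs) (mset ys) =
    Min ((\<lambda>\<sigma>. sqrt (\<Sum>i<length xs. (norm (xs ! i - ys ! \<sigma> i))\<^sup>2)) ` {\<sigma>. \<sigma> permutes {..<length xs}})"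
proof -
  have eq: "(\<Sum>(x, y)\<leftarrow>zip xs (permute_list \<sigma> ys). (norm (x - y))\<^sup>2) =
      (\<Sum>i<length xs. (norm (xs ! i - ys ! \<sigma> i))\<^sup>2)"
    if "\<sigma> permutes {..<length xs}" for \<sigma>
    using that assms by (simp add: sum_list_zip_norm permute_list_nth)
  show ?thesis
  proof (rule sym, rule Min_eqI)
    show "finite ((\<lambda>\<sigma>. sqrt (\<Sum>i<length xs. (norm (xs ! i - ys ! \<sigma> i))\<^sup>2)) ` {\<sigma>. \<sigma> permutes {..<length xs}})"
      by (intro finite_imageI finite_permutations) simp
  next
    fix d assume "d \<in> (\<lambda>\<sigma>. sqrt (\<Sum>i<length xs. (norm (xs ! i - ys ! \<sigma> i))\<^sup>2)) ` {\<sigma>. \<sigma> permutes {..<length xs}}"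
    then obtain \<sigma> where \<sigma>: "\<sigma> permutes {..<length xs}"
      "d = sqrt (\<Sum>i<length xs. (norm (xs ! i - ys ! \<sigma> i))\<^sup>2)" by blast
    then have "d = sqrt (\<Sum>(x, y)\<leftarrow>zip xs (permute_list \<sigma> ys). (norm (x - y))\<^sup>2)"
      using eq by simp
    then show "G2 (mset xs) (mset ys) \<le> d"
      using G2_le[of xs "mset xs" "permute_list \<sigma> ys" "mset ys"] \<sigma>(1) assms by simp
  next
    obtain \<sigma> where \<sigma>: "\<sigma> permutes {..<length ys}"
      "G2 (mset xs) (mset ys) = sqrt (\<Sum>(x, y)\<leftarrow>zip xs (permute_list \<sigma> ys). (norm (x - y))\<^sup>2)"
      using G2_attained_perm[OF assms] by metis
    then show "G2 (mset xs) (mset ys) \<in> (\<lambda>\<sigma>. sqrt (\<Sum>i<length xs. (norm (xs ! i - ys ! \<sigma> i))\<^sup>2)) ` {\<sigma>. \<sigma> permutes {..<length xs}}"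
      using eq[of \<sigma>] assms by auto
  qed
qed

lemma Metric_space_G2: "Metric_space (QQ Q) (G2 :: 'b::real_inner multiset \<Rightarrow> _)"
proof
  show nonneg: "0 \<le> G2 M N" for M N :: "'b multiset"
    by (rule G2_attained[of M N]) (auto intro!: sum_list_nonneg)
  have "G2 M N \<le> G2 N M" for M N :: "'b multiset"
  proof -
    obtain xs ys where "mset xs = N" "mset ys = M"
      "G2 N M = sqrt (\<Sum>(x, y)\<leftarrow>zip xs ys. (norm (x - y))\<^sup>2)"
      by (rule G2_attained)
    moreover have "(\<Sum>(x, y)\<leftarrow>zip xs ys. (norm (x - y))\<^sup>2) = (\<Sum>(x, y)\<leftarrow>zip ys xs. (norm (x - y))\<^sup>2)"
      by (subst zip_commute) (simp add: o_def case_prod_unfold norm_minus_commute)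
    ultimately show ?thesis using G2_le[of ys M xs N] by simp
  qed
  then show "G2 M N = G2 N M" for M N :: "'b multiset"
    by (simp add: order_antisym)
  show "G2 M N = 0 \<longleftrightarrow> M = N" if "M \<in> QQ Q" "N \<in> QQ Q" for M N :: "'b multiset"
  proof
    assume 0: "G2 M N = 0"
    obtain xs ys where 1: "mset xs = M" "mset ys = N"
      "G2 M N = sqrt (\<Sum>(x, y)\<leftarrow>zip xs ys. (norm (x - y))\<^sup>2)"
      by (rule G2_attained)
    have len: "length xs = length ys" using that 1 by (metis QQ_def mem_Collect_eq size_mset)
    have "(\<Sum>i<length xs. (norm (xs ! i - ys ! i))\<^sup>2) = 0"
      using 0 1(3) sum_list_zip_norm[OF len] by simp
    then have "\<forall>i<length xs. xs ! i = ys ! i"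
      by (subst (asm) sum_nonneg_eq_0_iff) auto
    then have "xs = ys" using len by (simp add: nth_equalityI)
    then show "M = N" using 1 by simp
  next
    assume "M = N"
    obtain xs where "mset xs = M" using ex_mset by blast
    then have "G2 M N \<le> sqrt (\<Sum>(x, y)\<leftarrow>zip xs xs. (norm (x - y))\<^sup>2)"
      using \<open>M = N\<close> by (intro G2_le) auto
    then show "G2 M N = 0" using nonneg[of M N] by (simp add: sum_list_zip_norm)
  qed
  show "G2 M K \<le> G2 M N + G2 N K" if "M \<in> QQ Q" "N \<in> QQ Q" "K \<in> QQ Q" for M N K :: "'b multiset"
  proof -
    obtain xs ys where 1: "mset xs = M" "mset ys = N"
      "G2 M N = sqrt (\<Sum>(x, y)\<leftarrow>zip xs ys. (norm (x - y))\<^sup>2)"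
      by (rule G2_attained)
    obtain zs0 where zs0: "mset zs0 = K" using ex_mset by blast
    have l: "length xs = Q" "length ys = Q" "length zs0 = Q"
      using that 1 zs0 by (auto simp: QQ_def)
    obtain \<sigma> where \<sigma>: "\<sigma> permutes {..<length zs0}"
      "G2 (mset ys) (mset zs0) = sqrt (\<Sum>(x, y)\<leftarrow>zip ys (permute_list \<sigma> zs0). (norm (x - y))\<^sup>2)"
      using G2_attained_perm[of ys zs0] l by metis
    define zs where "zs = permute_list \<sigma> zs0"
    have zs: "mset zs = K" "length zs = Q"
      using \<sigma>(1) zs0 l by (auto simp: zs_def)
    have "G2 M K \<le> L2_set (\<lambda>i. norm (xs ! i - zs ! i)) {..<Q}"
      using G2_le[OF 1(1) zs(1)] l zs by (simp add: sum_list_zip_norm L2_set_def)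
    also have "\<dots> \<le> L2_set (\<lambda>i. norm (xs ! i - ys ! i) + norm (ys ! i - zs ! i)) {..<Q}"
      by (rule L2_set_mono) (use norm_triangle_ineq[of "xs ! i - ys ! i" "ys ! i - zs ! i" for i] in auto)
    also have "\<dots> \<le> L2_set (\<lambda>i. norm (xs ! i - ys ! i)) {..<Q} + L2_set (\<lambda>i. norm (ys ! i - zs ! i)) {..<Q}"
      by (rule L2_set_triangle_ineq)
    also have "\<dots> = G2 M N + G2 N K"
      using 1 zs0 \<sigma>(2) l zs by (simp add: sum_list_zip_norm L2_set_def zs_def[symmetric])
    finally show ?thesis .
  qed
qed

definition QQ_metric :: "nat \<Rightarrow> 'b::real_inner multiset metric" where
  "QQ_metric Q = metric (QQ Q, G2)"

lemma mspace_QQ_metric [simp]: "mspace (QQ_metric Q) = QQ Q"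
  unfolding QQ_metric_def by (rule Metric_space.mspace_metric[OF Metric_space_G2])

lemma mdist_QQ_metric [simp]: "mdist (QQ_metric Q) = G2"
  unfolding QQ_metric_def by (rule Metric_space.mdist_metric[OF Metric_space_G2])

definition QQ_borel :: "nat \<Rightarrow> 'b::real_inner multiset measure" where
  "QQ_borel Q = sigma (QQ Q) {W. openin (mtopology_of (QQ_metric Q)) W}"

lemma space_QQ_borel [simp]: "space (QQ_borel Q) = QQ Q"
  unfolding QQ_borel_def
  by (rule space_measure_of) (auto dest!: openin_subset)


section \<open>Approximate differentiability\<close>

definition affine_fun :: "('a::real_vector \<Rightarrow> 'b::real_vector) \<Rightarrow> bool" where
  "affine_fun A \<longleftrightarrow> linear (\<lambda>x. A x - A 0)"

definition hs_norm :: "(real^'m::finite \<Rightarrow> 'b::real_inner) \<Rightarrow> real" where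
  "hs_norm L = sqrt (\<Sum>j\<in>UNIV. (norm (L (axis j 1)))\<^sup>2)"

text \<open>Only meaningful for Lebesgue measurable \<open>S\<close>, which is the case for the sets below
  whenever \<open>f\<close> is Borel.\<close>

definition density_zero :: "(real^'m::finite) set \<Rightarrow> real^'m \<Rightarrow> bool" where
  "density_zero S a \<longleftrightarrow>
    ((\<lambda>r. measure lebesgue (S \<inter> cball a r) / measure lebesgue (cball a r)) \<longlongrightarrow> 0) (at_right 0)"

definition approx_affine ::
  "nat \<Rightarrow> (real^'m::finite) set \<Rightarrow> (real^'m \<Rightarrow> 'b::real_inner multiset) \<Rightarrow> real^'m \<Rightarrow>
    (real^'m \<Rightarrow> 'b) multiset \<Rightarrow> bool" where
  "approx_affine Q U f a As \<longleftrightarrow>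
    size As = Q \<and> (\<forall>A\<in>#As. affine_fun A) \<and>
    (\<forall>\<epsilon>>0. density_zero {x\<in>U. G2 (f x) {#A x. A \<in># As#} > \<epsilon> * norm (x - a)} a)"

definition approx_differentiable ::
  "nat \<Rightarrow> (real^'m::finite) set \<Rightarrow> (real^'m \<Rightarrow> 'b::real_inner multiset) \<Rightarrow> real^'m \<Rightarrow> bool" where
  "approx_differentiable Q U f a \<longleftrightarrow> (\<exists>As. approx_affine Q U f a As)"

text \<open>The multiset \<open>As\<close> is unique when it exists. The value 0 elsewhere is immaterial: the maps
  considered below are approximately differentiable almost everywhere.\<close>

definition Dnorm ::
  "nat \<Rightarrow> (real^'m::finite) set \<Rightarrow> (real^'m \<Rightarrow> 'b::real_inner multiset) \<Rightarrow> real^'m \<Rightarrow> real" where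
  "Dnorm Q U f a =
    (if approx_differentiable Q U f a
     then sqrt (\<Sum>A\<in>#(SOME As. approx_affine Q U f a As). (hs_norm (\<lambda>x. A x - A 0))\<^sup>2)
     else 0)"


section \<open>Sobolev spaces of maps into unordered tuples\<close>

definition Lp_QQ ::
  "nat \<Rightarrow> (real^'m::finite) set \<Rightarrow> real \<Rightarrow> (real^'m \<Rightarrow> 'b::real_inner multiset) set" where
  "Lp_QQ Q U p = {f. f \<in> measurable (restrict_space borel U) (QQ_borel Q) \<and>
     (\<integral>\<^sup>+x\<in>U. ennreal (G2 (f x) (replicate_mset Q 0) powr p) \<partial>lebesgue) < \<infinity>}"

text \<open>Used only for \<open>f\<close> and \<open>g\<close> in \<open>Lp_QQ Q U p\<close>, where the integral is finite.\<close>

definition dist_p ::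
  "(real^'m::finite) set \<Rightarrow> real \<Rightarrow> (real^'m \<Rightarrow> 'b::real_inner multiset) \<Rightarrow>
    (real^'m \<Rightarrow> 'b multiset) \<Rightarrow> real" where
  "dist_p U p f g = (LINT x:U|lebesgue. G2 (f x) (g x) powr p) powr (1 / p)"

definition W1p_QQ ::
  "nat \<Rightarrow> (real^'m::finite) set \<Rightarrow> real \<Rightarrow> (real^'m \<Rightarrow> 'b::real_inner multiset) set" where
  "W1p_QQ Q U p = {f \<in> Lp_QQ Q U p. \<exists>F :: nat \<Rightarrow> real^'m \<Rightarrow> 'b multiset.
     (\<forall>j. Lipschitz_continuous_map euclidean_metric (QQ_metric Q) (F j) \<and> F j \<in> Lp_QQ Q U p) \<and>
     (SUP j. \<integral>\<^sup>+x\<in>U. ennreal (Dnorm Q UNIV (F j) x powr p) \<partial>lebesgue) < \<infinity> \<and>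
     (\<lambda>j. dist_p U p f (F j)) \<longlonglongrightarrow> 0}"

text \<open>Here \<open>\<ell>\<^sub>2\<^sup>n\<close> is identified with the span of the first \<open>n\<close> basis vectors. Computing \<open>Dnorm\<close> in
  \<open>ell2\<close> rather than in this subspace makes no difference: \<open>ell2_proj n\<close> is 1-Lipschitz, so by
  uniqueness the affine approximations take values in the subspace.\<close>

definition delta_norm ::
  "nat \<Rightarrow> (real^'m::finite) set \<Rightarrow> (real^'m \<Rightarrow> ell2 multiset) \<Rightarrow> real^'m \<Rightarrow> real" where
  "delta_norm Q U f x = lim (\<lambda>n. Dnorm Q U (\<lambda>y. image_mset (ell2_proj n) (f y)) x)"


section \<open>Classical Sobolev spaces and the extension property\<close>

definition partial_deriv :: "'m \<Rightarrow> (real^'m::finite \<Rightarrow> real) \<Rightarrow> real^'m \<Rightarrow> real" where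
  "partial_deriv j g x = frechet_derivative g (at x) (axis j 1)"

primrec C_k :: "nat \<Rightarrow> (real^'m::finite \<Rightarrow> real) \<Rightarrow> bool" where
  "C_k 0 g \<longleftrightarrow> continuous_on UNIV g"
| "C_k (Suc k) g \<longleftrightarrow> g differentiable_on UNIV \<and> (\<forall>j. C_k k (partial_deriv j g))"

definition test_function :: "(real^'m::finite) set \<Rightarrow> (real^'m \<Rightarrow> real) \<Rightarrow> bool" where
  "test_function U \<phi> \<longleftrightarrow>
    (\<forall>k. C_k k \<phi>) \<and> compact (closure {x. \<phi> x \<noteq> 0}) \<and> closure {x. \<phi> x \<noteq> 0} \<subseteq> U"

definition Lp_real :: "(real^'m::finite) set \<Rightarrow> real \<Rightarrow> (real^'m \<Rightarrow> real) set" where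
  "Lp_real U p = {u. u \<in> borel_measurable (lebesgue_on U) \<and>
     (\<integral>\<^sup>+x\<in>U. ennreal (\<bar>u x\<bar> powr p) \<partial>lebesgue) < \<infinity>}"

definition weak_partial ::
  "(real^'m::finite) set \<Rightarrow> 'm \<Rightarrow> (real^'m \<Rightarrow> real) \<Rightarrow> (real^'m \<Rightarrow> real) \<Rightarrow> bool" where
  "weak_partial U j u g \<longleftrightarrow> (\<forall>\<phi>. test_function U \<phi> \<longrightarrow>
     (LINT x:U|lebesgue. u x * partial_deriv j \<phi> x) = - (LINT x:U|lebesgue. g x * \<phi> x))"

definition W1p :: "(real^'m::finite) set \<Rightarrow> real \<Rightarrow> (real^'m \<Rightarrow> real) set" where
  "W1p U p = {u \<in> Lp_real U p. \<forall>j. \<exists>g\<in>Lp_real U p. weak_partial U j u g}"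

text \<open>Weak partial derivatives are unique up to null sets, so the choice does not matter.\<close>

definition W1p_norm :: "(real^'m::finite) set \<Rightarrow> real \<Rightarrow> (real^'m \<Rightarrow> real) \<Rightarrow> real" where
  "W1p_norm U p u =
    ((LINT x:U|lebesgue. \<bar>u x\<bar> powr p) +
     (\<Sum>j\<in>UNIV. LINT x:U|lebesgue.
        \<bar>(SOME g. g \<in> Lp_real U p \<and> weak_partial U j u g) x\<bar> powr p)) powr (1 / p)"

text \<open>Elements of \<open>W1p\<close> are functions, not classes modulo null sets, hence \<open>E\<close> is required to be
  linear only almost everywhere. Together with the bound this makes \<open>E\<close> well defined on classes.\<close>

definition extension_property :: "(real^'m::finite) set \<Rightarrow> bool" where
  "extension_property U \<longleftrightarrow> (\<forall>p>1. \<exists>(E :: (real^'m \<Rightarrow> real) \<Rightarrow> real^'m \<Rightarrow> real) C.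
     (\<forall>u\<in>W1p U p. E u \<in> W1p UNIV p \<and> (AE x in lebesgue. x \<in> U \<longrightarrow> E u x = u x) \<and>
        W1p_norm UNIV p (E u) \<le> C * W1p_norm U p u) \<and>
     (\<forall>u\<in>W1p U p. \<forall>v\<in>W1p U p. \<forall>a b.
        AE x in lebesgue. E (\<lambda>y. a * u y + b * v y) x = a * E u x + b * E v x))"

end

theory Submission
  imports Defs
begin

text \<open>
  The point is to find a Borel function \<open>\<psi>\<close>, at most \<open>|\<delta>f|\<close> almost everywhere on \<open>V\<close>, that bounds
  the oscillation of \<open>f\<close> along almost every segment of \<open>V\<close>:
  \<open>G\<^sub>2(f(x), f(y)) \<le> |y - x| \<integral>\<^sub>0\<^sup>1 \<psi>(x + t(y - x)) dt\<close>. Integrating the \<open>q\<close>-th power of this in \<open>y\<close>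
  (Jensen, then Fubini and a dilation centred at \<open>x\<close>) gives the first inequality. Integrating that one in
  \<open>x\<close>, where \<open>\<integral>\<^sub>V |z - x|\<^sup>1\<^sup>-\<^sup>m dx \<le> C(m) |V|\<^sup>1\<^sup>/\<^sup>m\<close>, and choosing \<open>x\<close> where the right hand side is at most its
  mean, gives the second one with \<open>v = f(x)\<close>.

  To find \<open>\<psi>\<close>: on a set where \<open>f\<close> is Lipschitz and takes a constant number of distinct values, \<open>f\<close>
  splits locally into Lipschitz selections, so the Rademacher theorem gives its approximate differential,
  and \<open>|Df|\<close> bounds the gradients of Lipschitz extensions of the functions \<open>G\<^sub>2(f(\<cdot>), f(w))\<close>. Take for \<open>\<psi>\<close>
  the supremum of these gradients over countably many \<open>w\<close> and over a sequence of sets where \<open>f\<close> is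
  Lipschitz; it bounds \<open>f\<close> along segments if the Lipschitz constants times the measures of the remaining
  sets are summable. For the Lipschitz maps approximating \<open>f\<close> a single set suffices. The bounds \<open>\<psi>\<close> so
  obtained for them are bounded in \<open>L\<^sub>p\<close>; since \<open>p > 1\<close>, convex combinations converge in \<open>L\<^sub>1\<close>, and the limit
  bounds \<open>f\<close> along segments. Hence \<open>f\<close> is Lipschitz, with constant of order \<open>s\<close>, where no average of that limit
  over a ball exceeds \<open>s\<close>, and the remaining set has measure \<open>o(1/s)\<close>: the sets needed for \<open>f\<close> itself.
\<close>

section \<open>Lebesgue density points\<close>

text \<open>The bound that the approximating maps provide is a limit of convex combinations and need
  not be comparable to \<open>|\<delta>f|\<close>. It serves only to show that \<open>f\<close> is
  Lipschitz off small sets; there \<open>f\<close> itself is differentiated, and this yields a bound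
  of the right size. As the values lie in an infinite dimensional space, no finite family of
  coordinates controls \<open>G2\<close>; the test functions \<open>G2 (f x) (f w)\<close>, with
  \<open>w\<close> in a countable dense set of points, recover it. For the same reason
  differentiability of every coordinate of a Lipschitz map into \<open>ell2\<close> is not enough:
  the tails of the sum over coordinates must be uniformly small, and a Morrey estimate near density
  points provides this. The first inequality has constant 1 because the integral over the dilation
  parameter has an antiderivative with denominator \<open>q + m - 1 \<ge> 1\<close>; the constant of
  the second is that of the Riesz kernel integrated over a set of given measure. All integration is
  carried out with the Borel function \<open>\<psi>\<close>, as \<open>delta_norm\<close> comes
  without a proof of measurability; it enters by comparison at the end.\<close>

definition density_one :: "'a::euclidean_space set \<Rightarrow> 'a \<Rightarrow> bool" where
  "density_one E a \<longleftrightarrow>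
    (\<forall>e>0. \<exists>d>0. \<forall>r. 0 < r \<and> r < d \<longrightarrow> measure lborel (cball a r - E) \<le> e * r ^ DIM('a))"

lemma unit_ball_vol_pos_DIM: "0 < unit_ball_vol (real DIM('a::euclidean_space))"
  by (rule unit_ball_vol_pos) simp

lemma borel_cball_fmeasurable:
  "E \<in> sets borel \<Longrightarrow> cball a r - E \<in> fmeasurable lborel"
  for a :: "'a::euclidean_space"
  by (rule fmeasurableI2[of "cball a r"]) (auto simp: fmeasurable_def emeasure_lborel_cball_finite[unfolded infinity_ennreal_def])

text \<open>The Lebesgue density theorem by one Vitali covering. Near a point of \<open>S k\<close>
  the complement of \<open>E\<close> fills a fixed fraction of arbitrarily small balls. Disjoint
  balls of this kind inside an open \<open>T\<close> with \<open>T - E\<close> small cover almost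
  all of \<open>S k\<close>, and their total volume is at most \<open>c\<close> times the measure of
  \<open>T - E\<close>.\<close>

lemma density_one_AE:
  fixes E :: "'a::euclidean_space set"
  assumes E: "E \<in> sets borel"
  shows "AE a in lborel. a \<in> E \<longrightarrow> density_one E a"
proof -
  let ?n = "DIM('a)"
  let ?w = "unit_ball_vol (real DIM('a))"
  define S where "S k = {a\<in>E. \<forall>d>0. \<exists>r. 0 < r \<and> r < d \<and>
      measure lborel (cball a r - E) > r ^ ?n / real (Suc k)}" for k
  have neg: "negligible (S k)" for k
    unfolding negligible_outer_le
  proof (intro allI impI)
    fix e :: real assume "0 < e"
    \<comment> \<open>The ratio of the volume of a ball to the lower bound for the part of it
      outside \<open>E\<close>.\<close>
    define c where "c = ?w * real (Suc k)"
    have cpos: "c > 0" using unit_ball_vol_pos_DIM[where 'a='a] by (simp add: c_def)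
    obtain T where T: "open T" "E \<subseteq> T" "emeasure lebesgue (T - E) < ennreal (e / c)"
      using sets_lebesgue_outer_open[of E "e / c"] E \<open>0 < e\<close> cpos
      by (metis divide_pos_pos sets_completionI_sets sets_lborel)
    define K where "K = {(a, r). a \<in> S k \<and> 0 < r \<and> cball a r \<subseteq> T \<and>
        measure lborel (cball a r - E) > r ^ ?n / real (Suc k)}"
    have cov: "\<exists>i. i \<in> K \<and> x \<in> cball (fst i) (snd i) \<and> snd i < d" if xS: "x \<in> S k" "0 < d" for x d
    proof -
      have "x \<in> T" using that T by (auto simp: S_def)
      then obtain d' where d': "d' > 0" "cball x d' \<subseteq> T" using T(1) open_contains_cball by blast
      have "\<exists>r. 0 < r \<and> r < min d d' \<and> measure lborel (cball x r - E) > r ^ ?n / real (Suc k)"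
        using xS d'(1) by (simp add: S_def del: min_less_iff_conj)
      then obtain r where "0 < r" "r < min d d'" "measure lborel (cball x r - E) > r ^ ?n / real (Suc k)"
        by blast
      then show ?thesis
        using xS d' by (intro exI[of _ "(x, r)"]) (auto simp: K_def)
    qed
    obtain C where C: "countable C" "C \<subseteq> K"
      "pairwise (\<lambda>i j. disjnt (cball (fst i) (snd i)) (cball (fst j) (snd j))) C"
      "negligible (S k - (\<Union>i\<in>C. cball (fst i) (snd i)))"
    proof (rule Vitali_covering_theorem_cballs[of K snd "S k" fst])
      show "0 < snd i" if "i \<in> K" for i using that by (auto simp: K_def)
      show "\<exists>i. i \<in> K \<and> x \<in> cball (fst i) (snd i) \<and> snd i < d" if "x \<in> S k" "0 < d" for x d
        using that by (rule cov)
    qed blast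
    define B where "B = (\<Union>i\<in>C. cball (fst i) (snd i))"
    have Bm: "B \<in> sets borel" unfolding B_def using C(1) by (intro sets.countable_UN'') auto
    have dis: "disjoint_family_on (\<lambda>i. cball (fst i) (snd i)) C"
      using C(3) by (auto simp: pairwise_def disjoint_family_on_def disjnt_def)
    have "emeasure lborel B = (\<integral>\<^sup>+i. emeasure lborel (cball (fst i) (snd i)) \<partial>count_space C)"
      unfolding B_def by (rule emeasure_UN_countable[OF _ C(1) dis]) auto
    also have "\<dots> \<le> (\<integral>\<^sup>+i. ennreal c * emeasure lborel (cball (fst i) (snd i) - E) \<partial>count_space C)"
    proof (rule nn_integral_mono)
      fix i assume "i \<in> space (count_space C)"
      then have i: "i \<in> K" using C(2) by auto
      obtain a r where ar: "i = (a, r)" by (cases i)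
      have r: "0 < r" "measure lborel (cball a r - E) > r ^ ?n / real (Suc k)"
        using i unfolding ar K_def by auto
      have "?w * r ^ ?n = c * (r ^ ?n / real (Suc k))" by (simp add: c_def)
      also have "\<dots> \<le> c * measure lborel (cball a r - E)"
        using r cpos by (intro mult_left_mono) auto
      finally have "ennreal (?w * r ^ ?n) \<le> ennreal (c * measure lborel (cball a r - E))"
        by (rule ennreal_leI)
      also have "\<dots> = ennreal c * emeasure lborel (cball a r - E)"
        using borel_cball_fmeasurable[OF E, of a r] cpos
        by (simp add: ennreal_mult' emeasure_eq_measure2)
      finally show "emeasure lborel (cball (fst i) (snd i)) \<le> ennreal c * emeasure lborel (cball (fst i) (snd i) - E)"
        using r by (simp add: ar emeasure_cball)
    qed
    also have "\<dots> = ennreal c * (\<integral>\<^sup>+i. emeasure lborel (cball (fst i) (snd i) - E) \<partial>count_space C)"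
      by (rule nn_integral_cmult) auto
    also have "(\<integral>\<^sup>+i. emeasure lborel (cball (fst i) (snd i) - E) \<partial>count_space C)
      = emeasure lborel (\<Union>i\<in>C. cball (fst i) (snd i) - E)"
    proof (rule emeasure_UN_countable[symmetric, OF _ C(1)])
      show "disjoint_family_on (\<lambda>i. cball (fst i) (snd i) - E) C"
        using dis unfolding disjoint_family_on_def by blast
    qed (use E in auto)
    also have "\<dots> \<le> emeasure lborel (T - E)"
      using C(2) T E by (intro emeasure_mono) (auto simp: K_def subset_eq)
    also have "\<dots> = emeasure lebesgue (T - E)" using T E by simp
    also have "ennreal c * emeasure lebesgue (T - E) \<le> ennreal c * ennreal (e / c)"
      using T(3) by (intro mult_left_mono) auto
    also have "\<dots> = ennreal e" using cpos \<open>0 < e\<close> by (simp add: ennreal_mult'[symmetric])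
    finally have Be: "emeasure lborel B \<le> ennreal e" by (simp add: mult_left_mono)
    have BL: "B \<in> lmeasurable"
      using Be Bm by (auto simp: fmeasurable_def) (metis ennreal_less_top infinity_ennreal_def not_le top.not_eq_extremum)
    have Nn: "S k - B \<in> null_sets lebesgue" using C(4) by (simp add: B_def negligible_iff_null_sets)
    show "\<exists>T. S k \<subseteq> T \<and> T \<in> lmeasurable \<and> measure lebesgue T \<le> e"
    proof (intro exI conjI)
      show "S k \<subseteq> B \<union> (S k - B)" by auto
      show "B \<union> (S k - B) \<in> lmeasurable" using BL Nn by (intro fmeasurable.Un) (auto intro: negligible_imp_measurable simp: negligible_iff_null_sets)
      have "emeasure lebesgue (B \<union> (S k - B)) = emeasure lborel B"
        using Nn Bm by (subst emeasure_Un_null_set) auto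
      then show "measure lebesgue (B \<union> (S k - B)) \<le> e"
        using Be \<open>0 < e\<close> by (simp add: measure_def enn2real_leI)
    qed
  qed
  have "negligible (\<Union>k. S k)" using neg by (intro negligible_countable_Union) auto
  then have "AE a in lebesgue. a \<notin> (\<Union>k. S k)"
    by (intro AE_not_in) (simp only: negligible_iff_null_sets)
  then have "AE a in lborel. a \<notin> (\<Union>k. S k)"
    by (simp add: AE_completion_iff)
  then show ?thesis
  proof eventually_elim
    fix a assume a: "a \<notin> (\<Union>k. S k)"
    show "a \<in> E \<longrightarrow> density_one E a"
      unfolding density_one_def
    proof (intro impI allI)
      fix e :: real assume "a \<in> E" "e > 0"
      obtain k where k: "1 / real (Suc k) < e" using \<open>e > 0\<close> nat_approx_posE by blast
      have "a \<notin> S k" using a by blast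
      then obtain d where d: "d > 0" "\<And>r. 0 < r \<Longrightarrow> r < d \<Longrightarrow> measure lborel (cball a r - E) \<le> r ^ ?n / real (Suc k)"
        using \<open>a \<in> E\<close> unfolding S_def by (simp add: not_less) (meson not_le)
      have "measure lborel (cball a r - E) \<le> e * r ^ ?n" if "0 < r" "r < d" for r
      proof -
        have "r ^ ?n / real (Suc k) = (1 / real (Suc k)) * r ^ ?n" by simp
        also have "\<dots> \<le> e * r ^ ?n" using k that by (intro mult_right_mono) auto
        finally show ?thesis using d(2)[OF that] by simp
      qed
      then show "\<exists>d>0. \<forall>r. 0 < r \<and> r < d \<longrightarrow> measure lborel (cball a r - E) \<le> e * r ^ ?n"
        using d(1) by blast
    qed
  qed
qed

lemma density_one_Int:
  fixes A B :: "'a::euclidean_space set"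
  assumes "A \<in> sets borel" "B \<in> sets borel" "density_one A a" "density_one B a"
  shows "density_one (A \<inter> B) a"
  unfolding density_one_def
proof (intro allI impI)
  fix e :: real assume "e > 0"
  then have e2: "e / 2 > 0" by simp
  obtain d1 where d1: "d1 > 0" "\<And>r. 0 < r \<Longrightarrow> r < d1 \<Longrightarrow> measure lborel (cball a r - A) \<le> e / 2 * r ^ DIM('a)"
    using assms(3) e2 unfolding density_one_def by blast
  obtain d2 where d2: "d2 > 0" "\<And>r. 0 < r \<Longrightarrow> r < d2 \<Longrightarrow> measure lborel (cball a r - B) \<le> e / 2 * r ^ DIM('a)"
    using assms(4) e2 unfolding density_one_def by blast
  show "\<exists>d>0. \<forall>r. 0 < r \<and> r < d \<longrightarrow> measure lborel (cball a r - A \<inter> B) \<le> e * r ^ DIM('a)"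
  proof (intro exI conjI allI impI)
    show "min d1 d2 > 0" using d1 d2 by simp
    fix r assume r: "0 < r \<and> r < min d1 d2"
    have "cball a r - A \<inter> B = (cball a r - A) \<union> (cball a r - B)" by auto
    then have "measure lborel (cball a r - A \<inter> B) \<le> measure lborel (cball a r - A) + measure lborel (cball a r - B)"
      using assms by (metis borel_closed closed_cball measure_Un_le sets.Diff sets_lborel)
    also have "\<dots> \<le> e * r ^ DIM('a)" using d1(2)[of r] d2(2)[of r] r by auto
    finally show "measure lborel (cball a r - A \<inter> B) \<le> e * r ^ DIM('a)" .
  qed
qed

lemma density_one_interior:
  fixes A :: "'a::euclidean_space set"
  assumes "a \<in> A" "open A"
  shows "density_one A a"
proof -
  obtain d where d: "d > 0" "cball a d \<subseteq> A" using assms open_contains_cball by blast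
  then have "cball a r - A = {}" if "r < d" for r using that by auto
  then show ?thesis using d(1) unfolding density_one_def by (metis measure_empty mult_nonneg_nonneg less_imp_le zero_le_power)
qed

text \<open>A ball of radius \<open>\<theta> * s\<close> around \<open>a + h\<close> that missed
  \<open>E\<close> would lie in \<open>cball a (2 * s) - E\<close> and be too large for density one.
  The radius \<open>d\<close> does not depend on the direction \<open>h\<close>.\<close>

lemma density_one_meets:
  fixes E :: "'a::euclidean_space set"
  assumes E: "E \<in> sets borel" "density_one E a" and "\<eta> > 0"
  shows "\<exists>d>0. \<forall>h s. 0 < s \<and> s < d \<and> norm h \<le> s \<longrightarrow> (\<exists>x\<in>E. norm (x - (a + h)) \<le> \<eta> * s)"
proof -
  let ?n = "DIM('a)" and ?w = "unit_ball_vol (real DIM('a))"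
  define \<theta> where "\<theta> = min \<eta> 1"
  have \<theta>: "\<theta> > 0" "\<theta> \<le> 1" "\<theta> \<le> \<eta>" using assms by (auto simp: \<theta>_def)
  \<comment> \<open>With this \<open>e\<close> the set \<open>cball a (2 * s) - E\<close> has at
    most half the volume of the missed ball.\<close>
  define e where "e = ?w * (\<theta> / 2) ^ ?n / 2"
  have "e > 0" unfolding e_def using unit_ball_vol_pos_DIM[where 'a='a] \<theta> by simp
  then obtain d where d: "d > 0" "\<And>r. 0 < r \<Longrightarrow> r < d \<Longrightarrow> measure lborel (cball a r - E) \<le> e * r ^ ?n"
    using E unfolding density_one_def by blast
  show ?thesis
  proof (intro exI conjI allI impI)
    show "d / 2 > 0" using d by simp
    fix h :: 'a and s :: real assume s: "0 < s \<and> s < d / 2 \<and> norm h \<le> s"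
    show "\<exists>x\<in>E. norm (x - (a + h)) \<le> \<eta> * s"
    proof (rule ccontr)
      assume con: "\<not> ?thesis"
      have sub: "cball (a + h) (\<theta> * s) \<subseteq> cball a (2 * s) - E"
      proof
        fix x assume "x \<in> cball (a + h) (\<theta> * s)"
        then have x: "norm (x - (a + h)) \<le> \<theta> * s" by (simp add: dist_norm norm_minus_commute)
        moreover have "\<theta> * s \<le> \<eta> * s" "\<theta> * s \<le> s" using \<theta> s by (auto intro: mult_right_mono simp: mult_left_le_one_le)
        ultimately have "x \<notin> E" "norm (x - (a + h)) \<le> s" using con by (force, linarith)
        moreover have "norm (x - a) \<le> norm (x - (a + h)) + norm h"
          using norm_triangle_ineq[of "x - (a + h)" h] by simp
        ultimately show "x \<in> cball a (2 * s) - E" using s by (simp add: dist_norm norm_minus_commute)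
      qed
      have "?w * (\<theta> * s) ^ ?n = measure lborel (cball (a + h) (\<theta> * s))"
        using \<theta> s by (simp add: content_cball)
      also have "\<dots> \<le> measure lborel (cball a (2 * s) - E)"
        using sub borel_cball_fmeasurable[OF E(1)] by (intro measure_mono_fmeasurable) auto
      also have "\<dots> \<le> e * (2 * s) ^ ?n" using s by (intro d) auto
      also have "\<dots> = ?w * (\<theta> * s) ^ ?n / 2" by (simp add: e_def power_mult_distrib power_divide)
      finally show False using unit_ball_vol_pos_DIM[where 'a='a] \<theta> s by (simp add: field_simps)
    qed
  qed
qed

text \<open>The points approach \<open>a\<close> asymptotically along \<open>h\<close> and replace
  the ray in this direction, on which nothing may be known. This is how derivatives are read off
  from a set of density one. The set may change with \<open>n\<close>, so that an accuracy improving
  with \<open>n\<close> can be built in.\<close>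

lemma density_one_pick:
  fixes B :: "nat \<Rightarrow> 'a::euclidean_space set"
  assumes "\<And>n. B n \<in> sets borel" "\<And>n. density_one (B n) a"
  obtains x t where "\<And>n. t n > 0" "t \<longlonglongrightarrow> 0" "\<And>n. x n \<in> B n"
    "(\<lambda>n. (x n - a) /\<^sub>R t n) \<longlonglongrightarrow> h"
proof -
  define c where "c = norm h + 1"
  have c: "c > 0" "norm h \<le> c" by (auto simp: c_def add_nonneg_pos)
  have "\<exists>x t. t > 0 \<and> t \<le> 1 / real (Suc n) \<and> x \<in> B n \<and> norm ((x - a) /\<^sub>R t - h) \<le> 1 / real (Suc n)" for n
  proof -
    have "1 / (real (Suc n) * c) > 0" using c by simp
    from density_one_meets[OF assms(1,2) this] obtain d where d: "d > 0"
      "\<And>h s. 0 < s \<Longrightarrow> s < d \<Longrightarrow> norm h \<le> s \<Longrightarrow> \<exists>x\<in>B n. norm (x - (a + h)) \<le> 1 / (real (Suc n) * c) * s"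
      by blast
    define t where "t = min (d / (2 * c)) (1 / real (Suc n))"
    have t: "t > 0" "t \<le> 1 / real (Suc n)" "t * c < d"
    proof -
      show "t > 0" using d c by (simp add: t_def)
      have "t * c \<le> d / (2 * c) * c" using c by (intro mult_right_mono) (auto simp: t_def)
      also have "\<dots> < d" using c d by simp
      finally show "t * c < d" .
    qed (simp add: t_def)
    have "norm (t *\<^sub>R h) \<le> t * c" using t c by (simp add: mult_left_mono)
    then obtain x where x: "x \<in> B n" "norm (x - (a + t *\<^sub>R h)) \<le> 1 / (real (Suc n) * c) * (t * c)"
      using d(2)[of "t * c" "t *\<^sub>R h"] t c by auto
    have "norm ((x - a) /\<^sub>R t - h) = norm ((x - (a + t *\<^sub>R h)) /\<^sub>R t)"
      using t by (simp add: algebra_simps)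
    also have "\<dots> = norm (x - (a + t *\<^sub>R h)) / t" using t by (simp add: divide_inverse mult.commute)
    also have "\<dots> \<le> 1 / (real (Suc n) * c) * (t * c) / t" using x t by (intro divide_right_mono) auto
    also have "\<dots> = 1 / real (Suc n)" using t c by simp
    finally show ?thesis using t x by blast
  qed
  then obtain x t where xt: "\<And>n. t n > 0" "\<And>n. t n \<le> 1 / real (Suc n)" "\<And>n. x n \<in> B n"
    "\<And>n. norm ((x n - a) /\<^sub>R t n - h) \<le> 1 / real (Suc n)" by metis
  have z: "(\<lambda>n. 1 / real (Suc n)) \<longlonglongrightarrow> 0" by (rule lim_1_over_n[THEN LIMSEQ_Suc])
  show ?thesis
  proof
    show "t \<longlonglongrightarrow> 0"
      by (rule tendsto_sandwich[OF _ _ tendsto_const z]) (use xt in \<open>auto intro!: always_eventually less_imp_le\<close>)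
    show "(\<lambda>n. (x n - a) /\<^sub>R t n) \<longlonglongrightarrow> h"
      by (subst LIM_zero_iff[symmetric], rule Lim_null_comparison[OF _ z]) (use xt in auto)
  qed (use xt in auto)
qed

section \<open>Lipschitz functions of real variables\<close>

text \<open>With \<open>w = u / L\<close> both \<open>(t + w t) / 2\<close> and
  \<open>(t - w t) / 2\<close> are nondecreasing and their sum is \<open>t\<close>, so their
  Stieltjes measures add up to Lebesgue measure. Each is therefore absolutely continuous with
  density between 0 and 1: Radon-Nikodym takes the place of the differentiation theory of monotone
  functions.\<close>

lemma lipschitz_real_density:
  fixes u :: "real \<Rightarrow> real"
  assumes L: "L > 0" and u: "L-lipschitz_on UNIV u"
  obtains \<phi> :: "real \<Rightarrow> real" where "\<phi> \<in> borel_measurable borel" "\<And>t. 0 \<le> \<phi> t" "\<And>t. \<phi> t \<le> 1"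
    "\<And>a b. a \<le> b \<Longrightarrow> ((\<lambda>t. \<phi> t) has_integral ((b - a) + (u b - u a) / L) / 2) {a..b}"
proof -
  have lip: "\<bar>u x - u y\<bar> \<le> L * \<bar>x - y\<bar>" for x y
    using lipschitz_onD[OF u, of x y] by (simp add: dist_real_def)
  define w where "w t = u t / L" for t
  define F where "F t = (t + w t) / 2" for t
  define G where "G t = (t - w t) / 2" for t
  have quot: "\<bar>w y - w x\<bar> \<le> \<bar>y - x\<bar>" for x y
    using lip[of y x] L by (simp add: w_def field_simps flip: diff_divide_distrib)
  have Fm: "F x \<le> F y" if "x \<le> y" for x y
    unfolding F_def using quot[of y x] that by (intro divide_right_mono) (auto simp: abs_le_iff)
  have Gm: "G x \<le> G y" if "x \<le> y" for x y
    unfolding G_def using quot[of y x] that by (intro divide_right_mono) (auto simp: abs_le_iff)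
  have cu: "continuous_on UNIV u" by (rule lipschitz_on_continuous_on[OF u])
  have Fc: "continuous_on UNIV F" unfolding F_def w_def using L by (intro continuous_intros cu) auto
  have Gc: "continuous_on UNIV G" unfolding G_def w_def using L by (intro continuous_intros cu) auto
  let ?\<nu> = "interval_measure F" and ?\<nu>' = "interval_measure G"
  define M where "M = measure_of UNIV (sets borel) (\<lambda>X. emeasure ?\<nu> X + emeasure ?\<nu>' X)"
  have Mem: "emeasure M X = emeasure ?\<nu> X + emeasure ?\<nu>' X" if "X \<in> sets borel" for X
    unfolding M_def
  proof (rule emeasure_measure_of_sigma)
    show "sigma_algebra UNIV (sets (borel :: real measure))"
      by (metis sets.sigma_algebra_axioms space_borel)
    show "positive (sets borel) (\<lambda>X. emeasure ?\<nu> X + emeasure ?\<nu>' X)" by (simp add: positive_def)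
    show "countably_additive (sets borel) (\<lambda>X. emeasure ?\<nu> X + emeasure ?\<nu>' X)"
    proof (rule countably_additiveI)
      fix A :: "nat \<Rightarrow> real set" assume A: "range A \<subseteq> sets borel" "disjoint_family A"
      have "(\<Sum>i. emeasure ?\<nu> (A i) + emeasure ?\<nu>' (A i)) = (\<Sum>i. emeasure ?\<nu> (A i)) + (\<Sum>i. emeasure ?\<nu>' (A i))"
        by (rule suminf_add[symmetric]) auto
      then show "(\<Sum>i. emeasure ?\<nu> (A i) + emeasure ?\<nu>' (A i)) = emeasure ?\<nu> (\<Union> (range A)) + emeasure ?\<nu>' (\<Union> (range A))"
        using A by (simp add: suminf_emeasure)
    qed
  qed (use that in auto)
  have sM: "sets M = sets borel" unfolding M_def by (simp add: sets.sigma_sets_eq[of borel, simplified])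
  have atom: "emeasure (interval_measure H) {a<..<b} = ennreal (H b - H a)"
    if H: "\<And>x y. x \<le> y \<Longrightarrow> H x \<le> H y" "continuous_on UNIV H" and "a \<le> b" for H :: "real \<Rightarrow> real" and a b
  proof (cases "a = b")
    case False
    have s: "emeasure (interval_measure H) {b..b} = 0"
      using emeasure_interval_measure_Icc[of b b H] H by simp
    have cr: "continuous (at_right a) H" for a
      using H(2) by (metis continuous_on_eq_continuous_within continuous_within_subset UNIV_I subset_UNIV)
    have "emeasure (interval_measure H) {a<..b} = emeasure (interval_measure H) ({a<..<b} \<union> {b..b})"
      using False that(3) by (intro arg_cong2[where f=emeasure]) auto
    also have "\<dots> = emeasure (interval_measure H) {a<..<b}"
      by (rule emeasure_Un_null_set) (use s in auto)
    finally show ?thesis using emeasure_interval_measure_Ioc[of a b H] H(1) cr that(3) by auto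
  qed simp
  \<comment> \<open>Lebesgue measure is determined by its values on boxes, and on an open interval
    the increments of \<open>F\<close> and \<open>G\<close> add up to the length.\<close>
  have "lborel = M"
  proof (rule lborel_eqI)
    fix l r :: real assume "\<And>b. b \<in> Basis \<Longrightarrow> l \<bullet> b \<le> r \<bullet> b"
    then have lr: "l \<le> r" by simp
    have "emeasure M (box l r) = ennreal (F r - F l) + ennreal (G r - G l)"
      using Mem[of "box l r"] atom[of F, OF Fm Fc lr] atom[of G, OF Gm Gc lr] by (simp add: box_real)
    also have "\<dots> = ennreal (r - l)"
      using Fm[OF lr] Gm[OF lr] by (subst ennreal_plus[symmetric]) (auto simp: F_def G_def field_simps)
    finally show "emeasure M (box l r) = (\<Prod>b\<in>Basis. (r - l) \<bullet> b)" by simp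
  qed (rule sM)
  then have le: "emeasure ?\<nu> X \<le> emeasure lborel X" if "X \<in> sets borel" for X
    using Mem[OF that] by simp
  have ac: "absolutely_continuous lborel ?\<nu>"
    unfolding absolutely_continuous_def using le by (force simp: null_sets_def)
  obtain f where f: "f \<in> borel_measurable lborel" "density lborel f = ?\<nu>"
    using sigma_finite_measure.Radon_Nikodym[OF sigma_finite_lborel ac] by auto
  have fm[measurable]: "f \<in> borel_measurable borel" using f(1) by simp
  have nuf: "emeasure ?\<nu> X = (\<integral>\<^sup>+x\<in>X. f x \<partial>lborel)" if "X \<in> sets borel" for X
    using that f(2)[symmetric] by (simp add: emeasure_density)
  have AE1: "AE x in lborel. f x \<le> 1"
  proof (rule AE_upper_bound_inf_ennreal)
    fix e :: real assume "e > 0"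
    \<comment> \<open>On a bounded interval the measure of the exceptional set is finite and can be
      cancelled from the inequality.\<close>
    have "AE x in lborel. x \<in> {-real n..real n} \<longrightarrow> f x \<le> 1 + ennreal e" for n
    proof -
      define X where "X = {x \<in> {-real n..real n}. 1 + ennreal e < f x}"
      have X: "X \<in> sets borel" unfolding X_def by measurable
      have fin: "emeasure lborel X < \<infinity>"
      proof -
        have "emeasure lborel X \<le> emeasure lborel {-real n..real n}" by (rule emeasure_mono) (auto simp: X_def)
        then show ?thesis by (metis emeasure_lborel_Icc_eq ennreal_less_top infinity_ennreal_def le_less_trans)
      qed
      have "(1 + ennreal e) * emeasure lborel X = (\<integral>\<^sup>+x\<in>X. (1 + ennreal e) \<partial>lborel)"
        using X by (simp add: nn_integral_cmult_indicator)
      also have "\<dots> \<le> (\<integral>\<^sup>+x\<in>X. f x \<partial>lborel)"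
        by (rule nn_integral_mono) (auto simp: X_def indicator_def)
      also have "\<dots> \<le> emeasure lborel X" using le[OF X] nuf[OF X] by simp
      finally have "emeasure lborel X + ennreal e * emeasure lborel X \<le> emeasure lborel X"
        by (simp add: distrib_right)
      then have "ennreal e * emeasure lborel X = 0"
        using fin by (metis add.right_neutral ennreal_add_left_cancel_le infinity_ennreal_def le_zero_eq not_less_iff_gr_or_eq)
      then have "emeasure lborel X = 0" using \<open>e > 0\<close> by simp
      then have "AE x in lborel. x \<notin> X" using X by (intro AE_not_in) auto
      then show ?thesis by eventually_elim (auto simp: X_def not_less)
    qed
    then have "AE x in lborel. \<forall>n. x \<in> {-real n..real n} \<longrightarrow> f x \<le> 1 + ennreal e"
      by (subst AE_all_countable) blast
    then show "AE x in lborel. f x \<le> 1 + ennreal e"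
    proof eventually_elim
      fix x assume *: "\<forall>n. x \<in> {-real n..real n} \<longrightarrow> f x \<le> 1 + ennreal e"
      obtain n where "\<bar>x\<bar> \<le> real n" using real_arch_simple by blast
      then have "x \<in> {-real n..real n}" by auto
      then show "f x \<le> 1 + ennreal e" using * by blast
    qed
  qed
  define \<phi> where "\<phi> x = enn2real (min (f x) 1)" for x
  have phim[measurable]: "\<phi> \<in> borel_measurable borel" unfolding \<phi>_def by measurable
  have phif: "AE x in lborel. ennreal (\<phi> x) = f x"
    using AE1 by eventually_elim (auto simp: \<phi>_def min_def ennreal_enn2real_if top_unique)
  have phi01: "0 \<le> \<phi> t" "\<phi> t \<le> 1" for t
    unfolding \<phi>_def using enn2real_mono[of "min (f t) 1" 1] by auto
  have "((\<lambda>t. \<phi> t) has_integral ((b - a) + (u b - u a) / L) / 2) {a..b}" if ab: "a \<le> b" for a b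
  proof -
    have "(\<integral>\<^sup>+x. ennreal (\<phi> x * indicator {a..b} x) \<partial>lborel) = (\<integral>\<^sup>+x\<in>{a..b}. f x \<partial>lborel)"
      using phif by (intro nn_integral_cong_AE) (auto simp: indicator_def elim!: eventually_mono)
    also have "\<dots> = emeasure ?\<nu> {a..b}" using nuf by simp
    also have "\<dots> = ennreal (F b - F a)" using emeasure_interval_measure_Icc[OF ab, of F] Fm Fc by simp
    finally have "((\<lambda>x. \<phi> x * indicator {a..b} x) has_integral (F b - F a)) UNIV"
      using Fm[OF ab] phi01 by (intro nn_integral_has_integral) auto
    then have "((\<lambda>x. if x \<in> {a..b} then \<phi> x else 0) has_integral (F b - F a)) UNIV"
      by (rule has_integral_eq[rotated]) (auto simp: indicator_def)
    then have "(\<phi> has_integral (F b - F a)) {a..b}" by (simp only: has_integral_restrict_UNIV)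
    moreover have "F b - F a = ((b - a) + (u b - u a) / L) / 2" by (simp add: F_def w_def diff_divide_distrib add_divide_distrib)
    ultimately show ?thesis by simp
  qed
  then show ?thesis using that phim phi01 by blast
qed


text \<open>The density becomes a bounded \<open>v\<close> whose integrals are the increments of
  \<open>u\<close>. The derivative of \<open>u\<close> at \<open>t\<close> is \<open>v t\<close>
  whenever \<open>t\<close> is a density point of every band \<open>E n k\<close> of values of
  \<open>v\<close> that contains it: off the band \<open>v\<close> is merely bounded, but on a set
  of small proportion.\<close>

lemma lipschitz_real_FTC:
  fixes u :: "real \<Rightarrow> real"
  assumes u: "L-lipschitz_on UNIV u"
  obtains v :: "real \<Rightarrow> real" and K where "v \<in> borel_measurable borel" "\<And>t. \<bar>v t\<bar> \<le> K"
    "AE t in lborel. (u has_real_derivative v t) (at t)"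
    "\<And>a b. a \<le> b \<Longrightarrow> (v has_integral (u b - u a)) {a..b}"
proof -
  \<comment> \<open>The constant \<open>L\<close> may vanish, and \<open>K\<close> is used as a
    divisor.\<close>
  define K where "K = L + 1"
  have K: "K > 0" "K-lipschitz_on UNIV u"
    using u lipschitz_on_nonneg[OF u] by (auto simp: K_def intro: lipschitz_on_le)
  obtain \<phi> where phi: "\<phi> \<in> borel_measurable borel" "\<And>t. 0 \<le> \<phi> t" "\<And>t. \<phi> t \<le> 1"
    "\<And>a b. a \<le> b \<Longrightarrow> (\<phi> has_integral ((b - a) + (u b - u a) / K) / 2) {a..b}"
    by (rule lipschitz_real_density[OF K]) blast
  define v where "v t = K * (2 * \<phi> t - 1)" for t
  have [measurable]: "v \<in> borel_measurable borel" unfolding v_def using phi(1) by measurable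
  have vK: "\<bar>v t\<bar> \<le> K" for t
  proof -
    have "\<bar>2 * \<phi> t - 1\<bar> \<le> 1" using phi(2,3)[of t] by linarith
    then show ?thesis using K by (simp add: v_def abs_mult)
  qed
  have int: "(v has_integral (u b - u a)) {a..b}" if "a \<le> b" for a b
  proof -
    have "((\<lambda>t. K * (2 * \<phi> t - 1)) has_integral K * (2 * (((b - a) + (u b - u a) / K) / 2) - (b - a))) {a..b}"
      using that by (intro has_integral_mult_right has_integral_diff phi(4)) (use has_integral_const_real[of "1::real" a b] in auto)
    moreover have "K * (2 * (((b - a) + (u b - u a) / K) / 2) - (b - a)) = u b - u a"
      using K by (simp add: field_simps)
    ultimately show ?thesis unfolding v_def[abs_def] by simp
  qed
  define E where "E n k = {t. real_of_int k / real (Suc n) \<le> v t \<and> v t < real_of_int (k + 1) / real (Suc n)}" for n k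
  have Em: "E n k \<in> sets borel" for n k unfolding E_def by measurable
  have "AE t in lborel. \<forall>n k. t \<in> E n k \<longrightarrow> density_one (E n k) t"
    by (subst AE_all_countable, intro allI)+ (rule density_one_AE[OF Em])
  then have der: "AE t in lborel. (u has_real_derivative v t) (at t)"
  proof eventually_elim
    fix t0 assume t0: "\<forall>n k. t0 \<in> E n k \<longrightarrow> density_one (E n k) t0"
    have "((\<lambda>h. (u (t0 + h) - u t0) / h) \<longlongrightarrow> v t0) (at 0)"
      unfolding LIM_eq
    proof (intro allI impI)
      fix e :: real assume "e > 0"
      then obtain n where n: "1 / real (Suc n) < e / 2" using nat_approx_posE[of "e / 2"] by auto
      define k where "k = \<lfloor>v t0 * real (Suc n)\<rfloor>"
      have "real_of_int k \<le> v t0 * real (Suc n)" "v t0 * real (Suc n) < real_of_int (k + 1)"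
        unfolding k_def by linarith+
      then have tE: "t0 \<in> E n k"
        unfolding E_def mem_Collect_eq by (simp add: divide_le_eq less_divide_eq del: of_nat_Suc)
      have near: "\<bar>v t - v t0\<bar> \<le> 1 / real (Suc n)" if "t \<in> E n k" for t
      proof -
        have "real_of_int (k + 1) / real (Suc n) = real_of_int k / real (Suc n) + 1 / real (Suc n)"
          by (simp add: add_divide_distrib)
        then show ?thesis using that tE unfolding E_def by auto
      qed
      \<comment> \<open>Off the band \<open>v\<close> differs from \<open>v t0\<close> by at most
        \<open>2 * K\<close>, so the complement contributes at most \<open>e / 4\<close> times the
        step length, besides \<open>e / 2\<close> from the band.\<close>
      have "e / (8 * K) > 0" using \<open>e > 0\<close> K by simp
      then obtain d where d: "d > 0" "\<And>r. 0 < r \<Longrightarrow> r < d \<Longrightarrow> measure lborel (cball t0 r - E n k) \<le> e / (8 * K) * r"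
        using t0 tE unfolding density_one_def by force
      have "\<bar>(u (t0 + h) - u t0) / h - v t0\<bar> < e" if h: "h \<noteq> 0" "\<bar>h\<bar> < d" for h
      proof -
        define a where "a = min t0 (t0 + h)"
        define b where "b = max t0 (t0 + h)"
        have ab: "a \<le> b" "b - a = \<bar>h\<bar>" by (auto simp: a_def b_def)
        define S where "S = {a..b} - E n k"
        have Sb: "S \<in> sets borel" using Em by (auto simp: S_def)
        have "S \<subseteq> cball t0 \<bar>h\<bar> - E n k" by (auto simp: S_def a_def b_def dist_real_def)
        then have "measure lborel S \<le> measure lborel (cball t0 \<bar>h\<bar> - E n k)"
          using Sb borel_cball_fmeasurable[OF Em] by (intro measure_mono_fmeasurable) auto
        also have "\<dots> \<le> e / (8 * K) * \<bar>h\<bar>" using h by (intro d) auto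
        finally have mS: "measure lborel S \<le> e / (8 * K) * \<bar>h\<bar>" .
        have Sfin: "emeasure lborel S < \<infinity>"
        proof -
          have "emeasure lborel S \<le> emeasure lborel {a..b}" by (rule emeasure_mono) (auto simp: S_def)
          then show ?thesis by (metis emeasure_lborel_Icc_eq ennreal_less_top infinity_ennreal_def le_less_trans)
        qed
        have "((\<lambda>x. 1::real) has_integral measure lborel S) S"
          by (rule has_integral_measure_lborel[OF Sb Sfin])
        then have iS: "((\<lambda>x. if x \<in> S then 1 else 0 :: real) has_integral measure lborel S) {a..b}"
          by (subst has_integral_restrict) (auto simp: S_def)
        have ig: "((\<lambda>x. 1 / real (Suc n) + 2 * K * (if x \<in> S then 1 else 0)) has_integral
            (1 / real (Suc n) * (b - a) + 2 * K * measure lborel S)) {a..b}"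
          by (intro has_integral_add has_integral_mult_right iS)
            (use has_integral_const_real[of "1 / real (Suc n)" a b] ab in \<open>auto simp: mult.commute\<close>)
        have iv: "((\<lambda>x. v x - v t0) has_integral (u b - u a - v t0 * (b - a))) {a..b}"
          by (intro has_integral_diff int ab) (use has_integral_const_real[of "v t0" a b] ab in \<open>auto simp: mult.commute\<close>)
        have "norm (integral {a..b} (\<lambda>x. v x - v t0)) \<le> integral {a..b} (\<lambda>x. 1 / real (Suc n) + 2 * K * (if x \<in> S then 1 else 0))"
        proof (rule integral_norm_bound_integral)
          fix x assume x: "x \<in> {a..b}"
          show "norm (v x - v t0) \<le> 1 / real (Suc n) + 2 * K * (if x \<in> S then 1 else 0)"
          proof (cases "x \<in> S")
            case True
            have "norm (v x - v t0) \<le> 0 + 2 * K"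
              using vK[of x] vK[of t0] abs_triangle_ineq4[of "v x" "v t0"] by simp
            also have "\<dots> \<le> 1 / real (Suc n) + 2 * K" by (intro add_right_mono) simp
            finally show ?thesis using True by simp
          next
            case False
            then show ?thesis using x near[of x] by (simp add: S_def del: of_nat_Suc)
          qed
        qed (use iv ig in \<open>blast+\<close>)
        then have "\<bar>u b - u a - v t0 * (b - a)\<bar> \<le> 1 / real (Suc n) * \<bar>h\<bar> + 2 * K * measure lborel S"
          using integral_unique[OF iv] integral_unique[OF ig] ab by simp
        also have "\<dots> \<le> e / 2 * \<bar>h\<bar> + 2 * K * (e / (8 * K) * \<bar>h\<bar>)"
          using n mS K by (intro add_mono mult_right_mono mult_left_mono) auto
        also have "\<dots> < e * \<bar>h\<bar>" using K h \<open>e > 0\<close> by (simp add: field_simps)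
        finally have *: "\<bar>u b - u a - v t0 * (b - a)\<bar> < e * \<bar>h\<bar>" .
        have "\<bar>u b - u a - v t0 * (b - a)\<bar> = \<bar>u (t0 + h) - u t0 - v t0 * h\<bar>"
          by (cases "h \<ge> 0") (auto simp: a_def b_def min_def max_def abs_if algebra_simps)
        also have "\<dots> = \<bar>(u (t0 + h) - u t0) / h - v t0\<bar> * \<bar>h\<bar>"
          using h by (simp add: abs_mult[symmetric] field_simps)
        finally show ?thesis using * h by simp
      qed
      then show "\<exists>s>0. \<forall>x. x \<noteq> 0 \<and> norm (x - 0) < s \<longrightarrow> norm ((u (t0 + x) - u t0) / x - v t0) < e"
        using d(1) by auto
    qed
    then show "(u has_real_derivative v t0) (at t0)" by (simp add: DERIV_def)
  qed
  show ?thesis by (rule that[of v K]) (use vK der int in auto)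
qed

text \<open>The hypothesis speaks of every derivative \<open>D\<close> that exists, so that a caller
  bounds derivatives pointwise without fixing a representative of the derivative of
  \<open>u\<close>.\<close>

lemma lipschitz_real_increment_le:
  fixes u :: "real \<Rightarrow> real" and g :: "real \<Rightarrow> ennreal"
  assumes u: "L-lipschitz_on UNIV u" and g[measurable]: "g \<in> borel_measurable borel"
    and le: "AE t in lborel. t \<in> {0..1} \<longrightarrow> (\<forall>D. (u has_real_derivative D) (at t) \<longrightarrow> ennreal \<bar>D\<bar> \<le> g t)"
  shows "ennreal \<bar>u 1 - u 0\<bar> \<le> (\<integral>\<^sup>+t\<in>{0..1}. g t \<partial>lborel)"
proof -
  obtain v K where v: "v \<in> borel_measurable borel" "\<And>t. \<bar>v t\<bar> \<le> K"
    "AE t in lborel. (u has_real_derivative v t) (at t)"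
    "\<And>a b. a \<le> b \<Longrightarrow> (v has_integral (u b - u a)) {a..b}"
    by (rule lipschitz_real_FTC[OF u]) blast
  note [measurable] = v(1)
  have "integrable lborel (\<lambda>t. indicator {0..1} t *\<^sub>R v t)"
    by (rule integrableI_bounded_set_indicator[where B=K]) (use v(2) in auto)
  then have int: "integrable lborel (\<lambda>t. indicator {0..1} t * v t)" by simp
  have "((\<lambda>t. indicator {0..1} t * v t) has_integral (LINT t|lborel. indicator {0..1} t * v t)) UNIV"
    using has_integral_integral_lborel[OF int] by simp
  moreover have "((\<lambda>t. if t \<in> {0..1} then v t else 0) has_integral (u 1 - u 0)) UNIV"
    using v(4)[of 0 1] by (simp only: has_integral_restrict_UNIV)
  then have "((\<lambda>t. indicator {0..1} t * v t) has_integral (u 1 - u 0)) UNIV"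
    by (rule has_integral_eq[rotated]) (auto simp: indicator_def)
  ultimately have "u 1 - u 0 = (LINT t|lborel. indicator {0..1} t * v t)"
    using has_integral_unique by blast
  then have "ennreal \<bar>u 1 - u 0\<bar> \<le> (\<integral>\<^sup>+t. ennreal (norm (indicator {0..1} t * v t)) \<partial>lborel)"
    using integral_norm_bound_ennreal[OF int] by simp
  also have "\<dots> \<le> (\<integral>\<^sup>+t\<in>{0..1}. g t \<partial>lborel)"
    using le v(3) by (intro nn_integral_mono_AE) (auto simp: indicator_def elim!: eventually_elim2)
  finally show ?thesis .
qed

text \<open>Translation invariance turns the measure of \<open>N\<close> into the mean, over
  \<open>t\<close> in the unit interval, of the measures of its translates by
  \<open>- t *\<^sub>R b\<close>. Exchanging the integrals leaves the lengths of the intersections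
  with lines, and the space is never split into coordinates.\<close>

lemma null_sets_lines:
  fixes N :: "'a::euclidean_space set"
  assumes N[measurable]: "N \<in> sets borel" and lines: "\<And>z. AE t in lborel. z + t *\<^sub>R b \<notin> N"
  shows "N \<in> null_sets lborel"
proof -
  have tr: "(\<integral>\<^sup>+z. indicator N (z + c) \<partial>lborel) = emeasure lborel N" for c
  proof -
    have "(\<integral>\<^sup>+z. indicator N (c + z) \<partial>lborel) = (\<integral>\<^sup>+z. indicator N z \<partial>distr lborel borel ((+) c))"
      by (subst nn_integral_distr) auto
    then show ?thesis by (simp add: lborel_distr_plus add.commute)
  qed
  have "emeasure lborel N = (\<integral>\<^sup>+t. emeasure lborel N * indicator {0..1::real} t \<partial>lborel)"
    by (subst nn_integral_cmult_indicator) auto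
  also have "\<dots> = (\<integral>\<^sup>+t. (\<integral>\<^sup>+z. indicator N (z + t *\<^sub>R b) * indicator {0..1} t \<partial>lborel) \<partial>lborel)"
    by (simp add: nn_integral_multc tr)
  also have "\<dots> = (\<integral>\<^sup>+z. (\<integral>\<^sup>+t. indicator N (z + t *\<^sub>R b) * indicator {0..1} t \<partial>lborel) \<partial>lborel)"
    by (rule lborel_pair.Fubini') measurable
  also have "\<dots> = (\<integral>\<^sup>+z. 0 \<partial>(lborel :: 'a measure))"
  proof (rule nn_integral_cong)
    fix z
    have "(\<integral>\<^sup>+t. indicator N (z + t *\<^sub>R b) * indicator {0..1} t \<partial>lborel) = (\<integral>\<^sup>+t. 0 \<partial>(lborel :: real measure))"
      using lines[of z] by (intro nn_integral_cong_AE) (auto elim!: eventually_mono)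
    then show "(\<integral>\<^sup>+t. indicator N (z + t *\<^sub>R b) * indicator {0..1::real} t \<partial>lborel) = 0" by simp
  qed
  finally show ?thesis using N by (auto simp: null_sets_def)
qed

text \<open>The linear part may depend on the accuracy. Two parts with errors
  \<open>1 / Suc n\<close> and \<open>1 / Suc k\<close> differ by at most the sum of the errors, as
  testing in the direction of their difference shows; so they converge, and the limit is the
  gradient.\<close>

lemma differentiable_if_approx:
  fixes u :: "'a::euclidean_space \<Rightarrow> real"
  assumes app: "\<And>e. e > 0 \<Longrightarrow> \<exists>c. \<exists>d>0. \<forall>h. norm h < d \<longrightarrow> \<bar>u (a + h) - u a - c \<bullet> h\<bar> \<le> e * norm h"
  shows "u differentiable (at a)"
proof -
  have "\<exists>c. \<exists>d>0. \<forall>h. norm h < d \<longrightarrow> \<bar>u (a + h) - u a - c \<bullet> h\<bar> \<le> 1 / real (Suc n) * norm h" for n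
    by (rule app) simp
  then obtain c d where cd: "\<And>n. d n > 0"
    "\<And>n h. norm h < d n \<Longrightarrow> \<bar>u (a + h) - u a - c n \<bullet> h\<bar> \<le> 1 / real (Suc n) * norm h" by metis
  have cc: "norm (c n - c k) \<le> 1 / real (Suc n) + 1 / real (Suc k)" for n k
  proof (cases "c n = c k")
    case False
    define w where "w = c n - c k"
    have w: "norm w > 0" using False by (simp add: w_def)
    define s where "s = min (d n) (d k) / (2 * norm w)"
    have s: "s > 0" using cd(1)[of n] cd(1)[of k] w by (simp add: s_def)
    have ns: "norm (s *\<^sub>R w) < d n" "norm (s *\<^sub>R w) < d k"
      using w s cd(1)[of n] cd(1)[of k] by (auto simp: s_def min_def field_simps)
    have "s * (norm w)\<^sup>2 = c n \<bullet> (s *\<^sub>R w) - c k \<bullet> (s *\<^sub>R w)"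
      by (simp add: w_def power2_norm_eq_inner inner_diff_left right_diff_distrib)
    also have "\<dots> \<le> (1 / real (Suc n) + 1 / real (Suc k)) * norm (s *\<^sub>R w)"
      using cd(2)[OF ns(1)] cd(2)[OF ns(2)] by (simp add: distrib_right del: norm_scaleR of_nat_Suc)
    also have "\<dots> = (1 / real (Suc n) + 1 / real (Suc k)) * (s * norm w)" using s by simp
    finally have "(s * norm w) * norm w \<le> (s * norm w) * (1 / real (Suc n) + 1 / real (Suc k))"
      by (simp add: power2_eq_square mult_ac)
    then show ?thesis using s w by (simp add: w_def del: of_nat_Suc)
  qed simp
  have "Cauchy c"
  proof (rule metric_CauchyI)
    fix e :: real assume "e > 0"
    then obtain N where N: "1 / real (Suc N) < e / 2" using nat_approx_posE[of "e/2"] by auto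
    have "dist (c m) (c n) < e" if "m \<ge> N" "n \<ge> N" for m n
    proof -
      have "1 / real (Suc m) \<le> 1 / real (Suc N)" "1 / real (Suc n) \<le> 1 / real (Suc N)"
        using that by (auto intro!: divide_left_mono)
      then show ?thesis using cc[of m n] N by (simp add: dist_norm del: of_nat_Suc)
    qed
    then show "\<exists>M. \<forall>m\<ge>M. \<forall>n\<ge>M. dist (c m) (c n) < e" by blast
  qed
  then obtain D where D: "c \<longlonglongrightarrow> D" by (auto simp: Cauchy_convergent_iff convergent_def)
  have cD: "norm (c n - D) \<le> 1 / real (Suc n)" for n
  proof (rule LIMSEQ_le)
    show "(\<lambda>k. norm (c n - c k)) \<longlonglongrightarrow> norm (c n - D)" by (intro tendsto_intros D)
    have "(\<lambda>k. 1 / real (Suc n) + 1 / real (Suc k)) \<longlonglongrightarrow> 1 / real (Suc n) + 0"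
      by (intro tendsto_intros lim_1_over_n[THEN LIMSEQ_Suc])
    then show "(\<lambda>k. 1 / real (Suc n) + 1 / real (Suc k)) \<longlonglongrightarrow> 1 / real (Suc n)" by simp
  qed (use cc in auto)
  have "(u has_derivative (\<lambda>h. D \<bullet> h)) (at a)"
    unfolding has_derivative_at_alt
  proof (intro conjI allI impI)
    show "bounded_linear ((\<bullet>) D)" by (rule bounded_linear_inner_right)
    fix e :: real assume "e > 0"
    then obtain N where N: "1 / real (Suc N) < e / 2" using nat_approx_posE[of "e/2"] by auto
    have "norm (u y - u a - D \<bullet> (y - a)) \<le> e * norm (y - a)" if "norm (y - a) < d N" for y
    proof -
      have 1: "\<bar>u y - u a - c N \<bullet> (y - a)\<bar> \<le> 1 / real (Suc N) * norm (y - a)"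
        using cd(2)[OF that] by simp
      have "\<bar>(c N - D) \<bullet> (y - a)\<bar> \<le> norm (c N - D) * norm (y - a)" by (rule Cauchy_Schwarz_ineq2)
      also have "\<dots> \<le> 1 / real (Suc N) * norm (y - a)" by (intro mult_right_mono cD) simp
      finally have 2: "\<bar>c N \<bullet> (y - a) - D \<bullet> (y - a)\<bar> \<le> 1 / real (Suc N) * norm (y - a)"
        by (simp add: inner_diff_left)
      have "norm (u y - u a - D \<bullet> (y - a)) \<le> (1 / real (Suc N) + 1 / real (Suc N)) * norm (y - a)"
        unfolding distrib_right real_norm_def using 1 2 by linarith
      also have "\<dots> \<le> e * norm (y - a)" using N by (intro mult_right_mono) auto
      finally show ?thesis .
    qed
    then show "\<exists>d>0. \<forall>y. norm (y - a) < d \<longrightarrow> norm (u y - u a - D \<bullet> (y - a)) \<le> e * norm (y - a)"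
      using cd(1) by blast
  qed
  then show ?thesis unfolding differentiable_def by blast
qed

text \<open>On lines \<open>u\<close> is differentiable almost everywhere. The set
  \<open>E b k n c\<close> consists of the points where the slope \<open>c\<close> in direction
  \<open>b\<close> is accurate to \<open>1 / Suc k\<close> up to distance \<open>1 / Suc n\<close>.
  As \<open>c\<close> is rational, almost every point is a density point of all those sets that
  contain it. At such a point directions are added one by one: after an increment without
  \<open>b\<close> component a point of the set is close by, and from there the step along
  \<open>b\<close> is known.\<close>

theorem rademacher:
  fixes u :: "'a::euclidean_space \<Rightarrow> real"
  assumes u: "L-lipschitz_on UNIV u"
  shows "AE z in lborel. u differentiable (at z)"
proof -
  have lip: "\<bar>u x - u y\<bar> \<le> L * norm (x - y)" for x y
    using lipschitz_onD[OF u, of x y] by (simp add: dist_real_def dist_norm)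
  have L0: "L \<ge> 0" by (rule lipschitz_on_nonneg[OF u])
  have cont: "continuous_on S u" for S
    using lipschitz_on_continuous_on[OF u] continuous_on_subset by blast
  define E where "E b k n c = {z. \<forall>t. \<bar>t\<bar> \<le> 1 / real (Suc n) \<longrightarrow>
    \<bar>u (z + t *\<^sub>R b) - u z - t * c\<bar> \<le> 1 / real (Suc k) * \<bar>t\<bar>}" for b k n c
  have Ecl: "closed (E b k n c)" for b k n c
    unfolding E_def
    by (intro closed_Collect_all closed_Collect_imp closed_Collect_le open_Collect_const)
      (intro continuous_intros continuous_on_compose2[OF cont[of UNIV]] cont; simp)+
  have Em[measurable]: "E b k n c \<in> sets borel" for b k n c using Ecl by (rule borel_closed)
  define G where "G b = (\<Inter>k. \<Union>n. \<Union>c\<in>\<rat>. E b k n c)" for b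
  have Gm[measurable]: "G b \<in> sets borel" for b
  proof -
    have "(\<Union>c\<in>\<rat>. E b k n c) \<in> sets borel" for k n
      by (rule sets.countable_UN''[OF countable_rat]) simp
    then have "(\<Union>n. \<Union>c\<in>\<rat>. E b k n c) \<in> sets borel" for k
      by (intro sets.countable_UN) auto
    then show ?thesis unfolding G_def by (intro sets.countable_INT) auto
  qed
  have G: "AE z in lborel. z \<in> G b" for b
  proof -
    have "- G b \<in> null_sets lborel"
    proof (rule null_sets_lines[of _ b])
      fix z
      define w where "w t = u (z + t *\<^sub>R b)" for t
      have wl: "(L * norm b)-lipschitz_on UNIV w"
      proof (rule lipschitz_onI)
        fix s t :: real
        have "dist (w s) (w t) \<le> L * norm ((s - t) *\<^sub>R b)"
          using lip[of "z + s *\<^sub>R b" "z + t *\<^sub>R b"] by (simp add: w_def dist_real_def algebra_simps)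
        then show "dist (w s) (w t) \<le> L * norm b * dist s t" by (simp add: dist_real_def mult_ac)
      qed (use L0 in simp)
      obtain v K where v: "AE t in lborel. (w has_real_derivative v t) (at t)"
        by (rule lipschitz_real_FTC[OF wl]) blast
      then show "AE t in lborel. z + t *\<^sub>R b \<notin> - G b"
      proof eventually_elim
        fix t0 assume "(w has_real_derivative v t0) (at t0)"
        then have lim: "((\<lambda>h. (w (t0 + h) - w t0) / h) \<longlongrightarrow> v t0) (at 0)" by (simp add: DERIV_def)
        have "\<exists>n. \<exists>c\<in>\<rat>. z + t0 *\<^sub>R b \<in> E b k n c" for k
        proof -
          have e: "0 < 1 / real (Suc k) / 2" by simp
          obtain s where s: "s > 0" "\<And>h. h \<noteq> 0 \<Longrightarrow> \<bar>h\<bar> < s \<Longrightarrow> \<bar>(w (t0 + h) - w t0) / h - v t0\<bar> < 1 / real (Suc k) / 2"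
            using LIM_D[OF lim e] by auto
          obtain n where n: "1 / real (Suc n) < s" using nat_approx_posE[OF s(1)] by blast
          obtain c where c: "c \<in> \<rat>" "v t0 < c" "c < v t0 + 1 / real (Suc k) / 2"
            using Rats_dense_in_real[of "v t0" "v t0 + 1 / real (Suc k) / 2"] e by auto
          have "\<bar>w (t0 + h) - w t0 - h * c\<bar> \<le> 1 / real (Suc k) * \<bar>h\<bar>" if "\<bar>h\<bar> \<le> 1 / real (Suc n)" for h
          proof (cases "h = 0")
            case False
            have "\<bar>(w (t0 + h) - w t0) / h - v t0\<bar> < 1 / real (Suc k) / 2" using False that n by (intro s) auto
            then have "\<bar>(w (t0 + h) - w t0) / h - c\<bar> \<le> 1 / real (Suc k)"
            proof -
              have "\<bar>q - c\<bar> \<le> e" if "\<bar>q - p\<bar> < e / 2" "p < c" "c < p + e / 2" for q p e :: real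
                using that by linarith
              then show ?thesis using \<open>\<bar>(w (t0 + h) - w t0) / h - v t0\<bar> < 1 / real (Suc k) / 2\<close> c(2,3) by blast
            qed
            then have "\<bar>(w (t0 + h) - w t0) / h - c\<bar> * \<bar>h\<bar> \<le> 1 / real (Suc k) * \<bar>h\<bar>"
              by (rule mult_right_mono) simp
            moreover have "\<bar>(w (t0 + h) - w t0) / h - c\<bar> * \<bar>h\<bar> = \<bar>w (t0 + h) - w t0 - h * c\<bar>"
              using False by (simp add: abs_mult[symmetric] field_simps)
            ultimately show ?thesis by simp
          qed simp
          then have "z + t0 *\<^sub>R b \<in> E b k n c"
            by (auto simp: E_def w_def algebra_simps simp del: of_nat_Suc)
          then show ?thesis using c by blast
        qed
        then show "z + t0 *\<^sub>R b \<notin> - G b" by (auto simp: G_def)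
      qed
    qed measurable
    then have "AE z in lborel. z \<notin> - G b" by (rule AE_not_in)
    then show ?thesis by simp
  qed
  have "AE z in lborel. \<forall>b\<in>Basis. z \<in> G b"
    by (subst AE_ball_countable) (auto intro: countable_finite G)
  moreover have "AE z in lborel. \<forall>b\<in>Basis. \<forall>k n. \<forall>c\<in>\<rat>. z \<in> E b k n c \<longrightarrow> density_one (E b k n c) z"
    by (subst AE_ball_countable AE_all_countable; (intro countable_finite finite_Basis countable_rat ballI allI)?)+
      (rule density_one_AE[OF Em])
  ultimately show ?thesis
  proof eventually_elim
    fix a :: 'a
    assume aG: "\<forall>b\<in>Basis. a \<in> G b"
      and dens: "\<forall>b\<in>Basis. \<forall>k n. \<forall>c\<in>\<rat>. a \<in> E b k n c \<longrightarrow> density_one (E b k n c) a"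
    \<comment> \<open>Increments are confined to the span of \<open>I\<close>. The error is measured
      by a radius \<open>r \<ge> norm h\<close> and not by \<open>norm h\<close>, because points of
      the sets \<open>E b k n c\<close> are found only up to a fraction of the radius.\<close>
    have claim: "\<forall>e>0. \<exists>c. \<exists>d>0. \<forall>r h. 0 < r \<and> r < d \<and> norm h \<le> r \<and> (\<forall>b\<in>Basis - I. h \<bullet> b = 0) \<longrightarrow>
        \<bar>u (a + h) - u a - c \<bullet> h\<bar> \<le> e * r" if "I \<subseteq> Basis" for I
      using finite_subset[OF that finite_Basis] that
    proof (induction I rule: finite_induct)
      case empty
      have "h = 0" if "\<forall>b\<in>Basis. h \<bullet> b = 0" for h :: 'a
        using that by (simp add: euclidean_eq_iff[of h 0])
      then have "h = 0" if "\<forall>b\<in>Basis - {}. h \<bullet> b = 0" for h :: 'a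
        using that by simp
      then have "\<bar>u (a + h) - u a - 0 \<bullet> h\<bar> \<le> e * r" if "\<forall>b\<in>Basis - {}. h \<bullet> b = 0" "0 < e" "0 < r" for h e r
      proof -
        have "h = 0" using \<open>\<And>h. \<forall>b\<in>Basis - {}. h \<bullet> b = 0 \<Longrightarrow> h = 0\<close> that(1) by blast
        then show ?thesis using that by simp
      qed
      then show ?case by (blast intro: zero_less_one)
    next
      case (insert b I)
      show ?case
      proof (intro allI impI)
        fix e :: real assume e: "e > 0"
        have bB: "b \<in> Basis" using insert by auto
        have IB: "I \<subseteq> Basis" using insert by auto
        have "\<exists>c. \<exists>d>0. \<forall>r h. 0 < r \<and> r < d \<and> norm h \<le> r \<and> (\<forall>b\<in>Basis - I. h \<bullet> b = 0) \<longrightarrow>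
            \<bar>u (a + h) - u a - c \<bullet> h\<bar> \<le> e / 2 * r"
          using insert.IH[OF IB] half_gt_zero[OF e] by blast
        then obtain c' d1 where c': "d1 > 0" "\<And>r h. 0 < r \<Longrightarrow> r < d1 \<Longrightarrow> norm h \<le> r \<Longrightarrow> (\<forall>b\<in>Basis - I. h \<bullet> b = 0) \<Longrightarrow>
            \<bar>u (a + h) - u a - c' \<bullet> h\<bar> \<le> e / 2 * r"
          by blast
        obtain k where k: "1 / real (Suc k) < e / 4" using nat_approx_posE[of "e/4"] e by auto
        obtain n cb where cb: "cb \<in> \<rat>" "a \<in> E b k n cb" using aG bB unfolding G_def by blast
        have de: "density_one (E b k n cb) a" using dens bB cb by blast
        \<comment> \<open>The budget: \<open>e / 2\<close> from the induction hypothesis,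
          \<open>e / 8\<close> for each of the moves from \<open>a + h'\<close> to \<open>z\<close>
          and from \<open>z + t *\<^sub>R b\<close> to \<open>a + h\<close>, and
          \<open>e / 4\<close> for the step along \<open>b\<close>.\<close>
        define \<eta> where "\<eta> = e / (8 * (L + 1))"
        have eta: "\<eta> > 0" using e L0 by (simp add: \<eta>_def)
        obtain d2 where d2: "d2 > 0" "\<And>h s. 0 < s \<Longrightarrow> s < d2 \<Longrightarrow> norm h \<le> s \<Longrightarrow>
            \<exists>x\<in>E b k n cb. norm (x - (a + h)) \<le> \<eta> * s"
          using density_one_meets[OF Em de eta] by blast
        define c where "c = c' + (cb - c' \<bullet> b) *\<^sub>R b"
        define d where "d = min (min d1 d2) (1 / real (Suc n))"
        have "\<bar>u (a + h) - u a - c \<bullet> h\<bar> \<le> e * r"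
          if r: "0 < r" "r < d" "norm h \<le> r" and h: "\<forall>b\<in>Basis - insert b I. h \<bullet> b = 0" for r h
        proof -
          define t where "t = h \<bullet> b"
          define h' where "h' = h - t *\<^sub>R b"
          have tr: "\<bar>t\<bar> \<le> r" using Basis_le_norm[OF bB, of h] r by (simp add: t_def)
          have h'b: "h' \<bullet> b = 0" using bB by (simp add: h'_def t_def inner_diff_left)
          have "(norm h)\<^sup>2 = (norm h')\<^sup>2 + t\<^sup>2"
          proof -
            have "h = h' + t *\<^sub>R b" by (simp add: h'_def)
            then have "(norm h)\<^sup>2 = (h' + t *\<^sub>R b) \<bullet> (h' + t *\<^sub>R b)" by (simp add: power2_norm_eq_inner)
            also have "\<dots> = h' \<bullet> h' + t * t" using h'b bB
              by (simp add: inner_add_left inner_add_right inner_commute[of b h'])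
            finally show ?thesis by (simp only: dot_square_norm power2_eq_square[of t])
          qed
          then have "(norm h')\<^sup>2 \<le> (norm h)\<^sup>2" by simp
          then have nh': "norm h' \<le> r" using r(3) by (meson norm_ge_zero order_trans power2_le_imp_le)
          have h'0: "\<forall>b\<in>Basis - I. h' \<bullet> b = 0"
          proof
            fix b' assume b': "b' \<in> Basis - I"
            show "h' \<bullet> b' = 0"
            proof (cases "b' = b")
              case False
              then show ?thesis using b' h bB by (simp add: h'_def inner_diff_left inner_Basis)
            qed (use h'b in simp)
          qed
          have 1: "\<bar>u (a + h') - u a - c' \<bullet> h'\<bar> \<le> e / 2 * r"
            using r by (intro c'(2) nh' h'0) (auto simp: d_def)
          obtain z where z: "z \<in> E b k n cb" "norm (z - (a + h')) \<le> \<eta> * r"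
            using d2(2)[OF r(1) _ nh'] r by (auto simp: d_def)
          have zt: "\<bar>u (z + t *\<^sub>R b) - u z - t * cb\<bar> \<le> 1 / real (Suc k) * \<bar>t\<bar>"
            using z(1) tr r unfolding E_def d_def by auto
          have q: "L * norm (z - (a + h')) \<le> e / 8 * r"
          proof -
            have "L * norm (z - (a + h')) \<le> (L + 1) * (\<eta> * r)"
              using z(2) L0 by (intro mult_mono) auto
            also have "\<dots> = e / 8 * r"
            proof -
              have "M * (e / (8 * M) * r) = e / 8 * r" if "M > 0" for M :: real using that by simp
              note * = this
              show ?thesis unfolding \<eta>_def by (rule *) (use L0 in simp)
            qed
            finally show ?thesis .
          qed
          have ah: "a + h - (z + t *\<^sub>R b) = - (z - (a + h'))" by (simp add: h'_def)
          have 2: "\<bar>u (a + h) - u (z + t *\<^sub>R b)\<bar> \<le> e / 8 * r"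
            using lip[of "a + h" "z + t *\<^sub>R b"] q unfolding ah norm_minus_cancel by linarith
          have 3: "\<bar>u z - u (a + h')\<bar> \<le> e / 8 * r" using lip[of z "a + h'"] q by linarith
          have 4: "1 / real (Suc k) * \<bar>t\<bar> \<le> e / 4 * r"
            using k tr e by (intro mult_mono) auto
          have ch: "c \<bullet> h = c' \<bullet> h' + t * cb"
            using bB by (simp add: c_def h'_def t_def inner_add_left inner_diff_right algebra_simps inner_commute)
          show ?thesis using 1 2 3 4 zt unfolding ch by linarith
        qed
        moreover have "d > 0" using c'(1) d2(1) by (simp add: d_def)
        ultimately show "\<exists>c. \<exists>d>0. \<forall>r h. 0 < r \<and> r < d \<and> norm h \<le> r \<and> (\<forall>b\<in>Basis - insert b I. h \<bullet> b = 0) \<longrightarrow>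
          \<bar>u (a + h) - u a - c \<bullet> h\<bar> \<le> e * r" by blast
      qed
    qed
    show "u differentiable (at a)"
    proof (rule differentiable_if_approx)
      fix e :: real assume "e > 0"
      then obtain c d where cd: "d > 0" "\<And>r h. 0 < r \<Longrightarrow> r < d \<Longrightarrow> norm h \<le> r \<Longrightarrow>
          \<bar>u (a + h) - u a - c \<bullet> h\<bar> \<le> e * r"
        using claim[OF order_refl, rule_format, OF \<open>e > 0\<close>] by (simp; blast)
      have "\<bar>u (a + h) - u a - c \<bullet> h\<bar> \<le> e * norm h" if "norm h < d" for h
        using cd(2)[of "norm h" h] that by (cases "h = 0") auto
      then show "\<exists>c. \<exists>d>0. \<forall>h. norm h < d \<longrightarrow> \<bar>u (a + h) - u a - c \<bullet> h\<bar> \<le> e * norm h"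
        using cd(1) by blast
    qed
  qed
qed

text \<open>The McShane extension, the infimum of the cones \<open>f a + L * dist x a\<close>; it
  keeps the constant \<open>L\<close>.\<close>

lemma lipschitz_extension_real:
  fixes f :: "'a::metric_space \<Rightarrow> real"
  assumes f: "L-lipschitz_on A f"
  obtains g where "L-lipschitz_on UNIV g" "\<And>x. x \<in> A \<Longrightarrow> g x = f x"
proof (cases "A = {}")
  case True
  show ?thesis by (rule that[of "\<lambda>_. 0"]) (use True lipschitz_on_nonneg[OF f] in \<open>auto intro!: lipschitz_onI\<close>)
next
  case False
  have L0: "L \<ge> 0" by (rule lipschitz_on_nonneg[OF f])
  define g where "g x = (INF a\<in>A. f a + L * dist x a)" for x
  have lb: "f b - L * dist x b \<le> f a + L * dist x a" if "a \<in> A" "b \<in> A" for a b x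
  proof -
    have "f b - f a \<le> L * dist b a" using lipschitz_onD[OF f that(2,1)] by (simp add: dist_real_def)
    also have "\<dots> \<le> L * (dist x b + dist x a)" using L0 by (intro mult_left_mono) (metis dist_commute dist_triangle)
    finally show ?thesis by (simp add: distrib_left)
  qed
  have bdd: "bdd_below ((\<lambda>a. f a + L * dist x a) ` A)" for x
    using False lb by (metis (no_types, lifting) bdd_belowI2 ex_in_conv)
  have gA: "g x = f x" if "x \<in> A" for x
    unfolding g_def
  proof (rule antisym)
    show "(INF a\<in>A. f a + L * dist x a) \<le> f x" using cINF_lower[OF bdd that, of x] by simp
    show "f x \<le> (INF a\<in>A. f a + L * dist x a)"
      using lb[OF _ that, of _ x] by (intro cINF_greatest False) auto
  qed
  have "g x \<le> g y + L * dist x y" for x y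
  proof -
    have "g x - L * dist x y \<le> f a + L * dist y a" if "a \<in> A" for a
    proof -
      have "g x \<le> f a + L * dist x a" unfolding g_def by (rule cINF_lower[OF bdd that])
      also have "\<dots> \<le> f a + L * (dist x y + dist y a)" using L0 by (intro add_left_mono mult_left_mono dist_triangle)
      finally show ?thesis by (simp add: distrib_left)
    qed
    then have "g x - L * dist x y \<le> g y" unfolding g_def[of y] by (intro cINF_greatest False) auto
    then show ?thesis by simp
  qed
  note * = this
  have "L-lipschitz_on UNIV g"
  proof (rule lipschitz_onI)
    fix x y
    show "dist (g x) (g y) \<le> L * dist x y"
      using *[of x y] *[of y x] by (simp add: dist_real_def dist_commute[of y x] abs_le_iff)
  qed (rule L0)
  then show ?thesis using that gA by blast
qed

section \<open>Integrals along segments\<close>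

lemma nn_integral_dilation:
  fixes H :: "'a::euclidean_space \<Rightarrow> ennreal"
  assumes [measurable]: "H \<in> borel_measurable borel" and c: "c > 0"
  shows "(\<integral>\<^sup>+y. H y \<partial>lborel) = ennreal (c ^ DIM('a)) * (\<integral>\<^sup>+z. H (x + c *\<^sub>R (z - x)) \<partial>lborel)"
proof -
  have "(\<integral>\<^sup>+y. H y \<partial>lborel) =
    (\<integral>\<^sup>+y. H y \<partial>density (distr lborel borel (\<lambda>z. (x - c *\<^sub>R x) + c *\<^sub>R z)) (\<lambda>_. ennreal (\<bar>c\<bar> ^ DIM('a))))"
    using lborel_affine[of c "x - c *\<^sub>R x"] c by simp
  also have "\<dots> = ennreal (c ^ DIM('a)) * (\<integral>\<^sup>+z. H ((x - c *\<^sub>R x) + c *\<^sub>R z) \<partial>lborel)"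
    using c by (simp add: nn_integral_density nn_integral_distr nn_integral_cmult)
  also have "(\<lambda>z. (x - c *\<^sub>R x) + c *\<^sub>R z) = (\<lambda>z. x + c *\<^sub>R (z - x))"
    by (simp add: algebra_simps)
  finally show ?thesis by (simp add: algebra_simps)
qed

text \<open>For fixed \<open>t > 0\<close> the map sending \<open>y\<close> to
  \<open>x + t *\<^sub>R (y - x)\<close> is a dilation and pulls null sets back to null sets; Fubini
  then exchanges \<open>t\<close> and \<open>y\<close>. The value \<open>t = 0\<close> is left out
  because \<open>x\<close> is a given point, at which \<open>P\<close> may fail.\<close>

lemma AE_segments:
  fixes x :: "'a::euclidean_space"
  assumes "AE z in lborel. P z"
  shows "AE y in lborel. AE t in lborel. t \<in> {0<..1} \<longrightarrow> P (x + t *\<^sub>R (y - x))"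
proof -
  obtain N where N: "N \<in> null_sets lborel" "{z. \<not> P z} \<subseteq> N"
    using assms by (auto simp: eventually_ae_filter)
  then have [measurable]: "N \<in> sets borel" by (auto simp: null_sets_def)
  have "(\<integral>\<^sup>+y. (\<integral>\<^sup>+t. indicator {0<..1} t * indicator N (x + t *\<^sub>R (y - x)) \<partial>lborel) \<partial>(lborel :: 'a measure))
    = (\<integral>\<^sup>+t. (\<integral>\<^sup>+y. indicator {0<..1} t * indicator N (x + t *\<^sub>R (y - x)) \<partial>(lborel :: 'a measure)) \<partial>(lborel :: real measure))"
    by (rule lborel_pair.Fubini'[symmetric]) measurable
  also have "\<dots> = (\<integral>\<^sup>+t. 0 \<partial>(lborel :: real measure))"
  proof (rule nn_integral_cong)
    fix t :: real
    show "(\<integral>\<^sup>+y. indicator {0<..1} t * indicator N (x + t *\<^sub>R (y - x)) \<partial>(lborel :: 'a measure)) = 0"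
    proof (cases "t \<in> {0<..1}")
      case True
      then have t: "t > 0" by simp
      have "(\<integral>\<^sup>+z. indicator N z \<partial>(lborel :: 'a measure)) = 0" using null_setsD1[OF N(1)] by simp
      then have "ennreal (t ^ DIM('a)) * (\<integral>\<^sup>+z. indicator N (x + t *\<^sub>R (z - x)) \<partial>lborel) = 0"
        using nn_integral_dilation[of "indicator N" t x] t by simp
      then have "(\<integral>\<^sup>+z. indicator N (x + t *\<^sub>R (z - x)) \<partial>(lborel::'a measure)) = 0" using t by simp
      then show ?thesis using True by simp
    qed simp
  qed
  finally have "(\<integral>\<^sup>+y. (\<integral>\<^sup>+t. indicator {0<..1} t * indicator N (x + t *\<^sub>R (y - x)) \<partial>lborel) \<partial>(lborel :: 'a measure)) = 0"
    by simp
  then have "AE y in (lborel :: 'a measure). (\<integral>\<^sup>+t. indicator {0<..1} t * indicator N (x + t *\<^sub>R (y - x)) \<partial>(lborel :: real measure)) = 0"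
    by (subst (asm) nn_integral_0_iff_AE) (auto intro!: lborel.borel_measurable_nn_integral)
  then show ?thesis
  proof eventually_elim
    fix y
    assume "(\<integral>\<^sup>+t. indicator {0<..1} t * indicator N (x + t *\<^sub>R (y - x)) \<partial>(lborel :: real measure)) = 0"
    then have "AE t in lborel. indicator {0<..1} t * indicator N (x + t *\<^sub>R (y - x)) = (0::ennreal)"
      by (subst (asm) nn_integral_0_iff_AE) auto
    then show "AE t in lborel. t \<in> {0<..1} \<longrightarrow> P (x + t *\<^sub>R (y - x))"
      by eventually_elim (use N in \<open>auto simp: indicator_def split: if_splits\<close>)
  qed
qed

text \<open>Almost every segment from the given point \<open>x\<close> runs through points of
  differentiability, up to a null set of parameters. There the chain rule bounds the derivative
  along the segment, and the bound for increments on the line applies.\<close>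

lemma lipschitz_segment_bound:
  fixes u :: "'a::euclidean_space \<Rightarrow> real" and g :: "'a \<Rightarrow> ennreal"
  assumes u: "L-lipschitz_on UNIV u" and g[measurable]: "g \<in> borel_measurable borel"
    and V: "convex V" "x \<in> V"
    and le: "AE z in lborel. z \<in> V \<longrightarrow> (\<forall>h. ennreal \<bar>frechet_derivative u (at z) h\<bar> \<le> g z * ennreal (norm h))"
  shows "AE y in lborel. y \<in> V \<longrightarrow>
    ennreal \<bar>u y - u x\<bar> \<le> ennreal (norm (y - x)) * (\<integral>\<^sup>+t\<in>{0..1}. g (x + t *\<^sub>R (y - x)) \<partial>lborel)"
proof -
  have L0: "L \<ge> 0" by (rule lipschitz_on_nonneg[OF u])
  have "AE z in lborel. u differentiable (at z) \<and>
    (z \<in> V \<longrightarrow> (\<forall>h. ennreal \<bar>frechet_derivative u (at z) h\<bar> \<le> g z * ennreal (norm h)))"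
    using rademacher[OF u] le by eventually_elim simp
  from AE_segments[OF this, of x] show ?thesis
  proof (eventually_elim, intro impI)
    fix y assume good: "AE t in lborel. t \<in> {0<..1} \<longrightarrow> u differentiable (at (x + t *\<^sub>R (y - x))) \<and>
      (x + t *\<^sub>R (y - x) \<in> V \<longrightarrow> (\<forall>h. ennreal \<bar>frechet_derivative u (at (x + t *\<^sub>R (y - x))) h\<bar> \<le> g (x + t *\<^sub>R (y - x)) * ennreal (norm h)))"
      and y: "y \<in> V"
    define w where "w t = u (x + t *\<^sub>R (y - x))" for t
    have wl: "(L * norm (y - x))-lipschitz_on UNIV w"
    proof (rule lipschitz_onI)
      fix s t :: real
      have "dist (w s) (w t) \<le> L * norm ((s - t) *\<^sub>R (y - x))"
        using lipschitz_onD[OF u, of "x + s *\<^sub>R (y - x)" "x + t *\<^sub>R (y - x)"] by (simp add: w_def dist_norm algebra_simps)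
      then show "dist (w s) (w t) \<le> L * norm (y - x) * dist s t" by (simp add: dist_real_def mult_ac)
    qed (use L0 in simp)
    have "AE t in lborel. t \<noteq> (0::real)" by (rule AE_lborel_singleton)
    with good have "AE t in lborel. t \<in> {0..1} \<longrightarrow> (\<forall>D. (w has_real_derivative D) (at t) \<longrightarrow>
        ennreal \<bar>D\<bar> \<le> g (x + t *\<^sub>R (y - x)) * ennreal (norm (y - x)))"
    proof (eventually_elim, intro impI allI)
      fix t D assume t: "t \<in> {0<..1} \<longrightarrow> u differentiable (at (x + t *\<^sub>R (y - x))) \<and>
        (x + t *\<^sub>R (y - x) \<in> V \<longrightarrow> (\<forall>h. ennreal \<bar>frechet_derivative u (at (x + t *\<^sub>R (y - x))) h\<bar> \<le> g (x + t *\<^sub>R (y - x)) * ennreal (norm h)))"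
        "t \<noteq> 0" "t \<in> {0..1}" and D: "(w has_real_derivative D) (at t)"
      have t01: "t \<in> {0<..1}" using t by auto
      have zV: "x + t *\<^sub>R (y - x) \<in> V"
        using convexD_alt[OF V(1) V(2) y, of t] t01 by (simp add: algebra_simps)
      let ?F = "frechet_derivative u (at (x + t *\<^sub>R (y - x)))"
      have du: "(u has_derivative ?F) (at (x + t *\<^sub>R (y - x)))"
        using t t01 frechet_derivative_works by blast
      have "((\<lambda>t. x + t *\<^sub>R (y - x)) has_derivative (\<lambda>s. s *\<^sub>R (y - x))) (at t)"
        by (auto intro!: derivative_eq_intros)
      then have "((u \<circ> (\<lambda>t. x + t *\<^sub>R (y - x))) has_derivative (?F \<circ> (\<lambda>s. s *\<^sub>R (y - x)))) (at t)"
        by (intro diff_chain_at du)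
      then have "(w has_derivative (\<lambda>s. ?F (s *\<^sub>R (y - x)))) (at t)" by (simp add: w_def[abs_def] o_def)
      moreover have "(w has_derivative (\<lambda>s. D * s)) (at t)" using D by (simp add: has_field_derivative_def)
      ultimately have "(\<lambda>s. ?F (s *\<^sub>R (y - x))) = (\<lambda>s. D * s)" by (rule has_derivative_unique)
      then have "?F (y - x) = D" by (metis mult.right_neutral scaleR_one)
      then show "ennreal \<bar>D\<bar> \<le> g (x + t *\<^sub>R (y - x)) * ennreal (norm (y - x))"
        using t t01 zV by auto
    qed
    then have "ennreal \<bar>w 1 - w 0\<bar> \<le> (\<integral>\<^sup>+t\<in>{0..1}. (g (x + t *\<^sub>R (y - x)) * ennreal (norm (y - x))) \<partial>lborel)"
      by (intro lipschitz_real_increment_le[OF wl]) auto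
    also have "\<dots> = (\<integral>\<^sup>+t. ennreal (norm (y - x)) * (g (x + t *\<^sub>R (y - x)) * indicator {0..1} t) \<partial>lborel)"
      by (simp add: mult_ac)
    also have "\<dots> = ennreal (norm (y - x)) * (\<integral>\<^sup>+t\<in>{0..1}. g (x + t *\<^sub>R (y - x)) \<partial>lborel)"
      by (rule nn_integral_cmult) auto
    finally show "ennreal \<bar>u y - u x\<bar> \<le> ennreal (norm (y - x)) * (\<integral>\<^sup>+t\<in>{0..1}. g (x + t *\<^sub>R (y - x)) \<partial>lborel)"
      by (simp add: w_def)
  qed
qed

text \<open>The origin of the factor \<open>D powr (q + real m - 1)\<close>. Its constant is 1
  because the value of the antiderivative at 1 and the denominator \<open>q + m - 1 \<ge> 1\<close>
  may be dropped.\<close>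

lemma powr_tail_integral:
  fixes a D q :: real
  assumes a: "0 < a" "a \<le> D" and q: "q \<ge> 1" and m: "m \<ge> (1::nat)"
  shows "(\<integral>\<^sup>+t. ennreal (a powr q * t powr (- (q + real m))) * indicator {a / D..1} t \<partial>lborel)
    \<le> ennreal (D powr (q + real m - 1) / a ^ (m - 1))"
proof -
  define s where "s = q + real m"
  have s: "s \<ge> 2" using q m by (simp add: s_def)
  define b where "b = a / D"
  have b: "0 < b" "b \<le> 1" using a by (auto simp: b_def)
  define F where "F t = a powr q * (- (t powr (1 - s)) / (s - 1))" for t
  have "(\<integral>\<^sup>+t. ennreal (a powr q * t powr (- s)) * indicator {b..1} t \<partial>lborel) = ennreal (F 1 - F b)"
  proof (rule nn_integral_FTC_Icc)
    fix t assume t: "t \<in> {b..1}"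
    then have t0: "t > 0" using b by simp
    have "((\<lambda>t. t powr (1 - s)) has_real_derivative (1 - s) * t powr (1 - s - 1)) (at t)"
      using t0 by (auto intro!: derivative_eq_intros has_real_derivative_powr)
    then have "(F has_real_derivative a powr q * (- ((1 - s) * t powr (1 - s - 1)) / (s - 1))) (at t)"
      unfolding F_def by (intro DERIV_cmult DERIV_cdivide DERIV_minus)
    also have "a powr q * (- ((1 - s) * t powr (1 - s - 1)) / (s - 1)) = a powr q * t powr (- s)"
      using s by (simp add: field_simps)
    finally show "DERIV F t :> a powr q * t powr (- s)" .
  qed (use b in auto)
  also have "F 1 - F b = a powr q * ((b powr (1 - s) - 1) / (s - 1))"
    using s by (simp add: F_def right_diff_distrib diff_divide_distrib)
  also have "\<dots> \<le> a powr q * b powr (1 - s)"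
  proof (rule mult_left_mono)
    have "b powr (1 - s) \<ge> 0" by simp
    then have "b powr (1 - s) * 1 \<le> b powr (1 - s) * (s - 1)" using s by (intro mult_left_mono) auto
    then show "(b powr (1 - s) - 1) / (s - 1) \<le> b powr (1 - s)" using s by (simp add: divide_le_eq)
  qed simp
  also have "a powr q * b powr (1 - s) = D powr (q + real m - 1) / a ^ (m - 1)"
  proof -
    have "b powr (1 - s) = a powr (1 - s) * D powr (s - 1)"
      using a by (simp add: b_def powr_divide powr_minus_divide[of D "s - 1", simplified])
    moreover have "a powr q * a powr (1 - s) = 1 / a ^ (m - 1)"
    proof -
      have "a powr q * a powr (1 - s) = a powr (- real (m - 1))"
        using m by (simp add: powr_add[symmetric] s_def of_nat_diff)
      also have "\<dots> = 1 / a ^ (m - 1)" using a by (simp only: powr_minus_divide powr_realpow)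
      finally show ?thesis .
    qed
    ultimately have "a powr q * b powr (1 - s) = 1 / a ^ (m - 1) * D powr (s - 1)" by (metis mult.assoc)
    then show ?thesis by (simp add: s_def)
  qed
  finally show ?thesis unfolding s_def b_def by (simp add: ennreal_leI)
qed

text \<open>For fixed \<open>t\<close> substitute \<open>z = x + t *\<^sub>R (y - x)\<close>, with
  Jacobian \<open>t powr (- m)\<close>. A point \<open>z\<close> is reached only for
  \<open>t \<ge> norm (z - x) / D\<close>, and integrating over these \<open>t\<close> leaves the
  Riesz kernel. The function \<open>k\<close> is the weight of \<open>z\<close> in the slice
  \<open>t\<close>; convexity keeps \<open>z\<close> in \<open>V\<close>.\<close>

lemma segment_potential_bound:
  fixes G :: "'a::euclidean_space \<Rightarrow> ennreal"
  assumes G[measurable]: "G \<in> borel_measurable borel" and V[measurable]: "V \<in> sets borel"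
    and cV: "convex V" "x \<in> V" and D: "\<And>y. y \<in> V \<Longrightarrow> norm (y - x) \<le> D" and q: "q \<ge> 1"
  shows "(\<integral>\<^sup>+y\<in>V. (ennreal (norm (y - x) powr q) * (\<integral>\<^sup>+t\<in>{0..1}. G (x + t *\<^sub>R (y - x)) \<partial>lborel)) \<partial>lborel)
    \<le> ennreal (D powr (q + real DIM('a) - 1)) * (\<integral>\<^sup>+z\<in>V. (G z * ennreal (1 / norm (z - x) ^ (DIM('a) - 1))) \<partial>lborel)"
proof -
  let ?m = "DIM('a)"
  define k :: "'a \<Rightarrow> real \<Rightarrow> ennreal" where
    "k z t = (if 0 < t \<and> t \<le> 1 \<and> norm (z - x) \<le> t * D then ennreal (norm (z - x) powr q * t powr (- (q + real ?m))) else 0)" for z t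
  have km[measurable]: "case_prod k \<in> borel_measurable (lborel \<Otimes>\<^sub>M lborel)"
    unfolding k_def[abs_def] case_prod_unfold by measurable
  have "(\<integral>\<^sup>+y\<in>V. (ennreal (norm (y - x) powr q) * (\<integral>\<^sup>+t\<in>{0..1}. G (x + t *\<^sub>R (y - x)) \<partial>lborel)) \<partial>lborel)
    = (\<integral>\<^sup>+y. (\<integral>\<^sup>+t. (indicator V y * ennreal (norm (y - x) powr q)) * (G (x + t *\<^sub>R (y - x)) * indicator {0..1} t) \<partial>lborel) \<partial>lborel)"
    by (intro nn_integral_cong, subst nn_integral_cmult) (auto simp: mult_ac)
  also have "\<dots> = (\<integral>\<^sup>+t. (\<integral>\<^sup>+y. (indicator V y * ennreal (norm (y - x) powr q)) * (G (x + t *\<^sub>R (y - x)) * indicator {0..1} t) \<partial>lborel) \<partial>lborel)"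
    by (rule lborel_pair.Fubini'[symmetric]) measurable
  also have "\<dots> \<le> (\<integral>\<^sup>+t. (\<integral>\<^sup>+z. indicator V z * G z * k z t \<partial>lborel) \<partial>lborel)"
  proof (rule nn_integral_mono_AE)
    have "AE t in lborel. t \<noteq> (0::real)" by (rule AE_lborel_singleton)
    then show "AE t in lborel. (\<integral>\<^sup>+y. (indicator V y * ennreal (norm (y - x) powr q)) * (G (x + t *\<^sub>R (y - x)) * indicator {0..1} t) \<partial>lborel)
      \<le> (\<integral>\<^sup>+z. indicator V z * G z * k z t \<partial>lborel)"
    proof eventually_elim
      fix t :: real assume "t \<noteq> 0"
      show "(\<integral>\<^sup>+y. (indicator V y * ennreal (norm (y - x) powr q)) * (G (x + t *\<^sub>R (y - x)) * indicator {0..1} t) \<partial>lborel)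
        \<le> (\<integral>\<^sup>+z. indicator V z * G z * k z t \<partial>lborel)"
      proof (cases "t \<in> {0..1}")
        case True
        then have t: "0 < t" "t \<le> 1" using \<open>t \<noteq> 0\<close> by auto
        have "(\<integral>\<^sup>+y. (indicator V y * ennreal (norm (y - x) powr q)) * (G (x + t *\<^sub>R (y - x)) * indicator {0..1} t) \<partial>lborel)
          = ennreal ((1 / t) ^ ?m) * (\<integral>\<^sup>+z. indicator V (x + (1 / t) *\<^sub>R (z - x)) * ennreal (norm ((1 / t) *\<^sub>R (z - x)) powr q) * G z \<partial>lborel)"
          using True t by (subst nn_integral_dilation[of _ "1 / t" x]) (auto simp del: norm_scaleR)
        also have "\<dots> = (\<integral>\<^sup>+z. ennreal ((1 / t) ^ ?m) * (indicator V (x + (1 / t) *\<^sub>R (z - x)) * ennreal (norm ((1 / t) *\<^sub>R (z - x)) powr q) * G z) \<partial>lborel)"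
          by (rule nn_integral_cmult[symmetric]) measurable
        also have "\<dots> \<le> (\<integral>\<^sup>+z. indicator V z * G z * k z t \<partial>lborel)"
        proof (rule nn_integral_mono)
          fix z :: 'a
          show "ennreal ((1 / t) ^ ?m) * (indicator V (x + (1 / t) *\<^sub>R (z - x)) * ennreal (norm ((1 / t) *\<^sub>R (z - x)) powr q) * G z)
            \<le> indicator V z * G z * k z t"
          proof (cases "x + (1 / t) *\<^sub>R (z - x) \<in> V")
            case zV: True
            have "(1 - t) *\<^sub>R x + t *\<^sub>R (x + (1 / t) *\<^sub>R (z - x)) \<in> V"
              by (rule convexD_alt[OF cV zV]) (use t in auto)
            moreover have "(1 - t) *\<^sub>R x + t *\<^sub>R (x + (1 / t) *\<^sub>R (z - x)) = z"
              using t by (simp add: algebra_simps)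
            ultimately have "z \<in> V" by simp
            have nt: "norm ((1 / t) *\<^sub>R (z - x)) = norm (z - x) / t" using t by simp
            have "norm ((1 / t) *\<^sub>R (z - x)) \<le> D" using D[OF zV] by simp
            then have nz: "norm (z - x) \<le> t * D" using t unfolding nt by (simp add: divide_le_eq mult.commute)
            have "(1 / t) ^ ?m * norm ((1 / t) *\<^sub>R (z - x)) powr q = norm (z - x) powr q * t powr (- (q + real ?m))"
            proof -
              have "norm ((1 / t) *\<^sub>R (z - x)) powr q = norm (z - x) powr q * t powr (- q)"
                using t unfolding nt by (simp add: powr_divide powr_minus_divide)
              moreover have "(1 / t) ^ ?m = t powr (- real ?m)"
                using t by (simp add: powr_minus_divide powr_realpow power_one_over)
              ultimately show ?thesis by (simp add: powr_add[symmetric] mult_ac)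
            qed
            then have "ennreal ((1 / t) ^ ?m) * ennreal (norm ((1 / t) *\<^sub>R (z - x)) powr q) = k z t"
              using t nz by (simp add: k_def ennreal_mult'[symmetric] del: norm_scaleR)
            then show ?thesis using zV \<open>z \<in> V\<close> by (simp add: mult_ac del: norm_scaleR)
          qed simp
        qed
        finally show ?thesis .
      qed simp
    qed
  qed
  also have "\<dots> = (\<integral>\<^sup>+z. (\<integral>\<^sup>+t. indicator V z * G z * k z t \<partial>lborel) \<partial>lborel)"
    by (rule lborel_pair.Fubini') measurable
  also have "\<dots> \<le> (\<integral>\<^sup>+z. ennreal (D powr (q + real ?m - 1)) * (G z * ennreal (1 / norm (z - x) ^ (?m - 1)) * indicator V z) \<partial>lborel)"
  proof (rule nn_integral_mono_AE)
    have "AE z in lborel. z \<noteq> x" by (rule AE_lborel_singleton)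
    then show "AE z in lborel. (\<integral>\<^sup>+t. indicator V z * G z * k z t \<partial>lborel)
      \<le> ennreal (D powr (q + real ?m - 1)) * (G z * ennreal (1 / norm (z - x) ^ (?m - 1)) * indicator V z)"
    proof eventually_elim
      fix z assume zx: "z \<noteq> x"
      have kz[measurable]: "k z \<in> borel_measurable borel"
        unfolding k_def[abs_def] by measurable
      show "(\<integral>\<^sup>+t. indicator V z * G z * k z t \<partial>lborel)
        \<le> ennreal (D powr (q + real ?m - 1)) * (G z * ennreal (1 / norm (z - x) ^ (?m - 1)) * indicator V z)"
      proof (cases "z \<in> V")
        case True
        define a where "a = norm (z - x)"
        have a: "0 < a" "a \<le> D" using zx D[OF True] by (auto simp: a_def)
        have "(\<integral>\<^sup>+t. k z t \<partial>lborel) \<le> (\<integral>\<^sup>+t. ennreal (a powr q * t powr (- (q + real ?m))) * indicator {a / D..1} t \<partial>lborel)"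
          by (rule nn_integral_mono) (use a in \<open>auto simp: k_def a_def[symmetric] indicator_def field_simps\<close>)
        also have "\<dots> \<le> ennreal (D powr (q + real ?m - 1) / a ^ (?m - 1))"
          by (rule powr_tail_integral[OF a q]) (simp add: Suc_leI)
        also have "\<dots> = ennreal (D powr (q + real ?m - 1)) * ennreal (1 / a ^ (?m - 1))"
          by (subst ennreal_mult[symmetric]) (use a in auto)
        finally have "G z * (\<integral>\<^sup>+t. k z t \<partial>lborel) \<le> G z * (ennreal (D powr (q + real ?m - 1)) * ennreal (1 / a ^ (?m - 1)))"
          by (rule mult_left_mono) simp
        then show ?thesis using True by (simp add: nn_integral_cmult a_def mult_ac)
      qed simp
    qed
  qed
  also have "\<dots> = ennreal (D powr (q + real ?m - 1)) * (\<integral>\<^sup>+z\<in>V. (G z * ennreal (1 / norm (z - x) ^ (?m - 1))) \<partial>lborel)"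
    by (rule nn_integral_cmult) measurable
  finally show ?thesis .
qed

text \<open>Cut the ball into dyadic shells. Between the radii \<open>R / 2 ^ Suc k\<close> and
  \<open>R / 2 ^ k\<close> the kernel is at most \<open>c k\<close>, and the growth condition makes
  the contributions geometric. The condition fits Lebesgue measure as well as functions with bounded
  averages around \<open>x\<close>.\<close>

lemma riesz_ball_bound:
  fixes G :: "'a::euclidean_space \<Rightarrow> ennreal"
  assumes G[measurable]: "G \<in> borel_measurable borel" and R: "R > 0" and K: "K \<ge> 0"
    and le: "\<And>r. 0 < r \<Longrightarrow> r \<le> R \<Longrightarrow> (\<integral>\<^sup>+z\<in>cball x r. G z \<partial>lborel) \<le> ennreal (K * r ^ DIM('a))"
  shows "(\<integral>\<^sup>+z\<in>cball x R. (G z * ennreal (1 / norm (z - x) ^ (DIM('a) - 1))) \<partial>lborel) \<le> ennreal (2 ^ DIM('a) * K * R)"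
proof -
  let ?m = "DIM('a)"
  obtain m' where m': "?m = Suc m'" using gr0_conv_Suc[of ?m] by auto
  define c where "c k = (2 ^ Suc k / R) ^ (?m - 1)" for k :: nat
  have c0: "c k \<ge> 0" for k using R by (simp add: c_def)
  have [measurable]: "Measurable.pred borel (\<lambda>z. z \<in> cball x r)" for r
    by (rule pred_sets2[OF _ measurable_ident_sets[OF refl]]) simp
  have "(\<integral>\<^sup>+z\<in>cball x R. (G z * ennreal (1 / norm (z - x) ^ (?m - 1))) \<partial>lborel)
    \<le> (\<integral>\<^sup>+z. (\<Sum>k. ennreal (c k) * (G z * indicator (cball x (R / 2 ^ k)) z)) \<partial>lborel)"
  proof (rule nn_integral_mono_AE)
    have "AE z in lborel. z \<noteq> x" by (rule AE_lborel_singleton)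
    then show "AE z in lborel. G z * ennreal (1 / norm (z - x) ^ (?m - 1)) * indicator (cball x R) z
        \<le> (\<Sum>k. ennreal (c k) * (G z * indicator (cball x (R / 2 ^ k)) z))"
    proof eventually_elim
      fix z assume zx: "z \<noteq> x"
      show "G z * ennreal (1 / norm (z - x) ^ (?m - 1)) * indicator (cball x R) z
        \<le> (\<Sum>k. ennreal (c k) * (G z * indicator (cball x (R / 2 ^ k)) z))"
      proof (cases "z \<in> cball x R")
        case True
        define a where "a = norm (z - x)"
        have a: "0 < a" "a \<le> R" using zx True by (auto simp: a_def dist_norm norm_minus_commute)
        have "\<exists>n. R / 2 ^ n < a"
        proof -
          have "\<exists>n. R / a < 2 ^ n" by (rule real_arch_pow) simp
          then obtain n where "R / a < 2 ^ n" by blast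
          then have "R / 2 ^ n < a" using a by (simp add: divide_less_eq mult.commute)
          then show ?thesis by blast
        qed
        then obtain n where n: "R / 2 ^ n < a" "\<And>j. j < n \<Longrightarrow> \<not> R / 2 ^ j < a"
          using exists_least_iff[of "\<lambda>n. R / 2 ^ n < a"] by blast
        have "n \<noteq> 0" using n(1) a by (cases n) auto
        then obtain k where k: "n = Suc k" by (cases n) auto
        have ak: "a \<le> R / 2 ^ k" using n(2)[of k] k by simp
        have "1 / a ^ (?m - 1) = (1 / a) ^ (?m - 1)" by (simp add: power_one_over)
        also have "\<dots> \<le> c k" unfolding c_def
          using n(1) k a R by (intro power_mono) (auto simp: field_simps)
        finally have "G z * ennreal (1 / a ^ (?m - 1)) \<le> G z * ennreal (c k)"
          by (intro mult_left_mono ennreal_leI) auto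
        also have "\<dots> = ennreal (c k) * (G z * indicator (cball x (R / 2 ^ k)) z)"
          using ak by (simp add: a_def dist_norm norm_minus_commute mult_ac)
        also have "\<dots> = (\<Sum>k\<in>{k}. ennreal (c k) * (G z * indicator (cball x (R / 2 ^ k)) z))" by simp
        also have "\<dots> \<le> (\<Sum>k. ennreal (c k) * (G z * indicator (cball x (R / 2 ^ k)) z))"
          by (rule sum_le_suminf) auto
        finally show ?thesis using True by (simp add: a_def)
      qed simp
    qed
  qed
  also have "\<dots> = (\<Sum>k. (\<integral>\<^sup>+z. ennreal (c k) * (G z * indicator (cball x (R / 2 ^ k)) z) \<partial>lborel))"
    by (rule nn_integral_suminf) measurable
  also have "\<dots> \<le> (\<Sum>k. ennreal (2 ^ m' * K * R * (1 / 2) ^ k))"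
  proof (intro suminf_le summableI)
    fix k
    have "(\<integral>\<^sup>+z. ennreal (c k) * (G z * indicator (cball x (R / 2 ^ k)) z) \<partial>lborel) = ennreal (c k) * (\<integral>\<^sup>+z\<in>cball x (R / 2 ^ k). G z \<partial>lborel)"
      by (rule nn_integral_cmult) measurable
    also have "\<dots> \<le> ennreal (c k) * ennreal (K * (R / 2 ^ k) ^ ?m)"
      using R by (intro mult_left_mono le) (auto simp: divide_le_eq)
    also have "\<dots> = ennreal (c k * (K * (R / 2 ^ k) ^ ?m))" using c0 by (simp add: ennreal_mult')
    also have "c k * (K * (R / 2 ^ k) ^ ?m) = 2 ^ m' * K * R * (1 / 2) ^ k"
    proof -
      have "c k * (R / 2 ^ k) ^ m' = (2 ^ Suc k / R * (R / 2 ^ k)) ^ m'"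
        unfolding c_def m' by (simp only: power_mult_distrib[symmetric] diff_Suc_1)
      also have "2 ^ Suc k / R * (R / 2 ^ k) = 2" using R by simp
      finally have "c k * (K * (R / 2 ^ k) ^ ?m) = 2 ^ m' * (K * (R / 2 ^ k))"
        unfolding m' power_Suc by (metis (no_types, lifting) mult.assoc mult.commute)
      then show ?thesis by (simp add: power_one_over)
    qed
    finally show "(\<integral>\<^sup>+z. ennreal (c k) * (G z * indicator (cball x (R / 2 ^ k)) z) \<partial>lborel) \<le> ennreal (2 ^ m' * K * R * (1 / 2) ^ k)" .
  qed
  also have "\<dots> = ennreal (2 ^ m' * K * R * 2)"
  proof (rule suminf_ennreal_eq)
    show "(\<lambda>k. 2 ^ m' * K * R * (1 / 2) ^ k) sums (2 ^ m' * K * R * 2)"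
      using sums_mult[OF geometric_sums[of "1/2::real"], of "2 ^ m' * K * R"] by simp
  qed (use K R in simp)
  also have "2 ^ m' * K * R * 2 = 2 ^ ?m * K * R" by (simp add: m')
  finally show ?thesis .
qed

text \<open>In the bound of the kernel over a set of given measure the first summand is the
  contribution of a ball around the pole, and the 1 that of the rest.\<close>

definition riesz_const :: "nat \<Rightarrow> real" where
  "riesz_const m = 2 ^ m * unit_ball_vol (real m) + 1"

lemma riesz_const_ge1: "riesz_const DIM('a::euclidean_space) \<ge> 1"
  unfolding riesz_const_def using unit_ball_vol_pos_DIM[where 'a='a] by simp

text \<open>Split at the radius \<open>R\<close> for which \<open>R ^ m\<close> is the measure of
  \<open>W\<close>. Inside, use the dyadic estimate for Lebesgue measure; outside, the kernel is at
  most \<open>1 / R ^ (m - 1)\<close>, and this times the measure of \<open>W\<close> is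
  \<open>R\<close>.\<close>

lemma riesz_measure_bound:
  fixes W :: "'a::euclidean_space set"
  assumes W[measurable]: "W \<in> sets borel" and fin: "emeasure lborel W < \<infinity>"
  shows "(\<integral>\<^sup>+z\<in>W. ennreal (1 / norm (z - x) ^ (DIM('a) - 1)) \<partial>lborel)
    \<le> ennreal (riesz_const DIM('a) * measure lborel W powr (1 / real DIM('a)))"
proof (cases "measure lborel W = 0")
  case True
  then have "emeasure lborel W = 0" using fin by (auto simp: measure_def enn2real_eq_0_iff)
  then have "W \<in> null_sets lborel" using W by auto
  then have "(\<integral>\<^sup>+z\<in>W. ennreal (1 / norm (z - x) ^ (DIM('a) - 1)) \<partial>lborel) = 0"
    by (rule nn_integral_null_set)
  then show ?thesis by simp
next
  case False
  let ?m = "DIM('a)" and ?w = "unit_ball_vol (real DIM('a))"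
  define M where "M = measure lborel W"
  have M: "M > 0" using False by (simp add: M_def zero_less_measure_iff)
  define R where "R = M powr (1 / real ?m)"
  have R: "R > 0" using M by (simp add: R_def)
  have Rm: "R ^ ?m = M" unfolding R_def using M by (simp add: powr_power)
  have w: "?w \<ge> 0" using unit_ball_vol_pos_DIM[where 'a='a] by simp
  have [measurable]: "Measurable.pred borel (\<lambda>z. z \<in> cball x r)" for r
    by (rule pred_sets2[OF _ measurable_ident_sets[OF refl]]) simp
  have eW: "emeasure lborel W = ennreal M"
    using fin by (simp add: M_def emeasure_eq_ennreal_measure)
  have "(\<integral>\<^sup>+z\<in>W. ennreal (1 / norm (z - x) ^ (?m - 1)) \<partial>lborel)
    \<le> (\<integral>\<^sup>+z. (1 * ennreal (1 / norm (z - x) ^ (?m - 1))) * indicator (cball x R) z + ennreal (1 / R ^ (?m - 1)) * indicator W z \<partial>lborel)"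
  proof (rule nn_integral_mono)
    fix z :: 'a
    show "ennreal (1 / norm (z - x) ^ (?m - 1)) * indicator W z
      \<le> (1 * ennreal (1 / norm (z - x) ^ (?m - 1))) * indicator (cball x R) z + ennreal (1 / R ^ (?m - 1)) * indicator W z"
    proof (cases "z \<in> cball x R")
      case True
      have "ennreal (1 / norm (z - x) ^ (?m - 1)) * indicator W z \<le> ennreal (1 / norm (z - x) ^ (?m - 1)) * 1"
        by (cases "z \<in> W") simp_all
      also have "\<dots> \<le> (1 * ennreal (1 / norm (z - x) ^ (?m - 1))) * indicator (cball x R) z + ennreal (1 / R ^ (?m - 1)) * indicator W z"
        using True by (simp add: add_increasing2)
      finally show ?thesis .
    next
      case False
      then have "R \<le> norm (z - x)" by (simp add: dist_norm norm_minus_commute)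
      then have "1 / norm (z - x) ^ (?m - 1) \<le> 1 / R ^ (?m - 1)"
        using R by (intro divide_left_mono power_mono mult_pos_pos zero_less_power) auto
      then have "ennreal (1 / norm (z - x) ^ (?m - 1)) * indicator W z \<le> ennreal (1 / R ^ (?m - 1)) * indicator W z"
        by (rule mult_right_mono[OF ennreal_leI]) simp
      then show ?thesis using False by simp
    qed
  qed
  also have "\<dots> = (\<integral>\<^sup>+z\<in>cball x R. (1 * ennreal (1 / norm (z - x) ^ (?m - 1))) \<partial>lborel) + (\<integral>\<^sup>+z. ennreal (1 / R ^ (?m - 1)) * indicator W z \<partial>lborel)"
    by (rule nn_integral_add; measurable)
  also have "\<dots> \<le> ennreal (2 ^ ?m * ?w * R) + ennreal R"
  proof (rule add_mono)
    show "(\<integral>\<^sup>+z\<in>cball x R. (1 * ennreal (1 / norm (z - x) ^ (?m - 1))) \<partial>lborel) \<le> ennreal (2 ^ ?m * ?w * R)"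
      by (rule riesz_ball_bound[OF _ R w]) (auto simp: emeasure_cball)
    have "(\<integral>\<^sup>+z. ennreal (1 / R ^ (?m - 1)) * indicator W z \<partial>lborel) = ennreal (1 / R ^ (?m - 1)) * ennreal (R ^ ?m)"
      by (subst nn_integral_cmult_indicator) (auto simp: eW Rm)
    also have "\<dots> = ennreal (1 / R ^ (?m - 1) * R ^ ?m)" using R by (subst ennreal_mult[symmetric]) auto
    also have "1 / R ^ (?m - 1) * R ^ ?m = R"
      using R by (cases ?m) auto
    finally show "(\<integral>\<^sup>+z. ennreal (1 / R ^ (?m - 1)) * indicator W z \<partial>lborel) \<le> ennreal R" by simp
  qed
  also have "\<dots> = ennreal (riesz_const ?m * R)"
    using R w by (subst ennreal_plus[symmetric]) (auto simp: riesz_const_def distrib_right)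
  finally show ?thesis by (simp add: R_def M_def)
qed

section \<open>A Morrey estimate with an exceptional set\<close>

lemma lipschitz_derivative_le:
  fixes v :: "'a::real_normed_vector \<Rightarrow> real"
  assumes v: "L-lipschitz_on UNIV v" and d: "(v has_derivative D) (at z)"
  shows "\<bar>D h\<bar> \<le> L * norm h"
proof -
  have "((\<lambda>t. z + t *\<^sub>R h) has_derivative (\<lambda>s. s *\<^sub>R h)) (at 0)"
    by (auto intro!: derivative_eq_intros)
  then have "((v \<circ> (\<lambda>t. z + t *\<^sub>R h)) has_derivative (D \<circ> (\<lambda>s. s *\<^sub>R h))) (at 0)"
    by (intro diff_chain_at) (use d in auto)
  moreover have "(D \<circ> (\<lambda>s. s *\<^sub>R h)) = (*) (D h)"
    using linear_cmul[OF has_derivative_linear[OF d]] by (auto simp: o_def mult.commute)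
  ultimately have "((v \<circ> (\<lambda>t. z + t *\<^sub>R h)) has_real_derivative D h) (at 0)"
    by (simp add: has_field_derivative_def)
  then have "((\<lambda>t. (v (z + t *\<^sub>R h) - v z) / t) \<longlongrightarrow> D h) (at 0)"
    by (simp add: DERIV_def)
  then have lim: "((\<lambda>t. \<bar>(v (z + t *\<^sub>R h) - v z) / t\<bar>) \<longlongrightarrow> \<bar>D h\<bar>) (at 0)"
    by (rule tendsto_rabs)
  have "\<bar>(v (z + t *\<^sub>R h) - v z) / t\<bar> \<le> L * norm h" if "t \<noteq> 0" for t
    using lipschitz_onD[OF v, of "z + t *\<^sub>R h" z] that
    by (simp add: dist_real_def dist_norm divide_le_eq mult_ac)
  then have "\<forall>\<^sub>F t in at 0. \<bar>(v (z + t *\<^sub>R h) - v z) / t\<bar> \<le> L * norm h"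
    by (auto simp: eventually_at_filter)
  then show ?thesis by (rule tendsto_upperbound[OF lim]) simp
qed

text \<open>The numerator collects the two base points, the factor \<open>3 ^ m\<close> (points of a
  ball of radius \<open>2 * r\<close> are within \<open>3 * r\<close> of each base point) and the
  kernel bounds. The denominator is the volume of that ball divided by \<open>r ^ m\<close>.\<close>

definition morrey_const :: "nat \<Rightarrow> real" where
  "morrey_const m = 2 * 3 ^ m * riesz_const m * (2 * unit_ball_vol (real m) powr (1 / real m) + 1) / (unit_ball_vol (real m) * 2 ^ m)"

text \<open>Both \<open>v x\<close> and \<open>v a\<close> are compared with the values of
  \<open>v\<close> on \<open>ball a (2 * r)\<close> by integration along segments. The part where
  the gradient is small contributes \<open>\<epsilon> * r\<close>. The exceptional part enters only
  through its measure to the power \<open>1 / m\<close>, which is small against \<open>r\<close> if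
  \<open>a\<close> is a density point of \<open>C\<close>; there the global constant
  \<open>L\<close> takes the place of higher integrability of the gradient.\<close>

lemma morrey_bound:
  fixes v :: "'a::euclidean_space \<Rightarrow> real"
  assumes v: "L-lipschitz_on UNIV v" and C[measurable]: "C \<in> sets borel" and e: "0 \<le> \<epsilon>"
    and le: "AE z in lborel. z \<in> C \<longrightarrow> (\<forall>h. \<bar>frechet_derivative v (at z) h\<bar> \<le> \<epsilon> * norm h)"
    and r: "norm (x - a) = r" "r > 0"
  shows "\<bar>v x - v a\<bar> \<le> morrey_const DIM('a) *
    (\<epsilon> * r + L * measure lborel (cball a (2 * r) - C) powr (1 / real DIM('a)))"
proof -
  let ?m = "DIM('a)" and ?w = "unit_ball_vol (real DIM('a))"
  have L0: "L \<ge> 0" by (rule lipschitz_on_nonneg[OF v])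
  have w: "?w > 0" by (rule unit_ball_vol_pos_DIM)
  have m1: "?m \<ge> 1" by (simp add: Suc_leI)
  define V where "V = ball a (2 * r)"
  have Vm[measurable]: "V \<in> sets borel" by (simp add: V_def)
  define g where "g z = ennreal \<epsilon> * indicator C z + ennreal L * indicator (- C) z" for z
  have gm[measurable]: "g \<in> borel_measurable borel" unfolding g_def[abs_def] by measurable
  have eV: "emeasure lborel V = ennreal (?w * (2 * r) ^ ?m)" using r by (simp add: V_def emeasure_ball)
  have mV: "measure lborel V = ?w * (2 * r) ^ ?m" using r by (simp add: V_def content_ball)
  have lipD: "\<bar>frechet_derivative v (at z) h\<bar> \<le> L * norm h" if "v differentiable (at z)" for z h
  proof -
    have d: "(v has_derivative frechet_derivative v (at z)) (at z)"
      by (rule frechet_derivative_works[THEN iffD1, OF that])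
    show ?thesis by (rule lipschitz_derivative_le[OF v d])
  qed
  have gle: "AE z in lborel. z \<in> V \<longrightarrow> (\<forall>h. ennreal \<bar>frechet_derivative v (at z) h\<bar> \<le> g z * ennreal (norm h))"
    using le rademacher[OF v]
  proof eventually_elim
    fix z assume "z \<in> C \<longrightarrow> (\<forall>h. \<bar>frechet_derivative v (at z) h\<bar> \<le> \<epsilon> * norm h)" "v differentiable (at z)"
    then show "z \<in> V \<longrightarrow> (\<forall>h. ennreal \<bar>frechet_derivative v (at z) h\<bar> \<le> g z * ennreal (norm h))"
      using lipD[of z] e L0 by (cases "z \<in> C") (simp_all add: g_def ennreal_mult'[symmetric] ennreal_leI)
  qed
  define B where "B = (3 * r) ^ ?m * (riesz_const ?m * (\<epsilon> * (?w powr (1 / real ?m) * (2 * r)) +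
      L * measure lborel (cball a (2 * r) - C) powr (1 / real ?m)))"
  have point: "(\<integral>\<^sup>+y\<in>V. ennreal \<bar>v y - v p\<bar> \<partial>lborel) \<le> ennreal B" if p: "norm (p - a) \<le> r" for p
  proof -
    have pV: "p \<in> V" using p r by (simp add: V_def dist_norm norm_minus_commute)
    have D: "norm (y - p) \<le> 3 * r" if "y \<in> V" for y
      using that p norm_triangle_ineq4[of "y - a" "p - a"] by (simp add: V_def dist_norm norm_minus_commute)
    have "(\<integral>\<^sup>+y\<in>V. ennreal \<bar>v y - v p\<bar> \<partial>lborel)
      \<le> (\<integral>\<^sup>+y\<in>V. (ennreal (norm (y - p) powr 1) * (\<integral>\<^sup>+t\<in>{0..1}. g (p + t *\<^sub>R (y - p)) \<partial>lborel)) \<partial>lborel)"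
      using lipschitz_segment_bound[OF v gm _ pV gle]
      by (intro nn_integral_mono_AE) (auto simp: V_def indicator_def elim!: eventually_mono)
    also have "\<dots> \<le> ennreal ((3 * r) powr (1 + real ?m - 1)) * (\<integral>\<^sup>+z\<in>V. (g z * ennreal (1 / norm (z - p) ^ (?m - 1))) \<partial>lborel)"
      by (rule segment_potential_bound) (use pV D in \<open>auto simp: V_def\<close>)
    also have "(\<integral>\<^sup>+z\<in>V. (g z * ennreal (1 / norm (z - p) ^ (?m - 1))) \<partial>lborel) =
      (\<integral>\<^sup>+z. ennreal \<epsilon> * (ennreal (1 / norm (z - p) ^ (?m - 1)) * indicator (V \<inter> C) z) +
        ennreal L * (ennreal (1 / norm (z - p) ^ (?m - 1)) * indicator (V - C) z) \<partial>lborel)"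
      by (intro nn_integral_cong) (auto simp: g_def indicator_def)
    also have "\<dots> = ennreal \<epsilon> * (\<integral>\<^sup>+z\<in>V \<inter> C. ennreal (1 / norm (z - p) ^ (?m - 1)) \<partial>lborel) +
      ennreal L * (\<integral>\<^sup>+z\<in>V - C. ennreal (1 / norm (z - p) ^ (?m - 1)) \<partial>lborel)"
      by (simp add: nn_integral_add nn_integral_cmult)
    also have "\<dots> \<le> ennreal \<epsilon> * ennreal (riesz_const ?m * (?w powr (1 / real ?m) * (2 * r))) +
      ennreal L * ennreal (riesz_const ?m * measure lborel (cball a (2 * r) - C) powr (1 / real ?m))"
    proof (intro add_mono mult_left_mono)
      have fV: "emeasure lborel V < \<infinity>" by (simp add: eV)
      have "(\<integral>\<^sup>+z\<in>V \<inter> C. ennreal (1 / norm (z - p) ^ (?m - 1)) \<partial>lborel) \<le> (\<integral>\<^sup>+z\<in>V. ennreal (1 / norm (z - p) ^ (?m - 1)) \<partial>lborel)"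
        by (intro nn_integral_mono) (auto simp: indicator_def)
      also have "\<dots> \<le> ennreal (riesz_const ?m * measure lborel V powr (1 / real ?m))"
        by (rule riesz_measure_bound[OF Vm fV])
      also have "measure lborel V powr (1 / real ?m) = ?w powr (1 / real ?m) * (2 * r)"
        unfolding mV using w r by (simp add: powr_mult powr_realpow[symmetric] powr_powr)
      finally show "(\<integral>\<^sup>+z\<in>V \<inter> C. ennreal (1 / norm (z - p) ^ (?m - 1)) \<partial>lborel) \<le> ennreal (riesz_const ?m * (?w powr (1 / real ?m) * (2 * r)))" .
      have sub: "V - C \<subseteq> cball a (2 * r) - C" by (auto simp: V_def)
      have "emeasure lborel (V - C) \<le> emeasure lborel V" by (rule emeasure_mono) auto
      then have "(\<integral>\<^sup>+z\<in>V - C. ennreal (1 / norm (z - p) ^ (?m - 1)) \<partial>lborel) \<le> ennreal (riesz_const ?m * measure lborel (V - C) powr (1 / real ?m))"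
        using fV by (intro riesz_measure_bound) auto
      also have "\<dots> \<le> ennreal (riesz_const ?m * measure lborel (cball a (2 * r) - C) powr (1 / real ?m))"
        using riesz_const_ge1[where 'a='a] sub
        by (intro ennreal_leI mult_left_mono powr_mono2 measure_mono_fmeasurable borel_cball_fmeasurable C) auto
      finally show "(\<integral>\<^sup>+z\<in>V - C. ennreal (1 / norm (z - p) ^ (?m - 1)) \<partial>lborel) \<le> \<dots>" .
    qed auto
    also have "\<dots> = ennreal (riesz_const ?m * (\<epsilon> * (?w powr (1 / real ?m) * (2 * r)) +
      L * measure lborel (cball a (2 * r) - C) powr (1 / real ?m)))"
      using e L0 r riesz_const_ge1[where 'a='a]
      by (simp add: ennreal_mult'[symmetric] ennreal_plus[symmetric] distrib_left mult_ac del: ennreal_plus)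
    finally have "(\<integral>\<^sup>+y\<in>V. ennreal \<bar>v y - v p\<bar> \<partial>lborel) \<le> ennreal ((3 * r) powr (1 + real ?m - 1)) *
       ennreal (riesz_const ?m * (\<epsilon> * (?w powr (1 / real ?m) * (2 * r)) + L * measure lborel (cball a (2 * r) - C) powr (1 / real ?m)))"
      by (simp add: mult_left_mono)
    also have "\<dots> = ennreal B"
      unfolding B_def using r by (simp add: ennreal_mult'[symmetric] powr_realpow)
    finally show ?thesis .
  qed
  have vm[measurable]: "v \<in> borel_measurable borel"
    using lipschitz_on_continuous_on[OF v] by (rule borel_measurable_continuous_onI)
  have "ennreal (\<bar>v x - v a\<bar> * (?w * (2 * r) ^ ?m)) = (\<integral>\<^sup>+y. ennreal \<bar>v x - v a\<bar> * indicator V y \<partial>lborel)"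
    using w r by (subst nn_integral_cmult_indicator) (auto simp: eV ennreal_mult')
  also have "\<dots> \<le> (\<integral>\<^sup>+y. ennreal \<bar>v y - v x\<bar> * indicator V y + ennreal \<bar>v y - v a\<bar> * indicator V y \<partial>lborel)"
    by (rule nn_integral_mono) (auto simp: indicator_def ennreal_plus[symmetric] simp del: ennreal_plus intro!: ennreal_leI)
  also have "\<dots> = (\<integral>\<^sup>+y\<in>V. ennreal \<bar>v y - v x\<bar> \<partial>lborel) + (\<integral>\<^sup>+y\<in>V. ennreal \<bar>v y - v a\<bar> \<partial>lborel)"
    by (rule nn_integral_add) measurable
  also have "\<dots> \<le> ennreal B + ennreal B" using r by (intro add_mono point) auto
  also have B0: "B \<ge> 0" unfolding B_def using e L0 r riesz_const_ge1[where 'a='a] by (intro mult_nonneg_nonneg add_nonneg_nonneg) auto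
  then have "ennreal B + ennreal B = ennreal (2 * B)" by (simp add: ennreal_plus[symmetric] del: ennreal_plus)
  finally have "\<bar>v x - v a\<bar> * (?w * (2 * r) ^ ?m) \<le> 2 * B" using B0 by (simp add: ennreal_le_iff)
  then have "\<bar>v x - v a\<bar> \<le> 2 * B / (?w * (2 * r) ^ ?m)"
    using w r by (simp add: pos_le_divide_eq)
  also have "\<dots> = 2 * 3 ^ ?m * riesz_const ?m / (?w * 2 ^ ?m) *
     (\<epsilon> * (?w powr (1 / real ?m) * (2 * r)) + L * measure lborel (cball a (2 * r) - C) powr (1 / real ?m))"
    using r w by (simp add: B_def power_mult_distrib)
  also have "\<dots> \<le> 2 * 3 ^ ?m * riesz_const ?m / (?w * 2 ^ ?m) *
     ((2 * ?w powr (1 / real ?m) + 1) * (\<epsilon> * r + L * measure lborel (cball a (2 * r) - C) powr (1 / real ?m)))"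
  proof (rule mult_left_mono)
    have "0 \<le> \<epsilon> * r" "0 \<le> 2 * ?w powr (1 / real ?m) * (L * measure lborel (cball a (2 * r) - C) powr (1 / real ?m))"
      using e r L0 by auto
    then show "\<epsilon> * (?w powr (1 / real ?m) * (2 * r)) + L * measure lborel (cball a (2 * r) - C) powr (1 / real ?m)
      \<le> (2 * ?w powr (1 / real ?m) + 1) * (\<epsilon> * r + L * measure lborel (cball a (2 * r) - C) powr (1 / real ?m))"
      by (simp add: algebra_simps)
    show "0 \<le> 2 * 3 ^ ?m * riesz_const ?m / (?w * 2 ^ ?m)" using w riesz_const_ge1[where 'a='a] by simp
  qed
  finally show ?thesis by (simp add: morrey_const_def)
qed

section \<open>Lipschitz maps into the Hilbert space\<close>

text \<open>A limit along the fixed sequence \<open>1 / Suc n\<close>, so that it is a Borel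
  function on the whole space; it agrees with the partial derivative wherever \<open>u\<close> is
  differentiable.\<close>

definition basis_deriv :: "('a::euclidean_space \<Rightarrow> real) \<Rightarrow> 'a \<Rightarrow> 'a \<Rightarrow> real" where
  "basis_deriv u b z = lim (\<lambda>n. real (Suc n) * (u (z + (1 / real (Suc n)) *\<^sub>R b) - u z))"

lemma basis_deriv_measurable:
  assumes "L-lipschitz_on UNIV u"
  shows "basis_deriv u b \<in> borel_measurable borel"
proof -
  have c: "continuous_on UNIV u" by (rule lipschitz_on_continuous_on[OF assms])
  have [measurable]: "(\<lambda>z. u (z + s *\<^sub>R b)) \<in> borel_measurable borel" for s
    by (intro borel_measurable_continuous_onI continuous_on_compose2[OF c] continuous_intros) auto
  have [measurable]: "u \<in> borel_measurable borel" by (rule borel_measurable_continuous_onI[OF c])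
  show ?thesis unfolding basis_deriv_def[abs_def] by measurable
qed

text \<open>The form of differentiability that matches sequences picked from a set of density one:
  the points need lie on the ray in direction \<open>h\<close> only asymptotically.\<close>

lemma has_derivative_sequence:
  fixes u :: "'a::real_normed_vector \<Rightarrow> 'b::real_normed_vector"
  assumes d: "(u has_derivative F) (at a within S)" and t: "\<And>n. t n > (0::real)" "t \<longlonglongrightarrow> 0"
    and x: "\<And>n. x n \<in> S" "(\<lambda>n. (x n - a) /\<^sub>R t n) \<longlonglongrightarrow> h"
  shows "(\<lambda>n. (u (x n) - u a) /\<^sub>R t n) \<longlonglongrightarrow> F h"
proof -
  have bl: "bounded_linear F" by (rule has_derivative_bounded_linear[OF d])
  interpret bounded_linear F by fact
  have "(\<lambda>n. t n *\<^sub>R ((x n - a) /\<^sub>R t n)) \<longlonglongrightarrow> 0 *\<^sub>R h" by (intro tendsto_intros t x)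
  moreover have "t n *\<^sub>R ((x n - a) /\<^sub>R t n) = x n - a" for n using t(1)[of n] by simp
  ultimately have xa: "(\<lambda>n. x n - a) \<longlonglongrightarrow> 0" by simp
  have nh: "(\<lambda>n. norm ((x n - a) /\<^sub>R t n)) \<longlonglongrightarrow> norm h" by (intro tendsto_intros x)
  define q where "q n = (u (x n) - u a) /\<^sub>R t n - F ((x n - a) /\<^sub>R t n)" for n
  have "q \<longlonglongrightarrow> 0"
  proof (rule LIMSEQ_I)
    fix e :: real assume e: "e > 0"
    define e' where "e' = e / (2 * (norm h + 1))"
    have hp: "norm h + 1 > 0" by (simp add: add_nonneg_pos)
    have e': "e' > 0" using e hp by (simp add: e'_def)
    obtain d where dd: "d > 0" "\<And>y. y \<in> S \<Longrightarrow> norm (y - a) < d \<Longrightarrow> norm (u y - u a - F (y - a)) \<le> e' * norm (y - a)"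
      using assms(1) e' unfolding has_derivative_within_alt by blast
    have "\<forall>\<^sub>F n in sequentially. norm (x n - a) < d"
      using tendsto_norm_zero[OF xa] dd(1) by (rule order_tendstoD)
    moreover have "\<forall>\<^sub>F n in sequentially. norm ((x n - a) /\<^sub>R t n) < norm h + 1"
      by (rule order_tendstoD(2)[OF nh]) simp
    ultimately have "\<forall>\<^sub>F n in sequentially. norm (q n - 0) < e"
    proof eventually_elim
      fix n assume n: "norm (x n - a) < d" "norm ((x n - a) /\<^sub>R t n) < norm h + 1"
      have "q n = (u (x n) - u a - F (x n - a)) /\<^sub>R t n"
        by (simp only: q_def scale scaleR_diff_right[of "inverse (t n)" "u (x n) - u a"])
      then have "norm (q n) = norm (u (x n) - u a - F (x n - a)) / t n"
        using t(1)[of n] by (simp add: divide_inverse mult.commute)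
      also have "\<dots> \<le> e' * norm (x n - a) / t n"
        using dd(2)[OF x(1) n(1)] t(1)[of n] by (intro divide_right_mono) auto
      also have "\<dots> = e' * norm ((x n - a) /\<^sub>R t n)"
        using t(1)[of n] by (simp add: divide_inverse mult_ac)
      also have "\<dots> \<le> e' * (norm h + 1)" using n(2) e' by (intro mult_left_mono) auto
      also have "\<dots> = e / 2"
      proof -
        have "e / (2 * M) * M = e / 2" if "M > 0" for M :: real using that by simp
        then show ?thesis unfolding e'_def using hp by blast
      qed
      also have "\<dots> < e" using e by simp
      finally show "norm (q n - 0) < e" by simp
    qed
    then show "\<exists>no. \<forall>n\<ge>no. norm (q n - 0) < e" by (simp add: eventually_sequentially)
  qed
  then have "(\<lambda>n. q n + F ((x n - a) /\<^sub>R t n)) \<longlonglongrightarrow> 0 + F h"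
    by (intro tendsto_intros tendsto[OF x(2)])
  then show ?thesis by (simp add: q_def)
qed

lemma basis_deriv_eq:
  assumes "u differentiable (at z)"
  shows "basis_deriv u b z = frechet_derivative u (at z) b"
proof -
  have d: "(u has_derivative frechet_derivative u (at z)) (at z)"
    by (rule frechet_derivative_works[THEN iffD1, OF assms])
  have "(\<lambda>n. (u (z + (1 / real (Suc n)) *\<^sub>R b) - u z) /\<^sub>R (1 / real (Suc n))) \<longlonglongrightarrow> frechet_derivative u (at z) b"
  proof (rule has_derivative_sequence[OF d])
    show "(\<lambda>n. 1 / real (Suc n)) \<longlonglongrightarrow> 0" by (rule lim_1_over_n[THEN LIMSEQ_Suc])
    have "(z + (1 / real (Suc n)) *\<^sub>R b - z) /\<^sub>R (1 / real (Suc n)) = b" for n by simp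
    then show "(\<lambda>n. (z + (1 / real (Suc n)) *\<^sub>R b - z) /\<^sub>R (1 / real (Suc n))) \<longlonglongrightarrow> b" by simp
  qed auto
  then show ?thesis unfolding basis_deriv_def by (intro limI) (simp add: divide_inverse)
qed

lemma frechet_le_basis_deriv:
  fixes u :: "'a::euclidean_space \<Rightarrow> real"
  assumes "u differentiable (at z)"
  shows "(frechet_derivative u (at z) h)\<^sup>2 \<le> (\<Sum>b\<in>Basis. (basis_deriv u b z)\<^sup>2) * (norm h)\<^sup>2"
proof -
  let ?F = "frechet_derivative u (at z)"
  have d: "(u has_derivative ?F) (at z)" by (rule frechet_derivative_works[THEN iffD1, OF assms])
  interpret F: linear ?F by (rule has_derivative_linear[OF d])
  have "?F h = ?F (\<Sum>b\<in>Basis. (h \<bullet> b) *\<^sub>R b)" by (simp add: euclidean_representation)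
  also have "\<dots> = (\<Sum>b\<in>Basis. basis_deriv u b z * (h \<bullet> b))"
    by (simp add: F.sum F.scale basis_deriv_eq[OF assms] mult.commute)
  finally have "(?F h)\<^sup>2 \<le> (\<Sum>b\<in>Basis. (basis_deriv u b z)\<^sup>2) * (\<Sum>b\<in>Basis. (h \<bullet> b)\<^sup>2)"
    by (simp add: Cauchy_Schwarz_ineq_sum)
  also have "(\<Sum>b\<in>Basis. (h \<bullet> b)\<^sup>2) = (norm h)\<^sup>2"
    unfolding power2_norm_eq_inner euclidean_inner[of h h] by (simp add: power2_eq_square)
  finally show ?thesis .
qed

lemma ell2_eqI: "(\<And>k. coord x k = coord y k) \<Longrightarrow> x = y"
  by (metis coord_inject ext)

lemma norm_ell2_le:
  assumes "\<And>M. (\<Sum>k<M. (coord x k)\<^sup>2) \<le> B\<^sup>2" "0 \<le> B"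
  shows "norm x \<le> B"
proof -
  have "(norm x)\<^sup>2 \<le> B\<^sup>2"
    unfolding norm_ell2_sq by (intro suminf_le_const[OF summable_coord_sq] assms(1))
  then show ?thesis using assms(2) by (rule power2_le_imp_le)
qed

text \<open>Each coordinate is extended to the whole space and differentiated. At density points of
  \<open>C\<close> the derivatives inherit the bound \<open>L\<close> in \<open>ell2\<close>, which
  defines \<open>T\<close>. It remains to make the increments of the coordinates from
  \<open>N\<close> on small near \<open>a\<close>, uniformly. On \<open>Cs N n\<close> the squared
  gradients of these coordinates sum to at most the square of \<open>1 / Suc n\<close>, and near a
  density point of \<open>Cs N n\<close> the Morrey estimate carries this over to
  increments.\<close>

theorem rademacher_ell2:
  fixes y :: "'a::euclidean_space \<Rightarrow> ell2"
  assumes C[measurable]: "C \<in> sets borel" and y: "L-lipschitz_on C y"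
  shows "AE a in lborel. a \<in> C \<longrightarrow> (\<exists>T. (y has_derivative T) (at a within C))"
proof -
  have L0: "L \<ge> 0" by (rule lipschitz_on_nonneg[OF y])
  have ylip: "norm (y p - y q) \<le> L * norm (p - q)" if "p \<in> C" "q \<in> C" for p q
    using lipschitz_onD[OF y that] by (simp add: dist_norm)
  have "\<exists>g. L-lipschitz_on UNIV g \<and> (\<forall>x\<in>C. g x = coord (y x) k)" for k
  proof -
    have "L-lipschitz_on C (\<lambda>x. coord (y x) k)"
    proof (rule lipschitz_onI)
      fix p q assume pq: "p \<in> C" "q \<in> C"
      have "\<bar>coord (y p - y q) k\<bar> \<le> norm (y p - y q)" by (rule abs_coord_le)
      also have "\<dots> \<le> L * norm (p - q)" by (rule ylip[OF pq])
      finally show "dist (coord (y p) k) (coord (y q) k) \<le> L * dist p q"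
        by (simp add: dist_real_def dist_norm minus_ell2.rep_eq)
    qed (rule L0)
    then show ?thesis by (metis lipschitz_extension_real)
  qed
  then obtain Y where Yl: "\<And>k. L-lipschitz_on UNIV (Y k)" and YC: "\<And>k x. x \<in> C \<Longrightarrow> Y k x = coord (y x) k"
    by metis
  define S where "S N M z = (\<Sum>k\<in>{N..<M}. \<Sum>b\<in>Basis. (basis_deriv (Y k) b z)\<^sup>2)" for N M z
  note [measurable] = basis_deriv_measurable[OF Yl]
  have Sm[measurable]: "S N M \<in> borel_measurable borel" for N M unfolding S_def[abs_def] by measurable
  define Cs where "Cs N n = {z\<in>C. \<forall>M. S N M z \<le> (1 / real (Suc n))\<^sup>2}" for N n
  have Csm[measurable]: "Cs N n \<in> sets borel" for N n
  proof -
    have "Cs N n = C \<inter> {z \<in> space borel. \<forall>M. S N M z \<le> (1 / real (Suc n))\<^sup>2}" by (auto simp: Cs_def)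
    also have "\<dots> \<in> sets borel" by measurable
    finally show ?thesis .
  qed
  have diff: "AE z in lborel. \<forall>k. Y k differentiable (at z)"
    by (subst AE_all_countable) (use rademacher[OF Yl] in blast)
  have densC: "AE z in lborel. z \<in> C \<longrightarrow> density_one C z" by (rule density_one_AE[OF C])
  have densCs: "AE z in lborel. \<forall>N n. z \<in> Cs N n \<longrightarrow> density_one (Cs N n) z"
    by (subst AE_all_countable, intro allI)+ (rule density_one_AE[OF Csm])
  let ?K = "morrey_const DIM('a)" and ?m = "DIM('a)"
  \<comment> \<open>The vector of tail increments is paired with its own direction \<open>e\<close>,
    which leaves a single scalar function. This function depends on \<open>x\<close>,
    \<open>a\<close>, \<open>N\<close> and \<open>M\<close>, but it is \<open>L\<close>-Lipschitz
    with small gradient on \<open>Cs N n\<close>, and the Morrey constant depends on the dimension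
    only.\<close>
  have tail: "(\<Sum>k\<in>{N..<M}. (Y k x - Y k a)\<^sup>2) \<le>
      (?K * (1 / real (Suc n) * norm (x - a) + L * measure lborel (cball a (2 * norm (x - a)) - Cs N n) powr (1 / real ?m)))\<^sup>2"
    if xa: "x \<in> C" "a \<in> C" "x \<noteq> a" for x a N M n
  proof (cases "(\<Sum>k\<in>{N..<M}. (Y k x - Y k a)\<^sup>2) = 0")
    case False
    let ?I = "{N..<M}"
    define s where "s = sqrt (\<Sum>k\<in>?I. (Y k x - Y k a)\<^sup>2)"
    have s2: "s\<^sup>2 = (\<Sum>k\<in>?I. (Y k x - Y k a)\<^sup>2)" by (simp add: s_def sum_nonneg)
    have sp: "s > 0" using False sum_nonneg[of ?I "\<lambda>k. (Y k x - Y k a)\<^sup>2"] by (simp add: s_def)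
    define e where "e k = (Y k x - Y k a) / s" for k
    have e1: "(\<Sum>k\<in>?I. (e k)\<^sup>2) = 1"
      using sp by (simp add: e_def power_divide sum_divide_distrib[symmetric] s2[symmetric])
    define v0 where "v0 p = (\<Sum>k\<in>?I. e k * Y k p)" for p
    \<comment> \<open>Only on \<open>C\<close> do the coordinates form an \<open>ell2\<close> vector
      with Lipschitz constant \<open>L\<close>. Off \<open>C\<close> the separate extensions may add
      up badly, so the combination is restricted to \<open>C\<close> and extended anew.\<close>
    have "L-lipschitz_on C v0"
    proof (rule lipschitz_onI)
      fix p q assume pq: "p \<in> C" "q \<in> C"
      have "(v0 p - v0 q)\<^sup>2 = (\<Sum>k\<in>?I. e k * coord (y p - y q) k)\<^sup>2"
        by (simp add: v0_def sum_subtractf[symmetric] YC pq minus_ell2.rep_eq right_diff_distrib)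
      also have "\<dots> \<le> (\<Sum>k\<in>?I. (e k)\<^sup>2) * (\<Sum>k\<in>?I. (coord (y p - y q) k)\<^sup>2)"
        by (rule Cauchy_Schwarz_ineq_sum)
      also have "\<dots> \<le> (\<Sum>k<M. (coord (y p - y q) k)\<^sup>2)"
        unfolding e1 by (simp, intro sum_mono2) auto
      also have "\<dots> \<le> (norm (y p - y q))\<^sup>2" by (rule sum_coord_sq_le)
      also have "\<dots> \<le> (L * norm (p - q))\<^sup>2" by (intro power_mono ylip pq) simp
      finally have "\<bar>v0 p - v0 q\<bar> \<le> L * norm (p - q)"
        using L0 by (simp add: abs_le_square_iff[symmetric])
      then show "dist (v0 p) (v0 q) \<le> L * dist p q" by (simp add: dist_real_def dist_norm)
    qed (rule L0)
    then obtain v where v: "L-lipschitz_on UNIV v" "\<And>p. p \<in> C \<Longrightarrow> v p = v0 p"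
      by (metis lipschitz_extension_real)
    have "AE z in lborel. z \<in> Cs N n \<longrightarrow> (\<forall>h. \<bar>frechet_derivative v (at z) h\<bar> \<le> 1 / real (Suc n) * norm h)"
      using diff densC rademacher[OF v(1)]
    proof (eventually_elim, intro impI allI)
      fix z h assume dY: "\<forall>k. Y k differentiable (at z)" and de: "z \<in> C \<longrightarrow> density_one C z"
        and dv: "v differentiable (at z)" and z: "z \<in> Cs N n"
      have zC: "z \<in> C" using z by (simp add: Cs_def)
      \<comment> \<open>The function \<open>v\<close> and the combination of the \<open>Y k\<close>
        agree on \<open>C\<close>; sequences in \<open>C\<close> identify their derivatives at its
        density points.\<close>
      obtain xs t where xt: "\<And>n. t n > 0" "t \<longlonglongrightarrow> 0" "\<And>n. xs n \<in> C" "(\<lambda>n. (xs n - z) /\<^sub>R t n) \<longlonglongrightarrow> h"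
        using density_one_pick[of "\<lambda>_. C" z h] C de zC by metis
      have l1: "(\<lambda>n. (v (xs n) - v z) /\<^sub>R t n) \<longlonglongrightarrow> frechet_derivative v (at z) h"
        by (rule has_derivative_sequence[OF frechet_derivative_works[THEN iffD1, OF dv] xt(1,2) _ xt(4)]) simp
      have lk: "(\<lambda>n. (Y k (xs n) - Y k z) /\<^sub>R t n) \<longlonglongrightarrow> frechet_derivative (Y k) (at z) h" for k
        by (rule has_derivative_sequence[OF frechet_derivative_works[THEN iffD1] xt(1,2) _ xt(4)]) (use dY in auto)
      have "(\<lambda>n. \<Sum>k\<in>?I. e k * ((Y k (xs n) - Y k z) /\<^sub>R t n)) \<longlonglongrightarrow> (\<Sum>k\<in>?I. e k * frechet_derivative (Y k) (at z) h)"
        by (intro tendsto_intros lk)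
      moreover have "(\<Sum>k\<in>?I. e k * ((Y k (xs n) - Y k z) /\<^sub>R t n)) = (v (xs n) - v z) /\<^sub>R t n" for n
        by (simp add: v xt(3) zC v0_def sum_subtractf[symmetric] sum_distrib_left right_diff_distrib mult_ac)
      ultimately have eq: "frechet_derivative v (at z) h = (\<Sum>k\<in>?I. e k * frechet_derivative (Y k) (at z) h)"
        using LIMSEQ_unique[OF l1] by simp
      have "(frechet_derivative v (at z) h)\<^sup>2 \<le> (\<Sum>k\<in>?I. (e k)\<^sup>2) * (\<Sum>k\<in>?I. (frechet_derivative (Y k) (at z) h)\<^sup>2)"
        unfolding eq by (rule Cauchy_Schwarz_ineq_sum)
      also have "\<dots> = (\<Sum>k\<in>?I. (frechet_derivative (Y k) (at z) h)\<^sup>2)" by (simp add: e1)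
      also have "\<dots> \<le> (\<Sum>k\<in>?I. (\<Sum>b\<in>Basis. (basis_deriv (Y k) b z)\<^sup>2) * (norm h)\<^sup>2)"
        by (intro sum_mono frechet_le_basis_deriv) (use dY in auto)
      also have "\<dots> = S N M z * (norm h)\<^sup>2" by (simp add: S_def sum_distrib_right)
      also have "\<dots> \<le> (1 / real (Suc n))\<^sup>2 * (norm h)\<^sup>2"
        using z by (intro mult_right_mono) (auto simp: Cs_def)
      finally have "(frechet_derivative v (at z) h)\<^sup>2 \<le> (1 / real (Suc n) * norm h)\<^sup>2"
        by (simp only: power_mult_distrib)
      then have "\<bar>frechet_derivative v (at z) h\<bar> \<le> \<bar>1 / real (Suc n) * norm h\<bar>" by (simp only: abs_le_square_iff)
      then show "\<bar>frechet_derivative v (at z) h\<bar> \<le> 1 / real (Suc n) * norm h" by simp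
    qed
    then have "\<bar>v x - v a\<bar> \<le> ?K * (1 / real (Suc n) * norm (x - a) + L * measure lborel (cball a (2 * norm (x - a)) - Cs N n) powr (1 / real ?m))"
      by (intro morrey_bound[OF v(1) Csm]) (use xa in auto)
    moreover have "v x - v a = s"
    proof -
      have "v x - v a = (\<Sum>k\<in>?I. e k * (Y k x - Y k a))"
        by (simp add: v xa v0_def sum_subtractf[symmetric] right_diff_distrib)
      also have "\<dots> = (\<Sum>k\<in>?I. (Y k x - Y k a)\<^sup>2 / s)"
        by (simp add: e_def power2_eq_square)
      also have "\<dots> = s\<^sup>2 / s" by (simp only: s2 sum_divide_distrib)
      also have "\<dots> = s" using sp by (simp add: power2_eq_square)
      finally show ?thesis .
    qed
    ultimately have "s \<le> ?K * (1 / real (Suc n) * norm (x - a) + L * measure lborel (cball a (2 * norm (x - a)) - Cs N n) powr (1 / real ?m))"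
      using sp by simp
    then show ?thesis unfolding s2[symmetric] using sp by (intro power_mono) auto
  qed simp
  from diff densC densCs show ?thesis
  proof (eventually_elim, intro impI)
    fix a assume dY: "\<forall>k. Y k differentiable (at a)" and "a \<in> C \<longrightarrow> density_one C a"
      and dens: "\<forall>N n. a \<in> Cs N n \<longrightarrow> density_one (Cs N n) a" and aC: "a \<in> C"
    then have dC: "density_one C a" by blast
    define F where "F k = frechet_derivative (Y k) (at a)" for k
    have Fd: "(Y k has_derivative F k) (at a)" for k
      unfolding F_def by (rule frechet_derivative_works[THEN iffD1]) (use dY in auto)
    \<comment> \<open>The extensions \<open>Y k\<close> satisfy no joint bound, so the bound in
      \<open>ell2\<close> is taken from difference quotients along points of
      \<open>C\<close>.\<close>
    have Fsum: "(\<Sum>k<M. (F k h)\<^sup>2) \<le> (L * norm h)\<^sup>2" for M h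
    proof -
      obtain xs t where xt: "\<And>n. t n > 0" "t \<longlonglongrightarrow> 0" "\<And>n. xs n \<in> C" "(\<lambda>n. (xs n - a) /\<^sub>R t n) \<longlonglongrightarrow> h"
        using density_one_pick[of "\<lambda>_. C" a h] C dC by metis
      have lk: "(\<lambda>n. (Y k (xs n) - Y k a) /\<^sub>R t n) \<longlonglongrightarrow> F k h" for k
        by (rule has_derivative_sequence[OF Fd xt(1,2) _ xt(4)]) simp
      show ?thesis
      proof (rule LIMSEQ_le)
        show "(\<lambda>n. \<Sum>k<M. ((Y k (xs n) - Y k a) /\<^sub>R t n)\<^sup>2) \<longlonglongrightarrow> (\<Sum>k<M. (F k h)\<^sup>2)"
          by (intro tendsto_intros lk)
        show "(\<lambda>n. (L * norm ((xs n - a) /\<^sub>R t n))\<^sup>2) \<longlonglongrightarrow> (L * norm h)\<^sup>2"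
          by (intro tendsto_intros xt)
        have "(\<Sum>k<M. ((Y k (xs n) - Y k a) /\<^sub>R t n)\<^sup>2) \<le> (L * norm ((xs n - a) /\<^sub>R t n))\<^sup>2" for n
        proof -
          have "(\<Sum>k<M. ((Y k (xs n) - Y k a) /\<^sub>R t n)\<^sup>2) = (inverse (t n))\<^sup>2 * (\<Sum>k<M. (coord (y (xs n) - y a) k)\<^sup>2)"
            by (simp add: YC xt(3) aC minus_ell2.rep_eq power_mult_distrib sum_distrib_left)
          also have "\<dots> \<le> (inverse (t n))\<^sup>2 * (norm (y (xs n) - y a))\<^sup>2"
            by (intro mult_left_mono sum_coord_sq_le) simp
          also have "\<dots> \<le> (inverse (t n))\<^sup>2 * (L * norm (xs n - a))\<^sup>2"
            by (intro mult_left_mono power_mono ylip xt(3) aC) auto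
          also have "\<dots> = (L * norm ((xs n - a) /\<^sub>R t n))\<^sup>2"
            using xt(1)[of n] by (simp add: power_mult_distrib mult_ac)
          finally show ?thesis .
        qed
        then show "\<exists>N. \<forall>n\<ge>N. (\<Sum>k<M. ((Y k (xs n) - Y k a) /\<^sub>R t n)\<^sup>2) \<le> (L * norm ((xs n - a) /\<^sub>R t n))\<^sup>2" by blast
      qed
    qed
    define T where "T h = Abs_ell2 (\<lambda>k. F k h)" for h
    have cT: "coord (T h) k = F k h" for h k
    proof -
      have "summable (\<lambda>k. (F k h)\<^sup>2)"
        by (rule summableI_nonneg_bounded[where x="(L * norm h)\<^sup>2"]) (use Fsum in auto)
      then show ?thesis by (simp add: T_def Abs_ell2_inverse)
    qed
    have Flin: "linear (F k)" for k by (rule has_derivative_linear[OF Fd])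
    have blT: "bounded_linear T"
    proof (rule bounded_linear_intro[where K=L])
      show "T (p + q) = T p + T q" for p q
        by (rule ell2_eqI) (simp add: cT plus_ell2.rep_eq linear_add[OF Flin])
      show "T (r *\<^sub>R p) = r *\<^sub>R T p" for r p
        by (rule ell2_eqI) (simp add: cT scaleR_ell2.rep_eq linear_cmul[OF Flin])
      show "norm (T p) \<le> norm p * L" for p
        by (rule norm_ell2_le) (use Fsum[of p] L0 in \<open>auto simp: cT mult.commute\<close>)
    qed
    have Ssum: "summable (\<lambda>k. \<Sum>b\<in>Basis. (basis_deriv (Y k) b a)\<^sup>2)"
    proof (rule summableI_nonneg_bounded)
      fix M
      have "(\<Sum>k<M. \<Sum>b\<in>Basis. (basis_deriv (Y k) b a)\<^sup>2) = (\<Sum>b\<in>Basis. \<Sum>k<M. (F k b)\<^sup>2)"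
        using dY by (subst sum.swap) (simp add: basis_deriv_eq F_def)
      also have "\<dots> \<le> (\<Sum>b\<in>(Basis::'a set). (L * norm b)\<^sup>2)" by (intro sum_mono Fsum)
      finally show "(\<Sum>k<M. \<Sum>b\<in>Basis. (basis_deriv (Y k) b a)\<^sup>2) \<le> (\<Sum>b\<in>(Basis::'a set). (L * norm b)\<^sup>2)" .
    qed (auto intro: sum_nonneg)
    show "\<exists>T. (y has_derivative T) (at a within C)"
    proof (intro exI)
      show "(y has_derivative T) (at a within C)"
        unfolding has_derivative_within_alt
      proof (intro conjI allI impI blT)
        fix e :: real assume e: "e > 0"
        \<comment> \<open>The final sum of squares is \<open>1 + 8 * ?K\<^sup>2 + 2\<close> times
          the square of \<open>\<epsilon> * r\<close>: from the first \<open>N\<close> coordinates,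
          from the tail of the increments and from the tail of \<open>T\<close>.\<close>
        define c where "c = sqrt (3 + 8 * ?K\<^sup>2)"
        have c: "c > 0" "c\<^sup>2 = 3 + 8 * ?K\<^sup>2" by (auto simp: c_def add_pos_nonneg)
        obtain n where n: "1 / real (Suc n) < e / c" using nat_approx_posE[of "e / c"] e c by auto
        define \<epsilon> where "\<epsilon> = 1 / real (Suc n)"
        have eps: "\<epsilon> > 0" "\<epsilon> * c \<le> e" using n c by (auto simp: \<epsilon>_def field_simps)
        obtain N where "\<forall>m\<ge>N. \<forall>n. norm (\<Sum>k\<in>{m..<n}. \<Sum>b\<in>Basis. (basis_deriv (Y k) b a)\<^sup>2) < \<epsilon>\<^sup>2"
          using Ssum eps unfolding summable_Cauchy by (meson zero_less_power)
        then have SN: "S N M a \<le> \<epsilon>\<^sup>2" for M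
          unfolding S_def real_norm_def
          by (meson abs_le_D1 less_imp_le order_refl)
        then have aCs: "a \<in> Cs N n" using aC by (simp add: Cs_def \<epsilon>_def)
        then have dCs: "density_one (Cs N n) a" using dens by blast
        define \<delta> where "\<delta> = (\<epsilon> / (2 * (L + 1))) ^ ?m / 2 ^ ?m"
        \<comment> \<open>Density at level \<open>\<theta> ^ ?m\<close> makes the exceptional
          measure to the power \<open>1 / m\<close> at most \<open>2 * \<theta> * r\<close>, and
          hence its contribution with the factor \<open>L\<close> at most
          \<open>\<epsilon> * r\<close>.\<close>
        define \<theta> where "\<theta> = \<epsilon> / (2 * (L + 1))"
        have th: "\<theta> > 0" "L * (2 * \<theta>) \<le> \<epsilon>"
        proof -
          show "\<theta> > 0" using eps L0 by (simp add: \<theta>_def)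
          have "L * (2 * \<theta>) \<le> (L + 1) * (2 * \<theta>)" using \<open>\<theta> > 0\<close> by (intro mult_right_mono) auto
          also have "\<dots> = \<epsilon>"
          proof -
            have "M * (2 * (\<epsilon> / (2 * M))) = \<epsilon>" if "M > 0" for M :: real using that by simp
            note * = this
            show ?thesis unfolding \<theta>_def by (rule *) (use L0 in simp)
          qed
          finally show "L * (2 * \<theta>) \<le> \<epsilon>" .
        qed
        have "\<theta> ^ ?m > 0" using th by simp
        then obtain d1 where d1: "d1 > 0" "\<And>r. 0 < r \<Longrightarrow> r < d1 \<Longrightarrow> measure lborel (cball a r - Cs N n) \<le> \<theta> ^ ?m * r ^ ?m"
          using dCs unfolding density_one_def by blast
        \<comment> \<open>The coordinates below \<open>N\<close> are finitely many and are handled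
          by their own derivatives; the division by \<open>Suc N\<close> keeps the sum of their
          squared errors below the square of \<open>\<epsilon> * r\<close>.\<close>
        have "\<exists>d>0. \<forall>k<N. \<forall>x. norm (x - a) < d \<longrightarrow> \<bar>Y k x - Y k a - F k (x - a)\<bar> \<le> \<epsilon> / real (Suc N) * norm (x - a)"
        proof -
          have "\<exists>d>0. \<forall>x. norm (x - a) < d \<longrightarrow> \<bar>Y k x - Y k a - F k (x - a)\<bar> \<le> \<epsilon> / real (Suc N) * norm (x - a)" for k
          proof -
            have "\<epsilon> / real (Suc N) > 0" using eps by simp
            then show ?thesis using Fd[of k] unfolding has_derivative_at_alt real_norm_def by blast
          qed
          then obtain d where d: "\<And>k. d k > 0" "\<And>k x. norm (x - a) < d k \<Longrightarrow> \<bar>Y k x - Y k a - F k (x - a)\<bar> \<le> \<epsilon> / real (Suc N) * norm (x - a)"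
            by metis
          define d0 where "d0 = Min (d ` {..N})"
          have "d0 > 0" unfolding d0_def using d(1) by (subst Min_gr_iff) auto
          moreover have "d0 \<le> d k" if "k < N" for k unfolding d0_def using that by (intro Min_le) auto
          ultimately show ?thesis using d(2) by (meson less_le_trans)
        qed
        then obtain d2 where d2: "d2 > 0" "\<And>k x. k < N \<Longrightarrow> norm (x - a) < d2 \<Longrightarrow> \<bar>Y k x - Y k a - F k (x - a)\<bar> \<le> \<epsilon> / real (Suc N) * norm (x - a)"
          by blast
        have main: "norm (y x - y a - T (x - a)) \<le> e * norm (x - a)" if x: "x \<in> C" "norm (x - a) < min (d1 / 2) d2" for x
        proof (cases "x = a")
          case True
          then show ?thesis using linear_0[OF bounded_linear.linear[OF blT]] by simp
        next
          case False
          define r where "r = norm (x - a)"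
          have r: "r > 0" using False by (simp add: r_def)
          have tl: "(\<Sum>k\<in>{N..<M}. (Y k x - Y k a)\<^sup>2) \<le> (2 * ?K * \<epsilon> * r)\<^sup>2" for M
          proof -
            have K0: "?K \<ge> 0" unfolding morrey_const_def
              using unit_ball_vol_pos_DIM[where 'a='a] riesz_const_ge1[where 'a='a] by simp
            have "measure lborel (cball a (2 * r) - Cs N n) \<le> \<theta> ^ ?m * (2 * r) ^ ?m"
              using r x by (intro d1) (auto simp: r_def)
            then have "measure lborel (cball a (2 * r) - Cs N n) powr (1 / real ?m) \<le> ((\<theta> * (2 * r)) ^ ?m) powr (1 / real ?m)"
              by (intro powr_mono2) (auto simp: power_mult_distrib)
            also have "\<dots> = \<theta> * (2 * r)" using th r by (simp add: powr_realpow[symmetric] powr_powr)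
            finally have "L * measure lborel (cball a (2 * r) - Cs N n) powr (1 / real ?m) \<le> L * (\<theta> * (2 * r))"
              using L0 by (rule mult_left_mono)
            also have "\<dots> = (L * (2 * \<theta>)) * r" by simp
            also have "\<dots> \<le> \<epsilon> * r" using th r by (intro mult_right_mono) auto
            finally have "?K * (\<epsilon> * r + L * measure lborel (cball a (2 * r) - Cs N n) powr (1 / real ?m)) \<le> ?K * (\<epsilon> * r + \<epsilon> * r)"
              using K0 by (intro mult_left_mono add_left_mono) auto
            also have "\<dots> = 2 * ?K * \<epsilon> * r" by simp
            finally have le: "?K * (\<epsilon> * r + L * measure lborel (cball a (2 * r) - Cs N n) powr (1 / real ?m)) \<le> 2 * ?K * \<epsilon> * r" .
            have "0 \<le> ?K * (\<epsilon> * r + L * measure lborel (cball a (2 * r) - Cs N n) powr (1 / real ?m))"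
              using K0 eps r L0 by (intro mult_nonneg_nonneg add_nonneg_nonneg) auto
            then show ?thesis
              using tail[OF x(1) aC False, of N M n] power_mono[OF le, of 2] unfolding r_def \<epsilon>_def by linarith
          qed
          show ?thesis
          proof (rule norm_ell2_le)
            fix M
            have co: "coord (y x - y a - T (x - a)) k = (Y k x - Y k a) - F k (x - a)" for k
              by (simp add: minus_ell2.rep_eq YC x aC cT)
            have "(\<Sum>k<M. (coord (y x - y a - T (x - a)) k)\<^sup>2) \<le> (\<Sum>k\<in>{..<N} \<union> {N..<M}. (coord (y x - y a - T (x - a)) k)\<^sup>2)"
              by (rule sum_mono2) auto
            also have "\<dots> = (\<Sum>k<N. ((Y k x - Y k a) - F k (x - a))\<^sup>2) + (\<Sum>k\<in>{N..<M}. ((Y k x - Y k a) - F k (x - a))\<^sup>2)"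
              unfolding co by (rule sum.union_disjoint) auto
            also have "\<dots> \<le> (\<epsilon> * r)\<^sup>2 + (\<Sum>k\<in>{N..<M}. (2 * (Y k x - Y k a)\<^sup>2 + 2 * (F k (x - a))\<^sup>2))"
            proof (rule add_mono)
              have "(\<Sum>k<N. ((Y k x - Y k a) - F k (x - a))\<^sup>2) \<le> (\<Sum>k<N. (\<epsilon> / real (Suc N) * r)\<^sup>2)"
              proof (rule sum_mono)
                fix k assume "k \<in> {..<N}"
                then have "\<bar>Y k x - Y k a - F k (x - a)\<bar> \<le> \<epsilon> / real (Suc N) * r" using d2(2)[of k x] x by (simp add: r_def)
                then have "\<bar>Y k x - Y k a - F k (x - a)\<bar>\<^sup>2 \<le> (\<epsilon> / real (Suc N) * r)\<^sup>2" by (rule power_mono) simp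
                then show "((Y k x - Y k a) - F k (x - a))\<^sup>2 \<le> (\<epsilon> / real (Suc N) * r)\<^sup>2" by simp
              qed
              also have "\<dots> = (\<epsilon> * r)\<^sup>2 * (real N / (real (Suc N))\<^sup>2)" by (simp add: power_mult_distrib power_divide)
              also have "\<dots> \<le> (\<epsilon> * r)\<^sup>2 * 1"
              proof (rule mult_left_mono)
                have "real N \<le> (real (Suc N))\<^sup>2" by (simp add: power2_eq_square algebra_simps)
                then show "real N / (real (Suc N))\<^sup>2 \<le> 1" by (simp add: divide_le_eq del: of_nat_Suc)
              qed simp
              finally show "(\<Sum>k<N. ((Y k x - Y k a) - F k (x - a))\<^sup>2) \<le> (\<epsilon> * r)\<^sup>2" by simp
              have "((Y k x - Y k a) - F k (x - a))\<^sup>2 \<le> 2 * (Y k x - Y k a)\<^sup>2 + 2 * (F k (x - a))\<^sup>2" for k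
              proof -
                have "(p - q)\<^sup>2 \<le> 2 * p\<^sup>2 + 2 * q\<^sup>2" for p q :: real
                  using zero_le_power2[of "p + q"] by (simp add: power2_sum power2_diff)
                then show ?thesis .
              qed
              then show "(\<Sum>k\<in>{N..<M}. ((Y k x - Y k a) - F k (x - a))\<^sup>2) \<le> (\<Sum>k\<in>{N..<M}. (2 * (Y k x - Y k a)\<^sup>2 + 2 * (F k (x - a))\<^sup>2))"
                by (rule sum_mono)
            qed
            also have "\<dots> = (\<epsilon> * r)\<^sup>2 + (2 * (\<Sum>k\<in>{N..<M}. (Y k x - Y k a)\<^sup>2) + 2 * (\<Sum>k\<in>{N..<M}. (F k (x - a))\<^sup>2))"
              by (simp add: sum.distrib sum_distrib_left)
            also have "(\<Sum>k\<in>{N..<M}. (F k (x - a))\<^sup>2) \<le> S N M a * r\<^sup>2"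
              unfolding S_def sum_distrib_right r_def F_def
              by (intro sum_mono) (use frechet_le_basis_deriv dY in \<open>auto simp: sum_distrib_right[symmetric]\<close>)
            also have "S N M a * r\<^sup>2 \<le> \<epsilon>\<^sup>2 * r\<^sup>2" by (intro mult_right_mono SN) simp
            finally have "(\<Sum>k<M. (coord (y x - y a - T (x - a)) k)\<^sup>2) \<le> (\<epsilon> * r)\<^sup>2 + (2 * (2 * ?K * \<epsilon> * r)\<^sup>2 + 2 * (\<epsilon>\<^sup>2 * r\<^sup>2))"
              using tl[of M] by linarith
            also have "\<dots> = c\<^sup>2 * (\<epsilon> * r)\<^sup>2" unfolding c by (simp add: power_mult_distrib algebra_simps)
            also have "\<dots> = (\<epsilon> * c * r)\<^sup>2" by (simp add: power_mult_distrib)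
            also have "\<dots> \<le> (e * r)\<^sup>2" using eps c r by (intro power_mono mult_right_mono) auto
            finally show "(\<Sum>k<M. (coord (y x - y a - T (x - a)) k)\<^sup>2) \<le> (e * norm (x - a))\<^sup>2" by (simp add: r_def)
          qed (use e in simp)
        qed
        show "\<exists>d>0. \<forall>x\<in>C. norm (x - a) < d \<longrightarrow> norm (y x - y a - T (x - a)) \<le> e * norm (x - a)"
          using main d1(1) d2(1) by (intro exI[of _ "min (d1 / 2) d2"]) auto
      qed
    qed
  qed
qed

section \<open>Enumerations of unordered tuples\<close>

lemma list_gap:
  fixes ys :: "'b::real_normed_vector list"
  obtains s where "s > 0" "\<And>i j. i < length ys \<Longrightarrow> j < length ys \<Longrightarrow> ys ! i \<noteq> ys ! j \<Longrightarrow> s \<le> norm (ys ! i - ys ! j)"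
proof -
  \<comment> \<open>The inserted 1 keeps the set nonempty when all entries coincide.\<close>
  define D where "D = insert 1 ((\<lambda>(p, q). norm (p - q)) ` {(p, q) \<in> set ys \<times> set ys. p \<noteq> q})"
  have fin: "finite D"
  proof -
    have "finite {(p, q) \<in> set ys \<times> set ys. p \<noteq> q}"
      by (rule finite_subset[of _ "set ys \<times> set ys"]) auto
    then show ?thesis unfolding D_def by simp
  qed
  have "\<forall>d\<in>D. d > 0" by (auto simp: D_def)
  then have "Min D > 0" using fin by (subst Min_gr_iff) (auto simp: D_def)
  moreover have "Min D \<le> norm (ys ! i - ys ! j)" if "i < length ys" "j < length ys" "ys ! i \<noteq> ys ! j" for i j
  proof (rule Min_le[OF fin])
    show "norm (ys ! i - ys ! j) \<in> D" unfolding D_def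
      by (rule insertI2, rule image_eqI[of _ _ "(ys ! i, ys ! j)"]) (use that in simp_all)
  qed
  ultimately show ?thesis using that by blast
qed

section \<open>The metric \<open>G2\<close> and optimal matchings\<close>

lemma G2_nonneg: "0 \<le> G2 M N"
  by (rule Metric_space.nonneg[OF Metric_space_G2])

lemma G2_sym: "G2 M N = G2 N M"
  by (rule Metric_space.commute[OF Metric_space_G2])

lemma G2_triangle: "M \<in> QQ Q \<Longrightarrow> N \<in> QQ Q \<Longrightarrow> K \<in> QQ Q \<Longrightarrow> G2 M K \<le> G2 M N + G2 N K"
  by (rule Metric_space.triangle[OF Metric_space_G2])

lemma G2_self: "G2 M M = 0"
  using Metric_space.zero[OF Metric_space_G2[of "size M"], of M M] by (simp add: QQ_def)

lemma G2_eq_0: "M \<in> QQ Q \<Longrightarrow> N \<in> QQ Q \<Longrightarrow> G2 M N = 0 \<Longrightarrow> M = N"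
  by (rule Metric_space.zero[OF Metric_space_G2, THEN iffD1])

lemma G2_diff_le:
  "M \<in> QQ Q \<Longrightarrow> N \<in> QQ Q \<Longrightarrow> K \<in> QQ Q \<Longrightarrow> \<bar>G2 M K - G2 N K\<bar> \<le> G2 M N"
  using G2_triangle[of M Q N K] G2_triangle[of N Q M K] G2_sym[of M N] by linarith

lemma G2_lists_le:
  "length xs = length ys \<Longrightarrow> G2 (mset xs) (mset ys) \<le> sqrt (\<Sum>i<length xs. (norm (xs ! i - ys ! i))\<^sup>2)"
  using G2_le[of xs "mset xs" ys "mset ys"] by (simp add: sum_list_zip_norm)

text \<open>If every entry moves by at most half the distance from its own point to the other points
  of \<open>ys\<close>, then matching it with its own point is cheapest for each index separately,
  so no permutation beats the identity.\<close>

lemma G2_lists_near: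
  assumes len: "length xs = length ys"
    and near: "\<And>i j. i < length ys \<Longrightarrow> j < length ys \<Longrightarrow> ys ! i \<noteq> ys ! j \<Longrightarrow>
      2 * norm (xs ! i - ys ! i) \<le> norm (ys ! i - ys ! j)"
  shows "G2 (mset xs) (mset ys) = sqrt (\<Sum>i<length xs. (norm (xs ! i - ys ! i))\<^sup>2)"
proof (rule antisym[OF G2_lists_le[OF len]])
  obtain \<sigma> where s: "\<sigma> permutes {..<length ys}"
    "G2 (mset xs) (mset ys) = sqrt (\<Sum>(x, y)\<leftarrow>zip xs (permute_list \<sigma> ys). (norm (x - y))\<^sup>2)"
    by (rule G2_attained_perm[OF len])
  have "(\<Sum>i<length xs. (norm (xs ! i - ys ! i))\<^sup>2) \<le> (\<Sum>i<length xs. (norm (xs ! i - permute_list \<sigma> ys ! i))\<^sup>2)"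
  proof (rule sum_mono)
    fix i assume "i \<in> {..<length xs}"
    then have i: "i < length ys" using len by simp
    have si: "\<sigma> i < length ys" using permutes_in_image[OF s(1), of i] i by simp
    have pl: "permute_list \<sigma> ys ! i = ys ! \<sigma> i" using permute_list_nth[OF s(1)] i by simp
    have "norm (xs ! i - ys ! i) \<le> norm (xs ! i - ys ! \<sigma> i)"
    proof (cases "ys ! i = ys ! \<sigma> i")
      case False
      have "norm (ys ! i - ys ! \<sigma> i) \<le> norm (xs ! i - ys ! \<sigma> i) + norm (xs ! i - ys ! i)"
        using norm_triangle_ineq4[of "xs ! i - ys ! \<sigma> i" "xs ! i - ys ! i"] by simp
      then show ?thesis using near[OF i si False] by simp
    qed simp
    then show "(norm (xs ! i - ys ! i))\<^sup>2 \<le> (norm (xs ! i - permute_list \<sigma> ys ! i))\<^sup>2"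
      unfolding pl by (intro power_mono) auto
  qed
  then show "sqrt (\<Sum>i<length xs. (norm (xs ! i - ys ! i))\<^sup>2) \<le> G2 (mset xs) (mset ys)"
    using s(2) len by (simp add: sum_list_zip_norm)
qed

lemma G2_aligned_list:
  assumes "size M = length ys"
  obtains xs where "mset xs = M" "length xs = length ys" "G2 M (mset ys) = sqrt (\<Sum>i<length ys. (norm (xs ! i - ys ! i))\<^sup>2)"
proof -
  obtain xs0 where x0: "mset xs0 = M" using ex_mset by blast
  have l0: "length ys = length xs0" using assms x0 by auto
  obtain \<sigma> where s: "\<sigma> permutes {..<length xs0}"
    "G2 (mset ys) (mset xs0) = sqrt (\<Sum>(x, y)\<leftarrow>zip ys (permute_list \<sigma> xs0). (norm (x - y))\<^sup>2)"
    by (rule G2_attained_perm[OF l0])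
  show ?thesis
  proof
    show "mset (permute_list \<sigma> xs0) = M" using s(1) x0 by simp
    show "length (permute_list \<sigma> xs0) = length ys" using l0 by simp
    show "G2 M (mset ys) = sqrt (\<Sum>i<length ys. (norm (permute_list \<sigma> xs0 ! i - ys ! i))\<^sup>2)"
      using s(2) l0 x0 G2_sym[of M "mset ys"] by (simp add: sum_list_zip_norm norm_minus_commute)
  qed
qed

lemma le_sqrt_sum:
  fixes g :: "nat \<Rightarrow> real"
  assumes "i < n" "\<And>i. 0 \<le> g i"
  shows "g i \<le> sqrt (\<Sum>i<n. (g i)\<^sup>2)"
proof (rule real_le_rsqrt)
  show "(g i)\<^sup>2 \<le> (\<Sum>i<n. (g i)\<^sup>2)" using assms(1) by (intro member_le_sum) auto
qed

text \<open>Entries of \<open>xs\<close> that coincide lie near the same point of \<open>ys\<close>,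
  so sending \<open>xs ! i\<close> to \<open>ys ! i\<close> is a well defined surjection between the
  supports. The number of distinct values can thus only increase nearby; if it stays the same, the
  map is injective and every cluster of \<open>xs\<close> is one repeated point.\<close>

lemma support_selection:
  fixes ys xs :: "'b::real_normed_vector list"
  assumes len: "length xs = length ys"
    and gap: "\<And>i j. i < length ys \<Longrightarrow> j < length ys \<Longrightarrow> ys ! i \<noteq> ys ! j \<Longrightarrow> s \<le> norm (ys ! i - ys ! j)"
    and near: "\<And>i. i < length ys \<Longrightarrow> norm (xs ! i - ys ! i) < s / 4"
  shows "card (set ys) \<le> card (set xs)"
    "card (set xs) = card (set ys) \<Longrightarrow> i < length ys \<Longrightarrow> j < length ys \<Longrightarrow> ys ! i = ys ! j \<Longrightarrow> xs ! i = xs ! j"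
proof -
  have eqy: "ys ! i = ys ! j" if "i < length ys" "j < length ys" "xs ! i = xs ! j" for i j
  proof (rule ccontr)
    assume "ys ! i \<noteq> ys ! j"
    then have "s \<le> norm (ys ! i - ys ! j)" using gap that by blast
    moreover have "norm (ys ! i - ys ! j) \<le> norm (xs ! i - ys ! i) + norm (xs ! j - ys ! j)"
      using norm_triangle_ineq4[of "xs ! j - ys ! j" "xs ! i - ys ! i"] that(3) by (simp add: norm_minus_commute add.commute)
    moreover have "0 < s" using near[OF that(1)] norm_ge_zero[of "xs ! i - ys ! i"] by linarith
    ultimately show False using near[OF that(1)] near[OF that(2)] by linarith
  qed
  define \<phi> where "\<phi> e = ys ! (SOME i. i < length ys \<and> xs ! i = e)" for e
  have ph: "\<phi> (xs ! i) = ys ! i" if "i < length ys" for i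
  proof -
    have "(SOME k. k < length ys \<and> xs ! k = xs ! i) < length ys \<and> xs ! (SOME k. k < length ys \<and> xs ! k = xs ! i) = xs ! i"
      by (rule someI[of _ i]) (use that in simp)
    then show ?thesis unfolding \<phi>_def using eqy that by metis
  qed
  have img: "\<phi> ` set xs = set ys"
  proof -
    have "set xs = (!) xs ` {..<length ys}" using len by (auto simp: set_conv_nth)
    moreover have "set ys = (!) ys ` {..<length ys}" by (auto simp: set_conv_nth)
    ultimately show ?thesis using ph by (auto simp: image_image)
  qed
  show "card (set ys) \<le> card (set xs)" using card_image_le[of "set xs" \<phi>] img by simp
  assume c: "card (set xs) = card (set ys)" and ij: "i < length ys" "j < length ys" "ys ! i = ys ! j"
  have "inj_on \<phi> (set xs)" by (rule eq_card_imp_inj_on) (use img c in auto)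
  moreover have "xs ! i \<in> set xs" "xs ! j \<in> set xs" using ij len by auto
  ultimately show "xs ! i = xs ! j" using ph ij by (metis inj_onD)
qed

text \<open>On the set where \<open>f\<close> has exactly as many distinct values as at \<open>a\<close>, the values of \<open>f\<close> split
  into clusters around the values at \<open>a\<close>, each consisting of a single point; this selects \<open>f\<close>.\<close>

lemma local_selection:
  fixes f :: "'a::metric_space \<Rightarrow> 'b::real_inner multiset"
  assumes f: "\<And>x. x \<in> A \<Longrightarrow> f x \<in> QQ Q"
    and lip: "\<And>x y. x \<in> A \<Longrightarrow> y \<in> A \<Longrightarrow> G2 (f x) (f y) \<le> C * dist x y" and C: "C \<ge> 0" and a: "a \<in> A"
  obtains r Y where "r > 0" "\<And>x. x \<in> A \<Longrightarrow> dist x a < r \<Longrightarrow> card (set_mset (f a)) \<le> card (set_mset (f x))"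
    "\<And>i. i < Q \<Longrightarrow> C-lipschitz_on {x\<in>A. dist x a < r \<and> card (set_mset (f x)) = card (set_mset (f a))} (Y i)"
    "\<And>x. x \<in> A \<Longrightarrow> dist x a < r \<Longrightarrow> card (set_mset (f x)) = card (set_mset (f a)) \<Longrightarrow>
      f x = mset (map (\<lambda>i. Y i x) [0..<Q])"
proof -
  obtain ys where ys: "mset ys = f a" using ex_mset by blast
  have ly: "length ys = Q" using ys f[OF a] by (metis QQ_def mem_Collect_eq size_mset)
  obtain s where s: "s > 0" "\<And>i j. i < length ys \<Longrightarrow> j < length ys \<Longrightarrow> ys ! i \<noteq> ys ! j \<Longrightarrow> s \<le> norm (ys ! i - ys ! j)"
    by (rule list_gap[of ys]) blast
  \<comment> \<open>Within this radius of \<open>a\<close> the values of \<open>f\<close> stay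
    closer than \<open>s / 8\<close> to those at \<open>a\<close>, where \<open>s\<close> is the gap
    between distinct values.\<close>
  define r where "r = s / (8 * (C + 1))"
  have r: "r > 0" using s C by (simp add: r_def)
  have Cr: "C * d < s / 8" if "0 \<le> d" "d < r" for d
  proof -
    have "C * d \<le> (C + 1) * d" using that by (intro mult_right_mono) auto
    also have "\<dots> < (C + 1) * r" using that C by (intro mult_strict_left_mono) auto
    also have "\<dots> = s / 8"
    proof -
      have "M * (s / (8 * M)) = s / 8" if "M > 0" for M :: real using that by simp
      note * = this
      show ?thesis unfolding r_def by (rule *) (use C in simp)
    qed
    finally show ?thesis .
  qed
  have "\<exists>xs. x \<in> A \<and> dist x a < r \<longrightarrow> mset xs = f x \<and> length xs = Q \<and> (\<forall>i<Q. norm (xs ! i - ys ! i) < s / 8)" for x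
  proof (cases "x \<in> A \<and> dist x a < r")
    case True
    have "size (f x) = length ys" using f[of x] True ly by (simp add: QQ_def)
    then obtain xs where xs: "mset xs = f x" "length xs = length ys" "G2 (f x) (mset ys) = sqrt (\<Sum>i<length ys. (norm (xs ! i - ys ! i))\<^sup>2)"
      by (rule G2_aligned_list)
    have "norm (xs ! i - ys ! i) < s / 8" if "i < Q" for i
    proof -
      have "norm (xs ! i - ys ! i) \<le> G2 (f x) (mset ys)"
        unfolding xs(3) using that ly by (intro le_sqrt_sum[of i "length ys" "\<lambda>i. norm (xs ! i - ys ! i)"]) auto
      also have "\<dots> \<le> C * dist x a" using lip[of x a] True a ys by simp
      also have "\<dots> < s / 8" using Cr True by simp
      finally show ?thesis .
    qed
    then show ?thesis using xs ly by auto
  qed blast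
  then obtain X where X0: "\<And>x. x \<in> A \<and> dist x a < r \<longrightarrow> mset (X x) = f x \<and> length (X x) = Q \<and> (\<forall>i<Q. norm (X x ! i - ys ! i) < s / 8)"
    by metis
  have X: "x \<in> A \<Longrightarrow> dist x a < r \<Longrightarrow> mset (X x) = f x"
    "x \<in> A \<Longrightarrow> dist x a < r \<Longrightarrow> length (X x) = Q"
    "x \<in> A \<Longrightarrow> dist x a < r \<Longrightarrow> i < Q \<Longrightarrow> norm (X x ! i - ys ! i) < s / 8" for x i using X0 by blast+
  have near4: "norm (X x ! i - ys ! i) < s / 4" if "x \<in> A" "dist x a < r" "i < length ys" for x i
  proof -
    have "norm (X x ! i - ys ! i) < s / 8" using X(3)[OF that(1,2)] that(3) ly by simp
    also have "\<dots> < s / 4" using s(1) by simp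
    finally show ?thesis .
  qed
  have setX: "set (X x) = set_mset (f x)" if "x \<in> A" "dist x a < r" for x
    using X(1)[OF that] by (metis set_mset_mset)
  have sety: "set ys = set_mset (f a)" using ys by (metis set_mset_mset)
  show ?thesis
  proof
    show "r > 0" by fact
    show "card (set_mset (f a)) \<le> card (set_mset (f x))" if "x \<in> A" "dist x a < r" for x
      using support_selection(1)[of "X x" ys s] X(2) that ly s(2) near4 setX sety by simp
    show "f x = mset (map (\<lambda>i. X x ! i) [0..<Q])" if "x \<in> A" "dist x a < r" "card (set_mset (f x)) = card (set_mset (f a))" for x
      using X(1,2)[OF that(1,2)] by (metis map_nth)
    fix i assume i: "i < Q"
    show "C-lipschitz_on {x\<in>A. dist x a < r \<and> card (set_mset (f x)) = card (set_mset (f a))} (\<lambda>x. X x ! i)"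
    proof (rule lipschitz_onI)
      fix p q assume pq: "p \<in> {x\<in>A. dist x a < r \<and> card (set_mset (f x)) = card (set_mset (f a))}"
        "q \<in> {x\<in>A. dist x a < r \<and> card (set_mset (f x)) = card (set_mset (f a))}"
      have lpq: "length (X p) = length (X q)" using X(2) pq by simp
      have Gpq: "G2 (f p) (f q) < s / 4"
      proof -
        have "G2 (f p) (f q) \<le> G2 (f p) (f a) + G2 (f a) (f q)"
          using pq f a by (intro G2_triangle[of _ Q]) auto
        also have "\<dots> \<le> C * dist p a + C * dist q a"
          using lip[of p a] lip[of a q] dist_commute[of a q] pq a by (intro add_mono) auto
        also have "\<dots> < s / 8 + s / 8" using Cr pq by (intro add_strict_mono) auto
        finally show ?thesis by simp
      qed
      obtain \<sigma> where sg: "\<sigma> permutes {..<length (X q)}"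
        "G2 (mset (X p)) (mset (X q)) = sqrt (\<Sum>(x, y)\<leftarrow>zip (X p) (permute_list \<sigma> (X q)). (norm (x - y))\<^sup>2)"
        by (rule G2_attained_perm[OF lpq])
      have lq: "length (X q) = Q" using X(2) pq by simp
      have si: "\<sigma> i < Q" using permutes_in_image[OF sg(1), of i] i lq by simp
      have "G2 (f p) (f q) = sqrt (\<Sum>i<Q. (norm (X p ! i - permute_list \<sigma> (X q) ! i))\<^sup>2)"
        using sg(2) X(1)[of p] X(1)[of q] pq lpq lq by (simp add: sum_list_zip_norm)
      then have "norm (X p ! i - permute_list \<sigma> (X q) ! i) \<le> G2 (f p) (f q)"
        using le_sqrt_sum[of i Q "\<lambda>i. norm (X p ! i - permute_list \<sigma> (X q) ! i)"] i by simp
      moreover have "permute_list \<sigma> (X q) ! i = X q ! \<sigma> i" using permute_list_nth[OF sg(1)] i lq by simp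
      ultimately have ni: "norm (X p ! i - X q ! \<sigma> i) \<le> G2 (f p) (f q)" by simp
      \<comment> \<open>An optimal matching of \<open>f p\<close> with \<open>f q\<close> cannot
        leave a cluster, since \<open>s / 4 + s / 8 + s / 8\<close> is below the gap. As each
        cluster is a single point, the matched point is also the one of index
        \<open>i\<close>.\<close>
      have "ys ! i = ys ! \<sigma> i"
      proof (rule ccontr)
        assume "ys ! i \<noteq> ys ! \<sigma> i"
        then have "s \<le> norm (ys ! i - ys ! \<sigma> i)" using s(2) i si ly by simp
        also have "ys ! i - ys ! \<sigma> i = (X p ! i - X q ! \<sigma> i) + ((X q ! \<sigma> i - ys ! \<sigma> i) - (X p ! i - ys ! i))" by simp
        also have "norm \<dots> \<le> norm (X p ! i - X q ! \<sigma> i) + (norm (X q ! \<sigma> i - ys ! \<sigma> i) + norm (X p ! i - ys ! i))"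
          by (intro order_trans[OF norm_triangle_ineq] add_left_mono norm_triangle_ineq4)
        also have "\<dots> < s / 4 + (s / 8 + s / 8)"
          using ni Gpq X(3)[of p i] X(3)[of q "\<sigma> i"] pq i si by (intro add_strict_mono) auto
        finally show False using s(1) by simp
      qed
      then have "X q ! i = X q ! \<sigma> i"
        using support_selection(2)[of "X q" ys s i "\<sigma> i"] lq ly s(2) near4[of q] pq setX[of q] sety i si by simp
      then have "norm (X p ! i - X q ! i) \<le> C * dist p q"
        using ni lip[of p q] pq by simp
      then show "dist (X p ! i) (X q ! i) \<le> C * dist p q" by (simp add: dist_norm)
    qed (rule C)
  qed
qed

text \<open>The length of the directional derivative of the whole tuple. The square of
  \<open>|Df|\<close> is the sum of its squares over the coordinate directions, and it can be read
  off from the growth of \<open>G2\<close> alone, without identifying the individual linear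
  maps.\<close>

definition slope :: "('a::real_normed_vector \<Rightarrow> 'b::real_inner) multiset \<Rightarrow> 'a \<Rightarrow> real" where
  "slope As h = sqrt (\<Sum>A\<in>#As. (norm (A h - A 0))\<^sup>2)"

lemma slope_mset: "slope (mset Al) h = sqrt (\<Sum>i<length Al. (norm ((Al ! i) h - (Al ! i) 0))\<^sup>2)"
  unfolding slope_def
  by (simp only: mset_map[symmetric] sum_mset_sum_list sum_list_sum_nth length_map lessThan_atLeast0) simp

lemma affine_diff:
  assumes "affine_fun A"
  shows "A x - A y = A (x - y) - A 0"
  using linear_diff[OF assms[unfolded affine_fun_def], of x y] by simp

lemma slope_scale:
  assumes "\<forall>A\<in>#As. affine_fun A" "c \<ge> 0"
  shows "slope As (c *\<^sub>R h) = c * slope As h"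
proof -
  have "A (c *\<^sub>R h) - A 0 = c *\<^sub>R (A h - A 0)" if "A \<in># As" for A
    using assms(1) that linear_scale[of "\<lambda>x. A x - A 0" c h] by (auto simp: affine_fun_def)
  then have "(\<Sum>A\<in>#As. (norm (A (c *\<^sub>R h) - A 0))\<^sup>2) = (\<Sum>A\<in>#As. c\<^sup>2 * (norm (A h - A 0))\<^sup>2)"
    by (intro arg_cong[where f=sum_mset] image_mset_cong) (simp add: power_mult_distrib)
  then show ?thesis using assms(2) by (simp add: slope_def sum_mset_distrib_left[symmetric] real_sqrt_mult)
qed

lemma continuous_slope:
  fixes As :: "('a::euclidean_space \<Rightarrow> 'b::real_inner) multiset"
  assumes "\<forall>A\<in>#As. affine_fun A"
  shows "continuous_on UNIV (slope As)"
proof -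
  obtain Al where Al: "mset Al = As" using ex_mset by blast
  have "continuous_on UNIV (\<lambda>h. (Al ! i) h - (Al ! i) 0)" if "i < length Al" for i
  proof -
    have "Al ! i \<in># As" using that Al by auto
    then have "linear (\<lambda>h. (Al ! i) h - (Al ! i) 0)" using assms by (auto simp: affine_fun_def)
    then show ?thesis by (simp add: linear_continuous_on linear_conv_bounded_linear)
  qed
  then show ?thesis unfolding Al[symmetric] slope_mset[abs_def]
    by (intro continuous_on_real_sqrt continuous_on_sum continuous_on_power continuous_on_norm) auto
qed

text \<open>Pairing each affine map with itself gives the bound. Near \<open>a\<close> this pairing
  is optimal: values that differ at \<open>a\<close> stay separated, and maps that agree at
  \<open>a\<close> share the same target.\<close>

lemma G2_affine:
  fixes As :: "('a::euclidean_space \<Rightarrow> 'b::real_inner) multiset"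
  assumes aff: "\<forall>A\<in>#As. affine_fun A"
  shows "G2 {#A x. A\<in>#As#} {#A a. A\<in>#As#} \<le> slope As (x - a)"
    and "\<exists>d>0. \<forall>x. norm (x - a) < d \<longrightarrow> G2 {#A x. A\<in>#As#} {#A a. A\<in>#As#} = slope As (x - a)"
proof -
  obtain Al where Al: "mset Al = As" using ex_mset by blast
  have affi: "affine_fun (Al ! i)" if "i < length Al" for i using that aff Al by auto
  define X where "X x = map (\<lambda>A. A x) Al" for x
  have mX: "mset (X x) = {#A x. A\<in>#As#}" for x by (simp add: X_def Al[symmetric])
  have lX: "length (X x) = length Al" for x by (simp add: X_def)
  have sl: "slope As (x - a) = sqrt (\<Sum>i<length (X x). (norm (X x ! i - X a ! i))\<^sup>2)" for x
    unfolding Al[symmetric] slope_mset lX by (simp add: X_def affine_diff[OF affi, of _ x a])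
  show "G2 {#A x. A\<in>#As#} {#A a. A\<in>#As#} \<le> slope As (x - a)"
    unfolding sl mX[symmetric] by (rule G2_lists_le) (simp add: lX)
  obtain s where s: "s > 0" "\<And>i j. i < length (X a) \<Longrightarrow> j < length (X a) \<Longrightarrow> X a ! i \<noteq> X a ! j \<Longrightarrow> s \<le> norm (X a ! i - X a ! j)"
    by (rule list_gap[of "X a"]) blast
  have "continuous_on UNIV (\<lambda>x. slope As (x - a))"
    by (rule continuous_on_compose2[OF continuous_slope[OF aff]]) (auto intro: continuous_intros)
  then have "isCont (\<lambda>x. slope As (x - a)) a" by (simp add: continuous_on_eq_continuous_at)
  moreover have "slope As (a - a) = 0" by (simp add: slope_def)
  moreover have "s / 2 > 0" using s(1) by simp
  ultimately obtain d where d: "d > 0" "\<And>x. dist x a < d \<Longrightarrow> dist (slope As (x - a)) 0 < s / 2"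
    unfolding continuous_at_eps_delta by metis
  have "G2 {#A x. A\<in>#As#} {#A a. A\<in>#As#} = slope As (x - a)" if "norm (x - a) < d" for x
    unfolding sl mX[symmetric]
  proof (rule G2_lists_near)
    fix i j assume ij: "i < length (X a)" "j < length (X a)" "X a ! i \<noteq> X a ! j"
    have "norm (X x ! i - X a ! i) \<le> slope As (x - a)"
      unfolding sl using ij lX by (intro le_sqrt_sum[of i _ "\<lambda>i. norm (X x ! i - X a ! i)"]) auto
    also have "\<dots> < s / 2" using d(2)[of x] that by (simp add: dist_norm)
    finally show "2 * norm (X x ! i - X a ! i) \<le> norm (X a ! i - X a ! j)" using s(2)[OF ij] by simp
  qed (simp add: lX)
  then show "\<exists>d>0. \<forall>x. norm (x - a) < d \<longrightarrow> G2 {#A x. A\<in>#As#} {#A a. A\<in>#As#} = slope As (x - a)"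
    using d(1) by blast
qed

lemma G2_affine_sequence:
  fixes As :: "('a::euclidean_space \<Rightarrow> 'b::real_inner) multiset"
  assumes aff: "\<forall>A\<in>#As. affine_fun A"
    and t: "\<And>n. t n > (0::real)" "t \<longlonglongrightarrow> 0" and x: "(\<lambda>n. (x n - a) /\<^sub>R t n) \<longlonglongrightarrow> h"
  shows "(\<lambda>n. G2 {#A (x n). A\<in>#As#} {#A a. A\<in>#As#} / t n) \<longlonglongrightarrow> slope As h"
proof -
  have xn: "x n - a = t n *\<^sub>R ((x n - a) /\<^sub>R t n)" for n using t(1)[of n] by simp
  have "(\<lambda>n. t n *\<^sub>R ((x n - a) /\<^sub>R t n)) \<longlonglongrightarrow> 0 *\<^sub>R h" by (intro tendsto_intros t x)
  then have xa: "(\<lambda>n. x n - a) \<longlonglongrightarrow> 0" using xn by simp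
  obtain d where d: "d > 0" "\<And>x. norm (x - a) < d \<Longrightarrow> G2 {#A x. A\<in>#As#} {#A a. A\<in>#As#} = slope As (x - a)"
    using G2_affine(2)[OF aff] by blast
  have "\<forall>\<^sub>F n in sequentially. norm (x n - a) < d"
    using tendsto_norm_zero[OF xa] d(1) by (rule order_tendstoD)
  then have "\<forall>\<^sub>F n in sequentially. slope As ((x n - a) /\<^sub>R t n) = G2 {#A (x n). A\<in>#As#} {#A a. A\<in>#As#} / t n"
  proof eventually_elim
    fix n assume "norm (x n - a) < d"
    then have "G2 {#A (x n). A\<in>#As#} {#A a. A\<in>#As#} = slope As (t n *\<^sub>R ((x n - a) /\<^sub>R t n))"
      using d(2)[of "x n"] xn[of n] by simp
    also have "\<dots> = t n * slope As ((x n - a) /\<^sub>R t n)"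
      using t(1)[of n] by (intro slope_scale aff) simp
    finally show "slope As ((x n - a) /\<^sub>R t n) = G2 {#A (x n). A\<in>#As#} {#A a. A\<in>#As#} / t n"
      using t(1)[of n] by simp
  qed
  moreover have "(\<lambda>n. slope As ((x n - a) /\<^sub>R t n)) \<longlonglongrightarrow> slope As h"
    by (rule continuous_on_tendsto_compose[OF continuous_slope[OF aff] x]) auto
  ultimately show ?thesis by (simp add: Lim_transform_eventually)
qed

section \<open>Approximate differentials\<close>

text \<open>A stronger form of \<open>approx_affine\<close>: the expansion holds to first order
  along one Borel set \<open>B\<close> of density one, the same for all accuracies, and the tuple
  takes the value \<open>f a\<close> at \<open>a\<close>. It allows limits along sequences in
  \<open>B\<close>.\<close>

definition approx_affine_on ::
  "nat \<Rightarrow> 'a::euclidean_space set \<Rightarrow> ('a \<Rightarrow> 'b::real_inner multiset) \<Rightarrow> 'a \<Rightarrow> ('a \<Rightarrow> 'b) multiset \<Rightarrow> bool" where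
  "approx_affine_on Q B f a As \<longleftrightarrow> size As = Q \<and> (\<forall>A\<in>#As. affine_fun A) \<and> {#A a. A\<in>#As#} = f a \<and>
    B \<in> sets borel \<and> density_one B a \<and> (\<forall>x\<in>B. f x \<in> QQ Q) \<and> a \<in> B \<and>
    (\<forall>\<epsilon>>0. \<exists>d>0. \<forall>x\<in>B. norm (x - a) < d \<longrightarrow> G2 (f x) {#A x. A\<in>#As#} \<le> \<epsilon> * norm (x - a))"

text \<open>On the set \<open>W a\<close> of points near \<open>a\<close> with as many distinct
  values as at \<open>a\<close>, \<open>f\<close> is given by Lipschitz selections, to which the
  theorem for \<open>ell2\<close> applies. The number of distinct values is lower semicontinuous on
  \<open>A\<close>, which makes the sets \<open>W a\<close> Borel; by Lindelof countably many of
  them cover \<open>A\<close>.\<close>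

theorem rademacher_QQ:
  fixes f :: "'a::euclidean_space \<Rightarrow> ell2 multiset"
  assumes A[measurable]: "A \<in> sets borel" and f: "\<And>x. x \<in> A \<Longrightarrow> f x \<in> QQ Q"
    and lip: "\<And>x y. x \<in> A \<Longrightarrow> y \<in> A \<Longrightarrow> G2 (f x) (f y) \<le> C * dist x y" and C: "C \<ge> 0"
  shows "AE a in lborel. a \<in> A \<longrightarrow> (\<exists>B As. B \<subseteq> A \<and> approx_affine_on Q B f a As)"
proof -
  let ?N = "\<lambda>x. card (set_mset (f x))"
  define P where "P a r Y \<longleftrightarrow> r > 0 \<and> (\<forall>x\<in>A. dist x a < r \<longrightarrow> ?N a \<le> ?N x) \<and>
      (\<forall>i<Q. C-lipschitz_on {x\<in>A. dist x a < r \<and> ?N x = ?N a} (Y i)) \<and>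
      (\<forall>x\<in>A. dist x a < r \<and> ?N x = ?N a \<longrightarrow> f x = mset (map (\<lambda>i. Y i x) [0..<Q]))" for a r Y
  have "\<exists>r Y. P a r Y" if aA: "a \<in> A" for a
  proof -
    show ?thesis
    proof (rule local_selection[OF f lip C aA])
      fix r Y assume h: "0 < r" "\<And>x. x \<in> A \<Longrightarrow> dist x a < r \<Longrightarrow> ?N a \<le> ?N x"
        "\<And>i. i < Q \<Longrightarrow> C-lipschitz_on {x\<in>A. dist x a < r \<and> ?N x = ?N a} (Y i)"
        "\<And>x. x \<in> A \<Longrightarrow> dist x a < r \<Longrightarrow> ?N x = ?N a \<Longrightarrow> f x = mset (map (\<lambda>i. Y i x) [0..<Q])"
      have "P a r Y" unfolding P_def
      proof (intro conjI ballI allI impI)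
        show "0 < r" by (rule h(1))
        show "?N a \<le> ?N x" if "x \<in> A" "dist x a < r" for x using that by (rule h(2))
        show "C-lipschitz_on {x\<in>A. dist x a < r \<and> ?N x = ?N a} (Y i)" if "i < Q" for i using that by (rule h(3))
        show "f x = mset (map (\<lambda>i. Y i x) [0..<Q])" if "x \<in> A" "dist x a < r \<and> ?N x = ?N a" for x
          using that by (intro h(4)) simp_all
      qed
      then show ?thesis by (intro exI)
    qed
  qed
  then have "\<forall>a\<in>A. \<exists>p. P a (fst p) (snd p)" by simp
  then obtain p where "\<forall>a\<in>A. P a (fst (p a)) (snd (p a))" by (rule bchoice[THEN exE])
  then obtain r Y where P: "\<And>a. a \<in> A \<Longrightarrow> P a (r a) (Y a)"
    using that[of "\<lambda>a. fst (p a)" "\<lambda>a. snd (p a)"] by blast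
  have r: "r a > 0" if "a \<in> A" for a using P[OF that] unfolding P_def by blast
  have Nle: "?N a \<le> ?N x" if "a \<in> A" "x \<in> A" "dist x a < r a" for a x
    using P[OF that(1)] that(2,3) unfolding P_def by blast
  have Yl: "C-lipschitz_on {x\<in>A. dist x a < r a \<and> ?N x = ?N a} (Y a i)" if "a \<in> A" "i < Q" for a i
    using P[OF that(1)] that(2) unfolding P_def by simp
  have Yf: "f x = mset (map (\<lambda>i. Y a i x) [0..<Q])" if "a \<in> A" "x \<in> A" "dist x a < r a" "?N x = ?N a" for a x
    using P[OF that(1)] that(2-4) unfolding P_def by simp
  define W where "W a = {x\<in>A. dist x a < r a \<and> ?N x = ?N a}" for a
  have ge: "{x\<in>A. j \<le> ?N x} \<in> sets borel" for j
  proof -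
    have eq: "{x\<in>A. j \<le> ?N x} = A \<inter> (\<Union>a\<in>{a\<in>A. j \<le> ?N a}. ball a (r a))" (is "?l = ?r")
    proof
      show "?l \<subseteq> ?r"
      proof
        fix x assume "x \<in> ?l"
        then have "x \<in> A" "j \<le> ?N x" "x \<in> ball x (r x)" using r[of x] by auto
        then show "x \<in> ?r" by blast
      qed
      show "?r \<subseteq> ?l"
      proof
        fix x assume "x \<in> ?r"
        then obtain a where a: "x \<in> A" "a \<in> A" "j \<le> ?N a" "x \<in> ball a (r a)" by blast
        then have "dist x a < r a" by (simp add: dist_commute)
        then have "?N a \<le> ?N x" using Nle a by blast
        then have "j \<le> ?N x" using a(3) by linarith
        then show "x \<in> ?l" using a(1) by blast
      qed
    qed
    show ?thesis by (subst eq) (intro sets.Int A borel_open open_UN ballI open_ball)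
  qed
  have Wm: "W a \<in> sets borel" for a
  proof -
    have "W a = ({x\<in>A. ?N a \<le> ?N x} - {x\<in>A. Suc (?N a) \<le> ?N x}) \<inter> ball a (r a)"
    proof
      show "W a \<subseteq> ({x\<in>A. ?N a \<le> ?N x} - {x\<in>A. Suc (?N a) \<le> ?N x}) \<inter> ball a (r a)"
        unfolding W_def by (auto simp: dist_commute)
      show "({x\<in>A. ?N a \<le> ?N x} - {x\<in>A. Suc (?N a) \<le> ?N x}) \<inter> ball a (r a) \<subseteq> W a"
        unfolding W_def by (clarsimp simp: dist_commute)
    qed
    moreover have "({x\<in>A. ?N a \<le> ?N x} - {x\<in>A. Suc (?N a) \<le> ?N x}) \<inter> ball a (r a) \<in> sets borel"
      by (intro sets.Int sets.Diff ge borel_open open_ball)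
    ultimately show ?thesis by (rule ssubst)
  qed
  \<comment> \<open>The count \<open>j\<close> is fixed because a point in the ball around
    \<open>a\<close> belongs to \<open>W a\<close> only if it has the same count as
    \<open>a\<close>.\<close>
  have "\<exists>K. countable K \<and> K \<subseteq> {a\<in>A. ?N a = j} \<and> (\<Union>a\<in>{a\<in>A. ?N a = j}. ball a (r a)) = (\<Union>a\<in>K. ball a (r a))" for j
  proof -
    define F where "F = (\<lambda>a. ball a (r a)) ` {a\<in>A. ?N a = j}"
    have op: "open S" if "S \<in> F" for S using that by (auto simp: F_def)
    obtain F' where F': "F' \<subseteq> F" "countable F'" "\<Union>F' = \<Union>F"
      by (rule Lindelof[OF op])
    then obtain K where K: "countable K" "K \<subseteq> {a\<in>A. ?N a = j}" "F' = (\<lambda>a. ball a (r a)) ` K"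
      unfolding F_def by (meson countable_subset_image)
    have "(\<Union>a\<in>{a\<in>A. ?N a = j}. ball a (r a)) = (\<Union>a\<in>K. ball a (r a))"
      using F'(3) unfolding F_def K(3) by simp
    then show ?thesis using K(1,2) by blast
  qed
  then obtain K where K: "\<And>j. countable (K j)" "\<And>j. K j \<subseteq> {a\<in>A. ?N a = j}"
    "\<And>j. (\<Union>a\<in>{a\<in>A. ?N a = j}. ball a (r a)) = (\<Union>a\<in>K j. ball a (r a))" by metis
  define KK where "KK = (\<Union>j. K j)"
  have KK: "countable KK" "KK \<subseteq> A" using K(1,2) by (auto simp: KK_def)
  have cov: "\<exists>a\<in>KK. x \<in> W a" if "x \<in> A" for x
  proof -
    have "x \<in> (\<Union>a\<in>{a\<in>A. ?N a = ?N x}. ball a (r a))" using that r by auto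
    then obtain a where "a \<in> K (?N x)" "x \<in> ball a (r a)" using K(3) by blast
    then have "a \<in> KK" "x \<in> W a" using K(2)[of "?N x"] that by (auto simp: W_def KK_def dist_commute)
    then show ?thesis by blast
  qed
  have ae1: "AE x in lborel. \<forall>i\<in>{..<Q}. x \<in> W a \<longrightarrow> (\<exists>T. (Y a i has_derivative T) (at x within W a))" if "a \<in> KK" for a
  proof (rule AE_ball_countable[THEN iffD2])
    show "\<forall>i\<in>{..<Q}. AE x in lborel. x \<in> W a \<longrightarrow> (\<exists>T. (Y a i has_derivative T) (at x within W a))"
    proof
      fix i assume "i \<in> {..<Q}"
      then have "C-lipschitz_on (W a) (Y a i)" using Yl[of a i] that KK unfolding W_def by auto
      then show "AE x in lborel. x \<in> W a \<longrightarrow> (\<exists>T. (Y a i has_derivative T) (at x within W a))"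
        by (rule rademacher_ell2[OF Wm])
    qed
  qed simp
  have "AE x in lborel. \<forall>a\<in>KK. \<forall>i\<in>{..<Q}. x \<in> W a \<longrightarrow> (\<exists>T. (Y a i has_derivative T) (at x within W a))"
    by (rule AE_ball_countable[THEN iffD2, OF KK(1)]) (use ae1 in blast)
  moreover have "AE x in lborel. \<forall>a\<in>KK. x \<in> W a \<longrightarrow> density_one (W a) x"
    by (rule AE_ball_countable[THEN iffD2, OF KK(1)]) (use density_one_AE[OF Wm] in blast)
  ultimately show ?thesis
  proof (eventually_elim, intro impI)
    fix x0 assume d: "\<forall>a\<in>KK. \<forall>i\<in>{..<Q}. x0 \<in> W a \<longrightarrow> (\<exists>T. (Y a i has_derivative T) (at x0 within W a))"
      and dens: "\<forall>a\<in>KK. x0 \<in> W a \<longrightarrow> density_one (W a) x0" and "x0 \<in> A"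
    then obtain a where a: "a \<in> KK" "x0 \<in> W a" using cov by blast
    have aA: "a \<in> A" using a KK by blast
    obtain T where T: "\<And>i. i < Q \<Longrightarrow> (Y a i has_derivative T i) (at x0 within W a)"
      using d a by (metis lessThan_iff)
    define Al where "Al = map (\<lambda>i. (\<lambda>x. Y a i x0 + T i (x - x0))) [0..<Q]"
    have fW: "f x = mset (map (\<lambda>i. Y a i x) [0..<Q])" if "x \<in> W a" for x
      using Yf[OF aA] that by (auto simp: W_def)
    have "approx_affine_on Q (W a) f x0 (mset Al)"
      unfolding approx_affine_on_def
    proof (intro conjI allI impI ballI)
      show "size (mset Al) = Q" by (simp add: Al_def)
      fix B assume "B \<in># mset Al"
      then obtain i where i: "i < Q" "B = (\<lambda>x. Y a i x0 + T i (x - x0))" by (auto simp: Al_def)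
      have lin: "linear (T i)" by (rule has_derivative_linear[OF T[OF i(1)]])
      have "(\<lambda>x. B x - B 0) = T i" by (auto simp: i linear_diff[OF lin] linear_0[OF lin] linear_neg[OF lin])
      then show "affine_fun B" using lin by (simp add: affine_fun_def)
    next
      have "map (\<lambda>A. A x0) Al = map (\<lambda>i. Y a i x0) [0..<Q]"
        using linear_0[OF has_derivative_linear[OF T]] by (simp add: Al_def)
      then show "{#A x0. A\<in>#mset Al#} = f x0" using fW[OF a(2)] by (metis mset_map)
    next
      fix \<epsilon> :: real assume e: "\<epsilon> > 0"
      have e': "\<epsilon> / real (Suc Q) > 0" using e by simp
      have "\<forall>i. \<exists>d>0. i < Q \<longrightarrow> (\<forall>x\<in>W a. norm (x - x0) < d \<longrightarrow>
          norm (Y a i x - Y a i x0 - T i (x - x0)) \<le> \<epsilon> / real (Suc Q) * norm (x - x0))"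
        using T e' unfolding has_derivative_within_alt by (metis zero_less_one)
      then obtain d where dp: "\<And>i. d i > (0::real)" and dd: "\<And>i x. i < Q \<Longrightarrow> x \<in> W a \<Longrightarrow> norm (x - x0) < d i \<Longrightarrow>
          norm (Y a i x - Y a i x0 - T i (x - x0)) \<le> \<epsilon> / real (Suc Q) * norm (x - x0)" by metis
      define d0 where "d0 = Min (d ` {..Q})"
      have d0: "d0 > 0" unfolding d0_def using dp by (subst Min_gr_iff) auto
      have d0i: "d0 \<le> d i" if "i < Q" for i unfolding d0_def using that by (intro Min_le) auto
      have "G2 (f x) {#A x. A\<in>#mset Al#} \<le> \<epsilon> * norm (x - x0)" if x: "x \<in> W a" "norm (x - x0) < d0" for x
      proof -
        have "G2 (mset (map (\<lambda>i. Y a i x) [0..<Q])) (mset (map (\<lambda>A. A x) Al)) \<le>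
            sqrt (\<Sum>i<Q. (norm (Y a i x - (Y a i x0 + T i (x - x0))))\<^sup>2)"
          using G2_lists_le[of "map (\<lambda>i. Y a i x) [0..<Q]" "map (\<lambda>A. A x) Al"] by (simp add: Al_def)
        also have "\<dots> \<le> (\<Sum>i<Q. norm (Y a i x - (Y a i x0 + T i (x - x0))))"
          using L2_set_le_sum[of "{..<Q}" "\<lambda>i. norm (Y a i x - (Y a i x0 + T i (x - x0)))"] by (simp add: L2_set_def)
        also have "\<dots> \<le> (\<Sum>i<Q. \<epsilon> / real (Suc Q) * norm (x - x0))"
          using dd[OF _ x(1)] d0i x(2) by (intro sum_mono) (auto simp: diff_diff_eq dest: less_le_trans)
        also have "\<dots> = real Q / real (Suc Q) * (\<epsilon> * norm (x - x0))" by simp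
        also have "\<dots> \<le> 1 * (\<epsilon> * norm (x - x0))" using e by (intro mult_right_mono) auto
        finally show ?thesis using fW[OF x(1)] by simp
      qed
      then show "\<exists>d>0. \<forall>x\<in>W a. norm (x - x0) < d \<longrightarrow> G2 (f x) {#A x. A\<in>#mset Al#} \<le> \<epsilon> * norm (x - x0)"
        using d0 by blast
    qed (use Wm dens a f in \<open>auto simp: W_def\<close>)
    moreover have "W a \<subseteq> A" by (auto simp: W_def)
    ultimately show "\<exists>B As. B \<subseteq> A \<and> approx_affine_on Q B f x0 As" by blast
  qed
qed

lemma affine_QQ: "size As = Q \<Longrightarrow> {#A x. A\<in>#As#} \<in> QQ Q"
  by (simp add: QQ_def)

lemma approx_affine_on_sequence:
  assumes s: "approx_affine_on Q B f a As" and E: "E \<in> sets borel" "density_one E a"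
  obtains x t where "\<And>n. t n > 0" "t \<longlonglongrightarrow> 0" "\<And>n. x n \<in> E \<inter> B"
    "(\<lambda>n. (x n - a) /\<^sub>R t n) \<longlonglongrightarrow> h" "\<And>n::nat. G2 (f (x n)) (f a) \<le> G2 {#A (x n). A\<in>#As#} {#A a. A\<in>#As#} + G2 (f (x n)) {#A (x n). A\<in>#As#}"
    "(\<lambda>n. G2 (f (x n)) {#A (x n). A\<in>#As#} / t n) \<longlonglongrightarrow> 0"
proof -
  have B: "B \<in> sets borel" "density_one B a" "\<And>x. x \<in> B \<Longrightarrow> f x \<in> QQ Q" "a \<in> B" "{#A a. A\<in>#As#} = f a" "size As = Q"
    and ap: "\<And>\<epsilon>. \<epsilon> > 0 \<Longrightarrow> \<exists>d>0. \<forall>x\<in>B. norm (x - a) < d \<longrightarrow> G2 (f x) {#A x. A\<in>#As#} \<le> \<epsilon> * norm (x - a)"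
    using s unfolding approx_affine_on_def by auto
  obtain x t where xt: "\<And>n. t n > 0" "t \<longlonglongrightarrow> 0" "\<And>n::nat. x n \<in> E \<inter> B" "(\<lambda>n. (x n - a) /\<^sub>R t n) \<longlonglongrightarrow> h"
    by (rule density_one_pick[of "\<lambda>_. E \<inter> B" a h]) (use E B density_one_Int in blast)+
  have xn: "x n - a = t n *\<^sub>R ((x n - a) /\<^sub>R t n)" for n using xt(1)[of n] by simp
  have "(\<lambda>n. t n *\<^sub>R ((x n - a) /\<^sub>R t n)) \<longlonglongrightarrow> 0 *\<^sub>R h" by (intro tendsto_intros xt)
  then have xa: "(\<lambda>n. x n - a) \<longlonglongrightarrow> 0" using xn by simp
  have nh: "(\<lambda>n. norm ((x n - a) /\<^sub>R t n)) \<longlonglongrightarrow> norm h" by (intro tendsto_intros xt)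
  have lim: "(\<lambda>n. G2 (f (x n)) {#A (x n). A\<in>#As#} / t n) \<longlonglongrightarrow> 0"
  proof (rule LIMSEQ_I)
    fix e :: real assume e: "e > 0"
    have hp: "norm h + 1 > 0" by (simp add: add_nonneg_pos)
    have "e / (2 * (norm h + 1)) > 0" using e hp by simp
    from ap[OF this] obtain d where d: "d > 0" "\<And>x. x \<in> B \<Longrightarrow> norm (x - a) < d \<Longrightarrow> G2 (f x) {#A x. A\<in>#As#} \<le> e / (2 * (norm h + 1)) * norm (x - a)"
      by blast
    have "\<forall>\<^sub>F n in sequentially. norm (x n - a) < d"
      using tendsto_norm_zero[OF xa] d(1) by (rule order_tendstoD)
    moreover have "\<forall>\<^sub>F n in sequentially. norm ((x n - a) /\<^sub>R t n) < norm h + 1"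
      by (rule order_tendstoD(2)[OF nh]) simp
    ultimately have "\<forall>\<^sub>F n in sequentially. norm (G2 (f (x n)) {#A (x n). A\<in>#As#} / t n - 0) < e"
    proof eventually_elim
      fix n assume n: "norm (x n - a) < d" "norm ((x n - a) /\<^sub>R t n) < norm h + 1"
      have "norm (G2 (f (x n)) {#A (x n). A\<in>#As#} / t n - 0) = G2 (f (x n)) {#A (x n). A\<in>#As#} / t n"
        using xt(1)[of n] by (simp add: G2_nonneg)
      also have "\<dots> \<le> e / (2 * (norm h + 1)) * norm (x n - a) / t n"
        using d(2)[of "x n"] xt(3)[of n] n(1) xt(1)[of n] by (intro divide_right_mono) auto
      also have "\<dots> = e / (2 * (norm h + 1)) * norm ((x n - a) /\<^sub>R t n)"
        using xt(1)[of n] by (simp add: divide_inverse mult_ac)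
      also have "\<dots> \<le> e / (2 * (norm h + 1)) * (norm h + 1)"
        using n(2) e hp by (intro mult_left_mono) auto
      also have "\<dots> = e / 2"
      proof -
        have "e / (2 * M) * M = e / 2" if "M > 0" for M :: real using that by simp
        then show ?thesis using hp by blast
      qed
      also have "\<dots> < e" using e by simp
      finally show "norm (G2 (f (x n)) {#A (x n). A\<in>#As#} / t n - 0) < e" .
    qed
    then show "\<exists>no. \<forall>n\<ge>no. norm (G2 (f (x n)) {#A (x n). A\<in>#As#} / t n - 0) < e" by (simp add: eventually_sequentially)
  qed
  have tri: "G2 (f (x n)) (f a) \<le> G2 {#A (x n). A\<in>#As#} {#A a. A\<in>#As#} + G2 (f (x n)) {#A (x n). A\<in>#As#}" for n
    using G2_triangle[of "f (x n)" Q "{#A (x n). A\<in>#As#}" "f a"] B xt(3)[of n] affine_QQ[OF B(6)] by (simp add: B(5))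
  show ?thesis by (rule that[OF xt tri lim])
qed

text \<open>The function \<open>u\<close> is known only on \<open>E\<close>, but its derivative is
  determined by a sequence in \<open>E\<close> with the right direction. Along it the triangle
  inequality bounds the increments of \<open>u\<close> by those of \<open>f\<close>, which grow like
  \<open>slope As h\<close> whatever \<open>w\<close> is.\<close>

lemma derivative_le_slope:
  fixes u :: "'a::euclidean_space \<Rightarrow> real"
  assumes s: "approx_affine_on Q B f a As" and u: "u differentiable (at a)"
    and E: "E \<in> sets borel" "density_one E a" "a \<in> E" and w: "w \<in> QQ Q"
    and uf: "\<And>x. x \<in> E \<Longrightarrow> u x = G2 (f x) w"
  shows "\<bar>frechet_derivative u (at a) h\<bar> \<le> slope As h"
proof -
  have B: "\<And>x. x \<in> B \<Longrightarrow> f x \<in> QQ Q" "a \<in> B" "\<forall>A\<in>#As. affine_fun A"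
    using s unfolding approx_affine_on_def by auto
  obtain x t where xt: "\<And>n. t n > 0" "t \<longlonglongrightarrow> 0" "\<And>n. x n \<in> E \<inter> B"
    "(\<lambda>n. (x n - a) /\<^sub>R t n) \<longlonglongrightarrow> h" "\<And>n. G2 (f (x n)) (f a) \<le> G2 {#A (x n). A\<in>#As#} {#A a. A\<in>#As#} + G2 (f (x n)) {#A (x n). A\<in>#As#}"
    "(\<lambda>n. G2 (f (x n)) {#A (x n). A\<in>#As#} / t n) \<longlonglongrightarrow> 0"
    by (rule approx_affine_on_sequence[OF s E(1,2), where h=h]) blast
  have "(\<lambda>n. (u (x n) - u a) /\<^sub>R t n) \<longlonglongrightarrow> frechet_derivative u (at a) h"
    by (rule has_derivative_sequence[OF frechet_derivative_works[THEN iffD1, OF u] xt(1,2) _ xt(4)]) simp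
  then have l1: "(\<lambda>n. \<bar>(u (x n) - u a) /\<^sub>R t n\<bar>) \<longlonglongrightarrow> \<bar>frechet_derivative u (at a) h\<bar>" by (rule tendsto_rabs)
  have l2: "(\<lambda>n. G2 {#A (x n). A\<in>#As#} {#A a. A\<in>#As#} / t n + G2 (f (x n)) {#A (x n). A\<in>#As#} / t n) \<longlonglongrightarrow> slope As h + 0"
    by (intro tendsto_add G2_affine_sequence xt B(3))
  have "\<bar>(u (x n) - u a) /\<^sub>R t n\<bar> \<le> G2 {#A (x n). A\<in>#As#} {#A a. A\<in>#As#} / t n + G2 (f (x n)) {#A (x n). A\<in>#As#} / t n" for n
  proof -
    have "\<bar>u (x n) - u a\<bar> \<le> G2 (f (x n)) (f a)"
      using G2_diff_le[of "f (x n)" Q "f a" w] B xt(3)[of n] uf E(3) w by auto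
    also note xt(5)
    finally have "\<bar>u (x n) - u a\<bar> / t n \<le> (G2 {#A (x n). A\<in>#As#} {#A a. A\<in>#As#} + G2 (f (x n)) {#A (x n). A\<in>#As#}) / t n"
      using xt(1)[of n] by (intro divide_right_mono) auto
    moreover have "\<bar>(u (x n) - u a) /\<^sub>R t n\<bar> = \<bar>u (x n) - u a\<bar> / t n"
      using xt(1)[of n] by (simp add: abs_mult divide_inverse mult.commute)
    ultimately show ?thesis by (simp only: add_divide_distrib)
  qed
  then show ?thesis using LIMSEQ_le[OF l1 l2] by simp
qed

section \<open>Measurability of maps into unordered tuples\<close>

lemma openin_QQ_borel:
  assumes "openin (mtopology_of (QQ_metric Q)) W"
  shows "W \<in> sets (QQ_borel Q)"
proof -
  have "{W. openin (mtopology_of (QQ_metric Q)) W} \<subseteq> Pow (QQ Q)"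
    by (auto dest!: openin_subset)
  then show ?thesis unfolding QQ_borel_def by (rule in_measure_of) (use assms in simp)
qed

lemma QQ_Lipschitz_preimage:
  fixes P :: "'b::real_inner multiset \<Rightarrow> 'c::real_inner multiset"
  assumes "\<And>M. M \<in> QQ Q \<Longrightarrow> P M \<in> QQ Q'" "\<And>M N. M \<in> QQ Q \<Longrightarrow> N \<in> QQ Q \<Longrightarrow> G2 (P M) (P N) \<le> c * G2 M N"
  shows "P \<in> measurable (QQ_borel Q) (QQ_borel Q')"
proof -
  have "Lipschitz_continuous_map (QQ_metric Q) (QQ_metric Q') P"
    unfolding Lipschitz_continuous_map_def using assms by auto
  then have cont: "continuous_map (mtopology_of (QQ_metric Q)) (mtopology_of (QQ_metric Q')) P"
    by (rule Lipschitz_continuous_imp_continuous_map)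
  show ?thesis
    unfolding QQ_borel_def[of Q']
  proof (rule measurable_measure_of)
    show "{W. openin (mtopology_of (QQ_metric Q')) W} \<subseteq> Pow (QQ Q' :: 'c multiset set)" by (auto dest!: openin_subset)
    fix W :: "'c multiset set" assume "W \<in> {W. openin (mtopology_of (QQ_metric Q')) W}"
    then have "openin (mtopology_of (QQ_metric Q)) {x \<in> topspace (mtopology_of (QQ_metric Q)). P x \<in> W}"
      using cont by (intro openin_continuous_map_preimage) auto
    moreover have "{x \<in> topspace (mtopology_of (QQ_metric Q)). P x \<in> W} = P -` W \<inter> space (QQ_borel Q)" by auto
    ultimately show "P -` W \<inter> space (QQ_borel Q) \<in> sets (QQ_borel Q)"
      by (simp add: openin_QQ_borel)
  qed (use assms in auto)
qed

lemma borel_measurable_G2: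
  assumes "w \<in> QQ Q"
  shows "(\<lambda>M. G2 M w) \<in> borel_measurable (QQ_borel Q)"
proof -
  have "Lipschitz_continuous_map (QQ_metric Q) euclidean_metric (\<lambda>M. G2 M w)"
    unfolding Lipschitz_continuous_map_def
    using assms G2_diff_le by (auto simp: dist_real_def intro!: exI[of _ 1])
  then have cont: "continuous_map (mtopology_of (QQ_metric Q)) euclidean (\<lambda>M. G2 M w)"
    using Lipschitz_continuous_imp_continuous_map by fastforce
  show ?thesis
  proof (rule borel_measurableI)
    fix S :: "real set" assume "open S"
    then have "openin (mtopology_of (QQ_metric Q)) {x \<in> topspace (mtopology_of (QQ_metric Q)). G2 x w \<in> S}"
      using cont by (intro openin_continuous_map_preimage) auto
    moreover have "{x \<in> topspace (mtopology_of (QQ_metric Q)). G2 x w \<in> S} = (\<lambda>M. G2 M w) -` S \<inter> space (QQ_borel Q)" by auto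
    ultimately show "(\<lambda>M. G2 M w) -` S \<inter> space (QQ_borel Q) \<in> sets (QQ_borel Q)"
      by (simp add: openin_QQ_borel)
  qed
qed

lemma borel_measurable_G2_pair:
  fixes g :: "'a::euclidean_space \<Rightarrow> 'b::real_inner multiset"
  assumes f: "f \<in> measurable (restrict_space borel U) (QQ_borel Q)" and U: "U \<in> sets borel"
    and g: "\<And>x. g x \<in> QQ Q" and cont: "\<And>x e. e > 0 \<Longrightarrow> \<exists>d>0. \<forall>y. dist y x < d \<longrightarrow> G2 (g y) (g x) < e"
  shows "(\<lambda>x. G2 (f x) (g x)) \<in> borel_measurable (restrict_space borel U)"
proof (rule borel_measurableI_greater)
  fix c :: real
  have fQ: "f x \<in> QQ Q" if "x \<in> U" for x
    using measurable_space[OF f] that by (simp add: space_restrict_space)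
  obtain D :: "'a set" where D: "countable D" "\<And>X. open X \<Longrightarrow> X \<noteq> {} \<Longrightarrow> \<exists>d\<in>D. d \<in> X"
    using countable_dense_exists by blast
  have fd: "(\<lambda>x. G2 (f x) (g d)) \<in> borel_measurable (restrict_space borel U)" for d
    using measurable_compose[OF f borel_measurable_G2[OF g]] .
  have "continuous_on UNIV (\<lambda>x. G2 (g x) (g d))" for d
    unfolding continuous_on_iff
  proof (intro ballI allI impI)
    fix x e assume "(0::real) < e"
    from cont[OF this, of x] obtain s where "s > 0" "\<And>y. dist y x < s \<Longrightarrow> G2 (g y) (g x) < e" by blast
    moreover have "dist (G2 (g y) (g d)) (G2 (g x) (g d)) \<le> G2 (g y) (g x)" for y
      unfolding dist_real_def by (rule G2_diff_le) (rule g)+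
    ultimately show "\<exists>s>0. \<forall>y\<in>UNIV. dist y x < s \<longrightarrow> dist (G2 (g y) (g d)) (G2 (g x) (g d)) < e"
      by (meson le_less_trans)
  qed
  then have gd: "(\<lambda>x. G2 (g x) (g d)) \<in> borel_measurable (restrict_space borel U)" for d
    by (intro measurable_restrict_space1 borel_measurable_continuous_onI)
  have "{x \<in> space (restrict_space borel U). c < G2 (f x) (g x)} =
    (\<Union>d\<in>D. {x \<in> space (restrict_space borel U). c < G2 (f x) (g d) - G2 (g x) (g d)})" (is "?l = ?r")
  proof
    show "?r \<subseteq> ?l"
    proof
      fix x assume "x \<in> ?r"
      then obtain d where x: "x \<in> U" "c < G2 (f x) (g d) - G2 (g x) (g d)" by (auto simp: space_restrict_space)
      have "G2 (f x) (g d) \<le> G2 (f x) (g x) + G2 (g x) (g d)"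
        by (rule G2_triangle[OF fQ g g]) (rule x)
      then show "x \<in> ?l" using x by (simp add: space_restrict_space)
    qed
    show "?l \<subseteq> ?r"
    proof
      fix x assume "x \<in> ?l"
      then have x: "x \<in> U" "c < G2 (f x) (g x)" by (auto simp: space_restrict_space)
      define e where "e = (G2 (f x) (g x) - c) / 2"
      have e: "e > 0" using x by (simp add: e_def)
      from cont[OF e, of x] obtain s where s: "s > 0" "\<And>y. dist y x < s \<Longrightarrow> G2 (g y) (g x) < e" by blast
      obtain d where d: "d \<in> D" "d \<in> ball x s" using D(2)[of "ball x s"] s(1) by auto
      have "G2 (g d) (g x) < e" using s(2)[of d] d(2) by (simp add: dist_commute)
      moreover have "G2 (f x) (g x) \<le> G2 (f x) (g d) + G2 (g d) (g x)"
        by (rule G2_triangle[OF fQ g g]) (rule x)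
      ultimately have "c < G2 (f x) (g d) - G2 (g x) (g d)"
        using G2_sym[of "g x" "g d"] by (simp add: e_def field_simps)
      then show "x \<in> ?r" using d x by (auto simp: space_restrict_space)
    qed
  qed
  also have "\<dots> \<in> sets (restrict_space borel U)"
    by (intro sets.countable_UN'' D(1) borel_measurable_less borel_measurable_diff fd gd) simp
  finally show "{x \<in> space (restrict_space borel U). c < G2 (f x) (g x)} \<in> sets (restrict_space borel U)" .
qed

lemma density_zero_if_density_one:
  fixes a :: "real^'m::finite"
  assumes B: "B \<in> sets borel" "density_one B a" and d: "d > 0" "S \<inter> ball a d \<inter> B = {}"
  shows "density_zero S a"
  unfolding density_zero_def
proof (rule tendstoI)
  define w where "w = unit_ball_vol (real DIM(real^'m))"
  fix e :: real assume e: "e > 0"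
  have w: "w > 0" unfolding w_def by (rule unit_ball_vol_pos_DIM)
  have "e / 2 * w > 0" using e w by simp
  then obtain s where s: "s > 0" "\<And>r. 0 < r \<Longrightarrow> r < s \<Longrightarrow> measure lborel (cball a r - B) \<le> e / 2 * w * r ^ DIM(real^'m)"
    using B(2) unfolding density_one_def by blast
  have "dist (measure lebesgue (S \<inter> cball a r) / measure lebesgue (cball a r)) 0 < e" if r: "0 < r" "r < min s d" for r
  proof -
    have sub: "S \<inter> cball a r \<subseteq> cball a r - B" using d(2) r by auto
    have "measure lebesgue (S \<inter> cball a r) \<le> measure lebesgue (cball a r - B)"
    \<comment> \<open>A nonmeasurable set has \<open>measure\<close> 0 by convention, so the
      estimate holds for it as well.\<close>
    proof (cases "S \<inter> cball a r \<in> sets lebesgue")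
      case True
      have "cball a r - B \<in> lmeasurable"
        by (rule fmeasurableI2[of "cball a r"]) (use B in auto)
      then show ?thesis using True sub by (intro measure_mono_fmeasurable) auto
    qed (simp add: measure_notin_sets)
    also have "\<dots> = measure lborel (cball a r - B)" using B by simp
    also have "\<dots> \<le> e / 2 * w * r ^ DIM(real^'m)" using r by (intro s(2)) auto
    finally have 1: "measure lebesgue (S \<inter> cball a r) \<le> e / 2 * (w * r ^ DIM(real^'m))" by simp
    have mc: "measure lebesgue (cball a r) = w * r ^ DIM(real^'m)" using content_cball[of r a] r by (simp add: w_def)
    have pos: "w * r ^ DIM(real^'m) > 0" using w r by simp
    have "measure lebesgue (S \<inter> cball a r) / measure lebesgue (cball a r) \<le> e / 2"
      unfolding mc using 1 pos by (simp only: pos_divide_le_eq)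
    moreover have "0 \<le> measure lebesgue (S \<inter> cball a r) / measure lebesgue (cball a r)" by simp
    ultimately have "\<bar>measure lebesgue (S \<inter> cball a r) / measure lebesgue (cball a r)\<bar> \<le> e / 2" by linarith
    also have "\<dots> < e" using e by simp
    finally show ?thesis by (simp only: dist_real_def diff_zero)
  qed
  then show "\<forall>\<^sub>F r in at_right 0. dist (measure lebesgue (S \<inter> cball a r) / measure lebesgue (cball a r)) 0 < e"
    unfolding eventually_at_right_field using s(1) d(1) by (intro exI[of _ "min s d"]) auto
qed

lemma density_one_if_density_zero:
  fixes a :: "real^'m::finite"
  assumes S: "S \<in> sets borel" "density_zero S a"
  shows "density_one (- S) a"
  unfolding density_one_def
proof (intro allI impI)
  define w where "w = unit_ball_vol (real DIM(real^'m))"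
  fix e :: real assume e: "e > 0"
  have w: "w > 0" unfolding w_def by (rule unit_ball_vol_pos_DIM)
  have "e / w > 0" using e w by simp
  then have "\<forall>\<^sub>F r in at_right 0. dist (measure lebesgue (S \<inter> cball a r) / measure lebesgue (cball a r)) 0 < e / w"
    using S(2) unfolding density_zero_def by (rule tendstoD[rotated])
  then obtain d where d: "d > 0" "\<And>r. 0 < r \<Longrightarrow> r < d \<Longrightarrow> dist (measure lebesgue (S \<inter> cball a r) / measure lebesgue (cball a r)) 0 < e / w"
    unfolding eventually_at_right_field by auto
  have "measure lborel (cball a r - - S) \<le> e * r ^ DIM(real^'m)" if r: "0 < r" "r < d" for r
  proof -
    have mc: "measure lebesgue (cball a r) = w * r ^ DIM(real^'m)" using content_cball[of r a] r by (simp add: w_def)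
    have pos: "w * r ^ DIM(real^'m) > 0" using w r by simp
    have "measure lebesgue (S \<inter> cball a r) / (w * r ^ DIM(real^'m)) \<le> e / w"
      using d(2)[OF r] unfolding mc dist_real_def diff_zero by (rule order_trans[OF abs_ge_self less_imp_le])
    then have "measure lebesgue (S \<inter> cball a r) \<le> e / w * (w * r ^ DIM(real^'m))"
      using pos by (simp only: pos_divide_le_eq)
    also have "\<dots> = e * r ^ DIM(real^'m)" using w by simp
    also have "measure lebesgue (S \<inter> cball a r) = measure lborel (cball a r - - S)"
      using S by (simp add: Diff_eq Int_commute)
    finally show ?thesis .
  qed
  then show "\<exists>d>0. \<forall>r. 0 < r \<and> r < d \<longrightarrow> measure lborel (cball a r - - S) \<le> e * r ^ DIM(real^'m)" using d(1) by blast
qed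

lemma approx_affine_if_on:
  assumes s: "approx_affine_on Q B f a As"
  shows "approx_affine Q U f a As"
  unfolding approx_affine_def
proof (intro conjI allI impI)
  show "size As = Q" "\<forall>A\<in>#As. affine_fun A" using s by (auto simp: approx_affine_on_def)
  fix \<epsilon> :: real assume "\<epsilon> > 0"
  then obtain d where d: "d > 0" "\<And>x. x \<in> B \<Longrightarrow> norm (x - a) < d \<Longrightarrow> G2 (f x) {#A x. A\<in>#As#} \<le> \<epsilon> * norm (x - a)"
    using s unfolding approx_affine_on_def by blast
  show "density_zero {x \<in> U. \<epsilon> * norm (x - a) < G2 (f x) {#A x. A\<in>#As#}} a"
  proof (rule density_zero_if_density_one[OF _ _ d(1)])
    show "B \<in> sets borel" "density_one B a" using s by (auto simp: approx_affine_on_def)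
    show "{x \<in> U. \<epsilon> * norm (x - a) < G2 (f x) {#A x. A\<in>#As#}} \<inter> ball a d \<inter> B = {}"
      using d(2) by (force simp: dist_norm norm_minus_commute)
  qed
qed

text \<open>On \<open>G Cs n\<close> the tuple \<open>Cs\<close> is accurate to
  \<open>1 / Suc n\<close>; this set is Borel and has density one at \<open>a\<close>. Points common
  to the sets of \<open>As\<close> and \<open>Bs\<close>, of accuracy improving along the sequence,
  show that the tuples agree at \<open>a\<close> and grow at the same rate in direction
  \<open>h\<close>. Slopes are all that \<open>Dnorm\<close> depends on.\<close>

lemma approx_affine_slope_unique:
  fixes f :: "real^'m::finite \<Rightarrow> 'b::real_inner multiset"
  assumes f: "f \<in> measurable (restrict_space borel U) (QQ_borel Q)" and U: "open U" "a \<in> U"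
    and As: "approx_affine Q U f a As" and Bs: "approx_affine Q U f a Bs"
  shows "slope As h = slope Bs h"
proof -
  have fQ: "f x \<in> QQ Q" if "x \<in> U" for x
    using measurable_space[OF f] that by (simp add: space_restrict_space)
  have Um: "U \<in> sets borel" using U by simp
  define G where "G Cs n = {x\<in>U. G2 (f x) {#A x. A\<in>#Cs#} \<le> 1 / real (Suc n) * norm (x - a)}" for Cs n
  have G: "G Cs n \<in> sets borel \<and> density_one (G Cs n) a" if Cs: "approx_affine Q U f a Cs" for Cs n
  proof -
    have sz: "size Cs = Q" and aff: "\<forall>A\<in>#Cs. affine_fun A" using Cs by (auto simp: approx_affine_def)
    have m: "(\<lambda>x. G2 (f x) {#A x. A\<in>#Cs#}) \<in> borel_measurable (restrict_space borel U)"
    proof (rule borel_measurable_G2_pair[OF f Um])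
      show "{#A x. A\<in>#Cs#} \<in> QQ Q" for x using sz by (rule affine_QQ)
      fix x and e :: real assume "e > 0"
      have "isCont (slope Cs) 0" using continuous_slope[OF aff] by (simp add: continuous_on_eq_continuous_at)
      moreover have "slope Cs 0 = 0" by (simp add: slope_def)
      ultimately obtain d where d: "d > 0" "\<And>y. dist y 0 < d \<Longrightarrow> dist (slope Cs y) 0 < e"
        using \<open>e > 0\<close> unfolding continuous_at_eps_delta by metis
      have "G2 {#A y. A\<in>#Cs#} {#A x. A\<in>#Cs#} < e" if "dist y x < d" for y
        using G2_affine(1)[OF aff, of y x] d(2)[of "y - x"] that by (simp add: dist_norm)
      then show "\<exists>d>0. \<forall>y. dist y x < d \<longrightarrow> G2 {#A y. A\<in>#Cs#} {#A x. A\<in>#Cs#} < e" using d(1) by blast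
    qed
    define S where "S = {x\<in>U. G2 (f x) {#A x. A\<in>#Cs#} > 1 / real (Suc n) * norm (x - a)}"
    have "{x\<in>space (restrict_space borel U). 1 / real (Suc n) * norm (x - a) < G2 (f x) {#A x. A\<in>#Cs#}} \<in> sets (restrict_space borel U)"
      by (intro borel_measurable_less m measurable_restrict_space1) measurable
    then have S: "S \<in> sets borel"
      using Um by (simp add: S_def space_restrict_space sets_restrict_space_iff)
    have "1 / real (Suc n) > 0" by simp
    then have "density_zero S a" using Cs unfolding approx_affine_def S_def by blast
    then have "density_one (- S) a" by (rule density_one_if_density_zero[OF S])
    moreover have "density_one U a" by (rule density_one_interior[OF U(2,1)])
    moreover have "G Cs n = - S \<inter> U" by (auto simp: G_def S_def not_less)
    ultimately show ?thesis using density_one_Int[of "- S" U a] S Um by auto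
  qed
  have sz: "size As = Q" "size Bs = Q" and aff: "\<forall>A\<in>#As. affine_fun A" "\<forall>A\<in>#Bs. affine_fun A"
    using As Bs by (auto simp: approx_affine_def)
  obtain x t where xt: "\<And>n. t n > 0" "t \<longlonglongrightarrow> 0" "\<And>n. x n \<in> G As n \<inter> G Bs n" "(\<lambda>n. (x n - a) /\<^sub>R t n) \<longlonglongrightarrow> h"
    by (rule density_one_pick[of "\<lambda>n. G As n \<inter> G Bs n" a h]) (use G[OF As] G[OF Bs] density_one_Int in blast)+
  have xn: "x n - a = t n *\<^sub>R ((x n - a) /\<^sub>R t n)" for n using xt(1)[of n] by simp
  have "(\<lambda>n. t n *\<^sub>R ((x n - a) /\<^sub>R t n)) \<longlonglongrightarrow> 0 *\<^sub>R h" by (intro tendsto_intros xt)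
  then have xa: "(\<lambda>n. x n - a) \<longlonglongrightarrow> 0" using xn by simp
  have z: "(\<lambda>n. 1 / real (Suc n)) \<longlonglongrightarrow> 0" by (rule lim_1_over_n[THEN LIMSEQ_Suc])
  let ?A = "\<lambda>x. {#A x. A\<in>#As#}" and ?B = "\<lambda>x. {#A x. A\<in>#Bs#}"
  have near: "G2 (?A (x n)) (?B (x n)) \<le> 2 * (1 / real (Suc n)) * norm (x n - a)" for n
  proof -
    have "x n \<in> U" using xt(3)[of n] by (simp add: G_def)
    then have "G2 (?A (x n)) (?B (x n)) \<le> G2 (?A (x n)) (f (x n)) + G2 (f (x n)) (?B (x n))"
      by (intro G2_triangle[of _ Q] affine_QQ sz fQ)
    also have "\<dots> \<le> 1 / real (Suc n) * norm (x n - a) + 1 / real (Suc n) * norm (x n - a)"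
      using xt(3)[of n] by (intro add_mono) (auto simp: G_def G2_sym)
    finally show ?thesis by simp
  qed
  have "(\<lambda>n. slope Cs (x n - a)) \<longlonglongrightarrow> slope Cs 0" if "\<forall>A\<in>#Cs. affine_fun A" for Cs :: "(real^'m \<Rightarrow> 'b) multiset"
    by (rule continuous_on_tendsto_compose[OF continuous_slope[OF that] xa]) auto
  then have sl0: "(\<lambda>n. slope Cs (x n - a)) \<longlonglongrightarrow> 0" if "\<forall>A\<in>#Cs. affine_fun A" for Cs :: "(real^'m \<Rightarrow> 'b) multiset"
    using that by (simp add: slope_def[of _ 0])
  \<comment> \<open>The values at \<open>a\<close> have to be identified first:
    \<open>approx_affine\<close> is a density condition and says nothing about the single point
    \<open>a\<close>.\<close>
  have "G2 (?A a) (?B a) \<le> 0"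
  proof (rule LIMSEQ_le_const)
    have "(\<lambda>n. slope As (x n - a) + 2 * (1 / real (Suc n)) * norm (x n - a) + slope Bs (x n - a)) \<longlonglongrightarrow> 0 + 2 * 0 * norm (0::real^'m) + 0"
      by (intro tendsto_intros sl0 aff z xa)
    then show "(\<lambda>n. slope As (x n - a) + 2 * (1 / real (Suc n)) * norm (x n - a) + slope Bs (x n - a)) \<longlonglongrightarrow> 0" by simp
    have "G2 (?A a) (?B a) \<le> slope As (x n - a) + 2 * (1 / real (Suc n)) * norm (x n - a) + slope Bs (x n - a)" for n
    proof -
      have "G2 (?A a) (?B a) \<le> G2 (?A a) (?A (x n)) + G2 (?A (x n)) (?B a)"
        by (intro G2_triangle[of _ Q] affine_QQ sz)
      also have "G2 (?A (x n)) (?B a) \<le> G2 (?A (x n)) (?B (x n)) + G2 (?B (x n)) (?B a)"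
        by (intro G2_triangle[of _ Q] affine_QQ sz)
      finally show ?thesis
        using near[of n] G2_affine(1)[OF aff(1), of "x n" a] G2_affine(1)[OF aff(2), of "x n" a] G2_sym[of "?A a" "?A (x n)"] by linarith
    qed
    then show "\<exists>N. \<forall>n\<ge>N. G2 (?A a) (?B a) \<le> slope As (x n - a) + 2 * (1 / real (Suc n)) * norm (x n - a) + slope Bs (x n - a)" by blast
  qed
  then have eqa: "?A a = ?B a"
    using G2_nonneg[of "?A a" "?B a"] affine_QQ[OF sz(1)] affine_QQ[OF sz(2)] by (intro G2_eq_0[of _ Q]) auto
  have lA: "(\<lambda>n. G2 (?A (x n)) (?A a) / t n) \<longlonglongrightarrow> slope As h" by (rule G2_affine_sequence[OF aff(1) xt(1,2,4)])
  have lB: "(\<lambda>n. G2 (?B (x n)) (?B a) / t n) \<longlonglongrightarrow> slope Bs h" by (rule G2_affine_sequence[OF aff(2) xt(1,2,4)])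
  have l0: "(\<lambda>n. G2 (?A (x n)) (?A a) / t n - G2 (?B (x n)) (?B a) / t n) \<longlonglongrightarrow> 0"
  proof (rule Lim_null_comparison)
    have "(\<lambda>n. 2 * (1 / real (Suc n)) * norm ((x n - a) /\<^sub>R t n)) \<longlonglongrightarrow> 2 * 0 * norm h"
      by (intro tendsto_intros z xt)
    then show "(\<lambda>n. 2 * (1 / real (Suc n)) * norm ((x n - a) /\<^sub>R t n)) \<longlonglongrightarrow> 0" by simp
    have "norm (G2 (?A (x n)) (?A a) / t n - G2 (?B (x n)) (?B a) / t n) \<le> 2 * (1 / real (Suc n)) * norm ((x n - a) /\<^sub>R t n)" for n
    proof -
      have "\<bar>G2 (?A (x n)) (?A a) - G2 (?B (x n)) (?B a)\<bar> \<le> G2 (?A (x n)) (?B (x n))"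
        unfolding eqa by (intro G2_diff_le[of _ Q] affine_QQ sz)
      also note near
      finally have "\<bar>G2 (?A (x n)) (?A a) - G2 (?B (x n)) (?B a)\<bar> / t n \<le> 2 * (1 / real (Suc n)) * norm (x n - a) / t n"
        using xt(1)[of n] by (intro divide_right_mono) auto
      moreover have "norm (G2 (?A (x n)) (?A a) / t n - G2 (?B (x n)) (?B a) / t n) = \<bar>G2 (?A (x n)) (?A a) - G2 (?B (x n)) (?B a)\<bar> / t n"
        using xt(1)[of n] by (simp add: diff_divide_distrib[symmetric])
      moreover have "2 * (1 / real (Suc n)) * norm (x n - a) / t n = 2 * (1 / real (Suc n)) * norm ((x n - a) /\<^sub>R t n)"
        using xt(1)[of n] by (simp add: divide_inverse mult_ac)
      ultimately show ?thesis by (simp only:)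
    qed
    then show "\<forall>\<^sub>F n in sequentially. norm (G2 (?A (x n)) (?A a) / t n - G2 (?B (x n)) (?B a) / t n) \<le> 2 * (1 / real (Suc n)) * norm ((x n - a) /\<^sub>R t n)"
      by simp
  qed
  show ?thesis using LIMSEQ_unique[OF tendsto_diff[OF lA lB] l0] by simp
qed

text \<open>The tuple chosen inside \<open>Dnorm\<close> may differ from \<open>As\<close>.
  Exchanging the sums over the tuple and over the directions expresses the value through slopes,
  which do not depend on the choice.\<close>

lemma Dnorm_eq:
  fixes f :: "real^'m::finite \<Rightarrow> 'b::real_inner multiset"
  assumes f: "f \<in> measurable (restrict_space borel U) (QQ_borel Q)" and U: "open U" "a \<in> U"
    and As: "approx_affine Q U f a As"
  shows "Dnorm Q U f a = sqrt (\<Sum>j\<in>UNIV. (slope As (axis j 1))\<^sup>2)"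
proof -
  define Bs where "Bs = (SOME As. approx_affine Q U f a As)"
  have Bs: "approx_affine Q U f a Bs" unfolding Bs_def by (rule someI[of _ As]) (rule As)
  have "approx_differentiable Q U f a" using As by (auto simp: approx_differentiable_def)
  then have "Dnorm Q U f a = sqrt (\<Sum>A\<in>#Bs. (hs_norm (\<lambda>x. A x - A 0))\<^sup>2)"
    by (simp add: Dnorm_def Bs_def)
  also have "(\<Sum>A\<in>#Bs. (hs_norm (\<lambda>x. A x - A 0))\<^sup>2) = (\<Sum>A\<in>#Bs. \<Sum>j\<in>UNIV. (norm (A (axis j 1) - A 0))\<^sup>2)"
    by (intro arg_cong[where f=sum_mset] image_mset_cong) (simp add: hs_norm_def sum_nonneg)
  also have "\<dots> = (\<Sum>j\<in>UNIV. \<Sum>A\<in>#Bs. (norm (A (axis j 1) - A 0))\<^sup>2)"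
    by (induction Bs) (simp_all add: sum.distrib)
  also have "\<dots> = (\<Sum>j\<in>UNIV. (slope Bs (axis j 1))\<^sup>2)"
  proof -
    have "0 \<le> (\<Sum>A\<in>#Bs. (norm (A h - A 0))\<^sup>2)" for h
      by (induction Bs) auto
    then show ?thesis by (simp add: slope_def)
  qed
  finally show ?thesis using approx_affine_slope_unique[OF f U As Bs] by simp
qed

section \<open>Projections to finitely many coordinates\<close>

lemma coord_ell2_proj: "coord (ell2_proj n y) k = (if k < n then coord y k else 0)"
proof -
  have cb: "coord (ell2_basis i) k = (if k = i then 1 else 0)" for i k by transfer auto
  have ib: "y \<bullet> ell2_basis i = coord y i" for i
  proof -
    have "y \<bullet> ell2_basis i = (\<Sum>k. if k = i then coord y k else 0)"
      unfolding inner_ell2_def by (simp add: cb if_distrib cong: if_cong)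
    also have "\<dots> = coord y i" using sums_single[of i "coord y"] by (simp add: sums_iff)
    finally show ?thesis .
  qed
  have "coord (\<Sum>i\<in>I. g i) k = (\<Sum>i\<in>I. coord (g i) k)" if "finite I" for I :: "nat set" and g
    using that by (induction I) (simp_all add: zero_ell2.rep_eq plus_ell2.rep_eq)
  then show ?thesis
    by (simp add: ell2_proj_def ib scaleR_ell2.rep_eq cb if_distrib cong: if_cong)
qed

lemma ell2_proj_diff: "ell2_proj n x - ell2_proj n y = ell2_proj n (x - y)"
  by (rule ell2_eqI) (simp add: coord_ell2_proj minus_ell2.rep_eq)

lemma linear_ell2_proj: "linear (ell2_proj n)"
  by (rule linearI; rule ell2_eqI) (simp_all add: coord_ell2_proj plus_ell2.rep_eq scaleR_ell2.rep_eq)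

lemma norm_ell2_proj_sq: "(norm (ell2_proj n y))\<^sup>2 = (\<Sum>k<n. (coord y k)\<^sup>2)"
  unfolding norm_ell2_sq
  by (subst suminf_finite[of "{..<n}"]) (auto simp: coord_ell2_proj)

lemma norm_ell2_proj_le: "norm (ell2_proj n y) \<le> norm y"
  by (rule power2_le_imp_le) (simp_all add: norm_ell2_proj_sq sum_coord_sq_le)

lemma norm_ell2_proj_LIMSEQ: "(\<lambda>n. (norm (ell2_proj n y))\<^sup>2) \<longlonglongrightarrow> (norm y)\<^sup>2"
proof -
  have "(\<lambda>n. \<Sum>k<n. (coord y k)\<^sup>2) \<longlonglongrightarrow> (\<Sum>k. (coord y k)\<^sup>2)"
    by (rule summable_LIMSEQ[OF summable_coord_sq])
  then show ?thesis by (simp add: norm_ell2_proj_sq norm_ell2_sq[of y])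
qed

lemma G2_image_proj_le: "size M = size N \<Longrightarrow> G2 (image_mset (ell2_proj n) M) (image_mset (ell2_proj n) N) \<le> G2 M N"
proof -
  assume sz: "size M = size N"
  obtain xs ys where *: "mset xs = M" "mset ys = N" "G2 M N = sqrt (\<Sum>(x, y)\<leftarrow>zip xs ys. (norm (x - y))\<^sup>2)"
    by (rule G2_attained)
  have len: "length xs = length ys" using * sz by auto
  have "G2 (mset (map (ell2_proj n) xs)) (mset (map (ell2_proj n) ys)) \<le>
      sqrt (\<Sum>i<length xs. (norm (map (ell2_proj n) xs ! i - map (ell2_proj n) ys ! i))\<^sup>2)"
    using G2_lists_le[of "map (ell2_proj n) xs" "map (ell2_proj n) ys"] len by simp
  also have "\<dots> \<le> sqrt (\<Sum>i<length xs. (norm (xs ! i - ys ! i))\<^sup>2)"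
    using len by (intro real_sqrt_le_mono sum_mono power_mono) (auto simp: ell2_proj_diff norm_ell2_proj_le)
  finally show ?thesis using * len by (simp add: sum_list_zip_norm)
qed

text \<open>The projections do not increase \<open>G2\<close>, so the projected tuple approximates
  the projected map; its slopes converge to those of \<open>As\<close>. Hence
  \<open>delta_norm\<close> and \<open>Dnorm\<close> agree wherever \<open>f\<close> has such an
  approximation.\<close>

lemma delta_norm_eq:
  fixes f :: "real^'m::finite \<Rightarrow> ell2 multiset"
  assumes f: "f \<in> measurable (restrict_space borel U) (QQ_borel Q)" and U: "open U" "a \<in> U"
    and s: "approx_affine_on Q B f a As"
  shows "delta_norm Q U f a = sqrt (\<Sum>j\<in>UNIV. (slope As (axis j 1))\<^sup>2)"
proof -
  define An where "An n = image_mset (\<lambda>A x. ell2_proj n (A x)) As" for n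
  have sn: "approx_affine_on Q B (\<lambda>y. image_mset (ell2_proj n) (f y)) a (An n)" for n
    unfolding approx_affine_on_def
  proof (intro conjI allI impI ballI)
    have comp: "{#A x. A\<in>#An n#} = image_mset (ell2_proj n) {#A x. A\<in>#As#}" for x
      by (simp add: An_def image_mset.compositionality o_def)
    show "size (An n) = Q" using s by (simp add: An_def approx_affine_on_def)
    show "{#A a. A\<in>#An n#} = image_mset (ell2_proj n) (f a)"
      unfolding comp using s by (simp add: approx_affine_on_def)
    fix A assume "A \<in># An n"
    then obtain A' where A': "A' \<in># As" "A = (\<lambda>x. ell2_proj n (A' x))" by (auto simp: An_def)
    have "linear (\<lambda>x. A' x - A' 0)" using s A' by (auto simp: approx_affine_on_def affine_fun_def)
    from linear_compose[OF this linear_ell2_proj[of n]] show "affine_fun A"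
      by (simp add: affine_fun_def A' ell2_proj_diff o_def)
  next
    fix \<epsilon> :: real assume "\<epsilon> > 0"
    then obtain d where d: "d > 0" "\<And>x. x \<in> B \<Longrightarrow> norm (x - a) < d \<Longrightarrow> G2 (f x) {#A x. A\<in>#As#} \<le> \<epsilon> * norm (x - a)"
      using s unfolding approx_affine_on_def by blast
    have "G2 (image_mset (ell2_proj n) (f x)) {#A x. A\<in>#An n#} \<le> \<epsilon> * norm (x - a)" if "x \<in> B" "norm (x - a) < d" for x
    proof -
      have "size (f x) = size {#A x. A\<in>#As#}" using s that by (auto simp: approx_affine_on_def QQ_def)
      from G2_image_proj_le[OF this, of n] d(2)[OF that] show ?thesis
        by (simp add: An_def image_mset.compositionality o_def)
    qed
    then show "\<exists>d>0. \<forall>x\<in>B. norm (x - a) < d \<longrightarrow> G2 (image_mset (ell2_proj n) (f x)) {#A x. A\<in>#An n#} \<le> \<epsilon> * norm (x - a)"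
      using d(1) by blast
  qed (use s in \<open>auto simp: approx_affine_on_def QQ_def\<close>)
  have fn: "(\<lambda>y. image_mset (ell2_proj n) (f y)) \<in> measurable (restrict_space borel U) (QQ_borel Q)" for n
    by (rule measurable_compose[OF f QQ_Lipschitz_preimage[where c=1]]) (auto simp: QQ_def G2_image_proj_le)
  have Dn: "Dnorm Q U (\<lambda>y. image_mset (ell2_proj n) (f y)) a = sqrt (\<Sum>j\<in>UNIV. (slope (An n) (axis j 1))\<^sup>2)" for n
    by (rule Dnorm_eq[OF fn U approx_affine_if_on[OF sn]])
  have nn: "0 \<le> (\<Sum>A\<in>#Cs. (norm (A h - A 0))\<^sup>2)" for Cs :: "(real^'m \<Rightarrow> ell2) multiset" and h
    by (induction Cs) auto
  have "(\<lambda>n. (slope (An n) h)\<^sup>2) \<longlonglongrightarrow> (slope As h)\<^sup>2" for h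
  proof -
    have "(\<lambda>n. \<Sum>A\<in>#Cs. (norm (ell2_proj n (A h - A 0)))\<^sup>2) \<longlonglongrightarrow> (\<Sum>A\<in>#Cs. (norm (A h - A 0))\<^sup>2)"
      for Cs :: "(real^'m \<Rightarrow> ell2) multiset"
      by (induction Cs) (auto intro!: tendsto_add norm_ell2_proj_LIMSEQ)
    moreover have "(slope (An n) h)\<^sup>2 = (\<Sum>A\<in>#As. (norm (ell2_proj n (A h - A 0)))\<^sup>2)" for n
      using nn[where Cs="An n"] by (simp add: slope_def An_def image_mset.compositionality o_def ell2_proj_diff)
    moreover have "(slope As h)\<^sup>2 = (\<Sum>A\<in>#As. (norm (A h - A 0))\<^sup>2)"
      using nn[where Cs=As] by (simp add: slope_def)
    ultimately show ?thesis by (simp only:)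
  qed
  then have "(\<lambda>n. sqrt (\<Sum>j\<in>UNIV. (slope (An n) (axis j 1))\<^sup>2)) \<longlonglongrightarrow> sqrt (\<Sum>j\<in>UNIV. (slope As (axis j 1))\<^sup>2)"
    by (intro tendsto_real_sqrt tendsto_sum)
  then show ?thesis unfolding delta_norm_def Dn by (rule limI)
qed

lemma sum_Basis_vec:
  fixes g :: "real^'m::finite \<Rightarrow> real"
  shows "(\<Sum>b\<in>Basis. g b) = (\<Sum>j\<in>UNIV. g (axis j 1))"
proof -
  have "(Basis :: (real^'m) set) = range (\<lambda>j. axis j 1)" by (auto simp: Basis_vec_def)
  moreover have "inj (\<lambda>j::'m. axis j (1::real))" by (auto simp: inj_def axis_eq_axis)
  ultimately show ?thesis using sum.reindex[of "\<lambda>j::'m. axis j (1::real)" UNIV g] by simp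
qed

section \<open>Upper gradients\<close>

text \<open>The Riesz potential of an integrable function is integrable over the bounded set
  \<open>V\<close>, hence finite at almost every \<open>x\<close>. It dominates the integral over
  \<open>y\<close> of the segment integrals with weight \<open>norm (y - x)\<close>, and this weight
  vanishes only at \<open>y = x\<close>.\<close>

lemma AE_finite_segment_integral:
  fixes G :: "'a::euclidean_space \<Rightarrow> ennreal"
  assumes G[measurable]: "G \<in> borel_measurable borel" and V[measurable]: "V \<in> sets borel"
    and cV: "convex V" and bV: "bounded V" and fin: "(\<integral>\<^sup>+z\<in>V. G z \<partial>lborel) < \<infinity>"
  shows "AE x in lborel. x \<in> V \<longrightarrow> (AE y in lborel. y \<in> V \<longrightarrow> (\<integral>\<^sup>+t\<in>{0..1}. G (x + t *\<^sub>R (y - x)) \<partial>lborel) < \<infinity>)"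
proof -
  let ?m = "DIM('a)"
  define R where "R x = (\<integral>\<^sup>+z\<in>V. (G z * ennreal (1 / norm (z - x) ^ (?m - 1))) \<partial>lborel)" for x
  have Rm[measurable]: "R \<in> borel_measurable borel" unfolding R_def[abs_def] by measurable
  have fV: "emeasure lborel V < \<infinity>" using emeasure_bounded_finite[OF bV] .
  define c where "c = riesz_const ?m * measure lborel V powr (1 / real ?m)"
  have "(\<integral>\<^sup>+x\<in>V. R x \<partial>lborel) = (\<integral>\<^sup>+x. (\<integral>\<^sup>+z. G z * indicator V z * (ennreal (1 / norm (z - x) ^ (?m - 1)) * indicator V x) \<partial>lborel) \<partial>lborel)"
    unfolding R_def by (intro nn_integral_cong, subst nn_integral_multc[symmetric]) (auto simp: mult_ac)
  also have "\<dots> = (\<integral>\<^sup>+z. (\<integral>\<^sup>+x. G z * indicator V z * (ennreal (1 / norm (z - x) ^ (?m - 1)) * indicator V x) \<partial>lborel) \<partial>lborel)"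
    by (rule lborel_pair.Fubini') measurable
  also have "\<dots> = (\<integral>\<^sup>+z. G z * indicator V z * (\<integral>\<^sup>+x\<in>V. ennreal (1 / norm (x - z) ^ (?m - 1)) \<partial>lborel) \<partial>lborel)"
    by (intro nn_integral_cong, subst nn_integral_cmult) (auto simp: norm_minus_commute)
  also have "\<dots> \<le> (\<integral>\<^sup>+z. G z * indicator V z * ennreal c \<partial>lborel)"
    unfolding c_def by (intro nn_integral_mono mult_left_mono riesz_measure_bound V fV) auto
  also have "\<dots> = (\<integral>\<^sup>+z\<in>V. G z \<partial>lborel) * ennreal c" by (rule nn_integral_multc) measurable
  also have "\<dots> < \<infinity>" using fin by (simp add: ennreal_mult_less_top)
  finally have "(\<integral>\<^sup>+x\<in>V. R x \<partial>lborel) \<noteq> \<infinity>" by simp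
  then have "AE x in lborel. R x * indicator V x \<noteq> \<infinity>" by (intro nn_integral_PInf_AE) auto
  then show ?thesis
  proof (eventually_elim, intro impI)
    fix x assume Rx: "R x * indicator V x \<noteq> \<infinity>" and xV: "x \<in> V"
    obtain D where D: "\<And>y. y \<in> V \<Longrightarrow> norm (y - x) \<le> D"
      using bV unfolding bounded_any_center[of V x] by (auto simp: dist_norm norm_minus_commute)
    have "(\<integral>\<^sup>+y\<in>V. (ennreal (norm (y - x) powr 1) * (\<integral>\<^sup>+t\<in>{0..1}. G (x + t *\<^sub>R (y - x)) \<partial>lborel)) \<partial>lborel)
      \<le> ennreal (D powr (1 + real ?m - 1)) * R x"
      unfolding R_def by (rule segment_potential_bound[OF G V cV xV D]) auto
    also have "\<dots> < \<infinity>" using Rx xV by (simp add: ennreal_mult_less_top top.not_eq_extremum)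
    finally have "AE y in lborel. ennreal (norm (y - x) powr 1) * (\<integral>\<^sup>+t\<in>{0..1}. G (x + t *\<^sub>R (y - x)) \<partial>lborel) * indicator V y \<noteq> \<infinity>"
      by (intro nn_integral_PInf_AE) auto
    moreover have "AE y in lborel. y \<noteq> x" by (rule AE_lborel_singleton)
    ultimately show "AE y in lborel. y \<in> V \<longrightarrow> (\<integral>\<^sup>+t\<in>{0..1}. G (x + t *\<^sub>R (y - x)) \<partial>lborel) < \<infinity>"
      by eventually_elim (auto simp: ennreal_mult_eq_top_iff top.not_eq_extremum[symmetric])
  qed
qed

lemma ennreal_suminf_tendsto_0:
  fixes a :: "nat \<Rightarrow> ennreal"
  assumes "(\<Sum>n. a n) < \<infinity>"
  shows "a \<longlonglongrightarrow> 0"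
proof -
  have fin: "a n \<noteq> \<infinity>" for n
  proof
    assume "a n = \<infinity>"
    moreover have "sum a {n} \<le> (\<Sum>n. a n)" by (rule sum_le_suminf) auto
    ultimately show False using assms by simp
  qed
  then have eq: "a n = ennreal (enn2real (a n))" for n by (simp add: less_top)
  have "summable (\<lambda>n. enn2real (a n))"
    by (rule summable_suminf_not_top) (use assms eq in auto)
  then have "(\<lambda>n. enn2real (a n)) \<longlonglongrightarrow> 0" by (rule summable_LIMSEQ_zero)
  then have "(\<lambda>n. ennreal (enn2real (a n))) \<longlonglongrightarrow> ennreal 0" by (rule tendsto_ennrealI)
  then show ?thesis using eq by simp
qed

text \<open>Built from \<open>basis_deriv\<close>, and so defined everywhere and Borel for Lipschitz
  \<open>u\<close>.\<close>

definition grad_norm :: "('a::euclidean_space \<Rightarrow> real) \<Rightarrow> 'a \<Rightarrow> real" where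
  "grad_norm u z = sqrt (\<Sum>b\<in>Basis. (basis_deriv u b z)\<^sup>2)"

lemma grad_norm_nonneg: "0 \<le> grad_norm u z"
  by (simp add: grad_norm_def sum_nonneg)

lemma frechet_le_grad_norm:
  assumes "u differentiable (at z)"
  shows "\<bar>frechet_derivative u (at z) h\<bar> \<le> grad_norm u z * norm h"
proof -
  have "(frechet_derivative u (at z) h)\<^sup>2 \<le> (grad_norm u z * norm h)\<^sup>2"
    using frechet_le_basis_deriv[OF assms, of h] by (simp add: grad_norm_def power_mult_distrib sum_nonneg)
  then have "\<bar>frechet_derivative u (at z) h\<bar> \<le> \<bar>grad_norm u z * norm h\<bar>" by (simp only: abs_le_square_iff)
  then show ?thesis by (simp add: grad_norm_nonneg)
qed

text \<open>The gradient of an extension is controlled by \<open>f\<close> on \<open>A n\<close> and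
  by \<open>K n\<close> off it. The error terms have summable integrals, so along almost every
  segment they tend to 0 and a bound by \<open>\<psi>\<close> remains, the same for all
  \<open>w\<close>. Letting \<open>w\<close> approach \<open>x\<close> recovers
  \<open>G2 (f x) (f y)\<close>.\<close>

theorem upper_gradient_le_Dnorm:
  fixes f :: "real^'m::finite \<Rightarrow> ell2 multiset"
  assumes f: "f \<in> measurable (restrict_space borel U) (QQ_borel Q)" and U: "open U" "V \<subseteq> U"
    and V: "open V" "convex V" "bounded V"
    and A[measurable]: "\<And>n. A n \<in> sets borel" and AV: "\<And>n. A n \<subseteq> V" and K: "\<And>n. K n \<ge> 0"
    and lip: "\<And>n x y. x \<in> A n \<Longrightarrow> y \<in> A n \<Longrightarrow> G2 (f x) (f y) \<le> K n * dist x y"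
    and ev: "AE x in lborel. x \<in> V \<longrightarrow> (\<forall>\<^sub>F n in sequentially. x \<in> A n)"
    and summ: "summable (\<lambda>n. K n * measure lborel (V - A n))"
  obtains \<psi> :: "real^'m \<Rightarrow> real" where "\<psi> \<in> borel_measurable borel" "\<And>z. 0 \<le> \<psi> z"
    "AE z in lborel. z \<in> V \<longrightarrow> \<psi> z \<le> Dnorm Q U f z \<and> delta_norm Q U f z = Dnorm Q U f z"
    "AE x in lborel. x \<in> V \<longrightarrow> (AE y in lborel. y \<in> V \<longrightarrow>
      ennreal (G2 (f x) (f y)) \<le> ennreal (norm (y - x)) * (\<integral>\<^sup>+t\<in>{0..1}. ennreal (\<psi> (x + t *\<^sub>R (y - x))) \<partial>lborel))"
proof -
  have fQ: "f x \<in> QQ Q" if "x \<in> V" for x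
    using measurable_space[OF f, of x] that U(2) by (auto simp: space_restrict_space)
  have fA: "f x \<in> QQ Q" if "x \<in> A n" for x n using fQ AV that by blast
  have Vm[measurable]: "V \<in> sets borel" using V(1) by simp
  have "\<exists>D. countable D \<and> D \<subseteq> A n \<and> A n \<subseteq> closure D" for n
  proof -
    obtain T where "countable T" "T \<subseteq> A n" "A n \<subseteq> closure T" by (rule separable[of "A n"])
    then show ?thesis by blast
  qed
  then obtain D where D: "\<And>n. countable (D n)" "\<And>n. D n \<subseteq> A n" "\<And>n. A n \<subseteq> closure (D n)" by metis
  \<comment> \<open>Each \<open>A n\<close> is approached by points of \<open>A n\<close> itself:
    there \<open>f\<close> is Lipschitz, so that \<open>f w\<close> tends to
    \<open>f x\<close>.\<close>
  define W where "W = (\<Union>n. D n)"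
  have W: "countable W" "W \<subseteq> V" unfolding W_def using D(1,2) AV by (simp, blast)
  have ex: "\<exists>g. w \<in> W \<longrightarrow> (K n)-lipschitz_on UNIV g \<and> (\<forall>x\<in>A n. g x = G2 (f x) (f w))" for n w
  proof (cases "w \<in> W")
    case True
    have "(K n)-lipschitz_on (A n) (\<lambda>x. G2 (f x) (f w))"
    proof (rule lipschitz_onI[OF _ K])
      fix x y assume xy: "x \<in> A n" "y \<in> A n"
      have "\<bar>G2 (f x) (f w) - G2 (f y) (f w)\<bar> \<le> G2 (f x) (f y)"
        using xy True W(2) by (intro G2_diff_le[of _ Q] fA fQ) auto
      also have "\<dots> \<le> K n * dist x y" by (rule lip[OF xy])
      finally show "dist (G2 (f x) (f w)) (G2 (f y) (f w)) \<le> K n * dist x y" by (simp add: dist_real_def)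
    qed
    then obtain g where "(K n)-lipschitz_on UNIV g" "\<And>x. x \<in> A n \<Longrightarrow> g x = G2 (f x) (f w)"
      by (rule lipschitz_extension_real) blast
    then show ?thesis by blast
  qed blast
  define u where "u n w = (SOME g. w \<in> W \<longrightarrow> (K n)-lipschitz_on UNIV g \<and> (\<forall>x\<in>A n. g x = G2 (f x) (f w)))" for n w
  have u: "w \<in> W \<longrightarrow> (K n)-lipschitz_on UNIV (u n w) \<and> (\<forall>x\<in>A n. u n w x = G2 (f x) (f w))" for n w
    unfolding u_def by (rule someI_ex[OF ex])
  have ul: "(K n)-lipschitz_on UNIV (u n w)" if "w \<in> W" for n w using u that by blast
  have uf: "u n w x = G2 (f x) (f w)" if "w \<in> W" "x \<in> A n" for n w x using u that by blast
  \<comment> \<open>One function serves all \<open>n\<close> and \<open>w\<close>. Each gradient is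
    used on \<open>A n\<close> only, since elsewhere the extension carries no information on
    \<open>f\<close>.\<close>
  define \<psi>e where "\<psi>e z = (SUP n. SUP w\<in>W. ennreal (grad_norm (u n w) z) * indicator (A n) z)" for z
  have gm: "(\<lambda>z. ennreal (grad_norm (u n w) z) * indicator (A n) z) \<in> borel_measurable borel" if "w \<in> W" for n w
  proof -
    note [measurable] = basis_deriv_measurable[OF ul[OF that, of n]]
    show ?thesis unfolding grad_norm_def by measurable
  qed
  have pem[measurable]: "\<psi>e \<in> borel_measurable borel"
    unfolding \<psi>e_def[abs_def] by (intro borel_measurable_SUP W(1) gm countableI_type)
  define \<psi> where "\<psi> z = enn2real (\<psi>e z)" for z
  have pm[measurable]: "\<psi> \<in> borel_measurable borel" unfolding \<psi>_def[abs_def] by measurable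
  have p0: "0 \<le> \<psi> z" for z by (simp add: \<psi>_def)
  have dens: "AE z in lborel. \<forall>n. z \<in> A n \<longrightarrow> density_one (A n) z"
    by (subst AE_all_countable) (intro allI density_one_AE A)
  have app: "AE z in lborel. \<forall>n. z \<in> A n \<longrightarrow> (\<exists>B As. B \<subseteq> A n \<and> approx_affine_on Q B f z As)"
  proof (subst AE_all_countable, rule allI)
    fix n
    show "AE z in lborel. z \<in> A n \<longrightarrow> (\<exists>B As. B \<subseteq> A n \<and> approx_affine_on Q B f z As)"
      by (rule rademacher_QQ[OF A fA lip[of _ n] K[of n]])
  qed
  have diff: "AE z in lborel. \<forall>n. \<forall>w\<in>W. u n w differentiable (at z)"
  proof (subst AE_all_countable, intro allI, rule AE_ball_countable[THEN iffD2, OF W(1)], intro ballI)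
    fix n w assume w: "w \<in> W"
    show "AE z in lborel. u n w differentiable (at z)" by (rule rademacher[OF ul[OF w]])
  qed
  have good: "AE z in lborel. z \<in> V \<longrightarrow> \<psi>e z \<le> ennreal (Dnorm Q U f z) \<and> delta_norm Q U f z = Dnorm Q U f z"
    using dens app diff ev
  proof (eventually_elim, intro impI)
    fix z assume dn: "\<forall>n. z \<in> A n \<longrightarrow> density_one (A n) z"
      and ap: "\<forall>n. z \<in> A n \<longrightarrow> (\<exists>B As. B \<subseteq> A n \<and> approx_affine_on Q B f z As)"
      and df: "\<forall>n. \<forall>w\<in>W. u n w differentiable (at z)"
      and e: "z \<in> V \<longrightarrow> (\<forall>\<^sub>F n in sequentially. z \<in> A n)" and z: "z \<in> V"
    have zU: "z \<in> U" using z U by blast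
    have Dn: "Dnorm Q U f z = sqrt (\<Sum>j\<in>UNIV. (slope As (axis j 1))\<^sup>2)" "delta_norm Q U f z = Dnorm Q U f z"
      if "approx_affine_on Q B f z As" for As B
      using Dnorm_eq[OF f U(1) zU approx_affine_if_on[OF that]] delta_norm_eq[OF f U(1) zU that] by auto
    have "ennreal (grad_norm (u n w) z) * indicator (A n) z \<le> ennreal (Dnorm Q U f z)" if w: "w \<in> W" for n w
    proof (cases "z \<in> A n")
      case True
      then obtain B As where B: "B \<subseteq> A n" "approx_affine_on Q B f z As" using ap by blast
      have ud: "u n w differentiable (at z)" using df w by blast
      have "\<bar>basis_deriv (u n w) b z\<bar> \<le> slope As b" for b
        unfolding basis_deriv_eq[OF ud]
        by (rule derivative_le_slope[OF B(2) ud A[of n], where w="f w"]) (use True dn w W fQ uf in auto)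
      then have "(basis_deriv (u n w) b z)\<^sup>2 \<le> (slope As b)\<^sup>2" for b
        by (metis abs_ge_zero power2_abs power_mono)
      then have "grad_norm (u n w) z \<le> sqrt (\<Sum>b\<in>Basis. (slope As b)\<^sup>2)"
        unfolding grad_norm_def by (intro real_sqrt_le_mono sum_mono)
      also have "\<dots> = Dnorm Q U f z" unfolding Dn(1)[OF B(2)] by (simp add: sum_Basis_vec)
      finally show ?thesis using True by (simp add: ennreal_leI)
    qed simp
    then have "\<psi>e z \<le> ennreal (Dnorm Q U f z)" unfolding \<psi>e_def by (intro SUP_least) auto
    moreover obtain n where "z \<in> A n" using e z by (metis eventually_happens' sequentially_bot)
    then have "delta_norm Q U f z = Dnorm Q U f z" using ap Dn(2) by blast
    ultimately show "\<psi>e z \<le> ennreal (Dnorm Q U f z) \<and> delta_norm Q U f z = Dnorm Q U f z" by blast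
  qed
  have Dn0: "0 \<le> Dnorm Q U f z" for z
  proof -
    have "0 \<le> (\<Sum>A\<in>#As. (hs_norm (\<lambda>x. A x - A 0))\<^sup>2)" for As :: "(real^'m \<Rightarrow> ell2) multiset"
      by (induction As) auto
    then show ?thesis by (simp add: Dnorm_def)
  qed
  have res1: "AE z in lborel. z \<in> V \<longrightarrow> \<psi> z \<le> Dnorm Q U f z \<and> delta_norm Q U f z = Dnorm Q U f z"
    using good by eventually_elim (auto simp: \<psi>_def Dn0 intro: enn2real_leI)
  \<comment> \<open>The supremum could be infinite. It is finite almost everywhere on
    \<open>V\<close>, being bounded by the real number \<open>Dnorm\<close>, and so the passage to
    real values loses nothing there.\<close>
  have fin: "AE z in lborel. z \<in> V \<longrightarrow> ennreal (\<psi> z) = \<psi>e z"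
    using good
  proof (eventually_elim, intro impI)
    fix z assume "z \<in> V \<longrightarrow> \<psi>e z \<le> ennreal (Dnorm Q U f z) \<and> delta_norm Q U f z = Dnorm Q U f z" "z \<in> V"
    then have "\<psi>e z < top" using ennreal_less_top le_less_trans by blast
    then show "ennreal (\<psi> z) = \<psi>e z" by (simp add: \<psi>_def)
  qed
  define g where "g n z = ennreal (\<psi> z) + ennreal (K n) * indicator (V - A n) z" for n z
  have gmm[measurable]: "g n \<in> borel_measurable borel" for n unfolding g_def[abs_def] by measurable
  have gb: "AE z in lborel. z \<in> V \<longrightarrow> (\<forall>h. ennreal \<bar>frechet_derivative (u n w) (at z) h\<bar> \<le> g n z * ennreal (norm h))"
    if w: "w \<in> W" for n w
    using diff fin
  proof (eventually_elim, intro impI allI)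
    fix z h assume df: "\<forall>n. \<forall>w\<in>W. u n w differentiable (at z)" and fz: "z \<in> V \<longrightarrow> ennreal (\<psi> z) = \<psi>e z" and z: "z \<in> V"
    have ud: "u n w differentiable (at z)" using df w by blast
    show "ennreal \<bar>frechet_derivative (u n w) (at z) h\<bar> \<le> g n z * ennreal (norm h)"
    proof (cases "z \<in> A n")
      case True
      have "ennreal \<bar>frechet_derivative (u n w) (at z) h\<bar> \<le> ennreal (grad_norm (u n w) z) * ennreal (norm h)"
        using ennreal_leI[OF frechet_le_grad_norm[OF ud, of h]] by (simp add: ennreal_mult grad_norm_nonneg)
      also have "ennreal (grad_norm (u n w) z) \<le> \<psi>e z"
      proof -
        have "ennreal (grad_norm (u n w) z) * indicator (A n) z \<le> \<psi>e z"
          unfolding \<psi>e_def by (intro SUP_upper2[of n] SUP_upper2[of w] w order_refl UNIV_I)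
        then show ?thesis using True by simp
      qed
      then have "ennreal (grad_norm (u n w) z) * ennreal (norm h) \<le> \<psi>e z * ennreal (norm h)" by (rule mult_right_mono) simp
      also have "\<psi>e z = g n z" using True z fz by (simp add: g_def)
      finally show ?thesis .
    next
      case False
      have "\<bar>frechet_derivative (u n w) (at z) h\<bar> \<le> K n * norm h"
        by (rule lipschitz_derivative_le[OF ul[OF w] frechet_derivative_works[THEN iffD1, OF ud]])
      then have "ennreal \<bar>frechet_derivative (u n w) (at z) h\<bar> \<le> ennreal (K n) * ennreal (norm h)"
        by (simp add: ennreal_mult[symmetric] K ennreal_leI)
      also have "\<dots> \<le> g n z * ennreal (norm h)"
        using False z by (intro mult_right_mono) (auto simp: g_def)
      finally show ?thesis .
    qed
  qed
  \<comment> \<open>Finiteness of the segment integral of this sum forces the contributions of the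
    single terms to tend to 0.\<close>
  define H where "H z = (\<Sum>n. ennreal (K n) * indicator (V - A n) z)" for z
  have Hm[measurable]: "H \<in> borel_measurable borel" unfolding H_def[abs_def] by measurable
  have fV: "emeasure lborel V < \<infinity>" using emeasure_bounded_finite[OF V(3)] .
  have "(\<integral>\<^sup>+z\<in>V. H z \<partial>lborel) \<le> (\<integral>\<^sup>+z. H z \<partial>lborel)"
    by (intro nn_integral_mono) (auto simp: indicator_def)
  also have "\<dots> = (\<Sum>n. (\<integral>\<^sup>+z. ennreal (K n) * indicator (V - A n) z \<partial>lborel))"
    unfolding H_def by (rule nn_integral_suminf) measurable
  also have "\<dots> = (\<Sum>n. ennreal (K n * measure lborel (V - A n)))"
  proof (rule suminf_cong)
    fix n
    have "emeasure lborel (V - A n) \<le> emeasure lborel V" by (rule emeasure_mono) auto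
    then have "emeasure lborel (V - A n) \<noteq> top" using fV by (auto simp: top_unique)
    then have em: "emeasure lborel (V - A n) = ennreal (measure lborel (V - A n))"
      by (rule emeasure_eq_ennreal_measure)
    have "(\<integral>\<^sup>+z. ennreal (K n) * indicator (V - A n) z \<partial>lborel) = ennreal (K n) * emeasure lborel (V - A n)"
      by (rule nn_integral_cmult_indicator) simp
    then show "(\<integral>\<^sup>+z. ennreal (K n) * indicator (V - A n) z \<partial>lborel) = ennreal (K n * measure lborel (V - A n))"
      by (simp only: em ennreal_mult[OF K measure_nonneg])
  qed
  also have "\<dots> = ennreal (\<Sum>n. K n * measure lborel (V - A n))"
    by (rule suminf_ennreal2[OF _ summ]) (simp add: K)
  also have "\<dots> < \<infinity>" by simp
  finally have Hfin: "(\<integral>\<^sup>+z\<in>V. H z \<partial>lborel) < \<infinity>" .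
  have res2: "AE x in lborel. x \<in> V \<longrightarrow> (AE y in lborel. y \<in> V \<longrightarrow>
      ennreal (G2 (f x) (f y)) \<le> ennreal (norm (y - x)) * (\<integral>\<^sup>+t\<in>{0..1}. ennreal (\<psi> (x + t *\<^sub>R (y - x))) \<partial>lborel))"
    using ev AE_finite_segment_integral[OF Hm Vm V(2,3) Hfin]
  proof (eventually_elim, intro impI)
    fix x assume ex: "x \<in> V \<longrightarrow> (\<forall>\<^sub>F n in sequentially. x \<in> A n)"
      and Hx: "x \<in> V \<longrightarrow> (AE y in lborel. y \<in> V \<longrightarrow> (\<integral>\<^sup>+t\<in>{0..1}. H (x + t *\<^sub>R (y - x)) \<partial>lborel) < \<infinity>)"
      and x: "x \<in> V"
    have seg: "AE y in lborel. \<forall>n. \<forall>w\<in>W. y \<in> V \<longrightarrow> ennreal \<bar>u n w y - u n w x\<bar> \<le>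
        ennreal (norm (y - x)) * (\<integral>\<^sup>+t\<in>{0..1}. g n (x + t *\<^sub>R (y - x)) \<partial>lborel)"
    proof (subst AE_all_countable, intro allI, rule AE_ball_countable[THEN iffD2, OF W(1)], intro ballI)
      fix n w assume w: "w \<in> W"
      show "AE y in lborel. y \<in> V \<longrightarrow> ennreal \<bar>u n w y - u n w x\<bar> \<le>
        ennreal (norm (y - x)) * (\<integral>\<^sup>+t\<in>{0..1}. g n (x + t *\<^sub>R (y - x)) \<partial>lborel)"
        by (rule lipschitz_segment_bound[OF ul[OF w] gmm V(2) x gb[OF w]])
    qed
    have Hx': "AE y in lborel. y \<in> V \<longrightarrow> (\<integral>\<^sup>+t\<in>{0..1}. H (x + t *\<^sub>R (y - x)) \<partial>lborel) < \<infinity>"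
      using Hx x by blast
    from seg ev Hx' show "AE y in lborel. y \<in> V \<longrightarrow>
      ennreal (G2 (f x) (f y)) \<le> ennreal (norm (y - x)) * (\<integral>\<^sup>+t\<in>{0..1}. ennreal (\<psi> (x + t *\<^sub>R (y - x))) \<partial>lborel)"
    proof (eventually_elim, intro impI)
      fix y assume sy: "\<forall>n. \<forall>w\<in>W. y \<in> V \<longrightarrow> ennreal \<bar>u n w y - u n w x\<bar> \<le>
          ennreal (norm (y - x)) * (\<integral>\<^sup>+t\<in>{0..1}. g n (x + t *\<^sub>R (y - x)) \<partial>lborel)"
        and ey: "y \<in> V \<longrightarrow> (\<forall>\<^sub>F n in sequentially. y \<in> A n)"
        and Hy: "y \<in> V \<longrightarrow> (\<integral>\<^sup>+t\<in>{0..1}. H (x + t *\<^sub>R (y - x)) \<partial>lborel) < \<infinity>" and y: "y \<in> V"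
      define I where "I = (\<integral>\<^sup>+t\<in>{0..1}. ennreal (\<psi> (x + t *\<^sub>R (y - x))) \<partial>lborel)"
      define a where "a n = (\<integral>\<^sup>+t. ennreal (K n) * indicator (V - A n) (x + t *\<^sub>R (y - x)) * indicator {0..1} t \<partial>lborel)" for n
      have "(\<Sum>n. a n) = (\<integral>\<^sup>+t. (\<Sum>n. ennreal (K n) * indicator (V - A n) (x + t *\<^sub>R (y - x)) * indicator {0..1} t) \<partial>lborel)"
        unfolding a_def by (rule nn_integral_suminf[symmetric]) measurable
      also have "\<dots> = (\<integral>\<^sup>+t\<in>{0..1}. H (x + t *\<^sub>R (y - x)) \<partial>lborel)"
        unfolding H_def by (intro nn_integral_cong) (simp add: indicator_def)
      finally have "(\<Sum>n. a n) < \<infinity>" using Hy y by simp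
      then have a0: "a \<longlonglongrightarrow> 0" by (rule ennreal_suminf_tendsto_0)
      have gI: "(\<integral>\<^sup>+t\<in>{0..1}. g n (x + t *\<^sub>R (y - x)) \<partial>lborel) = I + a n" for n
        unfolding I_def a_def g_def by (subst nn_integral_add[symmetric]) (auto simp: distrib_right)
      have key: "ennreal \<bar>G2 (f y) (f w) - G2 (f x) (f w)\<bar> \<le> ennreal (norm (y - x)) * I" if w: "w \<in> W" for w
      proof (rule tendsto_lowerbound)
        have "(\<lambda>n. I + a n) \<longlonglongrightarrow> I + 0" by (intro tendsto_add tendsto_const a0)
        then show "(\<lambda>n. ennreal (norm (y - x)) * (I + a n)) \<longlonglongrightarrow> ennreal (norm (y - x)) * I"
          by (intro ennreal_tendsto_cmult) auto
        have "\<forall>\<^sub>F n in sequentially. x \<in> A n" "\<forall>\<^sub>F n in sequentially. y \<in> A n" using ex ey x y by auto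
        then show "\<forall>\<^sub>F n in sequentially. ennreal \<bar>G2 (f y) (f w) - G2 (f x) (f w)\<bar> \<le> ennreal (norm (y - x)) * (I + a n)"
        proof eventually_elim
          fix n assume "x \<in> A n" "y \<in> A n"
          then show "ennreal \<bar>G2 (f y) (f w) - G2 (f x) (f w)\<bar> \<le> ennreal (norm (y - x)) * (I + a n)"
            using sy[rule_format, OF w y, of n] gI[of n] uf[OF w] by simp
        qed
      qed simp
      \<comment> \<open>The point \<open>w\<close> is taken in the same \<open>A n\<close> as
        \<open>x\<close>, within a distance that makes twice \<open>G2 (f x) (f w)\<close> at most
        \<open>e\<close>; the factor 2 accounts for the triangle inequality and for the change of
        the test function at \<open>x\<close>.\<close>
      show "ennreal (G2 (f x) (f y)) \<le> ennreal (norm (y - x)) * (\<integral>\<^sup>+t\<in>{0..1}. ennreal (\<psi> (x + t *\<^sub>R (y - x))) \<partial>lborel)"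
        unfolding I_def[symmetric]
      proof (rule ennreal_le_epsilon)
        fix e :: real assume e: "0 < e"
        obtain n where n: "x \<in> A n" using ex x by (metis eventually_happens' sequentially_bot)
        define d where "d = e / (2 * (K n + 1))"
        have d: "d > 0" "2 * (K n * d) \<le> e"
        proof -
          show "d > 0" using e K[of n] by (simp add: d_def)
          have "2 * (K n * d) \<le> 2 * ((K n + 1) * d)" using \<open>d > 0\<close> by (intro mult_left_mono mult_right_mono) auto
          also have "\<dots> = e"
          proof -
            have "2 * (M * (e / (2 * M))) = e" if "M > 0" for M :: real using that by simp
            note * = this
            show ?thesis unfolding d_def by (rule *) (use K[of n] in simp)
          qed
          finally show "2 * (K n * d) \<le> e" .
        qed
        have "x \<in> closure (D n)" using n D(3) by blast
        then obtain w where w: "w \<in> D n" "dist w x < d" using d(1) by (auto simp: closure_approachable)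
        have wW: "w \<in> W" "w \<in> A n" "w \<in> V" using w(1) D(2) AV W by (auto simp: W_def)
        have "G2 (f x) (f w) \<le> K n * dist x w" by (rule lip[OF n wW(2)])
        also have "\<dots> \<le> K n * d" using w(2) K[of n] by (intro mult_left_mono) (auto simp: dist_commute)
        finally have xw: "2 * G2 (f x) (f w) \<le> e" using d(2) by linarith
        have "G2 (f x) (f y) \<le> G2 (f x) (f w) + G2 (f w) (f y)"
          by (intro G2_triangle[of _ Q] fQ x y wW)
        then have "G2 (f x) (f y) \<le> \<bar>G2 (f y) (f w) - G2 (f x) (f w)\<bar> + e"
          using xw G2_sym[of "f w" "f y"] by linarith
        then have "ennreal (G2 (f x) (f y)) \<le> ennreal (\<bar>G2 (f y) (f w) - G2 (f x) (f w)\<bar> + e)" by (rule ennreal_leI)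
        also have "\<dots> = ennreal \<bar>G2 (f y) (f w) - G2 (f x) (f w)\<bar> + ennreal e" using e by (simp add: ennreal_plus)
        also have "\<dots> \<le> ennreal (norm (y - x)) * I + ennreal e" by (intro add_right_mono key wW)
        finally show "ennreal (G2 (f x) (f y)) \<le> ennreal (norm (y - x)) * I + ennreal e" .
      qed
    qed
  qed
  show ?thesis by (rule that[OF pm p0 res1 res2])
qed

section \<open>Convergence of convex combinations\<close>

text \<open>Iterated midpoints of a tail in place of all its convex combinations: closure under
  midpoints is what the minimising argument uses, and bounds pass to the hull by induction without
  weights.\<close>

inductive_set mid_hull :: "(nat \<Rightarrow> 'a \<Rightarrow> real) \<Rightarrow> nat \<Rightarrow> ('a \<Rightarrow> real) set" for \<psi> n where
  base: "n \<le> j \<Longrightarrow> \<psi> j \<in> mid_hull \<psi> n"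
| mid: "g \<in> mid_hull \<psi> n \<Longrightarrow> h \<in> mid_hull \<psi> n \<Longrightarrow> (\<lambda>x. (g x + h x) / 2) \<in> mid_hull \<psi> n"

lemma mid_hull_antimono: "g \<in> mid_hull \<psi> n \<Longrightarrow> m \<le> n \<Longrightarrow> g \<in> mid_hull \<psi> m"
  by (induction rule: mid_hull.induct) (auto intro: mid_hull.intros)

lemma mid_hull_measurable:
  "g \<in> mid_hull \<psi> n \<Longrightarrow> (\<And>j. \<psi> j \<in> borel_measurable M) \<Longrightarrow> g \<in> borel_measurable M"
  by (induction rule: mid_hull.induct) auto

lemma mid_hull_nonneg:
  "g \<in> mid_hull \<psi> n \<Longrightarrow> (\<And>j x. 0 \<le> \<psi> j x) \<Longrightarrow> 0 \<le> g x"
  by (induction rule: mid_hull.induct) auto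

lemma ennreal_lincomb:
  assumes "0 \<le> a" "0 \<le> b" "0 \<le> c" "0 \<le> d"
  shows "ennreal (c * a + d * b) = ennreal c * ennreal a + ennreal d * ennreal b"
proof -
  have "ennreal (c * a + d * b) = ennreal (c * a) + ennreal (d * b)"
    by (rule ennreal_plus) (use assms in auto)
  also have "ennreal (c * a) = ennreal c * ennreal a" by (rule ennreal_mult) (use assms in auto)
  also have "ennreal (d * b) = ennreal d * ennreal b" by (rule ennreal_mult) (use assms in auto)
  finally show ?thesis .
qed

lemma powr_midpoint_le:
  fixes a b p :: real
  assumes "0 \<le> a" "0 \<le> b" "1 \<le> p"
  shows "((a + b) / 2) powr p \<le> (a powr p + b powr p) / 2"
proof -
  have half: "(b / 2) powr p \<le> b powr p / 2" if "0 \<le> b" for b :: real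
  proof -
    have "(2::real) powr 1 \<le> 2 powr p" using assms(3) by (intro powr_mono) auto
    then have "b powr p / 2 powr p \<le> b powr p / 2" by (intro divide_left_mono) auto
    then show ?thesis using that by (simp add: powr_divide)
  qed
  show ?thesis
  \<comment> \<open>The convexity of \<open>powr\<close> is applied to positive arguments; if one
    argument is 0, the inequality reduces to \<open>2 powr p \<ge> 2\<close>.\<close>
  proof (cases "a = 0 \<or> b = 0")
    case True
    then show ?thesis using half[of a] half[of b] assms by auto
  next
    case False
    from convex_onD[OF powr_convex[OF assms(3)], of "1/2" a b] False assms show ?thesis
      by (simp add: add_divide_distrib)
  qed
qed

lemma mid_hull_powr_integral:
  assumes "g \<in> mid_hull \<psi> n" and [measurable]: "\<And>j. \<psi> j \<in> borel_measurable M" and nn: "\<And>j x. 0 \<le> \<psi> j x"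
    and p: "1 \<le> p" and C: "\<And>j. (\<integral>\<^sup>+x. ennreal (\<psi> j x powr p) \<partial>M) \<le> C"
  shows "(\<integral>\<^sup>+x. ennreal (g x powr p) \<partial>M) \<le> C"
  using assms(1)
proof (induction rule: mid_hull.induct)
  case (base j)
  then show ?case using C by simp
next
  case (mid g h)
  have [measurable]: "g \<in> borel_measurable M" "h \<in> borel_measurable M"
    using mid_hull_measurable mid(1,2) assms(2) by blast+
  have "(\<integral>\<^sup>+x. ennreal (((g x + h x) / 2) powr p) \<partial>M) \<le> (\<integral>\<^sup>+x. ennreal (1 / 2) * ennreal (g x powr p) + ennreal (1 / 2) * ennreal (h x powr p) \<partial>M)"
  proof (rule nn_integral_mono)
    fix x
    have "ennreal (((g x + h x) / 2) powr p) \<le> ennreal (1 / 2 * g x powr p + 1 / 2 * h x powr p)"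
      using powr_midpoint_le[OF mid_hull_nonneg[OF mid(1) nn] mid_hull_nonneg[OF mid(2) nn] p, of x x]
      by (intro ennreal_leI) simp
    also have "\<dots> = ennreal (1 / 2) * ennreal (g x powr p) + ennreal (1 / 2) * ennreal (h x powr p)"
      by (rule ennreal_lincomb) auto
    finally show "ennreal (((g x + h x) / 2) powr p) \<le> ennreal (1 / 2) * ennreal (g x powr p) + ennreal (1 / 2) * ennreal (h x powr p)" .
  qed
  also have "\<dots> = ennreal (1 / 2) * (\<integral>\<^sup>+x. ennreal (g x powr p) \<partial>M) + ennreal (1 / 2) * (\<integral>\<^sup>+x. ennreal (h x powr p) \<partial>M)"
    by (simp add: nn_integral_add nn_integral_cmult)
  also have "\<dots> \<le> ennreal (1 / 2) * C + ennreal (1 / 2) * C"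
    by (intro add_mono mult_left_mono mid.IH) auto
  also have "\<dots> = (ennreal (1 / 2) + ennreal (1 / 2)) * C" by (simp add: distrib_right)
  also have "ennreal (1 / 2) + ennreal (1 / 2) = 1" by (subst ennreal_plus[symmetric]) auto
  finally show ?case by simp
qed

text \<open>The functional minimised over the tails of the hull is \<open>g \<mapsto> \<integral> exp (-g)\<close>; its strict convexity
  makes almost minimal elements a Cauchy sequence, through
  \<open>exp (-a) + exp (-b) - 2 exp (-(a + b) / 2) = (exp (-a/2) - exp (-b/2))\<^sup>2\<close>.\<close>

lemma mid_hull_AE_convergent:
  fixes \<psi> :: "nat \<Rightarrow> 'a \<Rightarrow> real"
  assumes M: "finite_measure M" and m: "\<And>j. \<psi> j \<in> borel_measurable M" and nn: "\<And>j x. 0 \<le> \<psi> j x"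
    and C: "\<And>j. (\<integral>\<^sup>+x. ennreal (\<psi> j x) \<partial>M) \<le> C" "C < \<infinity>"
  obtains H where "\<And>k. H k \<in> mid_hull \<psi> k" "AE x in M. convergent (\<lambda>k. H k x)"
proof -
  interpret finite_measure M by fact
  let ?T = "measure M (space M)"
  define E :: "('a \<Rightarrow> real) \<Rightarrow> real" where "E g = (\<integral>x. exp (- g x) \<partial>M)" for g
  have hm: "g \<in> borel_measurable M" if "g \<in> mid_hull \<psi> n" for g n
    using mid_hull_measurable[OF that m] .
  have hn: "0 \<le> g x" if "g \<in> mid_hull \<psi> n" for g n x using mid_hull_nonneg[OF that nn] .
  have int: "integrable M (\<lambda>x. exp (- (g x)))" if "g \<in> borel_measurable M" "\<And>x. 0 \<le> g x" for g :: "'a \<Rightarrow> real"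
  proof (rule integrable_const_bound[where B=1])
    show "AE x in M. norm (exp (- g x)) \<le> 1" using that(2) by simp
    show "(\<lambda>x. exp (- g x)) \<in> borel_measurable M" using that(1) by measurable
  qed
  have E0: "0 \<le> E g" for g unfolding E_def by (rule integral_nonneg_AE) simp
  have ET: "E g \<le> ?T" if "g \<in> mid_hull \<psi> n" for g n
  proof -
    have "E g \<le> (\<integral>x. 1 \<partial>M)"
      unfolding E_def by (intro integral_mono int hm[OF that] hn[OF that]) (use hn[OF that] in auto)
    then show ?thesis by simp
  qed
  \<comment> \<open>The hulls of the tails decrease, so their infima increase to a limit
    \<open>L\<close>. The midpoint of two almost minimal elements lies in the larger of their two
    hulls and cannot fall below its infimum.\<close>
  define I where "I n = Inf (E ` mid_hull \<psi> n)" for n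
  have ne: "E ` mid_hull \<psi> n \<noteq> {}" for n using mid_hull.base[of n n \<psi>] by blast
  have bdd: "bdd_below (E ` mid_hull \<psi> n)" for n using E0 by (intro bdd_belowI2[of _ 0])
  have Ile: "I n \<le> E g" if "g \<in> mid_hull \<psi> n" for n g
    unfolding I_def by (rule cInf_lower) (use that bdd in auto)
  have Iinc: "incseq I"
    unfolding incseq_def
  proof (intro allI impI)
    fix a b :: nat assume "a \<le> b"
    show "I a \<le> I b" unfolding I_def[of b]
      by (rule cInf_greatest[OF ne]) (use Ile mid_hull_antimono \<open>a \<le> b\<close> in blast)
  qed
  have IT: "I n \<le> ?T" for n using Ile[OF mid_hull.base[OF order_refl]] ET[OF mid_hull.base[OF order_refl]] by (rule order_trans)
  obtain L where L: "I \<longlonglongrightarrow> L" "\<And>n. I n \<le> L"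
    using incseq_convergent[OF Iinc] IT by blast
  have "\<exists>g\<in>mid_hull \<psi> n. E g < I n + (1 / 16) ^ n" for n
  proof -
    have "Inf (E ` mid_hull \<psi> n) < I n + (1 / 16) ^ n" by (simp add: I_def)
    then show ?thesis using cInf_lessD[OF ne] by blast
  qed
  then obtain h where h: "\<And>n. h n \<in> mid_hull \<psi> n" "\<And>n. E (h n) < I n + (1 / 16) ^ n" by metis
  \<comment> \<open>The square root of the integrand \<open>exp (- h n x)\<close>: the convexity
    defect of the functional is the squared distance of these functions in the space of square
    integrable functions.\<close>
  define v where "v n x = exp (- (h n x / 2))" for n x
  have vm[measurable]: "v n \<in> borel_measurable M" for n unfolding v_def[abs_def] using hm[OF h(1)] by measurable
  have v01: "0 \<le> v n x" "v n x \<le> 1" for n x using hn[OF h(1), of n x] by (auto simp: v_def)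
  have sq: "(\<integral>x. (v n x - v k x)\<^sup>2 \<partial>M) \<le> (L - I n) + (1 / 16) ^ n + (1 / 16) ^ k" if "n \<le> k" for n k
  proof -
    have hk: "h k \<in> mid_hull \<psi> n" using h(1) that mid_hull_antimono by blast
    have md: "(\<lambda>x. (h n x + h k x) / 2) \<in> mid_hull \<psi> n" using h(1) hk by (rule mid_hull.mid)
    have "(v n x - v k x)\<^sup>2 = exp (- h n x) + exp (- h k x) - 2 * exp (- ((h n x + h k x) / 2))" for x
      unfolding v_def power2_diff
      by (simp add: power2_eq_square mult_exp_exp add_divide_distrib[symmetric]) (simp add: add_divide_distrib)?
    then have "(\<integral>x. (v n x - v k x)\<^sup>2 \<partial>M) = (\<integral>x. exp (- h n x) + exp (- h k x) - 2 * exp (- ((h n x + h k x) / 2)) \<partial>M)"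
      by simp
    also have "\<dots> = E (h n) + E (h k) - 2 * E (\<lambda>x. (h n x + h k x) / 2)"
      unfolding E_def
      by (subst Bochner_Integration.integral_diff Bochner_Integration.integral_add integral_mult_right;
          (intro Bochner_Integration.integrable_add integrable_mult_right int hm[OF h(1)] hn[OF h(1)] hm[OF md] hn[OF md])?)+ simp
    also have "\<dots> \<le> (I n + (1 / 16) ^ n) + (I k + (1 / 16) ^ k) - 2 * I n"
      using h(2)[of n] h(2)[of k] Ile[OF md] by linarith
    also have "\<dots> \<le> (L - I n) + (1 / 16) ^ n + (1 / 16) ^ k" using L(2)[of k] by linarith
    finally show ?thesis .
  qed
  have "\<exists>n\<ge>k. L - I n \<le> (1 / 16) ^ k" for k
  proof -
    have "\<forall>\<^sub>F n in sequentially. L - (1 / 16) ^ k < I n"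
      by (rule order_tendstoD(1)[OF L(1)]) simp
    then obtain n0 where "\<And>n. n \<ge> n0 \<Longrightarrow> L - (1 / 16) ^ k < I n" by (auto simp: eventually_sequentially)
    then show ?thesis by (intro exI[of _ "max k n0"]) (auto intro: less_imp_le simp: diff_le_eq add.commute less_diff_eq diff_less_eq)
  qed
  then obtain s where s: "\<And>k. s k \<ge> k" "\<And>k. L - I (s k) \<le> (1 / 16) ^ k" by metis
  \<comment> \<open>Indices are thinned out so that \<open>L - I (r k)\<close> is at most
    \<open>(1 / 16) ^ k\<close>. The recursion makes the next argument of \<open>s\<close> at least
    the current value of \<open>s\<close>, so that \<open>r\<close> is nondecreasing.\<close>
  define r where "r k = s (rec_nat 0 (\<lambda>k x. max (Suc k) (s x)) k)" for k
  define q where "q = rec_nat 0 (\<lambda>k x. max (Suc k) (s x))"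
  have q: "q (Suc k) \<ge> Suc k" "q (Suc k) \<ge> s (q k)" for k by (auto simp: q_def)
  have qk: "q k \<ge> k" for k by (cases k) (use q in \<open>auto simp: q_def\<close>)
  have r: "r k = s (q k)" for k by (simp add: r_def q_def)
  have rk: "r k \<ge> k" for k unfolding r using s(1) qk order_trans by blast
  have rmono: "r k \<le> r (Suc k)" for k unfolding r using q(2)[of k] s(1)[of "q (Suc k)"] by linarith
  have Lr: "L - I (r k) \<le> (1 / 16) ^ k" for k
  proof -
    have "L - I (r k) \<le> (1 / 16) ^ (q k)" unfolding r by (rule s(2))
    also have "\<dots> \<le> (1 / 16) ^ k" using qk by (intro power_decreasing) auto
    finally show ?thesis .
  qed
  define w where "w k x = v (Suc 0 * r (Suc k)) x - v (r k) x" for k x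
  have w: "w k x = v (r (Suc k)) x - v (r k) x" for k x by (simp add: w_def)
  have wm[measurable]: "w k \<in> borel_measurable M" for k unfolding w[abs_def] by measurable
  have w1: "\<bar>w k x\<bar> \<le> 1" for k x using v01[of "r k" x] v01[of "r (Suc k)" x] unfolding w by linarith
  have wsq: "(\<integral>x. (w k x)\<^sup>2 \<partial>M) \<le> 3 * (1 / 16) ^ k" for k
  proof -
    have "(\<integral>x. (w k x)\<^sup>2 \<partial>M) = (\<integral>x. (v (r k) x - v (r (Suc k)) x)\<^sup>2 \<partial>M)" by (simp add: w power2_commute)
    also have "\<dots> \<le> (L - I (r k)) + (1 / 16) ^ r k + (1 / 16) ^ r (Suc k)" by (rule sq[OF rmono])
    also have "\<dots> \<le> (1 / 16) ^ k + (1 / 16) ^ k + (1 / 16) ^ k"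
      using rk[of k] rk[of "Suc k"] by (intro add_mono Lr power_decreasing) auto
    finally show ?thesis by simp
  qed
  have wint: "integrable M (\<lambda>x. (w k x)\<^sup>2)" for k
    by (rule integrable_const_bound[where B=1]) (use w1 in \<open>auto simp: abs_square_le_1\<close>)
  have wabs: "(\<integral>\<^sup>+x. ennreal \<bar>w k x\<bar> \<partial>M) \<le> ennreal ((?T + 3) * (1 / 4) ^ k)" for k
  proof -
    define e :: real where "e = (1 / 4) ^ k"
    have e: "e > 0" "(1 / 16) ^ k = e * e" by (auto simp: e_def power_mult_distrib[symmetric])
    have iw: "integrable M (\<lambda>x. \<bar>w k x\<bar>)"
      by (rule integrable_const_bound[where B=1]) (use w1 in auto)
    have "(\<integral>\<^sup>+x. ennreal \<bar>w k x\<bar> \<partial>M) = ennreal (\<integral>x. \<bar>w k x\<bar> \<partial>M)"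
      by (rule nn_integral_eq_integral[OF iw]) simp
    \<comment> \<open>The weight \<open>e = (1 / 4) ^ k\<close> balances the two terms, since the
      squares integrate to at most \<open>3 * (e * e)\<close>.\<close>
    also have "(\<integral>x. \<bar>w k x\<bar> \<partial>M) \<le> (\<integral>x. e + (w k x)\<^sup>2 / e \<partial>M)"
    proof (rule integral_mono[OF iw])
      show "integrable M (\<lambda>x. e + (w k x)\<^sup>2 / e)" using wint by simp
      fix x
      have "0 \<le> (\<bar>w k x\<bar> - e)\<^sup>2" by simp
      moreover have "(\<bar>w k x\<bar> - e)\<^sup>2 = (w k x)\<^sup>2 - 2 * (\<bar>w k x\<bar> * e) + e * e"
        by (simp add: power2_diff) (simp add: power2_eq_square)?
      ultimately have "2 * (\<bar>w k x\<bar> * e) \<le> e * e + (w k x)\<^sup>2" by linarith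
      moreover have "0 \<le> \<bar>w k x\<bar> * e" using e by simp
      ultimately have "\<bar>w k x\<bar> * e \<le> e * e + (w k x)\<^sup>2" by linarith
      then have "\<bar>w k x\<bar> \<le> (e * e + (w k x)\<^sup>2) / e" using e by (simp add: pos_le_divide_eq)
      then show "\<bar>w k x\<bar> \<le> e + (w k x)\<^sup>2 / e" using e by (simp add: add_divide_distrib)
    qed
    also have "(\<integral>x. e + (w k x)\<^sup>2 / e \<partial>M) = e * ?T + (\<integral>x. (w k x)\<^sup>2 \<partial>M) / e"
      using wint by (simp add: Bochner_Integration.integral_add mult.commute)
    also have "\<dots> \<le> e * ?T + 3 * (e * e) / e"
      using wsq[of k] e by (intro add_left_mono divide_right_mono) auto
    also have "\<dots> = (?T + 3) * (1 / 4) ^ k" using e by (simp add: e_def[symmetric] algebra_simps)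
    finally show ?thesis by (simp add: ennreal_leI)
  qed
  have "(\<integral>\<^sup>+x. (\<Sum>k. ennreal \<bar>w k x\<bar>) \<partial>M) = (\<Sum>k. (\<integral>\<^sup>+x. ennreal \<bar>w k x\<bar> \<partial>M))"
    by (rule nn_integral_suminf) measurable
  also have "\<dots> \<le> (\<Sum>k. ennreal ((?T + 3) * (1 / 4) ^ k))" by (intro suminf_le wabs summableI)
  also have "\<dots> = ennreal ((?T + 3) * (1 / (1 - 1 / 4)))"
  proof (rule suminf_ennreal_eq)
    show "(\<lambda>k. (?T + 3) * (1 / 4) ^ k) sums ((?T + 3) * (1 / (1 - 1 / 4)))"
      by (rule sums_mult[OF geometric_sums]) simp
  qed simp
  finally have "(\<integral>\<^sup>+x. (\<Sum>k. ennreal \<bar>w k x\<bar>) \<partial>M) \<noteq> \<infinity>" by (auto simp: top_unique)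
  then have "AE x in M. (\<Sum>k. ennreal \<bar>w k x\<bar>) \<noteq> \<infinity>"
    by (intro nn_integral_PInf_AE) auto
  then have conv_v: "AE x in M. convergent (\<lambda>k. v (r k) x)"
  proof eventually_elim
    fix x assume "(\<Sum>k. ennreal \<bar>w k x\<bar>) \<noteq> \<infinity>"
    then have "summable (\<lambda>k. \<bar>w k x\<bar>)" by (intro summable_suminf_not_top) auto
    then have "summable (\<lambda>k. w k x)" by (rule summable_rabs_cancel)
    then have "(\<lambda>n. \<Sum>k<n. w k x) \<longlonglongrightarrow> suminf (\<lambda>k. w k x)" by (rule summable_LIMSEQ)
    moreover have "(\<Sum>k<n. w k x) = v (r n) x - v (r 0) x" for n
      unfolding w by (induction n) auto
    ultimately have "(\<lambda>n. v (r n) x - v (r 0) x + v (r 0) x) \<longlonglongrightarrow> suminf (\<lambda>k. w k x) + v (r 0) x"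
      by (intro tendsto_add tendsto_const) simp
    then show "convergent (\<lambda>k. v (r k) x)" by (auto simp: convergent_def)
  qed
  define H where "H k = h (r k)" for k
  have HH: "H k \<in> mid_hull \<psi> k" for k unfolding H_def using h(1) rk mid_hull_antimono by blast
  have [measurable]: "H k \<in> borel_measurable M" for k using hm[OF HH] .
  have HC: "(\<integral>\<^sup>+x. ennreal (H k x) \<partial>M) \<le> C" for k
    using mid_hull_powr_integral[OF HH m nn order_refl, of C] C(1) hn[OF HH] nn by simp
  have "(\<integral>\<^sup>+x. liminf (\<lambda>k. ennreal (H k x)) \<partial>M) \<le> liminf (\<lambda>k. (\<integral>\<^sup>+x. ennreal (H k x) \<partial>M))"
    by (rule nn_integral_liminf) measurable
  also have "\<dots> \<le> liminf (\<lambda>k. C)" by (intro Liminf_mono always_eventually allI HC)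
  also have "\<dots> = C" by (simp add: Liminf_const)
  finally have "(\<integral>\<^sup>+x. liminf (\<lambda>k. ennreal (H k x)) \<partial>M) \<noteq> \<infinity>" using C(2) by (auto simp: top_unique)
  then have "AE x in M. liminf (\<lambda>k. ennreal (H k x)) \<noteq> \<infinity>"
    by (intro nn_integral_PInf_AE) auto
  with conv_v have "AE x in M. convergent (\<lambda>k. H k x)"
  proof eventually_elim
    fix x assume c: "convergent (\<lambda>k. v (r k) x)" and li: "liminf (\<lambda>k. ennreal (H k x)) \<noteq> \<infinity>"
    obtain l where l: "(\<lambda>k. v (r k) x) \<longlonglongrightarrow> l" using c by (auto simp: convergent_def)
    have Hv: "H k x = - 2 * ln (v (r k) x)" for k by (simp add: H_def v_def)
    have l0: "l \<ge> 0" using LIMSEQ_le_const[OF l] v01 by blast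
    \<comment> \<open>A zero limit would mean that \<open>H k x\<close> tends to infinity, which the
      Fatou lemma excludes almost everywhere.\<close>
    have "l \<noteq> 0"
    proof
      assume "l = 0"
      have "filterlim (\<lambda>k. H k x) at_top sequentially"
        unfolding filterlim_at_top
      proof
        fix Z :: real
        have "\<forall>\<^sub>F k in sequentially. v (r k) x < exp (- (Z / 2))"
          by (rule order_tendstoD(2)[OF l]) (simp add: \<open>l = 0\<close>)
        then show "\<forall>\<^sub>F k in sequentially. Z \<le> H k x"
          by eventually_elim (simp add: v_def H_def)
      qed
      then have "(\<lambda>k. ennreal (H k x)) \<longlonglongrightarrow> \<infinity>"
        by (simp add: ennreal_tendsto_top_eq_at_top)
      then have "liminf (\<lambda>k. ennreal (H k x)) = \<infinity>" by (intro lim_imp_Liminf) auto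
      then show False using li by simp
    qed
    then have "(\<lambda>k. - 2 * ln (v (r k) x)) \<longlonglongrightarrow> - 2 * ln l" by (intro tendsto_intros l)
    then show "convergent (\<lambda>k. H k x)" unfolding Hv[abs_def] by (auto simp: convergent_def)
  qed
  then show ?thesis using that HH by blast
qed

section \<open>From almost everywhere convergence to convergence in mean\<close>

lemma powr_truncation_le:
  fixes a R p :: real
  assumes "0 \<le> a" "0 < R" "1 < p"
  shows "a - min a R \<le> a powr p * R powr (1 - p)"
proof (cases "a \<le> R")
  case False
  have "a = a powr p * a powr (1 - p)" using False assms by (simp add: powr_add[symmetric])
  also have "\<dots> \<le> a powr p * R powr (1 - p)"
    using False assms by (intro mult_left_mono powr_mono2') auto
  finally show ?thesis using assms False by simp
qed (use assms in simp)

text \<open>The bound on \<open>p\<close>-th powers with \<open>p > 1\<close> gives uniform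
  integrability: truncation at height \<open>R\<close> costs at most
  \<open>C * R powr (1 - p)\<close>, for every element of the hull and for the limit alike. The
  truncated functions converge by domination. The absolute value keeps the limit nonnegative also on
  the null set where \<open>lim\<close> is arbitrary.\<close>

lemma mid_hull_L1_convergent:
  fixes \<psi> :: "nat \<Rightarrow> 'a \<Rightarrow> real"
  assumes M: "finite_measure M" and m: "\<And>j. \<psi> j \<in> borel_measurable M" and nn: "\<And>j x. 0 \<le> \<psi> j x"
    and p: "1 < p" and C: "\<And>j. (\<integral>\<^sup>+x. ennreal (\<psi> j x powr p) \<partial>M) \<le> ennreal C" "0 \<le> C"
  obtains H where "\<And>k. H k \<in> mid_hull \<psi> k" "(\<integral>\<^sup>+x. ennreal \<bar>lim (\<lambda>k. H k x)\<bar> \<partial>M) < \<infinity>"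
    "(\<lambda>k. \<integral>\<^sup>+x. ennreal \<bar>H k x - \<bar>lim (\<lambda>k. H k x)\<bar>\<bar> \<partial>M) \<longlonglongrightarrow> 0"
proof -
  interpret finite_measure M by fact
  have pow1: "a \<le> 1 + a powr p" if "0 \<le> a" for a :: real
  proof (cases "a \<le> 1")
    case False
    then have "a powr 1 \<le> a powr p" using p by (intro powr_mono) auto
    then show ?thesis using False by simp
  qed (use that in \<open>simp add: add_increasing2\<close>)
  have L1: "(\<integral>\<^sup>+x. ennreal (g x) \<partial>M) \<le> ennreal (measure M (space M) + C)"
    if "g \<in> borel_measurable M" "\<And>x. 0 \<le> g x" "(\<integral>\<^sup>+x. ennreal (g x powr p) \<partial>M) \<le> ennreal C" for g
  proof -
    have [measurable]: "g \<in> borel_measurable M" by fact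
    have "(\<integral>\<^sup>+x. ennreal (g x) \<partial>M) \<le> (\<integral>\<^sup>+x. 1 + ennreal (g x powr p) \<partial>M)"
    proof (rule nn_integral_mono)
      fix x
      have "ennreal (g x) \<le> ennreal (1 + g x powr p)" using pow1[OF that(2)] by (rule ennreal_leI)
      then show "ennreal (g x) \<le> 1 + ennreal (g x powr p)" by (simp add: ennreal_plus)
    qed
    also have "\<dots> = emeasure M (space M) + (\<integral>\<^sup>+x. ennreal (g x powr p) \<partial>M)"
      by (simp add: nn_integral_add)
    also have "\<dots> \<le> emeasure M (space M) + ennreal C" by (intro add_left_mono that(3))
    also have "\<dots> = ennreal (measure M (space M) + C)" using C(2) by (simp add: emeasure_eq_measure ennreal_plus)
    finally show ?thesis .
  qed
  obtain H where H: "\<And>k. H k \<in> mid_hull \<psi> k" "AE x in M. convergent (\<lambda>k. H k x)"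
    by (rule mid_hull_AE_convergent[of M \<psi> "ennreal (measure M (space M) + C)"])
      (use M m nn L1[OF m nn C(1)] in auto)
  have Hm[measurable]: "H k \<in> borel_measurable M" for k using mid_hull_measurable[OF H(1) m] .
  have Hn: "0 \<le> H k x" for k x using mid_hull_nonneg[OF H(1) nn] .
  have HC: "(\<integral>\<^sup>+x. ennreal (H k x powr p) \<partial>M) \<le> ennreal C" for k
    by (rule mid_hull_powr_integral[OF H(1) m nn _ C(1)]) (use p in simp)
  define \<Phi> where "\<Phi> x = \<bar>lim (\<lambda>k. H k x)\<bar>" for x
  have Pm[measurable]: "\<Phi> \<in> borel_measurable M" unfolding \<Phi>_def[abs_def] by measurable
  have lim: "AE x in M. (\<lambda>k. H k x) \<longlonglongrightarrow> \<Phi> x"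
    using H(2)
  proof eventually_elim
    fix x assume "convergent (\<lambda>k. H k x)"
    then have l: "(\<lambda>k. H k x) \<longlonglongrightarrow> lim (\<lambda>k. H k x)" by (simp add: convergent_LIMSEQ_iff)
    moreover have "lim (\<lambda>k. H k x) \<ge> 0" using LIMSEQ_le_const[OF l] Hn by blast
    ultimately show "(\<lambda>k. H k x) \<longlonglongrightarrow> \<Phi> x" by (simp add: \<Phi>_def)
  qed
  have PC: "(\<integral>\<^sup>+x. ennreal (\<Phi> x powr p) \<partial>M) \<le> ennreal C"
  proof -
    have "(\<integral>\<^sup>+x. ennreal (\<Phi> x powr p) \<partial>M) = (\<integral>\<^sup>+x. liminf (\<lambda>k. ennreal (H k x powr p)) \<partial>M)"
    proof (rule nn_integral_cong_AE)
      show "AE x in M. ennreal (\<Phi> x powr p) = liminf (\<lambda>k. ennreal (H k x powr p))"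
        using lim
      proof eventually_elim
        fix x assume "(\<lambda>k. H k x) \<longlonglongrightarrow> \<Phi> x"
        then have "(\<lambda>k. ennreal (H k x powr p)) \<longlonglongrightarrow> ennreal (\<Phi> x powr p)"
          using p Hn by (intro tendsto_ennrealI tendsto_powr' tendsto_const) auto
        then show "ennreal (\<Phi> x powr p) = liminf (\<lambda>k. ennreal (H k x powr p))"
          by (intro lim_imp_Liminf[symmetric]) auto
      qed
    qed
    also have "\<dots> \<le> liminf (\<lambda>k. (\<integral>\<^sup>+x. ennreal (H k x powr p) \<partial>M))" by (rule nn_integral_liminf) measurable
    also have "\<dots> \<le> liminf (\<lambda>k. ennreal C)" by (intro Liminf_mono always_eventually allI HC)
    also have "\<dots> = ennreal C" by (simp add: Liminf_const)
    finally show ?thesis .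
  qed
  have fin: "(\<integral>\<^sup>+x. ennreal (\<Phi> x) \<partial>M) < \<infinity>"
    using L1[OF Pm _ PC] by (auto simp: \<Phi>_def intro: le_less_trans)
  have "(\<lambda>k. \<integral>\<^sup>+x. ennreal \<bar>H k x - \<Phi> x\<bar> \<partial>M) \<longlonglongrightarrow> 0"
  proof (rule order_tendstoI)
    fix e :: ennreal assume e: "0 < e"
    obtain e' :: real where e': "0 < e'" "ennreal e' < e"
      using dense[OF e] by (metis ennreal_cases ennreal_less_zero_iff not_less_iff_gr_or_eq order.strict_trans top.not_eq_extremum)
    have "((\<lambda>R. 2 * C * R powr (1 - p)) \<longlongrightarrow> 2 * C * 0) at_top"
      by (intro tendsto_intros tendsto_neg_powr filterlim_ident) (use p in simp)
    then have "\<forall>\<^sub>F R in at_top. 2 * C * R powr (1 - p) < e' / 2"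
      using e' by (intro order_tendstoD(2)) auto
    then obtain R where R: "R > 0" "2 * C * R powr (1 - p) < e' / 2"
      using eventually_happens'[OF trivial_limit_at_top_linorder eventually_conj[OF eventually_gt_at_top[of 0]]] by blast
    have dom: "(\<lambda>k. \<integral>\<^sup>+x. ennreal \<bar>min (H k x) R - min (\<Phi> x) R\<bar> \<partial>M) \<longlonglongrightarrow> (\<integral>\<^sup>+x. 0 \<partial>M)"
    proof (rule nn_integral_dominated_convergence[where w="\<lambda>x. ennreal R"])
      show "(\<integral>\<^sup>+x. ennreal R \<partial>M) < \<infinity>" by (simp add: emeasure_eq_measure ennreal_mult_less_top)
      show "AE x in M. ennreal \<bar>min (H k x) R - min (\<Phi> x) R\<bar> \<le> ennreal R" for k
      proof (rule AE_I2, rule ennreal_leI)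
        fix x
        have "\<bar>min a R - min b R\<bar> \<le> R" if "0 \<le> a" "0 \<le> b" for a b
          using that R(1) by (auto simp: min_def abs_if)
        then show "\<bar>min (H k x) R - min (\<Phi> x) R\<bar> \<le> R" using Hn by (simp add: \<Phi>_def)
      qed
      show "AE x in M. (\<lambda>k. ennreal \<bar>min (H k x) R - min (\<Phi> x) R\<bar>) \<longlonglongrightarrow> 0"
        using lim
      proof eventually_elim
        fix x assume "(\<lambda>k. H k x) \<longlonglongrightarrow> \<Phi> x"
        then have "(\<lambda>k. \<bar>min (H k x) R - min (\<Phi> x) R\<bar>) \<longlonglongrightarrow> \<bar>min (\<Phi> x) R - min (\<Phi> x) R\<bar>"
          by (intro tendsto_intros)
        then show "(\<lambda>k. ennreal \<bar>min (H k x) R - min (\<Phi> x) R\<bar>) \<longlonglongrightarrow> 0"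
          using tendsto_ennrealI by fastforce
      qed
    qed measurable
    then have "\<forall>\<^sub>F k in sequentially. (\<integral>\<^sup>+x. ennreal \<bar>min (H k x) R - min (\<Phi> x) R\<bar> \<partial>M) < ennreal (e' / 2)"
      using e' by (intro order_tendstoD(2)) auto
    then show "\<forall>\<^sub>F k in sequentially. (\<integral>\<^sup>+x. ennreal \<bar>H k x - \<Phi> x\<bar> \<partial>M) < e"
    proof eventually_elim
      fix k assume k: "(\<integral>\<^sup>+x. ennreal \<bar>min (H k x) R - min (\<Phi> x) R\<bar> \<partial>M) < ennreal (e' / 2)"
      define c where "c = R powr (1 - p)"
      have c: "c \<ge> 0" by (simp add: c_def)
      have "(\<integral>\<^sup>+x. ennreal \<bar>H k x - \<Phi> x\<bar> \<partial>M) \<le>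
        (\<integral>\<^sup>+x. ennreal \<bar>min (H k x) R - min (\<Phi> x) R\<bar> + (ennreal c * ennreal (H k x powr p) + ennreal c * ennreal (\<Phi> x powr p)) \<partial>M)"
      proof (rule nn_integral_mono)
        fix x
        have "\<bar>H k x - \<Phi> x\<bar> \<le> \<bar>min (H k x) R - min (\<Phi> x) R\<bar> + (c * H k x powr p + c * \<Phi> x powr p)"
          using powr_truncation_le[OF Hn[of k x] R(1) p] powr_truncation_le[of "\<Phi> x" R p] R(1) p
            min.cobounded1[of "H k x" R] min.cobounded1[of "\<Phi> x" R] abs_ge_zero[of "lim (\<lambda>k. H k x)"]
          unfolding c_def mult.commute[of "R powr (1 - p)"] \<Phi>_def by linarith
        then have "ennreal \<bar>H k x - \<Phi> x\<bar> \<le> ennreal (\<bar>min (H k x) R - min (\<Phi> x) R\<bar> + (c * H k x powr p + c * \<Phi> x powr p))"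
          by (rule ennreal_leI)
        then show "ennreal \<bar>H k x - \<Phi> x\<bar> \<le> ennreal \<bar>min (H k x) R - min (\<Phi> x) R\<bar> + (ennreal c * ennreal (H k x powr p) + ennreal c * ennreal (\<Phi> x powr p))"
          using c by (simp add: ennreal_plus ennreal_mult')
      qed
      also have "\<dots> = (\<integral>\<^sup>+x. ennreal \<bar>min (H k x) R - min (\<Phi> x) R\<bar> \<partial>M) +
         (ennreal c * (\<integral>\<^sup>+x. ennreal (H k x powr p) \<partial>M) + ennreal c * (\<integral>\<^sup>+x. ennreal (\<Phi> x powr p) \<partial>M))"
        by (simp add: nn_integral_add nn_integral_cmult)
      also have "\<dots> \<le> ennreal (e' / 2) + (ennreal c * ennreal C + ennreal c * ennreal C)"
        by (intro add_mono mult_left_mono HC PC less_imp_le[OF k]) auto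
      also have "\<dots> = ennreal (e' / 2 + (c * C + c * C))"
        unfolding ennreal_lincomb[OF C(2) C(2) c c, symmetric] using c C(2) e' by (intro ennreal_plus[symmetric]) auto
      also have "\<dots> \<le> ennreal e'" using R(2) by (intro ennreal_leI) (simp add: c_def mult_ac)
      also note e'(2)
      finally show "(\<integral>\<^sup>+x. ennreal \<bar>H k x - \<Phi> x\<bar> \<partial>M) < e" .
    qed
  qed simp
  then show ?thesis using that[OF H(1)] fin by (simp add: \<Phi>_def)
qed

section \<open>Lipschitz pieces\<close>

text \<open>The index set, possibly finite, is moved to the natural numbers. Each
  \<open>A' n\<close> and \<open>S' n\<close> is empty or one of the given sets, so subadditivity on
  one side and additivity on the other apply.\<close>

lemma countable_cover_bound:
  assumes C: "countable C" and A: "\<And>i. i \<in> C \<Longrightarrow> A i \<in> sets \<mu>" and S: "\<And>i. i \<in> C \<Longrightarrow> S i \<in> sets \<nu>"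
    and le: "\<And>i. i \<in> C \<Longrightarrow> emeasure \<mu> (A i) \<le> c * emeasure \<nu> (S i)"
    and dis: "disjoint_family_on S C"
  shows "emeasure \<mu> (\<Union>i\<in>C. A i) \<le> c * emeasure \<nu> (\<Union>i\<in>C. S i)"
proof -
  let ?e = "to_nat_on C"
  define A' where "A' n = (\<Union>i\<in>{i\<in>C. ?e i = n}. A i)" for n
  define S' where "S' n = (\<Union>i\<in>{i\<in>C. ?e i = n}. S i)" for n
  have one: "{i\<in>C. ?e i = n} = {} \<or> (\<exists>i\<in>C. {i\<in>C. ?e i = n} = {i})" for n
  proof (cases "\<exists>i\<in>C. ?e i = n")
    case True
    then obtain i where i: "i \<in> C" "?e i = n" by blast
    have "{i\<in>C. ?e i = n} = {i}" using i inj_onD[OF inj_on_to_nat_on[OF C]] by blast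
    then show ?thesis using i(1) by blast
  qed blast
  have cases: "(A' n = {} \<and> S' n = {}) \<or> (\<exists>i\<in>C. A' n = A i \<and> S' n = S i)" for n
    using one[of n] unfolding A'_def S'_def by (elim disjE bexE) auto
  have A'm: "A' n \<in> sets \<mu>" and S'm: "S' n \<in> sets \<nu>" and le': "emeasure \<mu> (A' n) \<le> c * emeasure \<nu> (S' n)" for n
    using cases[of n] A S le by auto
  have dis': "disjoint_family S'"
    unfolding disjoint_family_on_def
  proof (intro ballI impI)
    fix m n :: nat assume "m \<noteq> n"
    show "S' m \<inter> S' n = {}"
    proof (rule ccontr)
      assume "S' m \<inter> S' n \<noteq> {}"
      then obtain p i j where ij: "i \<in> C" "j \<in> C" "?e i = m" "?e j = n" "p \<in> S i" "p \<in> S j"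
        unfolding S'_def by blast
      then have "i \<noteq> j" using \<open>m \<noteq> n\<close> by blast
      then have "S i \<inter> S j = {}" by (rule disjoint_family_onD[OF dis ij(1,2)])
      then show False using ij(5,6) by blast
    qed
  qed
  have UA: "(\<Union>i\<in>C. A i) = (\<Union>n. A' n)" and US: "(\<Union>i\<in>C. S i) = (\<Union>n. S' n)"
    unfolding A'_def S'_def by auto
  have "emeasure \<mu> (\<Union>n. A' n) \<le> (\<Sum>n. emeasure \<mu> (A' n))"
    by (rule emeasure_subadditive_countably) (use A'm in auto)
  also have "\<dots> \<le> (\<Sum>n. c * emeasure \<nu> (S' n))" by (intro suminf_le le' summableI)
  also have "\<dots> = c * (\<Sum>n. emeasure \<nu> (S' n))" by (rule ennreal_suminf_cmult)
  also have "(\<Sum>n. emeasure \<nu> (S' n)) = emeasure \<nu> (\<Union>n. S' n)"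
    by (rule suminf_emeasure) (use S'm dis' in auto)
  finally show ?thesis unfolding UA US .
qed

text \<open>A superlevel set of the centred maximal function, with averages normalised by
  \<open>r ^ m\<close> in place of the volume of the ball.\<close>

definition large_average :: "('a::euclidean_space \<Rightarrow> ennreal) \<Rightarrow> real \<Rightarrow> 'a set" where
  "large_average \<Phi> \<tau> = {x. \<exists>r>0. (\<integral>\<^sup>+z\<in>ball x r. \<Phi> z \<partial>lborel) > ennreal (\<tau> * r ^ DIM('a))}"

text \<open>The integral over \<open>ball x r\<close> is the supremum of those over smaller
  concentric balls. One of these already satisfies the strict inequality, and it is contained in
  \<open>ball y r\<close> for all \<open>y\<close> near \<open>x\<close>.\<close>

lemma open_large_average:
  fixes \<Phi> :: "'a::euclidean_space \<Rightarrow> ennreal"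
  assumes [measurable]: "\<Phi> \<in> borel_measurable borel"
  shows "open (large_average \<Phi> \<tau>)"
  unfolding open_dist
proof
  fix x assume "x \<in> large_average \<Phi> \<tau>"
  then obtain r where r: "r > 0" "(\<integral>\<^sup>+z\<in>ball x r. \<Phi> z \<partial>lborel) > ennreal (\<tau> * r ^ DIM('a))"
    by (auto simp: large_average_def)
  define \<nu> where "\<nu> = density lborel \<Phi>"
  have \<nu>: "emeasure \<nu> (ball y s) = (\<integral>\<^sup>+z\<in>ball y s. \<Phi> z \<partial>lborel)" for y s
    unfolding \<nu>_def by (rule emeasure_density) auto
  define B where "B k = ball x (r - 1 / real (Suc k))" for k :: nat
  have inc: "incseq B"
    unfolding B_def incseq_def by (intro allI impI subset_ball) (simp add: divide_left_mono)
  have "(\<Union>k. B k) = ball x r"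
  proof
    show "(\<Union>k. B k) \<subseteq> ball x r"
    proof
      fix z assume "z \<in> (\<Union>k. B k)"
      then obtain k where "dist x z < r - 1 / real (Suc k)" by (auto simp: B_def)
      moreover have "1 / real (Suc k) > 0" by simp
      ultimately have "dist x z < r" by linarith
      then show "z \<in> ball x r" by simp
    qed
    show "ball x r \<subseteq> (\<Union>k. B k)"
    proof
      fix z assume "z \<in> ball x r"
      then have "r - dist x z > 0" by simp
      then obtain k where "1 / real (Suc k) < r - dist x z" using nat_approx_posE by blast
      then have "z \<in> B k" by (simp add: B_def)
      then show "z \<in> (\<Union>k. B k)" by blast
    qed
  qed
  moreover have "(SUP k. emeasure \<nu> (B k)) = emeasure \<nu> (\<Union>k. B k)"
    by (rule SUP_emeasure_incseq[OF _ inc]) (auto simp: \<nu>_def B_def)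
  ultimately have "ennreal (\<tau> * r ^ DIM('a)) < (SUP k. emeasure \<nu> (B k))" using r(2) by (simp add: \<nu>)
  then obtain k where k: "ennreal (\<tau> * r ^ DIM('a)) < emeasure \<nu> (B k)" by (auto simp: less_SUP_iff)
  have "y \<in> large_average \<Phi> \<tau>" if "dist y x < 1 / real (Suc k)" for y
  proof -
    have "B k \<subseteq> ball y r"
    proof
      fix z assume "z \<in> B k"
      then show "z \<in> ball y r" using that dist_triangle[of y z x] by (simp add: B_def)
    qed
    then have "emeasure \<nu> (B k) \<le> emeasure \<nu> (ball y r)" by (intro emeasure_mono) (auto simp: \<nu>_def)
    then show ?thesis unfolding large_average_def using r(1) k by (auto simp: \<nu> intro!: exI[of _ r] elim: less_le_trans)
  qed
  then show "\<exists>e>0. \<forall>y. dist y x < e \<longrightarrow> y \<in> large_average \<Phi> \<tau>"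
    by (intro exI[of _ "1 / real (Suc k)"]) auto
qed

lemma large_average_antimono: "\<tau> \<le> \<tau>' \<Longrightarrow> large_average \<Phi> \<tau>' \<subseteq> large_average (\<Phi> :: 'a::euclidean_space \<Rightarrow> ennreal) \<tau>"
proof
  fix x assume l: "\<tau> \<le> \<tau>'" and "x \<in> large_average \<Phi> \<tau>'"
  then obtain r where r: "r > 0" "(\<integral>\<^sup>+z\<in>ball x r. \<Phi> z \<partial>lborel) > ennreal (\<tau>' * r ^ DIM('a))"
    by (auto simp: large_average_def)
  have "ennreal (\<tau> * r ^ DIM('a)) \<le> ennreal (\<tau>' * r ^ DIM('a))" using l r(1) by (intro ennreal_leI mult_right_mono) auto
  then show "x \<in> large_average \<Phi> \<tau>" using r by (auto simp: large_average_def intro!: exI[of _ r] elim: le_less_trans)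
qed

text \<open>The weak type inequality for the maximal function, with a truncation: values of
  \<open>\<Phi>\<close> up to \<open>\<tau> / (2 * w)\<close> supply at most half of the mass
  \<open>\<tau> * r ^ m\<close> that a ball must exceed. So only the large values appear on the
  right, and their integral is small for large \<open>\<tau>\<close>.\<close>

lemma large_average_weak_bound:
  fixes \<Phi> :: "'a::euclidean_space \<Rightarrow> ennreal"
  assumes m[measurable]: "\<Phi> \<in> borel_measurable borel" and fin: "(\<integral>\<^sup>+z. \<Phi> z \<partial>lborel) < \<infinity>" and l: "\<tau> > 0"
  defines "w \<equiv> unit_ball_vol (real DIM('a))"
  shows "ennreal \<tau> * emeasure lborel (large_average \<Phi> \<tau>) \<le>
    ennreal (2 * w * 5 ^ DIM('a)) * (\<integral>\<^sup>+z. (\<Phi> z * indicator {z. \<Phi> z > ennreal (\<tau> / (2 * w))} z) \<partial>lborel)"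
proof -
  let ?m = "DIM('a)"
  have w: "w > 0" unfolding w_def by (rule unit_ball_vol_pos_DIM)
  have m1: "?m \<ge> 1" by (simp add: Suc_leI)
  define \<Psi> where "\<Psi> z = \<Phi> z * indicator {z. \<Phi> z > ennreal (\<tau> / (2 * w))} z" for z
  have Pm[measurable]: "\<Psi> \<in> borel_measurable borel" unfolding \<Psi>_def[abs_def] by measurable
  define \<nu> where "\<nu> = density lborel \<Psi>"
  have \<nu>: "emeasure \<nu> X = (\<integral>\<^sup>+z\<in>X. \<Psi> z \<partial>lborel)" if "X \<in> sets borel" for X
    unfolding \<nu>_def by (rule emeasure_density) (use that in auto)
  define K where "K = {(x, r). r > 0 \<and> (\<integral>\<^sup>+z\<in>ball x r. \<Phi> z \<partial>lborel) > ennreal (\<tau> * r ^ ?m)}"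
  obtain T where T: "(\<integral>\<^sup>+z. \<Phi> z \<partial>lborel) = ennreal T" "T \<ge> 0" using fin by (cases "\<integral>\<^sup>+z. \<Phi> z \<partial>lborel") auto
  have Kr: "0 < snd i \<and> snd i \<le> max 1 (T / \<tau>)" if "i \<in> K" for i
  proof -
    obtain x r where i: "i = (x, r)" by (cases i)
    have r: "r > 0" "(\<integral>\<^sup>+z\<in>ball x r. \<Phi> z \<partial>lborel) > ennreal (\<tau> * r ^ ?m)" using that by (auto simp: K_def i)
    have "(\<integral>\<^sup>+z\<in>ball x r. \<Phi> z \<partial>lborel) \<le> ennreal T"
      unfolding T(1)[symmetric] by (intro nn_integral_mono) (auto simp: indicator_def)
    then have "ennreal (\<tau> * r ^ ?m) < ennreal T" using r(2) by (rule less_le_trans[rotated])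
    then have "\<tau> * r ^ ?m < T" using l r(1) by (simp add: ennreal_less_iff)
    then have rT: "r ^ ?m \<le> T / \<tau>" using l by (simp add: pos_le_divide_eq mult.commute)
    have "r \<le> max 1 (T / \<tau>)"
    proof (cases "r \<le> 1")
      case False
      then have "r ^ 1 \<le> r ^ ?m" using m1 by (intro power_increasing) auto
      then show ?thesis using rT by simp
    qed simp
    then show ?thesis using r by (simp add: i)
  qed
  have half: "ennreal (w * 5 ^ ?m * r ^ ?m) \<le> ennreal (2 * w * 5 ^ ?m / \<tau>) * emeasure \<nu> (ball x r)"
    if "(x, r) \<in> K" for x r
  proof -
    have r: "r > 0" "(\<integral>\<^sup>+z\<in>ball x r. \<Phi> z \<partial>lborel) > ennreal (\<tau> * r ^ ?m)" using that by (auto simp: K_def)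
    have [measurable]: "ball x r \<in> sets borel" by simp
    have bm: "(\<lambda>z. ennreal (\<tau> / (2 * w)) * indicator (ball x r) z) \<in> borel_measurable borel"
      "(\<lambda>z. \<Psi> z * indicator (ball x r) z) \<in> borel_measurable borel" by measurable
    have "(\<integral>\<^sup>+z\<in>ball x r. \<Phi> z \<partial>lborel) \<le> (\<integral>\<^sup>+z. ennreal (\<tau> / (2 * w)) * indicator (ball x r) z + \<Psi> z * indicator (ball x r) z \<partial>lborel)"
      by (rule nn_integral_mono) (auto simp: \<Psi>_def indicator_def not_less)
    also have "(\<integral>\<^sup>+z. ennreal (\<tau> / (2 * w)) * indicator (ball x r) z + \<Psi> z * indicator (ball x r) z \<partial>lborel) = ennreal (\<tau> / (2 * w)) * emeasure lborel (ball x r) + emeasure \<nu> (ball x r)"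
      using bm by (subst nn_integral_add) (auto simp: nn_integral_cmult_indicator \<nu>)
    also have "ennreal (\<tau> / (2 * w)) * emeasure lborel (ball x r) = ennreal (\<tau> / 2 * r ^ ?m)"
      using r(1) l w by (simp add: emeasure_ball w_def[symmetric] ennreal_mult'[symmetric])
    finally have "ennreal (\<tau> * r ^ ?m) \<le> ennreal (\<tau> / 2 * r ^ ?m) + emeasure \<nu> (ball x r)" using r(2) by (meson less_imp_le less_le_trans)
    moreover have "ennreal (\<tau> * r ^ ?m) = ennreal (\<tau> / 2 * r ^ ?m) + ennreal (\<tau> / 2 * r ^ ?m)"
      using l r(1) by (subst ennreal_plus[symmetric]) auto
    ultimately have "ennreal (\<tau> / 2 * r ^ ?m) \<le> emeasure \<nu> (ball x r)"
      by (simp add: ennreal_add_left_cancel_le)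
    then have "ennreal (2 * w * 5 ^ ?m / \<tau>) * ennreal (\<tau> / 2 * r ^ ?m) \<le> ennreal (2 * w * 5 ^ ?m / \<tau>) * emeasure \<nu> (ball x r)"
      by (rule mult_left_mono) simp
    moreover have "ennreal (2 * w * 5 ^ ?m / \<tau>) * ennreal (\<tau> / 2 * r ^ ?m) = ennreal (w * 5 ^ ?m * r ^ ?m)"
      using l w r(1) by (subst ennreal_mult[symmetric]) auto
    ultimately show ?thesis by simp
  qed
  have sub: "large_average \<Phi> \<tau> \<subseteq> (\<Union>i\<in>K. ball (fst i) (snd i))"
  proof
    fix x assume "x \<in> large_average \<Phi> \<tau>"
    then obtain r where "(x, r) \<in> K" by (auto simp: large_average_def K_def)
    moreover from this have "x \<in> ball (fst (x, r)) (snd (x, r))" by (auto simp: K_def)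
    ultimately show "x \<in> (\<Union>i\<in>K. ball (fst i) (snd i))" by blast
  qed
  obtain C where C: "countable C" "C \<subseteq> K"
    "pairwise (\<lambda>i j. disjnt (ball (fst i) (snd i)) (ball (fst j) (snd j))) C"
    "large_average \<Phi> \<tau> \<subseteq> (\<Union>i\<in>C. ball (fst i) (5 * snd i))"
    by (rule Vitali_covering_lemma_balls[OF sub Kr])
  have "emeasure lborel (large_average \<Phi> \<tau>) \<le> emeasure lborel (\<Union>i\<in>C. ball (fst i) (5 * snd i))"
    using C(1,4) by (intro emeasure_mono) auto
  also have "\<dots> \<le> ennreal (2 * w * 5 ^ ?m / \<tau>) * emeasure \<nu> (\<Union>i\<in>C. ball (fst i) (snd i))"
  proof (rule countable_cover_bound[OF C(1)])
    fix i assume i: "i \<in> C"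
    obtain x r where xr: "i = (x, r)" by (cases i)
    have "r > 0" using i C(2) by (auto simp: xr K_def)
    then have "emeasure lborel (ball x (5 * r)) = ennreal (w * 5 ^ ?m * r ^ ?m)"
      by (simp add: emeasure_ball w_def power_mult_distrib mult.assoc)
    then show "emeasure lborel (ball (fst i) (5 * snd i)) \<le> ennreal (2 * w * 5 ^ ?m / \<tau>) * emeasure \<nu> (ball (fst i) (snd i))"
      using half[of x r] i C(2) by (auto simp: xr)
  next
    show "disjoint_family_on (\<lambda>i. ball (fst i) (snd i)) C"
      using C(3) unfolding pairwise_def disjoint_family_on_def disjnt_def by blast
  qed (auto simp: \<nu>_def)
  also have "emeasure \<nu> (\<Union>i\<in>C. ball (fst i) (snd i)) \<le> emeasure \<nu> UNIV"
    by (rule emeasure_mono) (auto simp: \<nu>_def)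
  also have "emeasure \<nu> UNIV = (\<integral>\<^sup>+z. \<Psi> z \<partial>lborel)" by (subst \<nu>) auto
  finally have "emeasure lborel (large_average \<Phi> \<tau>) \<le> ennreal (2 * w * 5 ^ ?m / \<tau>) * (\<integral>\<^sup>+z. \<Psi> z \<partial>lborel)"
    by (simp add: mult_left_mono)
  then have "ennreal \<tau> * emeasure lborel (large_average \<Phi> \<tau>) \<le> ennreal \<tau> * (ennreal (2 * w * 5 ^ ?m / \<tau>) * (\<integral>\<^sup>+z. \<Psi> z \<partial>lborel))"
    by (rule mult_left_mono) simp
  also have "\<dots> = (ennreal \<tau> * ennreal (2 * w * 5 ^ ?m / \<tau>)) * (\<integral>\<^sup>+z. \<Psi> z \<partial>lborel)" by (simp only: mult.assoc)
  also have "ennreal \<tau> * ennreal (2 * w * 5 ^ ?m / \<tau>) = ennreal (2 * w * 5 ^ ?m)"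
    using l w by (subst ennreal_mult[symmetric]) auto
  finally show ?thesis unfolding \<Psi>_def .
qed

text \<open>The usual weak type estimate would only bound this product. Its smallness is what allows
  Lipschitz constants times measures of exceptional sets to be summed.\<close>

lemma large_average_tendsto_0:
  fixes \<Phi> :: "'a::euclidean_space \<Rightarrow> ennreal"
  assumes m[measurable]: "\<Phi> \<in> borel_measurable borel" and fin: "(\<integral>\<^sup>+z. \<Phi> z \<partial>lborel) < \<infinity>" and e: "e > 0"
  shows "\<exists>\<tau>\<ge>real k. \<tau> > 0 \<and> ennreal \<tau> * emeasure lborel (large_average \<Phi> \<tau>) < ennreal e"
proof -
  define w where "w = unit_ball_vol (real DIM('a))"
  have w: "w > 0" unfolding w_def by (rule unit_ball_vol_pos_DIM)
  define I where "I n = (\<integral>\<^sup>+z. (\<Phi> z * indicator {z. \<Phi> z > ennreal (real (Suc n) / (2 * w))} z) \<partial>lborel)" for n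
  have "I \<longlonglongrightarrow> (\<integral>\<^sup>+z. 0 \<partial>(lborel :: 'a measure))"
    unfolding I_def
  proof (rule nn_integral_dominated_convergence[where w=\<Phi>])
    show "AE z in lborel. \<Phi> z * indicator {z. \<Phi> z > ennreal (real (Suc n) / (2 * w))} z \<le> \<Phi> z" for n
      by (auto simp: indicator_def)
    have "AE z in lborel. \<Phi> z \<noteq> \<infinity>" by (rule nn_integral_PInf_AE) (use fin in auto)
    then show "AE z in lborel. (\<lambda>n. \<Phi> z * indicator {z. \<Phi> z > ennreal (real (Suc n) / (2 * w))} z) \<longlonglongrightarrow> 0"
    proof eventually_elim
      fix z assume "\<Phi> z \<noteq> \<infinity>"
      then obtain p where p: "\<Phi> z = ennreal p" "p \<ge> 0" by (cases "\<Phi> z") auto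
      obtain N where N: "p * (2 * w) \<le> real N" using real_arch_simple by blast
      have "\<Phi> z * indicator {z. \<Phi> z > ennreal (real (Suc n) / (2 * w))} z = 0" if "n \<ge> N" for n
      proof -
        have "p * (2 * w) \<le> real (Suc n)" using N that by simp
        then have "p \<le> real (Suc n) / (2 * w)" using w by (simp add: pos_le_divide_eq)
        then show ?thesis using p by (simp add: not_less ennreal_leI del: of_nat_Suc)
      qed
      then show "(\<lambda>n. \<Phi> z * indicator {z. \<Phi> z > ennreal (real (Suc n) / (2 * w))} z) \<longlonglongrightarrow> 0"
        by (intro tendsto_eventually) (auto simp: eventually_sequentially)
    qed
  qed (use fin in auto)
  then have "(\<lambda>n. ennreal (2 * w * 5 ^ DIM('a)) * I n) \<longlonglongrightarrow> ennreal (2 * w * 5 ^ DIM('a)) * 0"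
    by (intro ennreal_tendsto_cmult) auto
  then have "\<forall>\<^sub>F n in sequentially. ennreal (2 * w * 5 ^ DIM('a)) * I n < ennreal e"
    using e by (intro order_tendstoD(2)) auto
  then obtain n where n: "n \<ge> k" "ennreal (2 * w * 5 ^ DIM('a)) * I n < ennreal e"
    unfolding eventually_sequentially by (meson linorder_linear order_refl)
  have "ennreal (real (Suc n)) * emeasure lborel (large_average \<Phi> (real (Suc n))) \<le> ennreal (2 * w * 5 ^ DIM('a)) * I n"
    unfolding I_def w_def by (rule large_average_weak_bound[OF m fin]) simp
  also note n(2)
  finally show ?thesis using n(1) by (intro exI[of _ "real (Suc n)"]) auto
qed

text \<open>Compare \<open>x\<close> with \<open>y\<close> through the points \<open>z\<close> of a
  ball \<open>E\<close> in \<open>V\<close> whose radius is proportional to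
  \<open>norm (x - y)\<close> and which lies within twice that distance of both. The integrals of
  \<open>d x z\<close> and \<open>d y z\<close> over \<open>E\<close> are estimated by Riesz
  potentials, and the bounded averages around \<open>x\<close> and \<open>y\<close> make their means
  of order \<open>\<tau> * norm (x - y)\<close>. The constant depends on \<open>V\<close> through an
  inscribed ball and a bound for the diameter.\<close>

lemma hajlasz_bound:
  fixes \<Phi> :: "'a::euclidean_space \<Rightarrow> ennreal" and d :: "'a \<Rightarrow> 'a \<Rightarrow> real"
  assumes m[measurable]: "\<Phi> \<in> borel_measurable borel" and V: "open V" "convex V" "bounded V" "V \<noteq> {}"
    and tri: "\<And>x y z. x \<in> V \<Longrightarrow> y \<in> V \<Longrightarrow> z \<in> V \<Longrightarrow> d x y \<le> d x z + d y z" and d0: "\<And>x y. 0 \<le> d x y"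
  shows "\<exists>c\<ge>0. \<forall>\<tau> x y. \<tau> \<ge> 0 \<longrightarrow> x \<in> V \<longrightarrow> y \<in> V \<longrightarrow> x \<noteq> y \<longrightarrow>
    x \<notin> large_average \<Phi> \<tau> \<longrightarrow> y \<notin> large_average \<Phi> \<tau> \<longrightarrow>
    (\<forall>p\<in>{x, y}. AE z in lborel. z \<in> V \<longrightarrow>
      ennreal (d p z) \<le> ennreal (norm (z - p)) * (\<integral>\<^sup>+t\<in>{0..1}. \<Phi> (p + t *\<^sub>R (z - p)) \<partial>lborel)) \<longrightarrow>
    d x y \<le> c * \<tau> * norm (x - y)"
proof -
  let ?m = "DIM('a)"
  define w where "w = unit_ball_vol (real DIM('a))"
  have w: "w > 0" unfolding w_def by (rule unit_ball_vol_pos_DIM)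
  have Vm[measurable]: "V \<in> sets borel" using V by simp
  obtain x0 where "x0 \<in> V" using V(4) by blast
  then obtain \<rho> where rho: "\<rho> > 0" "ball x0 \<rho> \<subseteq> V" using V(1) open_contains_ball by blast
  obtain D0 where "\<forall>p\<in>V. \<forall>q\<in>V. dist p q \<le> D0" using V(3) bounded_two_points by blast
  define D where "D = max D0 1"
  have D: "D > 0" "\<And>p q. p \<in> V \<Longrightarrow> q \<in> V \<Longrightarrow> norm (p - q) \<le> D"
    using \<open>\<forall>p\<in>V. \<forall>q\<in>V. dist p q \<le> D0\<close> by (auto simp: D_def dist_norm intro: max.coboundedI1)
  define c where "c = 2 * (2 ^ ?m * (4 ^ ?m * 2)) * D ^ ?m / (w * \<rho> ^ ?m)"
  show ?thesis
  proof (intro exI[of _ c] conjI allI impI)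
    show "c \<ge> 0" using w rho D by (simp add: c_def)
    fix \<tau> :: real and x y :: 'a
    assume l: "\<tau> \<ge> 0" and xy: "x \<in> V" "y \<in> V" "x \<noteq> y"
      and la: "x \<notin> large_average \<Phi> \<tau>" "y \<notin> large_average \<Phi> \<tau>"
      and good: "\<forall>p\<in>{x, y}. AE z in lborel. z \<in> V \<longrightarrow>
        ennreal (d p z) \<le> ennreal (norm (z - p)) * (\<integral>\<^sup>+t\<in>{0..1}. \<Phi> (p + t *\<^sub>R (z - p)) \<partial>lborel)"
    define \<delta> where "\<delta> = norm (x - y)"
    have del: "\<delta> > 0" "\<delta> \<le> D" using xy D by (auto simp: \<delta>_def)
    define s where "s = \<delta> / D"
    have s: "0 < s" "s \<le> 1" using del D by (auto simp: s_def)
    \<comment> \<open>The contraction, with centre \<open>x\<close> and ratio \<open>s\<close>, of a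
      fixed ball in \<open>V\<close>. Convexity keeps it inside \<open>V\<close> however close
      \<open>x\<close> is to the boundary.\<close>
    define E where "E = ball (x + s *\<^sub>R (x0 - x)) (s * \<rho>)"
    have EV: "z \<in> V \<and> norm (z - x) \<le> 2 * \<delta> \<and> norm (z - y) \<le> 2 * \<delta>" if "z \<in> E" for z
    proof -
      define z' where "z' = x0 + (1 / s) *\<^sub>R (z - (x + s *\<^sub>R (x0 - x)))"
      have "norm (z - (x + s *\<^sub>R (x0 - x))) < s * \<rho>" using that by (simp add: E_def dist_norm norm_minus_commute)
      then have "norm ((1 / s) *\<^sub>R (z - (x + s *\<^sub>R (x0 - x)))) < \<rho>" using s by (simp add: divide_less_eq mult.commute)
      then have z'V: "z' \<in> V" using rho(2) by (auto simp: z'_def dist_norm)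
      have "s *\<^sub>R z' = s *\<^sub>R x0 + (z - (x + s *\<^sub>R (x0 - x)))" using s by (simp add: z'_def scaleR_add_right)
      then have zz: "z = (1 - s) *\<^sub>R x + s *\<^sub>R z'" by (simp add: algebra_simps)
      have zV: "z \<in> V" unfolding zz by (rule convexD_alt[OF V(2) xy(1) z'V]) (use s in auto)
      have "z - x = s *\<^sub>R (z' - x)" unfolding zz by (simp add: algebra_simps)
      then have "norm (z - x) = s * norm (z' - x)" using s by simp
      also have "\<dots> \<le> s * D" using s D(2)[OF z'V xy(1)] by (intro mult_left_mono) auto
      also have "\<dots> = \<delta>" using D by (simp add: s_def)
      finally have zx: "norm (z - x) \<le> \<delta>" .
      have "norm (z - y) \<le> norm (z - x) + norm (x - y)" using norm_triangle_ineq[of "z - x" "x - y"] by simp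
      then show ?thesis using zV zx del norm_ge_zero[of "x - y"] unfolding \<delta>_def by (intro conjI) linarith+
    qed
    define B where "B = (2 * \<delta>) ^ ?m * (2 ^ ?m * (2 ^ ?m * \<tau>) * (2 * \<delta>))"
    have B0: "B \<ge> 0" using del l by (simp add: B_def)
    define h where "h p z = ennreal (norm (z - p) powr 1) * (\<integral>\<^sup>+t\<in>{0..1}. \<Phi> (p + t *\<^sub>R (z - p)) \<partial>lborel)" for p z
    have hm[measurable]: "h p \<in> borel_measurable borel" for p unfolding h_def[abs_def] by measurable
    have point: "(\<integral>\<^sup>+z\<in>E. h p z \<partial>lborel) \<le> ennreal B" if p: "p \<in> {x, y}" for p
    proof -
      define Vp where "Vp = V \<inter> cball p (2 * \<delta>)"
      have pV: "p \<in> V" "p \<notin> large_average \<Phi> \<tau>" using p xy la by auto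
      have Vpm[measurable]: "Vp \<in> sets borel" by (simp add: Vp_def)
      have avg: "(\<integral>\<^sup>+z\<in>cball p r. \<Phi> z \<partial>lborel) \<le> ennreal (2 ^ ?m * \<tau> * r ^ ?m)" if r: "0 < r" for r
      proof -
        have "(\<integral>\<^sup>+z\<in>cball p r. \<Phi> z \<partial>lborel) \<le> (\<integral>\<^sup>+z\<in>ball p (2 * r). \<Phi> z \<partial>lborel)"
          using r by (intro nn_integral_mono) (auto simp: indicator_def)
        also have "\<dots> \<le> ennreal (\<tau> * (2 * r) ^ ?m)"
          using pV(2) r unfolding large_average_def by (auto simp: not_less dest: spec[of _ "2 * r"])
        finally show ?thesis by (simp add: power_mult_distrib mult_ac)
      qed
      have EVp: "E \<subseteq> Vp" using EV p by (auto simp: Vp_def dist_norm norm_minus_commute)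
      have "(\<integral>\<^sup>+z\<in>E. h p z \<partial>lborel) \<le> (\<integral>\<^sup>+z\<in>Vp. h p z \<partial>lborel)"
        using EVp by (intro nn_integral_mono) (auto simp: indicator_def)
      also have "\<dots> \<le> ennreal ((2 * \<delta>) powr (1 + real ?m - 1)) * (\<integral>\<^sup>+z\<in>Vp. (\<Phi> z * ennreal (1 / norm (z - p) ^ (?m - 1))) \<partial>lborel)"
        unfolding h_def
      proof (rule segment_potential_bound[OF m Vpm])
        show "convex Vp" unfolding Vp_def by (intro convex_Int V convex_cball)
        show "p \<in> Vp" using pV del by (simp add: Vp_def)
      qed (auto simp: Vp_def dist_norm norm_minus_commute)
      also have "(\<integral>\<^sup>+z\<in>Vp. (\<Phi> z * ennreal (1 / norm (z - p) ^ (?m - 1))) \<partial>lborel) \<le> (\<integral>\<^sup>+z\<in>cball p (2 * \<delta>). (\<Phi> z * ennreal (1 / norm (z - p) ^ (?m - 1))) \<partial>lborel)"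
        by (intro nn_integral_mono) (auto simp: indicator_def Vp_def)
      also have "\<dots> \<le> ennreal (2 ^ ?m * (2 ^ ?m * \<tau>) * (2 * \<delta>))"
        by (rule riesz_ball_bound[OF m]) (use del l avg in auto)
      also have "ennreal ((2 * \<delta>) powr (1 + real ?m - 1)) * ennreal (2 ^ ?m * (2 ^ ?m * \<tau>) * (2 * \<delta>)) = ennreal B"
        using del l by (simp add: B_def ennreal_mult'[symmetric] powr_realpow)
      finally show ?thesis by (simp add: mult_left_mono)
    qed
    have eE: "emeasure lborel E = ennreal (w * (s * \<rho>) ^ ?m)"
      using s rho by (simp add: E_def emeasure_ball w_def)
    have Em: "E \<in> sets borel" by (simp add: E_def)
    have "ennreal (d x y * (w * (s * \<rho>) ^ ?m)) = (\<integral>\<^sup>+z. ennreal (d x y) * indicator E z \<partial>lborel)"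
      using Em d0 by (subst nn_integral_cmult_indicator) (auto simp: eE ennreal_mult')
    also have "\<dots> \<le> (\<integral>\<^sup>+z. h x z * indicator E z + h y z * indicator E z \<partial>lborel)"
    proof (rule nn_integral_mono_AE)
      have "AE z in lborel. z \<in> V \<longrightarrow> ennreal (d x z) \<le> h x z" "AE z in lborel. z \<in> V \<longrightarrow> ennreal (d y z) \<le> h y z"
        using good by (simp_all add: h_def)
      then show "AE z in lborel. ennreal (d x y) * indicator E z \<le> h x z * indicator E z + h y z * indicator E z"
      proof eventually_elim
        fix z assume hz: "z \<in> V \<longrightarrow> ennreal (d x z) \<le> h x z" "z \<in> V \<longrightarrow> ennreal (d y z) \<le> h y z"
        show "ennreal (d x y) * indicator E z \<le> h x z * indicator E z + h y z * indicator E z"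
        proof (cases "z \<in> E")
          case True
          then have zV: "z \<in> V" using EV by blast
          have "ennreal (d x y) \<le> ennreal (d x z + d y z)" by (intro ennreal_leI tri xy zV)
          also have "\<dots> = ennreal (d x z) + ennreal (d y z)" by (simp add: ennreal_plus d0)
          also have "\<dots> \<le> h x z + h y z" using hz zV by (intro add_mono) auto
          finally show ?thesis using True by simp
        qed simp
      qed
    qed
    also have "\<dots> = (\<integral>\<^sup>+z\<in>E. h x z \<partial>lborel) + (\<integral>\<^sup>+z\<in>E. h y z \<partial>lborel)"
      using Em by (intro nn_integral_add) auto
    also have "\<dots> \<le> ennreal B + ennreal B" by (intro add_mono point) auto
    also have "\<dots> = ennreal (2 * B)" using B0 by (simp add: ennreal_plus[symmetric] del: ennreal_plus)
    finally have "d x y * (w * (s * \<rho>) ^ ?m) \<le> 2 * B" using B0 by (simp add: ennreal_le_iff)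
    moreover have wp: "w * (s * \<rho>) ^ ?m > 0" using w s rho by simp
    ultimately have "d x y \<le> 2 * B / (w * (s * \<rho>) ^ ?m)" by (simp add: pos_le_divide_eq)
    also have "\<dots> = c * \<tau> * \<delta>"
      using w s rho D del unfolding B_def c_def s_def
      by (simp add: power_mult_distrib power_divide field_simps) (simp add: power_mult_distrib[symmetric])?
    finally show "d x y \<le> c * \<tau> * norm (x - y)" by (simp add: \<delta>_def)
  qed
qed

text \<open>\<open>A k\<close> is \<open>V\<close> without the level set of height
  \<open>l k\<close> and without a null set. The height times the measure of the level set is below
  \<open>(1 / 2) ^ k\<close>, and the Lipschitz constant on \<open>A k\<close> is
  \<open>c * l k\<close>; this gives the summability.\<close>

lemma lipschitz_pieces:
  fixes \<Phi> :: "'a::euclidean_space \<Rightarrow> ennreal" and d :: "'a \<Rightarrow> 'a \<Rightarrow> real"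
  assumes m[measurable]: "\<Phi> \<in> borel_measurable borel" and fin: "(\<integral>\<^sup>+z. \<Phi> z \<partial>lborel) < \<infinity>"
    and V: "open V" "convex V" "bounded V" "V \<noteq> {}"
    and tri: "\<And>x y z. x \<in> V \<Longrightarrow> y \<in> V \<Longrightarrow> z \<in> V \<Longrightarrow> d x y \<le> d x z + d y z"
    and d0: "\<And>x y. 0 \<le> d x y" "\<And>x. d x x = 0"
    and good: "AE x in lborel. x \<in> V \<longrightarrow> (AE y in lborel. y \<in> V \<longrightarrow>
      ennreal (d x y) \<le> ennreal (norm (y - x)) * (\<integral>\<^sup>+t\<in>{0..1}. \<Phi> (x + t *\<^sub>R (y - x)) \<partial>lborel))"
  obtains A K where "\<And>n::nat. A n \<in> sets borel" "\<And>n. A n \<subseteq> V" "\<And>n. K n \<ge> 0"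
    "\<And>n x y. x \<in> A n \<Longrightarrow> y \<in> A n \<Longrightarrow> d x y \<le> K n * dist x y"
    "AE x in lborel. x \<in> V \<longrightarrow> (\<forall>\<^sub>F n in sequentially. x \<in> A n)"
    "summable (\<lambda>n. K n * measure lborel (V - A n))"
proof -
  have hb: "\<exists>c\<ge>0. \<forall>\<tau> x y. \<tau> \<ge> 0 \<longrightarrow> x \<in> V \<longrightarrow> y \<in> V \<longrightarrow> x \<noteq> y \<longrightarrow>
    x \<notin> large_average \<Phi> \<tau> \<longrightarrow> y \<notin> large_average \<Phi> \<tau> \<longrightarrow>
    (\<forall>p\<in>{x, y}. AE z in lborel. z \<in> V \<longrightarrow>
      ennreal (d p z) \<le> ennreal (norm (z - p)) * (\<integral>\<^sup>+t\<in>{0..1}. \<Phi> (p + t *\<^sub>R (z - p)) \<partial>lborel)) \<longrightarrow>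
    d x y \<le> c * \<tau> * norm (x - y)"
    by (rule hajlasz_bound[OF m V]) (rule tri d0(1), assumption+ | rule d0(1))+
  obtain c where c: "c \<ge> 0" and c2: "\<forall>\<tau> x y. \<tau> \<ge> 0 \<longrightarrow> x \<in> V \<longrightarrow> y \<in> V \<longrightarrow> x \<noteq> y \<longrightarrow>
    x \<notin> large_average \<Phi> \<tau> \<longrightarrow> y \<notin> large_average \<Phi> \<tau> \<longrightarrow>
    (\<forall>p\<in>{x, y}. AE z in lborel. z \<in> V \<longrightarrow>
      ennreal (d p z) \<le> ennreal (norm (z - p)) * (\<integral>\<^sup>+t\<in>{0..1}. \<Phi> (p + t *\<^sub>R (z - p)) \<partial>lborel)) \<longrightarrow>
    d x y \<le> c * \<tau> * norm (x - y)"
    using hb by (elim exE conjE) (rule that)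
  let ?g = "\<lambda>x. x \<in> V \<longrightarrow> (AE y in lborel. y \<in> V \<longrightarrow>
      ennreal (d x y) \<le> ennreal (norm (y - x)) * (\<integral>\<^sup>+t\<in>{0..1}. \<Phi> (x + t *\<^sub>R (y - x)) \<partial>lborel))"
  obtain N where N: "N \<in> null_sets lborel" "{x. \<not> ?g x} \<subseteq> N"
    using good by (auto simp: eventually_ae_filter)
  have Nm: "N \<in> sets borel" using N(1) by (auto simp: null_sets_def)
  have "\<exists>\<tau>\<ge>real k. \<tau> > 0 \<and> ennreal \<tau> * emeasure lborel (large_average \<Phi> \<tau>) < ennreal ((1 / 2) ^ k)" for k
    by (rule large_average_tendsto_0[OF m fin]) simp
  then obtain l where l: "\<And>k. l k \<ge> real k" "\<And>k. l k > 0"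
    "\<And>k. ennreal (l k) * emeasure lborel (large_average \<Phi> (l k)) < ennreal ((1 / 2) ^ k)" by metis
  have Om: "large_average \<Phi> s \<in> sets borel" for s using open_large_average[OF m] by simp
  define A where "A k = V - large_average \<Phi> (l k) - N" for k
  define K where "K k = c * l k" for k
  have Vm: "V \<in> sets borel" using V(1) by simp
  have Am: "A k \<in> sets borel" for k unfolding A_def using Vm Om Nm by auto
  have meas: "measure lborel (V - A k) * l k \<le> (1 / 2) ^ k" for k
  proof -
    have Of: "emeasure lborel (large_average \<Phi> (l k)) < \<infinity>"
    proof (rule ccontr)
      assume "\<not> ?thesis"
      then have "emeasure lborel (large_average \<Phi> (l k)) = top" by (simp add: not_less top_unique)
      then show False using l(2,3)[of k] by (simp add: ennreal_mult_top)
    qed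
    have "emeasure lborel (V - A k) \<le> emeasure lborel (large_average \<Phi> (l k) \<union> N)"
      using Om Nm by (intro emeasure_mono) (auto simp: A_def)
    also have "\<dots> = emeasure lborel (large_average \<Phi> (l k))"
      using N(1) Om by (intro emeasure_Un_null_set) auto
    finally have le: "emeasure lborel (V - A k) \<le> emeasure lborel (large_average \<Phi> (l k))" .
    then have "emeasure lborel (V - A k) \<noteq> top" using Of by (auto simp: top_unique)
    then have em: "emeasure lborel (V - A k) = ennreal (measure lborel (V - A k))"
      by (rule emeasure_eq_ennreal_measure)
    have "ennreal (measure lborel (V - A k) * l k) = ennreal (l k) * emeasure lborel (V - A k)"
      unfolding em using l(2)[of k] by (subst ennreal_mult[symmetric]) (auto simp: mult.commute)
    also have "\<dots> \<le> ennreal (l k) * emeasure lborel (large_average \<Phi> (l k))" by (intro mult_left_mono le) simp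
    also have "\<dots> \<le> ennreal ((1 / 2) ^ k)" using l(3) by (rule less_imp_le)
    finally show ?thesis by (simp add: ennreal_le_iff)
  qed
  show ?thesis
  proof (rule that[of A K])
    show "A n \<in> sets borel" for n by (rule Am)
    show "A n \<subseteq> V" for n by (auto simp: A_def)
    show "0 \<le> K n" for n using c l(2)[of n] by (simp add: K_def)
    show "d x y \<le> K n * dist x y" if "x \<in> A n" "y \<in> A n" for n x y
    proof (cases "x = y")
      case False
      have "?g p" if "p \<in> {x, y}" for p using N(2) \<open>x \<in> A n\<close> \<open>y \<in> A n\<close> that unfolding A_def by blast
      then show ?thesis
        using c2[rule_format, of "l n" x y] that False less_imp_le[OF l(2)[of n]] unfolding K_def A_def dist_norm by blast
    qed (simp add: d0)
    show "AE x in lborel. x \<in> V \<longrightarrow> (\<forall>\<^sub>F n in sequentially. x \<in> A n)"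
    proof -
      have "(\<Inter>k. large_average \<Phi> (l k)) \<in> null_sets lborel"
      proof (rule null_setsI)
        show "(\<Inter>k. large_average \<Phi> (l k)) \<in> sets lborel" using Om by (intro sets.countable_INT) auto
        have "emeasure lborel (\<Inter>k. large_average \<Phi> (l k)) \<le> ennreal ((1 / 2) ^ Suc k)" for k
        proof -
          have "emeasure lborel (\<Inter>k. large_average \<Phi> (l k)) \<le> emeasure lborel (large_average \<Phi> (l (Suc k)))"
            using Om by (intro emeasure_mono) auto
          also have "\<dots> = 1 * \<dots>" by simp
          also have "\<dots> \<le> ennreal (l (Suc k)) * emeasure lborel (large_average \<Phi> (l (Suc k)))"
            using l(1)[of "Suc k"] by (intro mult_right_mono) (auto intro: order_trans[OF _ ennreal_leI[of 1]])
          also have "\<dots> \<le> ennreal ((1 / 2) ^ Suc k)" using l(3) by (rule less_imp_le)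
          finally show ?thesis .
        qed
        moreover have "(\<lambda>k. ennreal ((1 / 2) ^ Suc k)) \<longlonglongrightarrow> ennreal 0"
          by (intro tendsto_ennrealI LIMSEQ_Suc LIMSEQ_power_zero) simp
        ultimately have "emeasure lborel (\<Inter>k. large_average \<Phi> (l k)) \<le> ennreal 0"
          by (intro LIMSEQ_le_const[of "\<lambda>k. ennreal ((1 / 2) ^ Suc k)"]) auto
        then show "emeasure lborel (\<Inter>k. large_average \<Phi> (l k)) = 0" by simp
      qed
      then have "AE x in lborel. x \<notin> (\<Inter>k. large_average \<Phi> (l k))" by (rule AE_not_in)
      with AE_not_in[OF N(1)] show ?thesis
      proof (eventually_elim, intro impI)
        fix x assume x: "x \<notin> N" "x \<notin> (\<Inter>k. large_average \<Phi> (l k))" "x \<in> V"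
        then obtain k where k: "x \<notin> large_average \<Phi> (l k)" by blast
        obtain n0 where n0: "l k \<le> real n0" using real_arch_simple by blast
        \<comment> \<open>The heights need not be monotone, but \<open>l n \<ge> real n\<close>
          makes them exceed \<open>l k\<close> eventually.\<close>
        have "x \<in> A n" if "n \<ge> n0" for n
        proof -
          have "l k \<le> l n" using n0 l(1)[of n] that by (meson of_nat_le_iff order_trans)
          then show ?thesis using k x large_average_antimono[of "l k" "l n" \<Phi>] by (auto simp: A_def)
        qed
        then show "\<forall>\<^sub>F n in sequentially. x \<in> A n" by (auto simp: eventually_sequentially)
      qed
    qed
    show "summable (\<lambda>n. K n * measure lborel (V - A n))"
    proof (rule summable_comparison_test')
      show "summable (\<lambda>n. c * (1 / 2 :: real) ^ n)" by (intro summable_mult summable_geometric) simp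
      show "norm (K n * measure lborel (V - A n)) \<le> c * (1 / 2) ^ n" if "n \<ge> 0" for n
      proof -
        have "norm (K n * measure lborel (V - A n)) = c * (measure lborel (V - A n) * l n)"
          using c l(2)[of n] by (simp add: K_def abs_mult mult_ac)
        also have "\<dots> \<le> c * (1 / 2) ^ n" by (rule mult_left_mono[OF meas c])
        finally show ?thesis .
      qed
    qed
  qed
qed

section \<open>Sobolev maps into unordered tuples\<close>

lemma lipschitz_QQ_measurable:
  fixes F :: "'a::euclidean_space \<Rightarrow> 'b::real_inner multiset"
  assumes "Lipschitz_continuous_map euclidean_metric (QQ_metric Q) F"
  shows "F \<in> measurable borel (QQ_borel Q)"
proof -
  have cont: "continuous_map euclidean (mtopology_of (QQ_metric Q)) F"
    using Lipschitz_continuous_imp_continuous_map[OF assms] by simp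
  have FQ: "F x \<in> QQ Q" for x using assms unfolding Lipschitz_continuous_map_def by auto
  show ?thesis
    unfolding QQ_borel_def
  proof (rule measurable_measure_of)
    show "{W. openin (mtopology_of (QQ_metric Q)) W} \<subseteq> Pow (QQ Q :: 'b multiset set)" by (auto dest!: openin_subset)
    fix W :: "'b multiset set" assume "W \<in> {W. openin (mtopology_of (QQ_metric Q)) W}"
    then have "openin euclidean {x \<in> topspace euclidean. F x \<in> W}"
      using cont by (intro openin_continuous_map_preimage) auto
    moreover have "{x \<in> topspace euclidean. F x \<in> W} = F -` W \<inter> space borel" by auto
    ultimately show "F -` W \<inter> space borel \<in> sets borel" by simp
  qed (use FQ in auto)
qed

text \<open>Every set \<open>A n\<close> is \<open>V\<close> itself, so the remainders are empty.
  The bound passes from the Lipschitz approximations to the limit map because it is at most their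
  \<open>Dnorm\<close>, whose \<open>p\<close>-th powers have bounded integrals.\<close>

lemma lipschitz_upper_gradient:
  fixes F :: "real^'m::finite \<Rightarrow> ell2 multiset"
  assumes F: "Lipschitz_continuous_map euclidean_metric (QQ_metric Q) F"
    and V: "open V" "convex V" "bounded V"
  shows "\<exists>\<psi> :: real^'m \<Rightarrow> real. \<psi> \<in> borel_measurable borel \<and> (\<forall>z. 0 \<le> \<psi> z) \<and>
    (AE z in lborel. z \<in> V \<longrightarrow> \<psi> z \<le> Dnorm Q UNIV F z) \<and>
    (AE x in lborel. x \<in> V \<longrightarrow> (AE y in lborel. y \<in> V \<longrightarrow>
      ennreal (G2 (F x) (F y)) \<le> ennreal (norm (y - x)) * (\<integral>\<^sup>+t\<in>{0..1}. ennreal (\<psi> (x + t *\<^sub>R (y - x))) \<partial>lborel)))"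
proof -
  obtain B where B: "\<And>x y. G2 (F x) (F y) \<le> B * dist x y"
    using F unfolding Lipschitz_continuous_map_def by auto
  have lip: "G2 (F x) (F y) \<le> max B 0 * dist x y" for x y
    using B[of x y] mult_right_mono[of B "max B 0" "dist x y"] by simp
  obtain \<psi> :: "real^'m \<Rightarrow> real" where "\<psi> \<in> borel_measurable borel" "\<And>z. 0 \<le> \<psi> z"
    "AE z in lborel. z \<in> V \<longrightarrow> \<psi> z \<le> Dnorm Q UNIV F z \<and> delta_norm Q UNIV F z = Dnorm Q UNIV F z"
    "AE x in lborel. x \<in> V \<longrightarrow> (AE y in lborel. y \<in> V \<longrightarrow>
      ennreal (G2 (F x) (F y)) \<le> ennreal (norm (y - x)) * (\<integral>\<^sup>+t\<in>{0..1}. ennreal (\<psi> (x + t *\<^sub>R (y - x))) \<partial>lborel))"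
  proof (rule upper_gradient_le_Dnorm[of F UNIV Q V "\<lambda>_. V" "\<lambda>_. max B 0"])
    show "F \<in> measurable (restrict_space borel UNIV) (QQ_borel Q)"
      using lipschitz_QQ_measurable[OF F] by simp
  qed (use V lip in auto)
  then show ?thesis by (intro exI[of _ \<psi>]) (auto elim: eventually_mono)
qed

lemma powr_add_le:
  fixes a b p :: real
  assumes "0 \<le> a" "0 \<le> b" "1 \<le> p"
  shows "(a + b) powr p \<le> 2 powr p * (a powr p + b powr p)"
proof -
  have "(a + b) powr p = 2 powr p * ((a + b) / 2) powr p"
    using assms by (simp add: powr_divide)
  also have "\<dots> \<le> 2 powr p * (a powr p + b powr p)"
  proof (rule mult_left_mono)
    have gen: "X \<le> (A + B) / 2 \<Longrightarrow> 0 \<le> A \<Longrightarrow> 0 \<le> B \<Longrightarrow> X \<le> A + B" for X A B :: real by (erule order_trans) simp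
    show "((a + b) / 2) powr p \<le> a powr p + b powr p"
      by (rule gen[OF powr_midpoint_le[OF assms]]) auto
  qed simp
  finally show ?thesis .
qed

lemma W1p_AE_convergent:
  fixes f :: "real^'m::finite \<Rightarrow> 'b::real_inner multiset"
  assumes f: "f \<in> W1p_QQ Q U p" and p: "1 < p" and U: "open U"
  obtains F C where "\<And>j::nat. Lipschitz_continuous_map euclidean_metric (QQ_metric Q) (F j)"
    "\<And>j. (\<integral>\<^sup>+x\<in>U. ennreal (Dnorm Q UNIV (F j) x powr p) \<partial>lborel) \<le> ennreal C" "0 \<le> C"
    "AE x in lborel. x \<in> U \<longrightarrow> (\<lambda>j. G2 (f x) (F j x)) \<longlonglongrightarrow> 0"
proof -
  have p1: "1 \<le> p" using p by simp
  have Um[measurable]: "U \<in> sets borel" using U by simp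
  have fL: "f \<in> Lp_QQ Q U p" using f by (simp add: W1p_QQ_def)
  obtain F :: "nat \<Rightarrow> real^'m \<Rightarrow> 'b multiset" where
    lip: "\<And>j. Lipschitz_continuous_map euclidean_metric (QQ_metric Q) (F j)" and FL: "\<And>j. F j \<in> Lp_QQ Q U p"
    and sup: "(SUP j. \<integral>\<^sup>+x\<in>U. ennreal (Dnorm Q UNIV (F j) x powr p) \<partial>lebesgue) < \<infinity>"
    and lim: "(\<lambda>j. dist_p U p f (F j)) \<longlonglongrightarrow> 0"
    using f unfolding W1p_QQ_def by blast
  obtain C where C: "(SUP j. \<integral>\<^sup>+x\<in>U. ennreal (Dnorm Q UNIV (F j) x powr p) \<partial>lebesgue) = ennreal C" "0 \<le> C"
    using sup by (cases "SUP j. \<integral>\<^sup>+x\<in>U. ennreal (Dnorm Q UNIV (F j) x powr p) \<partial>lebesgue") auto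
  have DC: "(\<integral>\<^sup>+x\<in>U. ennreal (Dnorm Q UNIV (F j) x powr p) \<partial>lborel) \<le> ennreal C" for j
  proof -
    have "(\<integral>\<^sup>+x\<in>U. ennreal (Dnorm Q UNIV (F j) x powr p) \<partial>lborel) = (\<integral>\<^sup>+x\<in>U. ennreal (Dnorm Q UNIV (F j) x powr p) \<partial>lebesgue)"
      by (simp add: nn_integral_completion)
    also have "\<dots> \<le> ennreal C" unfolding C(1)[symmetric] by (rule SUP_upper) simp
    finally show ?thesis .
  qed
  have zQ: "replicate_mset Q (0::'b) \<in> QQ Q" by (simp add: QQ_def)
  have fm: "g \<in> measurable (restrict_space borel U) (QQ_borel Q)" if "g \<in> Lp_QQ Q U p" for g :: "real^'m \<Rightarrow> 'b multiset"
    using that by (simp add: Lp_QQ_def)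
  have fQ: "g x \<in> QQ Q" if "g \<in> Lp_QQ Q U p" "x \<in> U" for g :: "real^'m \<Rightarrow> 'b multiset" and x
    using measurable_space[OF fm[OF that(1)]] that(2) by (simp add: space_restrict_space)
  have FQ: "F j x \<in> QQ Q" for j x using lip[of j] unfolding Lipschitz_continuous_map_def by auto
  have Fcont: "\<exists>d>0. \<forall>y. dist y x < d \<longrightarrow> G2 (F j y) (F j x) < e" if e: "e > 0" for j x e
  proof -
    obtain B where B: "\<And>x y. G2 (F j x) (F j y) \<le> B * dist x y"
      using lip[of j] unfolding Lipschitz_continuous_map_def by auto
    have "G2 (F j y) (F j x) < e" if "dist y x < e / (\<bar>B\<bar> + 1)" for y
    proof -
      have "G2 (F j y) (F j x) \<le> B * dist y x" by (rule B)
      also have "\<dots> \<le> (\<bar>B\<bar> + 1) * dist y x" by (intro mult_right_mono) auto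
      also have "\<dots> < e" using that by (simp add: pos_less_divide_eq mult.commute add_nonneg_pos)
      finally show ?thesis .
    qed
    then show ?thesis using e by (intro exI[of _ "e / (\<bar>B\<bar> + 1)"]) (auto simp: add_nonneg_pos)
  qed
  have Gm: "(\<lambda>x. G2 (f x) (F j x)) \<in> borel_measurable (restrict_space borel U)" for j
    by (rule borel_measurable_G2_pair[OF fm[OF fL] Um FQ Fcont])
  define n where "n g x = G2 (g x) (replicate_mset Q 0) powr p" for g :: "real^'m \<Rightarrow> 'b multiset" and x
  have nm: "(\<lambda>x. indicator U x * n g x) \<in> borel_measurable borel"
    and nf: "(\<integral>\<^sup>+x. ennreal (indicator U x * n g x) \<partial>lborel) < \<infinity>" if g: "g \<in> Lp_QQ Q U p" for g
  proof -
    have "(\<lambda>x. G2 (g x) (replicate_mset Q 0)) \<in> borel_measurable (restrict_space borel U)"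
      using measurable_compose[OF fm[OF g] borel_measurable_G2[OF zQ]] .
    then have "n g \<in> borel_measurable (restrict_space borel U)" unfolding n_def[abs_def] by measurable
    then show "(\<lambda>x. indicator U x * n g x) \<in> borel_measurable borel"
      by (subst (asm) borel_measurable_restrict_space_iff) auto
    have "(\<integral>\<^sup>+x. ennreal (indicator U x * n g x) \<partial>lborel) = (\<integral>\<^sup>+x\<in>U. ennreal (n g x) \<partial>lborel)"
      by (rule nn_integral_cong) (auto simp: indicator_def)
    also have "\<dots> = (\<integral>\<^sup>+x\<in>U. ennreal (n g x) \<partial>lebesgue)" by (simp add: nn_integral_completion)
    also have "\<dots> < \<infinity>" using g by (simp add: Lp_QQ_def n_def)
    finally show "(\<integral>\<^sup>+x. ennreal (indicator U x * n g x) \<partial>lborel) < \<infinity>" .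
  qed
  define u where "u j x = indicator U x * G2 (f x) (F j x) powr p" for j x
  have um: "u j \<in> borel_measurable borel" for j
  proof -
    have "(\<lambda>x. G2 (f x) (F j x) powr p) \<in> borel_measurable (restrict_space borel U)"
      using Gm[of j] by measurable
    then show ?thesis unfolding u_def[abs_def] by (subst (asm) borel_measurable_restrict_space_iff) auto
  qed
  have u0: "0 \<le> u j x" for j x by (simp add: u_def)
  \<comment> \<open>\<open>dist_p\<close> is defined by a Bochner integral, which is 0 for
    nonintegrable functions; integrability gives its convergence a meaning.\<close>
  have int: "integrable lborel (u j)" for j
  proof (rule integrableI_nonneg)
    have m1: "(\<lambda>x. indicator U x * n f x) \<in> borel_measurable borel" and m2: "(\<lambda>x. indicator U x * n (F j) x) \<in> borel_measurable borel"
      using nm fL FL by auto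
    have "(\<integral>\<^sup>+x. ennreal (u j x) \<partial>lborel) \<le> (\<integral>\<^sup>+x. ennreal (2 powr p) * (ennreal (indicator U x * n f x) + ennreal (indicator U x * n (F j) x)) \<partial>lborel)"
    proof (rule nn_integral_mono)
      fix x
      have "u j x \<le> 2 powr p * (indicator U x * n f x + indicator U x * n (F j) x)"
      proof (cases "x \<in> U")
        case True
        have "G2 (f x) (F j x) \<le> G2 (f x) (replicate_mset Q 0) + G2 (F j x) (replicate_mset Q 0)"
          using G2_triangle[OF fQ[OF fL True] zQ FQ[of j x]] by (simp add: G2_sym)
        then have "G2 (f x) (F j x) powr p \<le> (G2 (f x) (replicate_mset Q 0) + G2 (F j x) (replicate_mset Q 0)) powr p"
          using p by (intro powr_mono2) (auto simp: G2_nonneg)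
        also have "\<dots> \<le> 2 powr p * (n f x + n (F j) x)"
          unfolding n_def by (rule powr_add_le) (auto simp: G2_nonneg p1)
        finally show ?thesis using True by (simp add: u_def)
      qed (simp add: u_def)
      then have "ennreal (u j x) \<le> ennreal (2 powr p * (indicator U x * n f x + indicator U x * n (F j) x))" by (rule ennreal_leI)
      also have "\<dots> = ennreal (2 powr p) * (ennreal (indicator U x * n f x) + ennreal (indicator U x * n (F j) x))"
        by (simp add: n_def ennreal_mult ennreal_plus)
      finally show "ennreal (u j x) \<le> \<dots>" .
    qed
    also have "\<dots> = ennreal (2 powr p) * ((\<integral>\<^sup>+x. ennreal (indicator U x * n f x) \<partial>lborel) + (\<integral>\<^sup>+x. ennreal (indicator U x * n (F j) x) \<partial>lborel))"
      using m1 m2 by (simp add: nn_integral_cmult nn_integral_add)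
    also have "\<dots> < \<infinity>" using nf[OF fL] nf[OF FL[of j]] by (simp add: ennreal_mult_less_top)
    finally show "(\<integral>\<^sup>+x. ennreal (u j x) \<partial>lborel) < \<infinity>" .
  qed (use um u0 in auto)
  have dist: "(\<integral>x. norm (u j x) \<partial>lborel) = dist_p U p f (F j) powr p" for j
  proof -
    have "(LINT x:U|lebesgue. G2 (f x) (F j x) powr p) = (\<integral>x. u j x \<partial>lborel)"
      unfolding set_lebesgue_integral_def real_scaleR_def u_def[symmetric] using um by (simp add: integral_completion)
    moreover have "(\<integral>x. norm (u j x) \<partial>lborel) = (\<integral>x. u j x \<partial>lborel)" using u0 by simp
    moreover have "0 \<le> (\<integral>x. u j x \<partial>lborel)" using u0 by simp
    ultimately show ?thesis using p unfolding dist_p_def by (simp add: powr_powr)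
  qed
  have "(\<lambda>j. \<integral>x. norm (u j x) \<partial>lborel) \<longlonglongrightarrow> 0"
    unfolding dist by (rule tendsto_zero_powrI[OF lim tendsto_const]) (use p in \<open>auto simp: dist_p_def\<close>)
  then obtain r where r: "strict_mono r" "AE x in lborel. (\<lambda>j. u (r j) x) \<longlonglongrightarrow> 0"
    using tendsto_L1_AE_subseq[of lborel u] int by blast
  show ?thesis
  proof (rule that[of "\<lambda>j. F (r j)" C])
    show "AE x in lborel. x \<in> U \<longrightarrow> (\<lambda>j. G2 (f x) (F (r j) x)) \<longlonglongrightarrow> 0"
      using r(2)
    proof (eventually_elim, intro impI)
      fix x assume "(\<lambda>j. u (r j) x) \<longlonglongrightarrow> 0" "x \<in> U"
      then have "(\<lambda>j. G2 (f x) (F (r j) x) powr p) \<longlonglongrightarrow> 0" by (simp add: u_def)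
      then have "(\<lambda>j. (G2 (f x) (F (r j) x) powr p) powr (1 / p)) \<longlonglongrightarrow> 0"
        by (rule tendsto_zero_powrI[OF _ tendsto_const]) (use p in auto)
      then show "(\<lambda>j. G2 (f x) (F (r j) x)) \<longlonglongrightarrow> 0" using p by (simp add: powr_powr G2_nonneg)
    qed
  qed (use lip DC C in auto)
qed

text \<open>The left side is an infimum over the tail and does not depend on \<open>g\<close>, while
  the right side is additive in \<open>g\<close>: two bounds of the same quantity give the bound by
  their mean.\<close>

lemma mid_hull_segment_bound:
  fixes \<psi> :: "nat \<Rightarrow> 'a::euclidean_space \<Rightarrow> real" and D :: "nat \<Rightarrow> 'a \<Rightarrow> 'a \<Rightarrow> ennreal"
  assumes g: "g \<in> mid_hull \<psi> k" and m: "\<And>j. \<psi> j \<in> borel_measurable borel" and nn: "\<And>j z. 0 \<le> \<psi> j z"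
    and D: "\<And>j. AE x in lborel. x \<in> V \<longrightarrow> (AE y in lborel. y \<in> V \<longrightarrow>
      D j x y \<le> ennreal (norm (y - x)) * (\<integral>\<^sup>+t\<in>{0..1}. ennreal (\<psi> j (x + t *\<^sub>R (y - x))) \<partial>lborel))"
  shows "AE x in lborel. x \<in> V \<longrightarrow> (AE y in lborel. y \<in> V \<longrightarrow>
      (INF j\<in>{k..}. D j x y) \<le> ennreal (norm (y - x)) * (\<integral>\<^sup>+t\<in>{0..1}. ennreal (g (x + t *\<^sub>R (y - x))) \<partial>lborel))"
  using g
proof (induction rule: mid_hull.induct)
  case (base j)
  have "(INF j\<in>{k..}. D j x y) \<le> D j x y" for x y using base by (intro INF_lower) auto
  then show ?case using D[of j] by (auto elim!: eventually_mono intro: order_trans)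
next
  case (mid g h)
  have [measurable]: "g \<in> borel_measurable borel" "h \<in> borel_measurable borel"
    using mid.hyps m by (auto intro: mid_hull_measurable)
  have gh: "0 \<le> g z" "0 \<le> h z" for z using mid.hyps nn by (auto intro: mid_hull_nonneg)
  have sum: "(\<integral>\<^sup>+t\<in>{0..1}. ennreal ((g (x + t *\<^sub>R (y - x)) + h (x + t *\<^sub>R (y - x))) / 2) \<partial>lborel) =
    ennreal (1 / 2) * (\<integral>\<^sup>+t\<in>{0..1}. ennreal (g (x + t *\<^sub>R (y - x))) \<partial>lborel) +
    ennreal (1 / 2) * (\<integral>\<^sup>+t\<in>{0..1}. ennreal (h (x + t *\<^sub>R (y - x))) \<partial>lborel)" for x y
  proof -
    have "ennreal ((g z + h z) / 2) = ennreal (1 / 2) * ennreal (g z) + ennreal (1 / 2) * ennreal (h z)" for z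
      using ennreal_lincomb[of "g z" "h z" "1 / 2" "1 / 2"] gh by (simp add: add_divide_distrib)
    then have "(\<integral>\<^sup>+t\<in>{0..1}. ennreal ((g (x + t *\<^sub>R (y - x)) + h (x + t *\<^sub>R (y - x))) / 2) \<partial>lborel) =
      (\<integral>\<^sup>+t. ennreal (1 / 2) * (ennreal (g (x + t *\<^sub>R (y - x))) * indicator {0..1} t) +
        ennreal (1 / 2) * (ennreal (h (x + t *\<^sub>R (y - x))) * indicator {0..1} t) \<partial>lborel)"
      by (intro nn_integral_cong) (simp add: distrib_right mult.assoc)
    also have "\<dots> = ennreal (1 / 2) * (\<integral>\<^sup>+t\<in>{0..1}. ennreal (g (x + t *\<^sub>R (y - x))) \<partial>lborel) +
      ennreal (1 / 2) * (\<integral>\<^sup>+t\<in>{0..1}. ennreal (h (x + t *\<^sub>R (y - x))) \<partial>lborel)"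
      by (subst nn_integral_add; (subst nn_integral_cmult)?) (measurable, simp add: nn_integral_cmult)
    finally show ?thesis .
  qed
  have half: "X \<le> c * (ennreal (1 / 2) * a + ennreal (1 / 2) * b)" if "X \<le> c * a" "X \<le> c * b" for X a b c :: ennreal
  proof -
    have "ennreal (1 / 2) + ennreal (1 / 2) = 1" by (subst ennreal_plus[symmetric]) auto
    then have "X = (ennreal (1 / 2) + ennreal (1 / 2)) * X" by (simp only: mult_1)
    also have "\<dots> = ennreal (1 / 2) * X + ennreal (1 / 2) * X" by (rule distrib_right)
    also have "\<dots> \<le> ennreal (1 / 2) * (c * a) + ennreal (1 / 2) * (c * b)"
      using that by (intro add_mono mult_left_mono) auto
    also have "\<dots> = c * (ennreal (1 / 2) * a + ennreal (1 / 2) * b)" by (simp add: distrib_left mult_ac)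
    finally show ?thesis .
  qed
  show ?case
    using mid.IH
  proof (eventually_elim, intro impI)
    fix x assume x: "x \<in> V"
      "x \<in> V \<longrightarrow> (AE y in lborel. y \<in> V \<longrightarrow> (INF j\<in>{k..}. D j x y) \<le> ennreal (norm (y - x)) * (\<integral>\<^sup>+t\<in>{0..1}. ennreal (g (x + t *\<^sub>R (y - x))) \<partial>lborel))"
      "x \<in> V \<longrightarrow> (AE y in lborel. y \<in> V \<longrightarrow> (INF j\<in>{k..}. D j x y) \<le> ennreal (norm (y - x)) * (\<integral>\<^sup>+t\<in>{0..1}. ennreal (h (x + t *\<^sub>R (y - x))) \<partial>lborel))"
    from x(2)[rule_format, OF x(1)] x(3)[rule_format, OF x(1)]
    show "AE y in lborel. y \<in> V \<longrightarrow> (INF j\<in>{k..}. D j x y) \<le> ennreal (norm (y - x)) * (\<integral>\<^sup>+t\<in>{0..1}. ennreal ((g (x + t *\<^sub>R (y - x)) + h (x + t *\<^sub>R (y - x))) / 2) \<partial>lborel)"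
      unfolding sum by eventually_elim (use half in blast)
  qed
qed

text \<open>Along a subsequence the errors have integrals below \<open>(1 / 2) ^ n\<close>, so their
  sum \<open>G\<close> is integrable over \<open>V\<close> and has finite integrals along almost
  every segment. On such a segment the errors tend to 0 in mean, while the infima over tails
  increase to the limit of \<open>D j x y\<close>.\<close>

lemma mid_hull_limit_segment_bound:
  fixes \<psi> :: "nat \<Rightarrow> 'a::euclidean_space \<Rightarrow> real" and D :: "nat \<Rightarrow> 'a \<Rightarrow> 'a \<Rightarrow> ennreal"
  assumes V: "open V" "convex V" "bounded V"
    and m: "\<And>j. \<psi> j \<in> borel_measurable borel" and nn: "\<And>j z. 0 \<le> \<psi> j z"
    and H: "\<And>k. H k \<in> mid_hull \<psi> k" and h[measurable]: "h \<in> borel_measurable borel" and h0: "\<And>z. 0 \<le> h z"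
    and lim: "(\<lambda>k. \<integral>\<^sup>+z\<in>V. ennreal \<bar>H k z - h z\<bar> \<partial>lborel) \<longlonglongrightarrow> 0"
    and D: "\<And>j. AE x in lborel. x \<in> V \<longrightarrow> (AE y in lborel. y \<in> V \<longrightarrow>
      D j x y \<le> ennreal (norm (y - x)) * (\<integral>\<^sup>+t\<in>{0..1}. ennreal (\<psi> j (x + t *\<^sub>R (y - x))) \<partial>lborel))"
    and conv: "AE x in lborel. x \<in> V \<longrightarrow> (AE y in lborel. y \<in> V \<longrightarrow> (\<lambda>j. D j x y) \<longlonglongrightarrow> E x y)"
  shows "AE x in lborel. x \<in> V \<longrightarrow> (AE y in lborel. y \<in> V \<longrightarrow>
      E x y \<le> ennreal (norm (y - x)) * (\<integral>\<^sup>+t\<in>{0..1}. ennreal (h (x + t *\<^sub>R (y - x))) \<partial>lborel))"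
proof -
  have Vm[measurable]: "V \<in> sets borel" using V by simp
  have Hm[measurable]: "H k \<in> borel_measurable borel" for k by (rule mid_hull_measurable[OF H m])
  have H0: "0 \<le> H k z" for k z by (rule mid_hull_nonneg[OF H nn])
  have "\<exists>k\<ge>n. (\<integral>\<^sup>+z\<in>V. ennreal \<bar>H k z - h z\<bar> \<partial>lborel) < ennreal ((1 / 2) ^ n)" for n
  proof -
    have "\<forall>\<^sub>F k in sequentially. (\<integral>\<^sup>+z\<in>V. ennreal \<bar>H k z - h z\<bar> \<partial>lborel) < ennreal ((1 / 2) ^ n)"
      by (rule order_tendstoD(2)[OF lim]) simp
    then show ?thesis unfolding eventually_sequentially by (meson linorder_linear order_refl)
  qed
  then obtain s where s: "\<And>n. s n \<ge> n" "\<And>n. (\<integral>\<^sup>+z\<in>V. ennreal \<bar>H (s n) z - h z\<bar> \<partial>lborel) < ennreal ((1 / 2) ^ n)"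
    by metis
  have Hs: "H (s n) \<in> mid_hull \<psi> n" for n by (rule mid_hull_antimono[OF H s(1)])
  define G where "G z = (\<Sum>n. ennreal \<bar>H (s n) z - h z\<bar>)" for z
  have Gm[measurable]: "G \<in> borel_measurable borel" unfolding G_def[abs_def] by measurable
  have "(\<integral>\<^sup>+z\<in>V. G z \<partial>lborel) = (\<integral>\<^sup>+z. (\<Sum>n. ennreal \<bar>H (s n) z - h z\<bar> * indicator V z) \<partial>lborel)"
    by (simp add: G_def)
  also have "\<dots> = (\<Sum>n. \<integral>\<^sup>+z\<in>V. ennreal \<bar>H (s n) z - h z\<bar> \<partial>lborel)"
    by (rule nn_integral_suminf) measurable
  also have "\<dots> \<le> (\<Sum>n. ennreal ((1 / 2) ^ n))" by (intro suminf_le summableI less_imp_le s(2))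
  also have "\<dots> = ennreal (\<Sum>n. (1 / 2) ^ n)" by (rule suminf_ennreal2) (auto intro: summable_geometric)
  also have "\<dots> < \<infinity>" by simp
  finally have Gfin: "(\<integral>\<^sup>+z\<in>V. G z \<partial>lborel) < \<infinity>" .
  define e where "e n x y = (\<integral>\<^sup>+t\<in>{0..1}. ennreal \<bar>H (s n) (x + t *\<^sub>R (y - x)) - h (x + t *\<^sub>R (y - x))\<bar> \<partial>lborel)" for n x y
  define I where "I x y = (\<integral>\<^sup>+t\<in>{0..1}. ennreal (h (x + t *\<^sub>R (y - x))) \<partial>lborel)" for x y
  have e0: "(\<lambda>n. e n x y) \<longlonglongrightarrow> 0" if "(\<integral>\<^sup>+t\<in>{0..1}. G (x + t *\<^sub>R (y - x)) \<partial>lborel) < \<infinity>" for x y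
  proof (rule ennreal_suminf_tendsto_0)
    have "(\<Sum>n. e n x y) = (\<integral>\<^sup>+t. (\<Sum>n. ennreal \<bar>H (s n) (x + t *\<^sub>R (y - x)) - h (x + t *\<^sub>R (y - x))\<bar> * indicator {0..1} t) \<partial>lborel)"
      unfolding e_def by (rule nn_integral_suminf[symmetric]) measurable
    also have "\<dots> = (\<integral>\<^sup>+t\<in>{0..1}. G (x + t *\<^sub>R (y - x)) \<partial>lborel)" by (simp add: G_def)
    finally show "(\<Sum>n. e n x y) < \<infinity>" using that by simp
  qed
  have Hle: "(\<integral>\<^sup>+t\<in>{0..1}. ennreal (H (s n) (x + t *\<^sub>R (y - x))) \<partial>lborel) \<le> I x y + e n x y" for n x y
  proof -
    have le: "ennreal (H (s n) z) \<le> ennreal (h z) + ennreal \<bar>H (s n) z - h z\<bar>" for z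
    proof -
      have "ennreal (H (s n) z) \<le> ennreal (h z + \<bar>H (s n) z - h z\<bar>)" by (intro ennreal_leI) linarith
      also have "\<dots> = ennreal (h z) + ennreal \<bar>H (s n) z - h z\<bar>" by (intro ennreal_plus h0 abs_ge_zero)
      finally show ?thesis .
    qed
    have "(\<integral>\<^sup>+t\<in>{0..1}. ennreal (H (s n) (x + t *\<^sub>R (y - x))) \<partial>lborel) \<le>
      (\<integral>\<^sup>+t. ennreal (h (x + t *\<^sub>R (y - x))) * indicator {0..1} t +
        ennreal \<bar>H (s n) (x + t *\<^sub>R (y - x)) - h (x + t *\<^sub>R (y - x))\<bar> * indicator {0..1} t \<partial>lborel)"
      using le by (intro nn_integral_mono) (auto simp: indicator_def)
    also have "\<dots> = I x y + e n x y"
      unfolding I_def e_def by (rule nn_integral_add) measurable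
    finally show ?thesis .
  qed
  have bound: "AE x in lborel. \<forall>n. x \<in> V \<longrightarrow> (AE y in lborel. y \<in> V \<longrightarrow>
      (INF j\<in>{n..}. D j x y) \<le> ennreal (norm (y - x)) * (\<integral>\<^sup>+t\<in>{0..1}. ennreal (H (s n) (x + t *\<^sub>R (y - x))) \<partial>lborel))"
    unfolding AE_all_countable by (intro allI mid_hull_segment_bound[OF Hs m nn D])
  have fin: "AE x in lborel. x \<in> V \<longrightarrow> (AE y in lborel. y \<in> V \<longrightarrow> (\<integral>\<^sup>+t\<in>{0..1}. G (x + t *\<^sub>R (y - x)) \<partial>lborel) < \<infinity>)"
    by (rule AE_finite_segment_integral[OF Gm Vm V(2,3) Gfin])
  show ?thesis
    using bound fin conv
  proof (eventually_elim, intro impI)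
    fix x assume b: "\<forall>n. x \<in> V \<longrightarrow> (AE y in lborel. y \<in> V \<longrightarrow>
        (INF j\<in>{n..}. D j x y) \<le> ennreal (norm (y - x)) * (\<integral>\<^sup>+t\<in>{0..1}. ennreal (H (s n) (x + t *\<^sub>R (y - x))) \<partial>lborel))"
      and f: "x \<in> V \<longrightarrow> (AE y in lborel. y \<in> V \<longrightarrow> (\<integral>\<^sup>+t\<in>{0..1}. G (x + t *\<^sub>R (y - x)) \<partial>lborel) < \<infinity>)"
      and c: "x \<in> V \<longrightarrow> (AE y in lborel. y \<in> V \<longrightarrow> (\<lambda>j. D j x y) \<longlonglongrightarrow> E x y)" and x: "x \<in> V"
    have b': "AE y in lborel. \<forall>n. y \<in> V \<longrightarrow>
        (INF j\<in>{n..}. D j x y) \<le> ennreal (norm (y - x)) * (\<integral>\<^sup>+t\<in>{0..1}. ennreal (H (s n) (x + t *\<^sub>R (y - x))) \<partial>lborel)"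
      unfolding AE_all_countable using b x by blast
    show "AE y in lborel. y \<in> V \<longrightarrow> E x y \<le> ennreal (norm (y - x)) * (\<integral>\<^sup>+t\<in>{0..1}. ennreal (h (x + t *\<^sub>R (y - x))) \<partial>lborel)"
      using b' f[rule_format, OF x] c[rule_format, OF x]
    proof (eventually_elim, intro impI)
      fix y assume b: "\<forall>n. y \<in> V \<longrightarrow>
        (INF j\<in>{n..}. D j x y) \<le> ennreal (norm (y - x)) * (\<integral>\<^sup>+t\<in>{0..1}. ennreal (H (s n) (x + t *\<^sub>R (y - x))) \<partial>lborel)"
        and f: "y \<in> V \<longrightarrow> (\<integral>\<^sup>+t\<in>{0..1}. G (x + t *\<^sub>R (y - x)) \<partial>lborel) < \<infinity>"
        and c: "y \<in> V \<longrightarrow> (\<lambda>j. D j x y) \<longlonglongrightarrow> E x y" and y: "y \<in> V"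
      have up: "(\<lambda>n. ennreal (norm (y - x)) * (I x y + e n x y)) \<longlonglongrightarrow> ennreal (norm (y - x)) * (I x y + 0)"
        by (intro ennreal_tendsto_cmult tendsto_add tendsto_const e0) (use f y in auto)
      have "incseq (\<lambda>n. INF j\<in>{n..}. D j x y)" by (auto simp: incseq_def intro!: INF_superset_mono)
      then have "(\<lambda>n. INF j\<in>{n..}. D j x y) \<longlonglongrightarrow> (SUP n. INF j\<in>{n..}. D j x y)" by (rule LIMSEQ_SUP)
      also have "(SUP n. INF j\<in>{n..}. D j x y) = liminf (\<lambda>j. D j x y)" by (rule liminf_SUP_INF[symmetric])
      also have "\<dots> = E x y" using c y by (intro lim_imp_Liminf) auto
      finally have lo: "(\<lambda>n. INF j\<in>{n..}. D j x y) \<longlonglongrightarrow> E x y" .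
      have "(INF j\<in>{n..}. D j x y) \<le> ennreal (norm (y - x)) * (I x y + e n x y)" for n
        using b[rule_format, OF y, of n] mult_left_mono[OF Hle[where n=n and x=x and y=y], of "ennreal (norm (y - x))"] by (meson order_trans zero_le)
      then have "E x y \<le> ennreal (norm (y - x)) * (I x y + 0)" by (intro LIMSEQ_le[OF lo up]) auto
      then show "E x y \<le> ennreal (norm (y - x)) * (\<integral>\<^sup>+t\<in>{0..1}. ennreal (h (x + t *\<^sub>R (y - x))) \<partial>lborel)"
        by (simp add: I_def)
    qed
  qed
qed

theorem W1p_segment_bound:
  fixes f :: "real^'m::finite \<Rightarrow> ell2 multiset"
  assumes f: "f \<in> W1p_QQ Q U p" and p: "1 < p" and U: "open U" "V \<subseteq> U"
    and V: "open V" "convex V" "bounded V"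
  obtains \<Phi> :: "real^'m \<Rightarrow> ennreal" where "\<Phi> \<in> borel_measurable borel" "(\<integral>\<^sup>+z. \<Phi> z \<partial>lborel) < \<infinity>"
    "AE x in lborel. x \<in> V \<longrightarrow> (AE y in lborel. y \<in> V \<longrightarrow>
      ennreal (G2 (f x) (f y)) \<le> ennreal (norm (y - x)) * (\<integral>\<^sup>+t\<in>{0..1}. \<Phi> (x + t *\<^sub>R (y - x)) \<partial>lborel))"
proof -
  have Vm[measurable]: "V \<in> sets borel" using V by simp
  obtain F C where lip: "\<And>j::nat. Lipschitz_continuous_map euclidean_metric (QQ_metric Q) (F j)"
    and C: "\<And>j. (\<integral>\<^sup>+x\<in>U. ennreal (Dnorm Q UNIV (F j) x powr p) \<partial>lborel) \<le> ennreal C" "0 \<le> C"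
    and conv: "AE x in lborel. x \<in> U \<longrightarrow> (\<lambda>j. G2 (f x) (F j x)) \<longlonglongrightarrow> 0"
    by (rule W1p_AE_convergent[OF f p U(1)]) (rule that; assumption)
  have "\<forall>j. \<exists>\<psi> :: real^'m \<Rightarrow> real. \<psi> \<in> borel_measurable borel \<and> (\<forall>z. 0 \<le> \<psi> z) \<and>
    (AE z in lborel. z \<in> V \<longrightarrow> \<psi> z \<le> Dnorm Q UNIV (F j) z) \<and>
    (AE x in lborel. x \<in> V \<longrightarrow> (AE y in lborel. y \<in> V \<longrightarrow>
      ennreal (G2 (F j x) (F j y)) \<le> ennreal (norm (y - x)) * (\<integral>\<^sup>+t\<in>{0..1}. ennreal (\<psi> (x + t *\<^sub>R (y - x))) \<partial>lborel)))"
    by (intro allI lipschitz_upper_gradient lip V)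
  then obtain \<psi> :: "nat \<Rightarrow> real^'m \<Rightarrow> real" where m[measurable]: "\<And>j. \<psi> j \<in> borel_measurable borel" and nn: "\<And>j z. 0 \<le> \<psi> j z"
    and le: "\<And>j. AE z in lborel. z \<in> V \<longrightarrow> \<psi> j z \<le> Dnorm Q UNIV (F j) z"
    and seg: "\<And>j. AE x in lborel. x \<in> V \<longrightarrow> (AE y in lborel. y \<in> V \<longrightarrow>
      ennreal (G2 (F j x) (F j y)) \<le> ennreal (norm (y - x)) * (\<integral>\<^sup>+t\<in>{0..1}. ennreal (\<psi> j (x + t *\<^sub>R (y - x))) \<partial>lborel))"
    by (auto dest!: choice)
  define M where "M = restrict_space (lborel :: (real^'m) measure) V"
  have int: "(\<integral>\<^sup>+x. u x \<partial>M) = (\<integral>\<^sup>+x\<in>V. u x \<partial>lborel)" for u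
    unfolding M_def by (rule nn_integral_restrict_space) simp
  have M: "finite_measure M"
    unfolding M_def using emeasure_bounded_finite[OF V(3)]
    by (intro finite_measureI) (simp add: emeasure_restrict_space space_restrict_space less_top)
  have mM: "\<psi> j \<in> borel_measurable M" for j unfolding M_def using m by (intro measurable_restrict_space1) simp
  have pint: "(\<integral>\<^sup>+x. ennreal (\<psi> j x powr p) \<partial>M) \<le> ennreal C" for j
  proof -
    have "(\<integral>\<^sup>+x. ennreal (\<psi> j x powr p) \<partial>M) \<le> (\<integral>\<^sup>+x\<in>U. ennreal (Dnorm Q UNIV (F j) x powr p) \<partial>lborel)"
      unfolding int
    proof (rule nn_integral_mono_AE)
      show "AE x in lborel. ennreal (\<psi> j x powr p) * indicator V x \<le> ennreal (Dnorm Q UNIV (F j) x powr p) * indicator U x"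
        using le[of j]
      proof eventually_elim
        fix x assume le: "x \<in> V \<longrightarrow> \<psi> j x \<le> Dnorm Q UNIV (F j) x"
        show "ennreal (\<psi> j x powr p) * indicator V x \<le> ennreal (Dnorm Q UNIV (F j) x powr p) * indicator U x"
        proof (cases "x \<in> V")
          case True
          then have "\<psi> j x powr p \<le> Dnorm Q UNIV (F j) x powr p" using le nn p by (intro powr_mono2) auto
          then show ?thesis using True U(2) by (auto intro: ennreal_leI)
        qed simp
      qed
    qed
    then show ?thesis using C(1)[of j] by (rule order_trans)
  qed
  obtain H where H: "\<And>k. H k \<in> mid_hull \<psi> k" and hfin: "(\<integral>\<^sup>+x. ennreal \<bar>lim (\<lambda>k. H k x)\<bar> \<partial>M) < \<infinity>"
    and Hlim: "(\<lambda>k. \<integral>\<^sup>+x. ennreal \<bar>H k x - \<bar>lim (\<lambda>k. H k x)\<bar>\<bar> \<partial>M) \<longlonglongrightarrow> 0"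
    by (rule mid_hull_L1_convergent[of M \<psi>, OF M mM nn p pint C(2)]) (rule that; assumption)
  define h where "h x = \<bar>lim (\<lambda>k. H k x)\<bar>" for x
  have Hm[measurable]: "H k \<in> borel_measurable borel" for k by (rule mid_hull_measurable[OF H m])
  have hm[measurable]: "h \<in> borel_measurable borel"
    unfolding h_def[abs_def] by (intro borel_measurable_abs borel_measurable_lim_metric Hm)
  have h0: "0 \<le> h x" for x by (simp add: h_def)
  have fQ: "f x \<in> QQ Q" if "x \<in> U" for x
  proof -
    have "f \<in> measurable (restrict_space borel U) (QQ_borel Q)" using f by (simp add: W1p_QQ_def Lp_QQ_def)
    from measurable_space[OF this] show ?thesis using that by (simp add: space_restrict_space)
  qed
  have FQ: "F j x \<in> QQ Q" for j x using lip[of j] unfolding Lipschitz_continuous_map_def by auto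
  have conv2: "(\<lambda>j. ennreal (G2 (F j x) (F j y))) \<longlonglongrightarrow> ennreal (G2 (f x) (f y))"
    if "x \<in> U" "y \<in> U" "(\<lambda>j. G2 (f x) (F j x)) \<longlonglongrightarrow> 0" "(\<lambda>j. G2 (f y) (F j y)) \<longlonglongrightarrow> 0" for x y
  proof (rule tendsto_ennrealI)
    have "(\<lambda>j. G2 (F j x) (F j y) - G2 (f x) (f y)) \<longlonglongrightarrow> 0"
    proof (rule Lim_null_comparison)
      have "\<bar>G2 (F j x) (F j y) - G2 (f x) (f y)\<bar> \<le> G2 (f x) (F j x) + G2 (f y) (F j y)" for j
        using G2_diff_le[OF FQ[of j x] fQ[OF that(1)] FQ[of j y]] G2_diff_le[OF FQ[of j y] fQ[OF that(2)] fQ[OF that(1)]]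
          G2_sym[of "F j x" "f x"] G2_sym[of "F j y" "f y"] G2_sym[of "F j y" "f x"] G2_sym[of "f y" "f x"] by linarith
      then show "\<forall>\<^sub>F j in sequentially. norm (G2 (F j x) (F j y) - G2 (f x) (f y)) \<le> G2 (f x) (F j x) + G2 (f y) (F j y)"
        by simp
      show "(\<lambda>j. G2 (f x) (F j x) + G2 (f y) (F j y)) \<longlonglongrightarrow> 0" using tendsto_add[OF that(3,4)] by simp
    qed
    then show "(\<lambda>j. G2 (F j x) (F j y)) \<longlonglongrightarrow> G2 (f x) (f y)" by (rule LIM_zero_cancel)
  qed
  have bound: "AE x in lborel. x \<in> V \<longrightarrow> (AE y in lborel. y \<in> V \<longrightarrow>
      ennreal (G2 (f x) (f y)) \<le> ennreal (norm (y - x)) * (\<integral>\<^sup>+t\<in>{0..1}. ennreal (h (x + t *\<^sub>R (y - x))) \<partial>lborel))"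
  proof (rule mid_hull_limit_segment_bound[OF V m nn H hm h0 _ seg])
    show "(\<lambda>k. \<integral>\<^sup>+z\<in>V. ennreal \<bar>H k z - h z\<bar> \<partial>lborel) \<longlonglongrightarrow> 0" using Hlim unfolding int h_def .
    show "AE x in lborel. x \<in> V \<longrightarrow> (AE y in lborel. y \<in> V \<longrightarrow>
        (\<lambda>j. ennreal (G2 (F j x) (F j y))) \<longlonglongrightarrow> ennreal (G2 (f x) (f y)))"
      using conv
    proof (eventually_elim, intro impI)
      fix x assume x: "x \<in> U \<longrightarrow> (\<lambda>j. G2 (f x) (F j x)) \<longlonglongrightarrow> 0" "x \<in> V"
      show "AE y in lborel. y \<in> V \<longrightarrow> (\<lambda>j. ennreal (G2 (F j x) (F j y))) \<longlonglongrightarrow> ennreal (G2 (f x) (f y))"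
        using conv by eventually_elim (use x U(2) conv2 in blast)
    qed
  qed
  show ?thesis
  \<comment> \<open>Cutting off outside \<open>V\<close> makes the function integrable on the whole
    space and changes nothing on segments between points of \<open>V\<close>.\<close>
  proof (rule that[of "\<lambda>z. ennreal (h z) * indicator V z"])
    show "(\<lambda>z. ennreal (h z) * indicator V z) \<in> borel_measurable borel" by measurable
    show "(\<integral>\<^sup>+z. ennreal (h z) * indicator V z \<partial>lborel) < \<infinity>" using hfin unfolding int h_def .
    have eq: "(\<integral>\<^sup>+t\<in>{0..1}. ennreal (h (x + t *\<^sub>R (y - x))) \<partial>lborel) =
        (\<integral>\<^sup>+t\<in>{0..1}. (ennreal (h (x + t *\<^sub>R (y - x))) * indicator V (x + t *\<^sub>R (y - x))) \<partial>lborel)" if "x \<in> V" "y \<in> V" for x y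
    proof (rule nn_integral_cong)
      fix t :: real
      have "x + t *\<^sub>R (y - x) \<in> V" if "t \<in> {0..1}"
        using convexD_alt[OF V(2) \<open>x \<in> V\<close> \<open>y \<in> V\<close>, of t] that by (simp add: algebra_simps)
      then show "ennreal (h (x + t *\<^sub>R (y - x))) * indicator {0..1} t =
        ennreal (h (x + t *\<^sub>R (y - x))) * indicator V (x + t *\<^sub>R (y - x)) * indicator {0..1} t"
        by (auto simp: indicator_def)
    qed
    show "AE x in lborel. x \<in> V \<longrightarrow> (AE y in lborel. y \<in> V \<longrightarrow>
      ennreal (G2 (f x) (f y)) \<le> ennreal (norm (y - x)) *
        (\<integral>\<^sup>+t\<in>{0..1}. (ennreal (h (x + t *\<^sub>R (y - x))) * indicator V (x + t *\<^sub>R (y - x))) \<partial>lborel))"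
      using bound
    proof (eventually_elim, intro impI)
      fix x assume x: "x \<in> V \<longrightarrow> (AE y in lborel. y \<in> V \<longrightarrow>
        ennreal (G2 (f x) (f y)) \<le> ennreal (norm (y - x)) * (\<integral>\<^sup>+t\<in>{0..1}. ennreal (h (x + t *\<^sub>R (y - x))) \<partial>lborel))" "x \<in> V"
      show "AE y in lborel. y \<in> V \<longrightarrow> ennreal (G2 (f x) (f y)) \<le> ennreal (norm (y - x)) *
        (\<integral>\<^sup>+t\<in>{0..1}. (ennreal (h (x + t *\<^sub>R (y - x))) * indicator V (x + t *\<^sub>R (y - x))) \<partial>lborel)"
        using x(1)[rule_format, OF x(2)] by eventually_elim (use eq[OF x(2)] in auto)
    qed
  qed
qed

section \<open>Poincare inequalities\<close>

text \<open>The tangent inequality for \<open>powr\<close> at \<open>a\<close>, scaled by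
  homogeneity to the tangent at 1.\<close>

lemma powr_tangent_le:
  fixes a s q :: real
  assumes "0 < a" "0 \<le> s" "1 \<le> q"
  shows "q * a powr (q - 1) * s \<le> s powr q + (q - 1) * a powr q"
proof -
  have "(s / a - 1) * q + 1 \<le> (s / a) powr q"
  proof (cases "s = 0")
    case True then show ?thesis using assms by simp
  next
    case False
    then have sa: "s / a > 0" using assms by simp
    have "q * 1 powr (q - 1) * (s / a - 1) \<le> (s / a) powr q - 1 powr q"
    proof (rule convex_on_imp_above_tangent[where A="{0<..}"])
      show "convex_on {0<..} (\<lambda>x. x powr q)" by (rule powr_convex) (use assms in auto)
      show "connected {0::real<..}" by simp
      show "(1::real) \<in> interior {0<..}" by (simp add: interior_open)
      show "s / a \<in> {0<..}" using sa by simp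
      show "((\<lambda>x. x powr q) has_real_derivative q * 1 powr (q - 1)) (at 1 within {0<..})"
        by (auto intro!: derivative_eq_intros)
    qed
    then show ?thesis by (simp add: mult.commute)
  qed
  then have "a powr q * ((s / a - 1) * q + 1) \<le> a powr q * (s / a) powr q"
    by (intro mult_left_mono) auto
  also have "\<dots> = s powr q" using assms by (simp add: powr_divide)
  finally have 1: "a powr q * ((s / a - 1) * q + 1) \<le> s powr q" .
  have "a powr q = a powr (q - 1) * a" using assms powr_add[of a "q - 1" 1] by simp
  then have 2: "a powr q * (s / a) = a powr (q - 1) * s" using assms by simp
  have "a powr q * ((s / a - 1) * q + 1) = q * (a powr q * (s / a)) - (q - 1) * a powr q"
    by (simp add: algebra_simps)
  also have "\<dots> = q * a powr (q - 1) * s - (q - 1) * a powr q" unfolding 2 by simp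
  finally have "a powr q * ((s / a - 1) * q + 1) = q * a powr (q - 1) * s - (q - 1) * a powr q" .
  then show ?thesis using 1 by simp
qed

text \<open>The tangent line at the mean value, in place of a general Jensen inequality.\<close>

lemma unit_interval_powr_bound:
  fixes \<psi> :: "real \<Rightarrow> real"
  assumes m[measurable]: "\<psi> \<in> borel_measurable borel" and nn: "\<And>t. 0 \<le> \<psi> t" and q: "1 \<le> q"
    and b: "0 \<le> b" "ennreal b \<le> (\<integral>\<^sup>+t\<in>{0..1}. ennreal (\<psi> t) \<partial>lborel)"
  shows "ennreal (b powr q) \<le> (\<integral>\<^sup>+t\<in>{0..1}. ennreal (\<psi> t powr q) \<partial>lborel)"
proof (cases "b = 0")
  case False
  then have b0: "b > 0" using b by simp
  define J where "J = (\<integral>\<^sup>+t\<in>{0..1}. ennreal (\<psi> t powr q) \<partial>lborel)"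
  have one: "(\<integral>\<^sup>+t. ennreal c * indicator {0..1::real} t \<partial>lborel) = ennreal c" for c
    by (simp add: nn_integral_cmult_indicator)
  have c0: "0 \<le> q * b powr (q - 1)" using q by simp
  have "ennreal (q * b powr (q - 1) * b) = ennreal (q * b powr (q - 1)) * ennreal b"
    using c0 b by (intro ennreal_mult) auto
  also have "\<dots> \<le> ennreal (q * b powr (q - 1)) * (\<integral>\<^sup>+t\<in>{0..1}. ennreal (\<psi> t) \<partial>lborel)"
    by (rule mult_left_mono[OF b(2)]) simp
  also have "\<dots> = (\<integral>\<^sup>+t. ennreal (q * b powr (q - 1)) * (ennreal (\<psi> t) * indicator {0..1} t) \<partial>lborel)"
    by (rule nn_integral_cmult[symmetric]) measurable
  also have "\<dots> \<le> (\<integral>\<^sup>+t. ennreal (\<psi> t powr q) * indicator {0..1} t + ennreal ((q - 1) * b powr q) * indicator {0..1} t \<partial>lborel)"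
  proof (rule nn_integral_mono)
    fix t :: real
    have "ennreal (q * b powr (q - 1)) * ennreal (\<psi> t) = ennreal (q * b powr (q - 1) * \<psi> t)"
      using c0 nn by (intro ennreal_mult[symmetric]) auto
    also have "\<dots> \<le> ennreal (\<psi> t powr q + (q - 1) * b powr q)"
      by (intro ennreal_leI powr_tangent_le b0 nn q)
    also have "\<dots> = ennreal (\<psi> t powr q) + ennreal ((q - 1) * b powr q)"
      using q by (intro ennreal_plus) auto
    finally show "ennreal (q * b powr (q - 1)) * (ennreal (\<psi> t) * indicator {0..1} t)
        \<le> ennreal (\<psi> t powr q) * indicator {0..1} t + ennreal ((q - 1) * b powr q) * indicator {0..1} t"
      by (auto simp: indicator_def)
  qed
  also have "\<dots> = J + ennreal ((q - 1) * b powr q)"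
    unfolding J_def by (subst nn_integral_add) (measurable, simp only: one)
  finally have le: "ennreal (q * b powr (q - 1) * b) \<le> J + ennreal ((q - 1) * b powr q)" .
  have "b powr q = b powr (q - 1) * b" using b0 powr_add[of b "q - 1" 1] by simp
  then have "q * b powr (q - 1) * b = b powr q + (q - 1) * b powr q" by (simp add: algebra_simps)
  then have "ennreal (b powr q) + ennreal ((q - 1) * b powr q) \<le> J + ennreal ((q - 1) * b powr q)"
    using le q by (simp add: ennreal_plus)
  then show ?thesis unfolding J_def[symmetric] by (simp add: ennreal_add_left_cancel_le add.commute)
qed simp

lemma segment_bound_powr:
  fixes \<psi> :: "'a::euclidean_space \<Rightarrow> real"
  assumes m[measurable]: "\<psi> \<in> borel_measurable borel" and nn: "\<And>z. 0 \<le> \<psi> z" and q: "1 \<le> q" and d: "0 \<le> d"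
    and le: "ennreal d \<le> ennreal (norm (y - x)) * (\<integral>\<^sup>+t\<in>{0..1}. ennreal (\<psi> (x + t *\<^sub>R (y - x))) \<partial>lborel)"
  shows "ennreal (d powr q) \<le> ennreal (norm (y - x) powr q) * (\<integral>\<^sup>+t\<in>{0..1}. ennreal (\<psi> (x + t *\<^sub>R (y - x)) powr q) \<partial>lborel)"
proof (cases "d = 0")
  case False
  define N where "N = norm (y - x)"
  have N: "N > 0"
  proof (rule ccontr)
    assume "\<not> N > 0"
    then have "y = x" by (simp add: N_def)
    then show False using le False d by simp
  qed
  have "ennreal (d / N) = ennreal (1 / N) * ennreal d" using d N by (simp add: ennreal_mult[symmetric])
  also have "\<dots> \<le> ennreal (1 / N) * (ennreal N * (\<integral>\<^sup>+t\<in>{0..1}. ennreal (\<psi> (x + t *\<^sub>R (y - x))) \<partial>lborel))"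
    using le by (intro mult_left_mono) (auto simp: N_def)
  also have "\<dots> = (ennreal (1 / N) * ennreal N) * (\<integral>\<^sup>+t\<in>{0..1}. ennreal (\<psi> (x + t *\<^sub>R (y - x))) \<partial>lborel)"
    by (simp only: mult.assoc)
  also have "ennreal (1 / N) * ennreal N = 1" using N by (subst ennreal_mult[symmetric]) auto
  finally have "ennreal (d / N) \<le> (\<integral>\<^sup>+t\<in>{0..1}. ennreal (\<psi> (x + t *\<^sub>R (y - x))) \<partial>lborel)" by simp
  then have "ennreal ((d / N) powr q) \<le> (\<integral>\<^sup>+t\<in>{0..1}. ennreal (\<psi> (x + t *\<^sub>R (y - x)) powr q) \<partial>lborel)"
    using d N by (intro unit_interval_powr_bound nn q) auto
  then have "ennreal (N powr q) * ennreal ((d / N) powr q) \<le> ennreal (N powr q) * (\<integral>\<^sup>+t\<in>{0..1}. ennreal (\<psi> (x + t *\<^sub>R (y - x)) powr q) \<partial>lborel)"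
    by (rule mult_left_mono) simp
  moreover have "ennreal (N powr q) * ennreal ((d / N) powr q) = ennreal (d powr q)"
    using d N by (subst ennreal_mult[symmetric]) (auto simp: powr_divide)
  ultimately show ?thesis by (simp add: N_def)
qed simp

text \<open>If \<open>R > b\<close> held at all good points, then \<open>R - b\<close> would have
  integral 0 over \<open>V\<close> although it is positive almost everywhere there. The property
  \<open>P\<close> is carried along so that a single point serves both estimates.\<close>

lemma exists_le_average:
  fixes R :: "'a::euclidean_space \<Rightarrow> ennreal"
  assumes m[measurable]: "R \<in> borel_measurable borel" and V[measurable]: "V \<in> sets borel"
    and pos: "0 < emeasure lborel V" "emeasure lborel V < \<infinity>"
    and int: "(\<integral>\<^sup>+x\<in>V. R x \<partial>lborel) \<le> ennreal (b * measure lborel V)" "0 \<le> b"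
    and good: "AE x in lborel. x \<in> V \<longrightarrow> P x"
  shows "\<exists>x\<in>V. P x \<and> R x \<le> ennreal b"
proof (rule ccontr)
  assume no: "\<not> ?thesis"
  have eV: "emeasure lborel V = ennreal (measure lborel V)" using pos(2) by (intro emeasure_eq_ennreal_measure) auto
  have AEb: "AE x in lborel. x \<in> V \<longrightarrow> ennreal b < R x"
    using good by eventually_elim (use no not_le in blast)
  have bint: "(\<integral>\<^sup>+x. ennreal b * indicator V x \<partial>lborel) = ennreal (b * measure lborel V)"
    using int(2) by (simp add: nn_integral_cmult_indicator eV ennreal_mult)
  have "(\<integral>\<^sup>+x. (R x - ennreal b) * indicator V x \<partial>lborel) = 0"
  proof -
    have "(\<integral>\<^sup>+x. (R x - ennreal b) * indicator V x \<partial>lborel) + ennreal (b * measure lborel V)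
      = (\<integral>\<^sup>+x. (R x - ennreal b) * indicator V x + ennreal b * indicator V x \<partial>lborel)"
      unfolding bint[symmetric] by (rule nn_integral_add[symmetric]) measurable
    also have "\<dots> = (\<integral>\<^sup>+x\<in>V. R x \<partial>lborel)"
    proof (rule nn_integral_cong_AE)
      show "AE x in lborel. (R x - ennreal b) * indicator V x + ennreal b * indicator V x = R x * indicator V x"
        using AEb by eventually_elim (auto simp: indicator_def diff_add_cancel_ennreal less_imp_le)
    qed
    also have "\<dots> \<le> 0 + ennreal (b * measure lborel V)" using int(1) by simp
    finally show ?thesis by (simp add: ennreal_add_left_cancel_le add.commute)
  qed
  then have "AE x in lborel. (R x - ennreal b) * indicator V x = 0"
    by (subst (asm) nn_integral_0_iff_AE) auto
  with AEb have "AE x in lborel. x \<notin> V"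
    by eventually_elim (auto simp: indicator_def diff_eq_0_iff_ennreal not_less[symmetric])
  then have "emeasure lborel V = 0" by (subst (asm) AE_iff_measurable[OF _ refl]) auto
  then show False using pos(1) by simp
qed

text \<open>The kernel is symmetric, so after exchanging the integrals the inner one is bounded
  through the measure of \<open>V\<close> alone, whatever \<open>z\<close> is.\<close>

lemma riesz_potential_integral:
  fixes G :: "'a::euclidean_space \<Rightarrow> ennreal"
  assumes G[measurable]: "G \<in> borel_measurable borel" and V[measurable]: "V \<in> sets borel" and fin: "emeasure lborel V < \<infinity>"
  shows "(\<integral>\<^sup>+x\<in>V. (\<integral>\<^sup>+z\<in>V. (G z * ennreal (1 / norm (z - x) ^ (DIM('a) - 1))) \<partial>lborel) \<partial>lborel)
    \<le> ennreal (riesz_const DIM('a) * measure lborel V powr (1 / real DIM('a))) * (\<integral>\<^sup>+z\<in>V. G z \<partial>lborel)"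
proof -
  let ?k = "\<lambda>x z :: 'a. ennreal (1 / norm (z - x) ^ (DIM('a) - 1))"
  let ?C = "ennreal (riesz_const DIM('a) * measure lborel V powr (1 / real DIM('a)))"
  have "(\<integral>\<^sup>+x\<in>V. (\<integral>\<^sup>+z\<in>V. (G z * ?k x z) \<partial>lborel) \<partial>lborel) =
    (\<integral>\<^sup>+x. \<integral>\<^sup>+z. G z * ?k x z * indicator V z * indicator V x \<partial>lborel \<partial>lborel)"
    by (intro nn_integral_cong nn_integral_multc[symmetric]) measurable
  also have "\<dots> = (\<integral>\<^sup>+z. \<integral>\<^sup>+x. G z * ?k x z * indicator V z * indicator V x \<partial>lborel \<partial>lborel)"
    by (rule lborel_pair.Fubini') measurable
  also have "\<dots> = (\<integral>\<^sup>+z. (G z * indicator V z) * (\<integral>\<^sup>+x\<in>V. ennreal (1 / norm (x - z) ^ (DIM('a) - 1)) \<partial>lborel) \<partial>lborel)"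
  proof (rule nn_integral_cong)
    fix z :: 'a
    have "(\<integral>\<^sup>+x. G z * ?k x z * indicator V z * indicator V x \<partial>lborel) =
      (\<integral>\<^sup>+x. (G z * indicator V z) * (ennreal (1 / norm (x - z) ^ (DIM('a) - 1)) * indicator V x) \<partial>lborel)"
      by (simp add: norm_minus_commute mult_ac)
    also have "\<dots> = (G z * indicator V z) * (\<integral>\<^sup>+x\<in>V. ennreal (1 / norm (x - z) ^ (DIM('a) - 1)) \<partial>lborel)"
      by (rule nn_integral_cmult) measurable
    finally show "(\<integral>\<^sup>+x. G z * ?k x z * indicator V z * indicator V x \<partial>lborel) = \<dots>" .
  qed
  also have "\<dots> \<le> (\<integral>\<^sup>+z. (G z * indicator V z) * ?C \<partial>lborel)"
    by (intro nn_integral_mono mult_left_mono riesz_measure_bound V fin) simp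
  also have "\<dots> = ?C * (\<integral>\<^sup>+z\<in>V. G z \<partial>lborel)"
    by (subst nn_integral_multc) (auto simp: mult.commute)
  finally show ?thesis .
qed

text \<open>The bound \<open>\<Phi>\<close> merely supplies the Lipschitz pieces. The function
  obtained from the pieces is compared with \<open>Dnorm\<close>, and almost everywhere on
  \<open>V\<close> this equals \<open>delta_norm\<close>.\<close>

lemma W1p_upper_gradient:
  fixes f :: "real^'m::finite \<Rightarrow> ell2 multiset"
  assumes f: "f \<in> W1p_QQ Q U p" and p: "1 < p" and U: "open U" "V \<subseteq> U"
    and V: "open V" "convex V" "bounded V" "V \<noteq> {}"
  obtains \<psi> :: "real^'m \<Rightarrow> real" where "\<psi> \<in> borel_measurable borel" "\<And>z. 0 \<le> \<psi> z"
    "AE z in lborel. z \<in> V \<longrightarrow> \<psi> z \<le> delta_norm Q U f z"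
    "AE x in lborel. x \<in> V \<longrightarrow> (AE y in lborel. y \<in> V \<longrightarrow>
      ennreal (G2 (f x) (f y)) \<le> ennreal (norm (y - x)) * (\<integral>\<^sup>+t\<in>{0..1}. ennreal (\<psi> (x + t *\<^sub>R (y - x))) \<partial>lborel))"
proof -
  have fm: "f \<in> measurable (restrict_space borel U) (QQ_borel Q)" using f by (simp add: W1p_QQ_def Lp_QQ_def)
  have fQ: "f x \<in> QQ Q" if "x \<in> V" for x
    using measurable_space[OF fm] that U(2) by (auto simp: space_restrict_space)
  have tri: "G2 (f x) (f y) \<le> G2 (f x) (f z) + G2 (f y) (f z)" if "x \<in> V" "y \<in> V" "z \<in> V" for x y z
    using G2_triangle[OF fQ[OF that(1)] fQ[OF that(3)] fQ[OF that(2)]] by (simp add: G2_sym[of "f y"])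
  obtain \<Phi> :: "real^'m \<Rightarrow> ennreal" where Phi: "\<Phi> \<in> borel_measurable borel" "(\<integral>\<^sup>+z. \<Phi> z \<partial>lborel) < \<infinity>"
    "AE x in lborel. x \<in> V \<longrightarrow> (AE y in lborel. y \<in> V \<longrightarrow>
      ennreal (G2 (f x) (f y)) \<le> ennreal (norm (y - x)) * (\<integral>\<^sup>+t\<in>{0..1}. \<Phi> (x + t *\<^sub>R (y - x)) \<partial>lborel))"
    by (rule W1p_segment_bound[OF f p U V(1,2,3)])
  obtain A K where AK: "\<And>n::nat. A n \<in> sets borel" "\<And>n. A n \<subseteq> V" "\<And>n. K n \<ge> 0"
    "\<And>n x y. x \<in> A n \<Longrightarrow> y \<in> A n \<Longrightarrow> G2 (f x) (f y) \<le> K n * dist x y"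
    "AE x in lborel. x \<in> V \<longrightarrow> (\<forall>\<^sub>F n in sequentially. x \<in> A n)"
    "summable (\<lambda>n. K n * measure lborel (V - A n))"
    by (rule lipschitz_pieces[of \<Phi> V "\<lambda>x y. G2 (f x) (f y)", OF Phi(1,2) V tri G2_nonneg G2_self Phi(3)])
      (assumption | rule that; assumption)+
  obtain \<psi> :: "real^'m \<Rightarrow> real" where psi: "\<psi> \<in> borel_measurable borel" "\<And>z. 0 \<le> \<psi> z"
    "AE z in lborel. z \<in> V \<longrightarrow> \<psi> z \<le> Dnorm Q U f z \<and> delta_norm Q U f z = Dnorm Q U f z"
    "AE x in lborel. x \<in> V \<longrightarrow> (AE y in lborel. y \<in> V \<longrightarrow>
      ennreal (G2 (f x) (f y)) \<le> ennreal (norm (y - x)) * (\<integral>\<^sup>+t\<in>{0..1}. ennreal (\<psi> (x + t *\<^sub>R (y - x))) \<partial>lborel))"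
    by (rule upper_gradient_le_Dnorm[OF fm U V(1,2,3) AK]) (assumption | rule that; assumption)+
  have "AE z in lborel. z \<in> V \<longrightarrow> \<psi> z \<le> delta_norm Q U f z"
    using psi(3) by eventually_elim auto
  then show ?thesis using that psi(1,2,4) by blast
qed

text \<open>Dividing the kernel bound \<open>\<mu> powr (1 / m)\<close> by the measure
  \<open>\<mu>\<close> leaves the exponent \<open>1 / m - 1\<close>, which combines with
  \<open>D powr (m - 1)\<close> to a power of \<open>D ^ m / \<mu>\<close>.\<close>

lemma diameter_factor_eq:
  fixes D \<mu> q r S :: real
  assumes "0 < D" "0 < \<mu>" "m \<ge> 1"
  shows "D powr (q + real m - 1) * (r * \<mu> powr (1 / real m) * S / \<mu>) =
    r * D powr q * (D ^ m / \<mu>) powr (1 - 1 / real m) * S"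
proof -
  have "(D ^ m / \<mu>) powr (1 - 1 / real m) = (D ^ m) powr (1 - 1 / real m) / \<mu> powr (1 - 1 / real m)"
    by (rule powr_divide)
  also have "(D ^ m) powr (1 - 1 / real m) = D powr (real m * (1 - 1 / real m))"
    using assms by (simp add: powr_realpow[symmetric] powr_powr)
  also have "real m * (1 - 1 / real m) = real m - 1" using assms(3) by (simp add: right_diff_distrib)
  also have "\<mu> powr (1 - 1 / real m) = \<mu> / \<mu> powr (1 / real m)" using assms by (simp add: powr_diff)
  finally have eq: "(D ^ m / \<mu>) powr (1 - 1 / real m) = D powr (real m - 1) * \<mu> powr (1 / real m) / \<mu>" by simp
  have "D powr (q + real m - 1) = D powr q * D powr (real m - 1)"
    by (simp add: powr_add[symmetric] add_diff_eq)
  then show ?thesis unfolding eq by (simp add: mult_ac)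
qed

theorem theorem4p6p2:
  shows "\<exists>c::real. c \<ge> 1 \<and>
    (\<forall>(Q::nat) (U :: (real^'m::finite) set) (p::real) (f :: real^'m \<Rightarrow> ell2 multiset)
       (q::real) (V :: (real^'m) set).
      Q \<ge> 1 \<longrightarrow>
      U = UNIV \<or> (bounded U \<and> open U \<and> extension_property U) \<longrightarrow>
      1 < p \<longrightarrow>
      f \<in> W1p_QQ Q U p \<longrightarrow>
      1 \<le> q \<longrightarrow> q \<le> p \<longrightarrow>
      V \<noteq> {} \<longrightarrow> bounded V \<longrightarrow> open V \<longrightarrow> convex V \<longrightarrow> V \<subseteq> U \<longrightarrow>
      (AE x in lebesgue_on V.
         (\<integral>\<^sup>+y\<in>V. ennreal (G2 (f x) (f y) powr q) \<partial>lebesgue)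
         \<le> ennreal (diameter V powr (q + real CARD('m) - 1)) *
           (\<integral>\<^sup>+z\<in>V. ennreal (delta_norm Q U f z powr q / norm (z - x) ^ (CARD('m) - 1)) \<partial>lebesgue)) \<and>
      (\<exists>v\<in>QQ Q.
         (\<integral>\<^sup>+x\<in>V. ennreal (G2 (f x) v powr q) \<partial>lebesgue)
         \<le> ennreal (c * diameter V powr q *
               (diameter V ^ CARD('m) / measure lebesgue V) powr (1 - 1 / real CARD('m))) *
           (\<integral>\<^sup>+z\<in>V. ennreal (delta_norm Q U f z powr q) \<partial>lebesgue)))"
\<comment> \<open>The first inequality has constant 1 and the point \<open>x\<close> is chosen by
  the mean, so the constant of the kernel integral is the final one.\<close>
proof (intro exI[of _ "riesz_const CARD('m)"] conjI allI impI)
  show c1: "1 \<le> riesz_const CARD('m)" using riesz_const_ge1[where 'a="real^'m"] by simp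
  fix Q :: nat and U :: "(real^'m) set" and p :: real and f :: "real^'m \<Rightarrow> ell2 multiset"
    and q :: real and V :: "(real^'m) set"
  assume "1 \<le> Q" and UU: "U = UNIV \<or> (bounded U \<and> open U \<and> extension_property U)" and p: "1 < p"
    and f: "f \<in> W1p_QQ Q U p" and q: "1 \<le> q" "q \<le> p"
    and V: "V \<noteq> {}" "bounded V" "open V" "convex V" "V \<subseteq> U"
  let ?m = "CARD('m)"
  let ?D = "diameter V"
  define \<mu> where "\<mu> = measure lborel V"
  have U: "open U" using UU by auto
  have Vm[measurable]: "V \<in> sets borel" using V by simp
  have dist: "norm (y - x) \<le> ?D" if "x \<in> V" "y \<in> V" for x y
    using diameter_bounded_bound[OF V(2) that(2,1)] by (simp add: dist_norm)
  have eV: "0 < emeasure lborel V" "emeasure lborel V < \<infinity>"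
    using emeasure_bounded_finite[OF V(2)] open_not_negligible[OF V(3,1)]
    by (auto simp: negligible_iff_emeasure0 zero_less_iff_neq_zero)
  have mu: "0 < \<mu>" using eV unfolding \<mu>_def by (simp add: measure_def enn2real_positive_iff)
  have D0: "0 < ?D"
  proof (rule ccontr)
    assume "\<not> 0 < ?D"
    obtain x where "x \<in> V" using V(1) by blast
    have "V \<subseteq> {x}"
    proof
      fix y assume "y \<in> V"
      then have "norm (y - x) \<le> 0" using dist[OF \<open>x \<in> V\<close>, of y] \<open>\<not> 0 < ?D\<close> by linarith
      then show "y \<in> {x}" by simp
    qed
    then have "emeasure lborel V \<le> emeasure lborel {x}" by (intro emeasure_mono) auto
    then show False using eV(1) by simp
  qed
  have fm: "f \<in> measurable (restrict_space borel U) (QQ_borel Q)" using f by (simp add: W1p_QQ_def Lp_QQ_def)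
  have fQ: "f x \<in> QQ Q" if "x \<in> V" for x
    using measurable_space[OF fm] that V(5) by (auto simp: space_restrict_space)
  obtain \<psi> :: "real^'m \<Rightarrow> real" where psi[measurable]: "\<psi> \<in> borel_measurable borel" and nn: "\<And>z. 0 \<le> \<psi> z"
    and le: "AE z in lborel. z \<in> V \<longrightarrow> \<psi> z \<le> delta_norm Q U f z"
    and seg: "AE x in lborel. x \<in> V \<longrightarrow> (AE y in lborel. y \<in> V \<longrightarrow>
      ennreal (G2 (f x) (f y)) \<le> ennreal (norm (y - x)) * (\<integral>\<^sup>+t\<in>{0..1}. ennreal (\<psi> (x + t *\<^sub>R (y - x))) \<partial>lborel))"
    by (rule W1p_upper_gradient[OF f p U V(5,3,4,2,1)]) (rule that; assumption)
  \<comment> \<open>The potential is formed with the Borel function \<open>\<psi>\<close>, so that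
    it can be integrated in \<open>x\<close>; \<open>delta_norm\<close> enters through monotonicity
    only.\<close>
  define R where "R x = (\<integral>\<^sup>+z\<in>V. (ennreal (\<psi> z powr q) * ennreal (1 / norm (z - x) ^ (?m - 1))) \<partial>lborel)" for x
  have Rm: "R \<in> borel_measurable borel" unfolding R_def[abs_def] by measurable
  have good: "AE x in lborel. x \<in> V \<longrightarrow>
    (\<integral>\<^sup>+y\<in>V. ennreal (G2 (f x) (f y) powr q) \<partial>lborel) \<le> ennreal (?D powr (q + real ?m - 1)) * R x"
    using seg
  proof (eventually_elim, intro impI)
    fix x assume x: "x \<in> V \<longrightarrow> (AE y in lborel. y \<in> V \<longrightarrow>
      ennreal (G2 (f x) (f y)) \<le> ennreal (norm (y - x)) * (\<integral>\<^sup>+t\<in>{0..1}. ennreal (\<psi> (x + t *\<^sub>R (y - x))) \<partial>lborel))" "x \<in> V"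
    have "(\<integral>\<^sup>+y\<in>V. ennreal (G2 (f x) (f y) powr q) \<partial>lborel) \<le>
      (\<integral>\<^sup>+y\<in>V. (ennreal (norm (y - x) powr q) * (\<integral>\<^sup>+t\<in>{0..1}. ennreal (\<psi> (x + t *\<^sub>R (y - x)) powr q) \<partial>lborel)) \<partial>lborel)"
    proof (rule nn_integral_mono_AE)
      show "AE y in lborel. ennreal (G2 (f x) (f y) powr q) * indicator V y \<le>
        ennreal (norm (y - x) powr q) * (\<integral>\<^sup>+t\<in>{0..1}. ennreal (\<psi> (x + t *\<^sub>R (y - x)) powr q) \<partial>lborel) * indicator V y"
        using x(1)[rule_format, OF x(2)]
      proof eventually_elim
        fix y assume y: "y \<in> V \<longrightarrow> ennreal (G2 (f x) (f y)) \<le> ennreal (norm (y - x)) * (\<integral>\<^sup>+t\<in>{0..1}. ennreal (\<psi> (x + t *\<^sub>R (y - x))) \<partial>lborel)"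
        show "ennreal (G2 (f x) (f y) powr q) * indicator V y \<le>
          ennreal (norm (y - x) powr q) * (\<integral>\<^sup>+t\<in>{0..1}. ennreal (\<psi> (x + t *\<^sub>R (y - x)) powr q) \<partial>lborel) * indicator V y"
        proof (cases "y \<in> V")
          case True
          then show ?thesis using segment_bound_powr[OF psi nn q(1) G2_nonneg y[rule_format, OF True]] by simp
        qed simp
      qed
    qed
    also have "\<dots> \<le> ennreal (?D powr (q + real DIM(real^'m) - 1)) *
      (\<integral>\<^sup>+z\<in>V. (ennreal (\<psi> z powr q) * ennreal (1 / norm (z - x) ^ (DIM(real^'m) - 1))) \<partial>lborel)"
      by (rule segment_potential_bound) (use V x(2) dist q in auto)
    finally show "(\<integral>\<^sup>+y\<in>V. ennreal (G2 (f x) (f y) powr q) \<partial>lborel) \<le> ennreal (?D powr (q + real ?m - 1)) * R x"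
      by (simp add: R_def)
  qed
  have Rle: "R x \<le> (\<integral>\<^sup>+z\<in>V. ennreal (delta_norm Q U f z powr q / norm (z - x) ^ (?m - 1)) \<partial>lborel)" for x
    unfolding R_def
  proof (rule nn_integral_mono_AE)
    show "AE z in lborel. ennreal (\<psi> z powr q) * ennreal (1 / norm (z - x) ^ (?m - 1)) * indicator V z \<le>
      ennreal (delta_norm Q U f z powr q / norm (z - x) ^ (?m - 1)) * indicator V z"
      using le
    proof eventually_elim
      fix z assume z: "z \<in> V \<longrightarrow> \<psi> z \<le> delta_norm Q U f z"
      show "ennreal (\<psi> z powr q) * ennreal (1 / norm (z - x) ^ (?m - 1)) * indicator V z \<le>
        ennreal (delta_norm Q U f z powr q / norm (z - x) ^ (?m - 1)) * indicator V z"
      proof (cases "z \<in> V")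
        case True
        have "\<psi> z powr q \<le> delta_norm Q U f z powr q" using z True nn q by (intro powr_mono2) auto
        then have "\<psi> z powr q * (1 / norm (z - x) ^ (?m - 1)) \<le> delta_norm Q U f z powr q / norm (z - x) ^ (?m - 1)"
          by (simp add: divide_right_mono)
        then have "ennreal (\<psi> z powr q * (1 / norm (z - x) ^ (?m - 1))) \<le> ennreal (delta_norm Q U f z powr q / norm (z - x) ^ (?m - 1))"
          by (rule ennreal_leI)
        moreover have "ennreal (\<psi> z powr q * (1 / norm (z - x) ^ (?m - 1))) = ennreal (\<psi> z powr q) * ennreal (1 / norm (z - x) ^ (?m - 1))"
          by (intro ennreal_mult) auto
        ultimately show ?thesis using True by (simp only: indicator_simps mult_1_right)
      qed simp
    qed
  qed
  have Sle: "(\<integral>\<^sup>+z\<in>V. ennreal (\<psi> z powr q) \<partial>lborel) \<le> (\<integral>\<^sup>+z\<in>V. ennreal (delta_norm Q U f z powr q) \<partial>lborel)"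
  proof (rule nn_integral_mono_AE)
    show "AE z in lborel. ennreal (\<psi> z powr q) * indicator V z \<le> ennreal (delta_norm Q U f z powr q) * indicator V z"
      using le
    proof eventually_elim
      fix z assume z: "z \<in> V \<longrightarrow> \<psi> z \<le> delta_norm Q U f z"
      show "ennreal (\<psi> z powr q) * indicator V z \<le> ennreal (delta_norm Q U f z powr q) * indicator V z"
        using z nn q by (auto simp: indicator_def intro!: ennreal_leI powr_mono2)
    qed
  qed
  show "AE x in lebesgue_on V.
         (\<integral>\<^sup>+y\<in>V. ennreal (G2 (f x) (f y) powr q) \<partial>lebesgue)
         \<le> ennreal (diameter V powr (q + real CARD('m) - 1)) *
           (\<integral>\<^sup>+z\<in>V. ennreal (delta_norm Q U f z powr q / norm (z - x) ^ (CARD('m) - 1)) \<partial>lebesgue)"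
  proof -
    have "AE x in lborel. x \<in> V \<longrightarrow> (\<integral>\<^sup>+y\<in>V. ennreal (G2 (f x) (f y) powr q) \<partial>lborel) \<le> ennreal (?D powr (q + real ?m - 1)) *
           (\<integral>\<^sup>+z\<in>V. ennreal (delta_norm Q U f z powr q / norm (z - x) ^ (?m - 1)) \<partial>lborel)"
      using good by eventually_elim (use Rle in \<open>meson mult_left_mono order_trans zero_le\<close>)
    then have "AE x in lebesgue. x \<in> V \<longrightarrow> (\<integral>\<^sup>+y\<in>V. ennreal (G2 (f x) (f y) powr q) \<partial>lborel) \<le> ennreal (?D powr (q + real ?m - 1)) *
           (\<integral>\<^sup>+z\<in>V. ennreal (delta_norm Q U f z powr q / norm (z - x) ^ (?m - 1)) \<partial>lborel)"
      by (rule AE_completion)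
    then show ?thesis by (simp add: AE_restrict_space_iff nn_integral_completion)
  qed
  let ?c = "riesz_const ?m * ?D powr q * (?D ^ ?m / \<mu>) powr (1 - 1 / real ?m)"
  have c0: "0 < ?c" using c1 D0 mu by simp
  have "\<exists>v\<in>QQ Q. (\<integral>\<^sup>+x\<in>V. ennreal (G2 (f x) v powr q) \<partial>lborel) \<le> ennreal ?c * (\<integral>\<^sup>+z\<in>V. ennreal (\<psi> z powr q) \<partial>lborel)"
  \<comment> \<open>For a finite integral \<open>x\<close> is chosen where \<open>R\<close> is at
    most its mean. If the integral is infinite, the right side is infinite because the constant is
    positive, and the value of \<open>f\<close> at any point will do.\<close>
  proof (cases "\<integral>\<^sup>+z\<in>V. ennreal (\<psi> z powr q) \<partial>lborel")
    case (real S)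
    define b where "b = riesz_const ?m * \<mu> powr (1 / real ?m) * S / \<mu>"
    have b0: "0 \<le> b" using c1 real mu by (simp add: b_def)
    have "(\<integral>\<^sup>+x\<in>V. R x \<partial>lborel) \<le> ennreal (riesz_const ?m * \<mu> powr (1 / real ?m)) * ennreal S"
      using riesz_potential_integral[of "\<lambda>z. ennreal (\<psi> z powr q)" V] eV(2) real(2)
      by (simp add: R_def \<mu>_def)
    also have "\<dots> = ennreal (b * measure lborel V)"
      using c1 real(1) mu by (subst ennreal_mult[symmetric]) (auto simp: b_def \<mu>_def)
    finally have "(\<integral>\<^sup>+x\<in>V. R x \<partial>lborel) \<le> ennreal (b * measure lborel V)" .
    from exists_le_average[OF Rm Vm eV this b0 good] obtain x where x: "x \<in> V"
      "(\<integral>\<^sup>+y\<in>V. ennreal (G2 (f x) (f y) powr q) \<partial>lborel) \<le> ennreal (?D powr (q + real ?m - 1)) * R x" "R x \<le> ennreal b"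
      by blast
    have "(\<integral>\<^sup>+y\<in>V. ennreal (G2 (f y) (f x) powr q) \<partial>lborel) = (\<integral>\<^sup>+y\<in>V. ennreal (G2 (f x) (f y) powr q) \<partial>lborel)"
      by (simp add: G2_sym[of "f x"])
    also note x(2)
    also have "ennreal (?D powr (q + real ?m - 1)) * R x \<le> ennreal (?D powr (q + real ?m - 1)) * ennreal b"
      by (rule mult_left_mono[OF x(3)]) simp
    also have "\<dots> = ennreal (?D powr (q + real ?m - 1) * b)" using b0 by (intro ennreal_mult[symmetric]) auto
    also have "?D powr (q + real ?m - 1) * b = ?c * S"
      unfolding b_def by (rule diameter_factor_eq[OF D0 mu]) (simp add: Suc_leI)
    also have "ennreal (?c * S) = ennreal ?c * ennreal S" using c0 real(1) by (intro ennreal_mult) auto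
    finally show ?thesis using fQ[OF x(1)] real(2) by auto
  next
    case top
    obtain x where "x \<in> V" using V(1) by blast
    have "ennreal ?c \<noteq> 0" using c0 by (simp only: ennreal_eq_0_iff not_le)
    then have "ennreal ?c * (\<integral>\<^sup>+z\<in>V. ennreal (\<psi> z powr q) \<partial>lborel) = top"
      unfolding top by (simp only: ennreal_mult_top if_False)
    then show ?thesis using fQ[OF \<open>x \<in> V\<close>] by (metis top_greatest)
  qed
  then obtain v where v: "v \<in> QQ Q" "(\<integral>\<^sup>+x\<in>V. ennreal (G2 (f x) v powr q) \<partial>lborel) \<le> ennreal ?c * (\<integral>\<^sup>+z\<in>V. ennreal (\<psi> z powr q) \<partial>lborel)"
    by blast
  have "(\<integral>\<^sup>+x\<in>V. ennreal (G2 (f x) v powr q) \<partial>lborel) \<le> ennreal ?c * (\<integral>\<^sup>+z\<in>V. ennreal (delta_norm Q U f z powr q) \<partial>lborel)"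
    using v(2) mult_left_mono[OF Sle, of "ennreal ?c"] by (meson order_trans zero_le)
  moreover have "\<mu> = measure lebesgue V" by (simp add: \<mu>_def)
  ultimately show "\<exists>v\<in>QQ Q.
         (\<integral>\<^sup>+x\<in>V. ennreal (G2 (f x) v powr q) \<partial>lebesgue)
         \<le> ennreal (riesz_const CARD('m) * diameter V powr q *
               (diameter V ^ CARD('m) / measure lebesgue V) powr (1 - 1 / real CARD('m))) *
           (\<integral>\<^sup>+z\<in>V. ennreal (delta_norm Q U f z powr q) \<partial>lebesgue)"
    using v(1) by (intro bexI[of _ v]) (simp_all add: nn_integral_completion)
qed

end
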